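(* Let $(A,B)$ be a pair of real random variables with $A\ge 0$, $A\not\equiv 1$. Let $\kappa>0$ and $\alpha\in(0,1]$, and assume: (1) $\mathbf{E}A^\kappa=1$ and $\mathbf{E}[A^\kappa\log_+A]=\infty$; (2) $\overline F_\kappa(x)=1-F_\kappa(x)=\ell(x)x^{-\alpha}$ for $x>0$, where $\ell$ is a slowly varying function; (3) $\displaystyle \lim_{\delta\to0}\limsup_{x\to\infty} x\overline F_\kappa(x)\int_1^{\delta x}\frac{1}{y\,\overline F_\kappa(y)^2}\,F_\kappa(x-\mathrm{d}y)=0$; (4) the law of $\log A$ conditioned on $A\neq0$ is nonarithmetic; (5) $\mathbf{E}|B|^\nu<\infty$ for some $\nu>\kappa$. Let $X$ be the solution of $X\stackrel{\mathcal D}{=}AX\vee B$, where on the right-hand side $(A,B)$ and $X$ are independent. Then $$\lim_{x\to\infty}m(\log x)\,x^\kappa\,\mathbf{P}\{X>x\}=\frac{C_\alpha}{\kappa}\,\mathbf{E}\big[(AX_+\vee B_+)^\kappa-(AX_+)^\kappa\big].$$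
   Context: Notation: $a\vee b=\max\{a,b\}$, $x_+=\max\{x,0\}$, $\log_+x=\max\{\log x,0\}$ (with $\log_+ 0=0$), $\log 0=-\infty$. $F_\kappa$ is the distribution function $F_\kappa(x)=\mathbf{E}[I(\log A\le x)A^\kappa]$, $x\in\mathbb{R}$ (a probability distribution function since $\mathbf{E}A^\kappa=1$), i.e. the law of $\log A$ under the measure $\mathbf{P}_\kappa\{\log A\in C\}=\mathbf{E}[I(\log A\in C)A^\kappa]$; $\overline F_\kappa=1-F_\kappa$. $m(x)=\int_0^x[F_\kappa(-u)+\overline F_\kappa(u)]\,\mathrm{d}u$ and $C_\alpha=[\Gamma(\alpha)\Gamma(2-\alpha)]^{-1}$. For a distribution function $H$, $\int_1^{\delta x}\varphi(y)\,H(x-\mathrm{d}y)$ means $\int \varphi(x-z)\,I(1\le x-z\le\delta x)\,H(\mathrm{d}z)$. "The solution" refers to the law of $X$; under these assumptions it is known to exist and be unique. In the expectation, $X$ is independent of $(A,B)$. *)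

theory Defs
  imports "HOL-Probability.Probability"
begin

definition indep_rv ::
    "'w measure \<Rightarrow> 'a measure \<Rightarrow> ('w \<Rightarrow> 'a) \<Rightarrow> 'b measure \<Rightarrow> ('w \<Rightarrow> 'b) \<Rightarrow> bool" where
  \<comment> \<open>The characterisation of \<open>indep_var\<close> given by \<open>indep_var_eq\<close>, without its restriction
     that both random variables take values in the same type.\<close>
  "indep_rv M S Y T Z \<longleftrightarrow>
     Y \<in> measurable M S \<and> Z \<in> measurable M T \<and>
     prob_space.indep_set M {Y -` C \<inter> space M | C. C \<in> sets S} {Z -` D \<inter> space M | D. D \<in> sets T}"

definition slowly_varying :: "(real \<Rightarrow> real) \<Rightarrow> bool" where
  "slowly_varying L \<longleftrightarrow>
     (\<exists>a>0. (\<forall>x\<ge>a. 0 < L x) \<and> L \<in> borel_measurable (restrict_space borel {a..})) \<and>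
     (\<forall>c>0. ((\<lambda>x. L (c * x) / L x) \<longlongrightarrow> 1) at_top)"

definition arithmetic_law :: "real measure \<Rightarrow> bool" where
  "arithmetic_law N \<longleftrightarrow> (\<exists>h>0. AE x in N. \<exists>k::int. x = h * of_int k)"

definition cond_log_law :: "'w measure \<Rightarrow> ('w \<Rightarrow> real) \<Rightarrow> real measure" where
  "cond_log_law M A =
     distr (uniform_measure M {\<omega> \<in> space M. A \<omega> \<noteq> 0}) borel (\<lambda>\<omega>. ln (A \<omega>))"

text \<open>
  In the next two definitions the event \<open>A = 0\<close>, where \<open>ln (A \<omega>) = 0\<close> instead of minus infinity,
  has weight \<open>0 powr \<kappa> = 0\<close>, so it contributes nothing.
\<close>

definition F_tilt :: "'w measure \<Rightarrow> ('w \<Rightarrow> real) \<Rightarrow> real \<Rightarrow> real \<Rightarrow> real" where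
  "F_tilt M A \<kappa> x = (LINT \<omega>|M. indicator {\<omega>. ln (A \<omega>) \<le> x} \<omega> * A \<omega> powr \<kappa>)"

definition tilted_log_law :: "'w measure \<Rightarrow> ('w \<Rightarrow> real) \<Rightarrow> real \<Rightarrow> real measure" where
  "tilted_log_law M A \<kappa> =
     distr (density M (\<lambda>\<omega>. ennreal (A \<omega> powr \<kappa>))) borel (\<lambda>\<omega>. ln (A \<omega>))"

lemma cdf_tilted_log_law:
  assumes A[measurable]: "A \<in> borel_measurable M"
  shows "cdf (tilted_log_law M A \<kappa>) x = F_tilt M A \<kappa> x"
proof -
  have S: "{\<omega> \<in> space M. ln (A \<omega>) \<le> x} \<in> sets M" by measurable
  have "cdf (tilted_log_law M A \<kappa>) x =
      measure (density M (\<lambda>\<omega>. ennreal (A \<omega> powr \<kappa>))) {\<omega> \<in> space M. ln (A \<omega>) \<le> x}"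
    unfolding cdf_def tilted_log_law_def
    by (subst measure_distr) (auto intro!: arg_cong2[where f = measure])
  also have "\<dots> = enn2real (\<integral>\<^sup>+\<omega>. ennreal (A \<omega> powr \<kappa>) * indicator {\<omega> \<in> space M. ln (A \<omega>) \<le> x} \<omega> \<partial>M)"
    unfolding measure_def by (subst emeasure_density) (use S in auto)
  also have "\<dots> = enn2real (\<integral>\<^sup>+\<omega>. ennreal (indicator {\<omega>. ln (A \<omega>) \<le> x} \<omega> * A \<omega> powr \<kappa>) \<partial>M)"
    by (intro arg_cong[where f = enn2real] nn_integral_cong) (auto split: split_indicator)
  also have "\<dots> = F_tilt M A \<kappa> x"
    unfolding F_tilt_def by (subst integral_eq_nn_integral) auto
  finally show ?thesis .
qed

definition Fbar_tilt :: "'w measure \<Rightarrow> ('w \<Rightarrow> real) \<Rightarrow> real \<Rightarrow> real \<Rightarrow> real" where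
  "Fbar_tilt M A \<kappa> x = 1 - F_tilt M A \<kappa> x"

definition m_trunc :: "'w measure \<Rightarrow> ('w \<Rightarrow> real) \<Rightarrow> real \<Rightarrow> real \<Rightarrow> real" where
  "m_trunc M A \<kappa> x = (LBINT u=0..x. F_tilt M A \<kappa> (- u) + Fbar_tilt M A \<kappa> u)"

definition C_const :: "real \<Rightarrow> real" where
  "C_const \<alpha> = inverse (Gamma \<alpha> * Gamma (2 - \<alpha>))"

definition conv_integral :: "(real \<Rightarrow> real) \<Rightarrow> real measure \<Rightarrow> real \<Rightarrow> real \<Rightarrow> real \<Rightarrow> ennreal" where
  \<comment> \<open>The integral of \<open>\<phi> y\<close> over \<open>a \<le> y \<le> b\<close> against \<open>H (x - dy)\<close>, for nonnegative \<open>\<phi>\<close>.\<close>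
  "conv_integral \<phi> H x a b =
     (\<integral>\<^sup>+z. ennreal (\<phi> (x - z)) * indicator {a..b} (x - z) \<partial>H)"

end

theory Submission
  imports Defs "HOL-Real_Asymp.Real_Asymp"
begin

text \<open>
  Let \<open>F\<close> be the law of \<open>log A\<close> under the tilted measure. The function \<open>G y = exp (\<kappa> y) P(X > exp y)\<close> solves the
  renewal equation \<open>G = H + G * F\<close> with \<open>H y = exp (\<kappa> y) P(A X \<le> exp y < B)\<close>, so that \<open>G = H * U\<close> for the renewal
  measure \<open>U\<close> of \<open>F\<close>, and \<open>\<integral> H\<close> is the expectation in the theorem divided by \<open>\<kappa>\<close>. It remains to prove the strong
  renewal theorem \<open>m x U{x<..x+h} \<longlongrightarrow> h C\<close> for the infinite-mean step law \<open>F\<close>; integrating over short intervals and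
  using that \<open>P(X > exp y)\<close> is monotone then yields the limit of \<open>m G\<close>.

  With \<open>a x = x / m x\<close>, the mass of \<open>{x<..x+h}\<close> under the \<open>k\<close>-fold convolution power of \<open>U\<close>, multiplied by
  \<open>x / a x ^ k\<close>, converges for every \<open>k\<close>. For large \<open>k\<close> this follows from Fourier inversion, the transform
  \<open>(1 - f) ^ - k\<close> being integrable after scaling. The identity \<open>y U\<^sub>k(dy) = k (z F(dz)) * U\<^sub>k\<^sub>+\<^sub>1\<close> transfers the
  convergence from \<open>k + 1\<close> to \<open>k\<close>; here the small values of \<open>x - z\<close> are controlled by the integral condition (3),
  since \<open>a y\<close> is at most \<open>1 / F{y<..}\<close>. For \<open>k = 1\<close> the limit is identified from the Laplace transform of \<open>U\<close>.
\<close>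

section \<open>Truncated mean of the step law\<close>

text \<open>Undoing the tilt gives \<integral> exp(-\<kappa> z) F(dz) \<le> 1, so large steps to the
  left are exponentially rare. The transform can therefore be damped by exp(-z/x): its modulus drops
  below 1, every series over n converges geometrically, and 1 - f has no zero on the line of
  inversion. The obstacle is slow growth: \<open>a x\<close> times 1 - f grows like |s|^\<alpha> in
  the rescaled frequency s, so its inverse is not integrable for \<alpha> \<le> 1. The proof has the
  lower rate \<alpha>/2 from Potter bounds and inverts for powers k with k \<alpha> \<ge> 4. On the
  way down to k = 1 local irregularities of F could spoil the limit, and this is where the integral
  condition enters. Only the existence of a limit is carried down; the last constant is fixed by an
  Abelian computation, \<Gamma>(2 - \<alpha>) coming from a(x) (1 - psi(1/x)) and \<Gamma>(\<alpha>)
  from the integral of v^(\<alpha>-1) exp(-v). Normalising by x / m x instead of 1 / F{x<..} lets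
  \<alpha> = 1, where the two differ in order, run along with \<alpha> < 1.\<close>

lemma max_min_scale:
  fixes z x c :: real
  assumes "1 \<le> c" "0 \<le> x"
  shows "max 0 (min z (c * x)) \<le> c * max 0 (min z x)"
proof -
  have "0 \<le> z \<Longrightarrow> z \<le> c * z" "x \<le> c * x"
    using assms mult_right_mono[of 1 c z] mult_right_mono[of 1 c x] by auto
  moreover have "0 \<le> c * x" using assms by simp
  ultimately show ?thesis using assms by (auto simp: max_def min_def)
qed

text \<open>A l'Hopital rule for divergent integrals. Applied to the tail at t u and at u it is the
  direct half of Karamata's theorem and makes the truncated mean regularly varying.\<close>

lemma ratio_of_integrals_tendsto:
  fixes f g :: "real \<Rightarrow> real"
  assumes fi: "\<And>x. 0 \<le> x \<Longrightarrow> set_integrable lborel {0..x} f"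
    and gi: "\<And>x. 0 \<le> x \<Longrightarrow> set_integrable lborel {0..x} g"
    and gpos: "\<And>x. 0 < g x"
    and lim: "((\<lambda>x. f x / g x) \<longlongrightarrow> c) at_top"
    and div: "filterlim (\<lambda>x. LBINT u:{0..x}. g u) at_top at_top"
  shows "((\<lambda>x. (LBINT u:{0..x}. f u) / (LBINT u:{0..x}. g u)) \<longlongrightarrow> c) at_top"
proof -
  let ?I = "\<lambda>f x. LBINT u:{0..x}. f u :: real"
  have split: "?I k x = ?I k y + (LBINT u:{y<..x}. k u)"
    if "0 \<le> y" "y \<le> x" "set_integrable lborel {0..x} k" for k :: "real \<Rightarrow> real" and x y
  proof -
    have "{0..x} = {0..y} \<union> {y<..x}" using that(1,2) by auto
    then show ?thesis using that
      by (auto intro!: set_integral_Un set_integrable_subset[OF that(3)])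
  qed
  show ?thesis
  proof (rule tendstoI)
    fix e :: real assume e: "0 < e"
    have "eventually (\<lambda>x. dist (f x / g x) c < e/2) at_top"
      using tendstoD[OF lim, of "e/2"] e by simp
    then obtain X0 where X0: "\<And>x. x \<ge> X0 \<Longrightarrow> dist (f x / g x) c < e/2"
      by (auto simp: eventually_at_top_linorder)
    define X where "X = max X0 0"
    have X: "X \<ge> 0" "\<And>x. x \<ge> X \<Longrightarrow> \<bar>f x - c * g x\<bar> \<le> e/2 * g x"
    proof -
      show "X \<ge> 0" by (simp add: X_def)
      fix x assume "x \<ge> X"
      then have "\<bar>f x / g x - c\<bar> < e/2" using X0[of x] by (simp add: X_def dist_real_def)
      then have "\<bar>f x / g x - c\<bar> * g x \<le> e/2 * g x" using gpos[of x] by (intro mult_right_mono) auto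
      also have "\<bar>f x / g x - c\<bar> * g x = \<bar>(f x / g x - c) * g x\<bar>" using gpos[of x] by (simp add: abs_mult)
      also have "(f x / g x - c) * g x = f x - c * g x" using gpos[of x] by (simp add: field_simps)
      finally show "\<bar>f x - c * g x\<bar> \<le> e/2 * g x" .
    qed
    define D where "D = \<bar>?I f X - c * ?I g X\<bar>"
    \<comment> \<open>The threshold makes the fixed discrepancy \<open>D\<close> accumulated up to
      \<open>X\<close> less than half of the allowed error; the 1 keeps the denominator
      positive.\<close>
    have "eventually (\<lambda>x. ?I g x > max 1 (2 * (D + 1) / e)) at_top"
      using div unfolding filterlim_at_top_dense by blast
    then show "eventually (\<lambda>x. dist (?I f x / ?I g x) c < e) at_top"
      using eventually_ge_at_top[of X]
    proof eventually_elim
      case (elim x)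
      have x0: "0 \<le> x" using elim X by simp
      have g2: "set_integrable lborel {X<..x} g" "set_integrable lborel {X<..x} f"
        using fi[OF x0] gi[OF x0] X by (auto intro: set_integrable_subset)
      have gX: "0 \<le> ?I g X" unfolding set_lebesgue_integral_def
        using gpos by (intro Bochner_Integration.integral_nonneg) (auto simp: indicator_def less_imp_le)
      have "\<bar>(LBINT u:{X<..x}. f u) - c * (LBINT u:{X<..x}. g u)\<bar> = \<bar>(LBINT u:{X<..x}. f u - c * g u)\<bar>"
        using g2 by (subst set_integral_diff) (auto intro: set_integrable_mult_right)
      also have "\<dots> \<le> (LBINT u:{X<..x}. \<bar>f u - c * g u\<bar>)"
        unfolding set_lebesgue_integral_def
        by (rule order_trans[OF integral_abs_bound]) (simp add: abs_mult)
      also have "\<dots> \<le> (LBINT u:{X<..x}. e/2 * g u)"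
        using g2 X(2) by (intro set_integral_mono) (auto intro!: set_integrable_mult_right set_integrable_abs)
      also have "\<dots> \<le> e/2 * ?I g x"
        using split[of X x g] gi[OF x0] elim X gX e by (simp)
      finally have 1: "\<bar>(LBINT u:{X<..x}. f u) - c * (LBINT u:{X<..x}. g u)\<bar> \<le> e/2 * ?I g x" .
      have 2: "D < e/2 * ?I g x"
      proof -
        have "2 * (D + 1) / e < ?I g x" using elim by simp
        then show ?thesis using e by (simp add: field_simps)
      qed
      have "?I f x - c * ?I g x = (?I f X - c * ?I g X) + ((LBINT u:{X<..x}. f u) - c * (LBINT u:{X<..x}. g u))"
        using split[of X x g] split[of X x f] gi[OF x0] fi[OF x0] elim X by (simp add: algebra_simps)
      then have "\<bar>?I f x - c * ?I g x\<bar> < e * ?I g x" using 1 2 unfolding D_def by linarith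
      moreover have "\<bar>p / q - c\<bar> < e" if "\<bar>p - c * q\<bar> < e * q" "1 < q" for p q :: real
      proof -
        have "p / q - c = (p - c * q) / q" using that by (simp add: diff_divide_distrib)
        then have "\<bar>p / q - c\<bar> = \<bar>p - c * q\<bar> / q" using that by (simp add: abs_divide)
        then show ?thesis using that by (simp add: pos_divide_less_eq)
      qed
      ultimately show ?case using elim unfolding dist_real_def by auto
    qed
  qed
qed

text \<open>The step law with everything else about A forgotten. \<open>left_tail\<close> is what
  undoing the tilt leaves, and it controls all contributions of negative steps;
  \<open>infinite_mean\<close> makes \<open>m\<close> diverge, so that bounded errors become
  negligible against it.\<close>

locale heavy_step = real_distribution F for F :: "real measure" +
  fixes \<kappa> \<alpha> :: real
  assumes kappa: "0 < \<kappa>"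
    and alpha: "0 < \<alpha>" "\<alpha> \<le> 1"
    and left_tail: "(\<integral>\<^sup>+z. ennreal (exp (- \<kappa> * z)) \<partial>F) \<le> 1"
    and tail_pos: "\<And>x. 0 < measure F {x<..}"
    and tail_rv: "\<And>c. 0 < c \<Longrightarrow> ((\<lambda>x. measure F {c * x<..} / measure F {x<..}) \<longlongrightarrow> c powr (-\<alpha>)) at_top"
    and infinite_mean: "(\<integral>\<^sup>+z. ennreal (max z 0) \<partial>F) = \<infinity>"
begin

definition Fb :: "real \<Rightarrow> real" where "Fb x = measure F {x<..}"
text \<open>This omits the left tail that the truncated mean of the theorem contains;
  \<open>m_trunc_asymptotic\<close> shows that the ratio of the two tends to 1.\<close>

definition m :: "real \<Rightarrow> real" where "m x = (LINT z|F. max 0 (min z x))"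
definition a :: "real \<Rightarrow> real" where "a x = x / m x"

lemma sets_F [simp, measurable_cong]: "sets F = sets borel" by (rule events_eq_borel)

lemma Fb_pos: "0 < Fb x" and Fb_nonneg: "0 \<le> Fb x" and Fb_le_1: "Fb x \<le> 1"
  using tail_pos[of x] by (auto simp: Fb_def)

lemma Fb_antimono: "x \<le> y \<Longrightarrow> Fb y \<le> Fb x"
  unfolding Fb_def by (intro finite_measure_mono) auto

lemma Fb_measurable [measurable]: "Fb \<in> borel_measurable borel"
proof -
  have "mono (\<lambda>x. - Fb x)" by (auto simp: mono_def Fb_antimono)
  then have "(\<lambda>x. - Fb x) \<in> borel_measurable borel" by (rule borel_measurable_mono)
  then have "(\<lambda>x. - (- Fb x)) \<in> borel_measurable borel" by measurable
  then show ?thesis by simp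
qed

lemma indicator_integrable [simp]: "A \<in> sets borel \<Longrightarrow> integrable F (indicator A :: real \<Rightarrow> real)"
  by (simp add: less_top[symmetric])

lemma m_integrable: "integrable F (\<lambda>z. max 0 (min z x))"
  by (rule integrable_const_bound[where B="\<bar>x\<bar>"]) auto

lemma m_mono: "x \<le> y \<Longrightarrow> m x \<le> m y"
  unfolding m_def by (intro integral_mono m_integrable) auto

lemma m_nonneg: "0 \<le> m x"
  unfolding m_def by (intro Bochner_Integration.integral_nonneg) auto

lemma m_measurable [measurable]: "m \<in> borel_measurable borel"
  by (intro borel_measurable_mono monoI m_mono)

lemma m_scale: "1 \<le> c \<Longrightarrow> 0 \<le> x \<Longrightarrow> m (c * x) \<le> c * m x"
  unfolding m_def integral_mult_right_zero[symmetric]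
  by (intro integral_mono m_integrable integrable_mult_right max_min_scale)

lemma Fb_le_m: "x * Fb x \<le> m x"
proof (cases "0 \<le> x")
  case True
  have "x * Fb x = (LINT z|F. x * indicator {x<..} z)" by (simp add: Fb_def)
  also have "\<dots> \<le> m x" unfolding m_def using True
    by (intro integral_mono m_integrable integrable_mult_right) (auto split: split_indicator simp: less_top[symmetric])
  finally show ?thesis .
next
  case False
  then have "x * Fb x \<le> 0" by (simp add: mult_nonpos_nonneg Fb_nonneg)
  then show ?thesis using m_nonneg[of x] by linarith
qed

lemma m_pos: "0 < x \<Longrightarrow> 0 < m x"
  using Fb_le_m[of x] Fb_pos[of x] by (meson less_le_trans mult_pos_pos)

text \<open>Monotone convergence along integer truncations.\<close>

lemma m_at_top: "filterlim m at_top at_top"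
proof -
  have "incseq (\<lambda>n z. ennreal (max 0 (min z (real n))))"
    by (auto simp: incseq_def le_fun_def intro!: ennreal_leI max.mono min.mono)
  then have "(\<integral>\<^sup>+z. (SUP n. ennreal (max 0 (min z (real n)))) \<partial>F) = (SUP n. (\<integral>\<^sup>+z. ennreal (max 0 (min z (real n))) \<partial>F))"
    by (intro nn_integral_monotone_convergence_SUP) auto
  also have "(\<lambda>z. (SUP n. ennreal (max 0 (min z (real n))))) = (\<lambda>z. ennreal (max z 0))"
  proof
    fix z :: real
    obtain n where n: "z \<le> real n" using real_arch_simple by blast
    show "(SUP n. ennreal (max 0 (min z (real n)))) = ennreal (max z 0)"
    proof (rule antisym)
      show "(SUP n. ennreal (max 0 (min z (real n)))) \<le> ennreal (max z 0)"
        by (intro SUP_least ennreal_leI) auto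
      have "ennreal (max z 0) = ennreal (max 0 (min z (real n)))" using n by (simp add: max.commute)
      then show "ennreal (max z 0) \<le> (SUP n. ennreal (max 0 (min z (real n))))"
        by (metis SUP_upper UNIV_I)
    qed
  qed
  also have "(\<lambda>n. \<integral>\<^sup>+z. ennreal (max 0 (min z (real n))) \<partial>F) = (\<lambda>n. ennreal (m (real n)))"
    unfolding m_def by (intro ext nn_integral_eq_integral m_integrable) auto
  finally have S: "(SUP n. ennreal (m (real n))) = \<infinity>" using infinite_mean by simp
  show ?thesis
    unfolding filterlim_at_top
  proof
    fix Z :: real
    have "ennreal (max 0 Z) < (SUP n. ennreal (m (real n)))" unfolding S by simp
    then obtain n where "ennreal (max 0 Z) < ennreal (m (real n))" by (auto simp: less_SUP_iff)
    then have "Z \<le> m (real n)" using m_nonneg[of "real n"] by (auto simp: ennreal_less_iff max_def not_le ennreal_neg split: if_splits)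
    then show "eventually (\<lambda>x. Z \<le> m x) at_top"
      using m_mono by (intro eventually_at_top_linorderI[of "real n"]) (metis order_trans)
  qed
qed

text \<open>Layer-cake formula: integrate the event u < z in the other order.\<close>

lemma nn_m_eq: "0 \<le> x \<Longrightarrow> ennreal (m x) = (\<integral>\<^sup>+u\<in>{0..x}. ennreal (Fb u) \<partial>lborel)"
proof -
  assume x: "0 \<le> x"
  have "(\<integral>\<^sup>+u\<in>{0..x}. ennreal (Fb u) \<partial>lborel) = (\<integral>\<^sup>+u. (\<integral>\<^sup>+z. indicator {u<..} z * indicator {0..x} u \<partial>F) \<partial>lborel)"
    by (intro nn_integral_cong) (simp add: Fb_def nn_integral_multc emeasure_eq_measure)
  also have "\<dots> = (\<integral>\<^sup>+z. (\<integral>\<^sup>+u. indicator {u<..} z * indicator {0..x} u \<partial>lborel) \<partial>F)"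
  proof -
    interpret P: pair_sigma_finite F lborel ..
    have "(\<lambda>(z,u). indicator {u<..} z * indicator {0..x} u :: ennreal) = (\<lambda>(z,u). indicator {p. snd p < fst p} (z,u) * indicator {0..x} u)"
      by (auto simp: fun_eq_iff split: split_indicator)
    then have [measurable]: "(\<lambda>(z,u). indicator {u<..} z * indicator {0..x} u :: ennreal) \<in> borel_measurable (F \<Otimes>\<^sub>M lborel)"
      by simp
    show ?thesis by (rule P.Fubini') measurable
  qed
  also have "\<dots> = (\<integral>\<^sup>+z. ennreal (max 0 (min z x)) \<partial>F)"
  proof (intro nn_integral_cong)
    fix z :: real
    have "(\<integral>\<^sup>+u. indicator {u<..} z * indicator {0..x} u \<partial>lborel) = (\<integral>\<^sup>+u. indicator (if z \<le> x then {0..<z} else {0..x}) u \<partial>lborel)"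
      by (intro nn_integral_cong) (auto split: split_indicator if_splits)
    also have "\<dots> = ennreal (max 0 (min z x))"
      using x by (cases "0 \<le> z") (auto simp: max_def min_def)
    finally show "(\<integral>\<^sup>+u. indicator {u<..} z * indicator {0..x} u \<partial>lborel) = ennreal (max 0 (min z x))" .
  qed
  also have "\<dots> = ennreal (m x)"
    unfolding m_def by (intro nn_integral_eq_integral m_integrable) auto
  finally show ?thesis by simp
qed

lemma Fb_set_integrable: "set_integrable lborel {0..x} (\<lambda>u. Fb (t * u))"
  unfolding set_integrable_def
  by (rule Bochner_Integration.integrable_bound[where f="indicator {0..x} :: real \<Rightarrow> real"])
     (auto simp: Fb_nonneg Fb_le_1 emeasure_lborel_Icc_eq intro!: integrable_real_indicator split: split_indicator)

lemma m_eq: "0 \<le> x \<Longrightarrow> m x = (LBINT u:{0..x}. Fb u)"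
proof -
  assume x: "0 \<le> x"
  have "(LBINT u:{0..x}. Fb u) = enn2real (\<integral>\<^sup>+u. ennreal (indicator {0..x} u *\<^sub>R Fb u) \<partial>lborel)"
    unfolding set_lebesgue_integral_def
    by (subst integral_eq_nn_integral) (auto simp: Fb_nonneg)
  also have "(\<integral>\<^sup>+u. ennreal (indicator {0..x} u *\<^sub>R Fb u) \<partial>lborel) = (\<integral>\<^sup>+u\<in>{0..x}. ennreal (Fb u) \<partial>lborel)"
    by (intro nn_integral_cong) (auto split: split_indicator)
  also have "\<dots> = ennreal (m x)" using nn_m_eq[OF x] by simp
  finally show ?thesis using m_nonneg by simp
qed

lemma m_eq_scaled: "0 \<le> x \<Longrightarrow> 0 < t \<Longrightarrow> m (t * x) = t * (LBINT u:{0..x}. Fb (t * u))"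
proof -
  assume x: "0 \<le> x" and t: "0 < t"
  have "m (t * x) = (LBINT u. indicator {0..t*x} u * Fb u)"
    using m_eq[of "t*x"] x t by (simp add: set_lebesgue_integral_def)
  also have "\<dots> = t * (LBINT u. indicator {0..t*x} (t*u) * Fb (t*u))"
    using lborel_integral_real_affine[of t "\<lambda>u. indicator {0..t*x} u * Fb u" 0] t by simp
  also have "(\<lambda>u. indicator {0..t*x} (t*u) * Fb (t*u)) = (\<lambda>u. indicator {0..x} u * Fb (t*u))"
    using t by (auto simp: fun_eq_iff split: split_indicator) (auto simp: zero_le_mult_iff)
  finally show ?thesis by (simp add: set_lebesgue_integral_def)
qed

text \<open>Substituting t u for u turns the ratio into t times a ratio of integrals, which inherits
  the limit t^-\<alpha> of its integrands.\<close>

lemma m_rv: "0 < t \<Longrightarrow> ((\<lambda>x. m (t * x) / m x) \<longlongrightarrow> t powr (1 - \<alpha>)) at_top"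
proof -
  assume t: "0 < t"
  have "((\<lambda>x. (LBINT u:{0..x}. Fb (t * u)) / (LBINT u:{0..x}. Fb u)) \<longlongrightarrow> t powr (-\<alpha>)) at_top"
  proof (rule ratio_of_integrals_tendsto)
    show "set_integrable lborel {0..x} (\<lambda>u. Fb (t * u))" for x using Fb_set_integrable[of x t] by simp
    show "set_integrable lborel {0..x} Fb" for x using Fb_set_integrable[of x 1] by simp
    show "((\<lambda>x. Fb (t * x) / Fb x) \<longlongrightarrow> t powr - \<alpha>) at_top" using tail_rv[OF t] by (simp add: Fb_def)
    show "filterlim (\<lambda>x. LBINT u:{0..x}. Fb u) at_top at_top"
      by (rule filterlim_mono_eventually[OF m_at_top order_refl order_refl])
         (use m_eq in \<open>auto intro!: eventually_at_top_linorderI[of 0]\<close>)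
  qed (rule Fb_pos)
  then have "((\<lambda>x. t * ((LBINT u:{0..x}. Fb (t * u)) / (LBINT u:{0..x}. Fb u))) \<longlongrightarrow> t * t powr (-\<alpha>)) at_top"
    by (intro tendsto_intros)
  moreover have "t * t powr (-\<alpha>) = t powr (1 - \<alpha>)"
    using t by (metis powr_mult_base less_imp_le diff_conv_add_uminus)
  moreover have "eventually (\<lambda>x. t * ((LBINT u:{0..x}. Fb (t * u)) / (LBINT u:{0..x}. Fb u)) = m (t * x) / m x) at_top"
    by (intro eventually_at_top_linorderI[of 0]) (simp add: m_eq m_eq_scaled t)
  ultimately show ?thesis using tendsto_cong by fastforce
qed

lemma m_diff: assumes "0 \<le> x" "x \<le> y" shows "(y - x) * Fb y \<le> m y - m x" "m y - m x \<le> (y - x) * Fb x"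
proof -
  have I: "m y - m x = (LINT z|F. max 0 (min z y) - max 0 (min z x))"
    unfolding m_def by (intro Bochner_Integration.integral_diff[symmetric] m_integrable)
  have "(y - x) * Fb y = (LINT z|F. (y - x) * indicator {y<..} z)" by (simp add: Fb_def)
  also have "\<dots> \<le> m y - m x" unfolding I using assms
    by (intro integral_mono m_integrable integrable_mult_right Bochner_Integration.integrable_diff) (auto split: split_indicator)
  finally show "(y - x) * Fb y \<le> m y - m x" .
  have "m y - m x \<le> (LINT z|F. (y - x) * indicator {x<..} z)"
    unfolding I using assms
    by (intro integral_mono m_integrable integrable_mult_right Bochner_Integration.integrable_diff) (auto split: split_indicator)
  also have "\<dots> = (y - x) * Fb x" by (simp add: Fb_def)
  finally show "m y - m x \<le> (y - x) * Fb x" .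
qed

text \<open>Monotone density argument: as \<open>Fb\<close> decreases, difference quotients of
  \<open>m\<close> between x and t x bracket x Fb(x), and those of t^(1-\<alpha>) at 1 tend to 1 -
  \<alpha>. At \<alpha> = 1 the limit 0 says that \<open>Fb x\<close> is of smaller order than
  \<open>m x / x\<close>, which there does the work that comparability of \<open>a\<close> and
  \<open>1 / Fb\<close> does for \<alpha> < 1.\<close>

lemma Fb_m_ratio: "((\<lambda>x. x * Fb x / m x) \<longlongrightarrow> 1 - \<alpha>) at_top"
proof -
  have der: "((\<lambda>t. (t powr (1 - \<alpha>) - 1) / (t - 1)) \<longlongrightarrow> 1 - \<alpha>) (at 1)"
  proof -
    have "((\<lambda>t. t powr (1 - \<alpha>)) has_real_derivative (1 - \<alpha>) * 1 powr (1 - \<alpha> - 1)) (at 1)"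
      by (rule has_real_derivative_powr) simp
    then show ?thesis by (simp add: has_field_derivative_iff)
  qed
  have q: "((\<lambda>x. (m (t * x) / m x - 1) / (t - 1)) \<longlongrightarrow> (t powr (1 - \<alpha>) - 1) / (t - 1)) at_top" if "0 < t" "t \<noteq> 1" for t
    using that by (intro tendsto_intros m_rv) auto
  show ?thesis
  proof (rule order_tendstoI)
    fix l assume "l < 1 - \<alpha>"
    then have "eventually (\<lambda>t. l < (t powr (1 - \<alpha>) - 1) / (t - 1)) (at_right 1)"
      by (rule order_tendstoD(1)[OF tendsto_mono[OF at_le[OF subset_UNIV] der]])
    moreover have "eventually (\<lambda>t::real. 1 < t) (at_right 1)" by (simp add: eventually_at_right_less)
    ultimately have "eventually (\<lambda>t. 1 < t \<and> l < (t powr (1 - \<alpha>) - 1) / (t - 1)) (at_right 1)"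
      by eventually_elim auto
    then obtain t where t: "1 < t" "l < (t powr (1 - \<alpha>) - 1) / (t - 1)"
      using eventually_happens'[OF trivial_limit_at_right_real] by blast
    have "eventually (\<lambda>x. l < (m (t * x) / m x - 1) / (t - 1)) at_top"
      using order_tendstoD(1)[OF q t(2)] t by simp
    then show "eventually (\<lambda>x. l < x * Fb x / m x) at_top"
      using eventually_gt_at_top[of 0]
    proof eventually_elim
      case (elim x)
      have "m (t * x) - m x \<le> (t - 1) * (x * Fb x)"
        using m_diff(2)[of x "t * x"] elim t by (simp add: algebra_simps)
      then have "(m (t * x) - m x) / m x \<le> ((t - 1) * (x * Fb x)) / m x"
        using m_pos[of x] elim by (intro divide_right_mono) auto
      then have q: "m (t * x) / m x - 1 \<le> (t - 1) * (x * Fb x / m x)"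
        using m_pos[of x] elim by (simp add: diff_divide_distrib)
      have "(p - 1) / (t - 1) \<le> q" if "p - 1 \<le> (t - 1) * q" for p q :: real
        using that t by (subst pos_divide_le_eq) (auto simp: mult.commute)
      from this[OF q] have "(m (t * x) / m x - 1) / (t - 1) \<le> x * Fb x / m x" .
      then show ?case using elim by simp
    qed
  next
    fix l assume "l > 1 - \<alpha>"
    then have "eventually (\<lambda>t. l > (t powr (1 - \<alpha>) - 1) / (t - 1)) (at_left 1)"
      by (rule order_tendstoD(2)[OF tendsto_mono[OF at_le[OF subset_UNIV] der]])
    moreover have "eventually (\<lambda>t::real. t \<in> {0<..<1}) (at_left 1)" by (rule eventually_at_left_real) simp
    ultimately have "eventually (\<lambda>t. 0 < t \<and> t < 1 \<and> l > (t powr (1 - \<alpha>) - 1) / (t - 1)) (at_left 1)"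
      by eventually_elim auto
    then obtain t where t: "0 < t" "t < 1" "l > (t powr (1 - \<alpha>) - 1) / (t - 1)"
      using eventually_happens'[OF trivial_limit_at_left_real] by blast
    have "eventually (\<lambda>x. l > (m (t * x) / m x - 1) / (t - 1)) at_top"
      using order_tendstoD(2)[OF q t(3)] t by simp
    then show "eventually (\<lambda>x. l > x * Fb x / m x) at_top"
      using eventually_gt_at_top[of 0]
    proof eventually_elim
      case (elim x)
      have "(1 - t) * (x * Fb x) \<le> m x - m (t * x)"
        using m_diff(1)[of "t * x" x] elim t by (simp add: algebra_simps)
      then have "((1 - t) * (x * Fb x)) / m x \<le> (m x - m (t * x)) / m x"
        using m_pos[of x] elim by (intro divide_right_mono) auto
      then have q: "(1 - t) * (x * Fb x / m x) \<le> 1 - m (t * x) / m x"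
        using m_pos[of x] elim by (simp add: diff_divide_distrib)
      have "q \<le> (p - 1) / (t - 1)" if "(1 - t) * q \<le> 1 - p" for p q :: real
        using that t by (subst neg_le_divide_eq) (auto simp: algebra_simps)
      from this[OF q] have "(m (t * x) / m x - 1) / (t - 1) \<ge> x * Fb x / m x" .
      then show ?case using elim by simp
    qed
  qed
qed

section \<open>The normalising function a\<close>

lemma a_pos: "0 < x \<Longrightarrow> 0 < a x"
  by (simp add: a_def m_pos)

lemma a_measurable [measurable]: "a \<in> borel_measurable borel"
  unfolding a_def by measurable

lemma a_scale: assumes "1 \<le> c" "0 < x" shows "a (c * x) \<le> c * a x"
proof -
  have "x \<le> c * x" using mult_right_mono[of 1 c x] assms by simp
  then have "(c * x) / m (c * x) \<le> (c * x) / m x"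
    using assms m_mono[of x "c * x"] m_pos[of x] by (intro divide_left_mono) (auto intro!: mult_pos_pos m_pos)
  then show ?thesis by (simp add: a_def)
qed

lemma a_mono: assumes "0 < x" "x \<le> y" shows "a x \<le> a y"
proof -
  have "m ((y / x) * x) \<le> (y / x) * m x" using assms by (intro m_scale) auto
  then have "m y * x \<le> y * m x" using assms by (simp add: pos_le_divide_eq)
  then show ?thesis using assms m_pos[of x] m_pos[of y] by (simp add: a_def frac_le_eq divide_le_0_iff mult.commute)
qed

lemma a_le_inverse_Fb: assumes "0 < x" shows "a x \<le> 1 / Fb x"
  unfolding a_def using Fb_le_m[of x] m_pos[of x] Fb_pos[of x] assms
  by (subst pos_divide_le_eq) (auto simp: pos_le_divide_eq)

lemma a_rv: assumes t: "0 < t" shows "((\<lambda>x. a (t * x) / a x) \<longlongrightarrow> t powr \<alpha>) at_top"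
proof -
  have "((\<lambda>x. t / (m (t * x) / m x)) \<longlongrightarrow> t / t powr (1 - \<alpha>)) at_top"
    using t by (intro tendsto_intros m_rv) auto
  also have "t / t powr (1 - \<alpha>) = t powr \<alpha>"
    using t by (simp add: powr_diff)
  finally show ?thesis
    by (rule Lim_transform_eventually) (rule eventually_at_top_linorderI[of 1], simp add: a_def)
qed

text \<open>Potter bound. Regular variation gives a(2x) \<ge> 2^(\<alpha>/2) a(x) beyond some
  \<open>X\<close>; iterating this over dyadic scales and filling the gaps by monotonicity produces
  the power.\<close>

lemma a_potter: "\<exists>C\<ge>1. \<forall>x y. 1 \<le> y \<and> y \<le> x \<longrightarrow> a y \<le> C * (y / x) powr (\<alpha>/2) * a x"
proof -
  have "2 powr (\<alpha>/2) < 2 powr \<alpha>" using alpha by (intro powr_less_mono) auto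
  then have "eventually (\<lambda>x. 2 powr (\<alpha>/2) < a (2 * x) / a x) at_top"
    by (intro order_tendstoD(1)[OF a_rv[of 2]]) auto
  then obtain X0 where X0: "\<And>x. X0 \<le> x \<Longrightarrow> 2 powr (\<alpha>/2) < a (2 * x) / a x"
    by (auto simp: eventually_at_top_linorder)
  define X where "X = max X0 1"
  have X1: "1 \<le> X" by (simp add: X_def)
  have X: "2 powr (\<alpha>/2) * a x \<le> a (2 * x)" if "X \<le> x" for x
    using X0[of x] that a_pos[of x] by (simp add: X_def field_simps)
  have it: "(2 ^ n) powr (\<alpha>/2) * a x \<le> a (2 ^ n * x)" if "X \<le> x" for n x
  proof (induction n)
    case (Suc n)
    have "x \<le> 2 ^ n * x" using that X1 by simp
    with that have "X \<le> 2 ^ n * x" by linarith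
    have "(2 ^ Suc n) powr (\<alpha>/2) * a x = 2 powr (\<alpha>/2) * ((2 ^ n) powr (\<alpha>/2) * a x)"
      by (simp add: powr_mult)
    also have "\<dots> \<le> 2 powr (\<alpha>/2) * a (2 ^ n * x)" using Suc by (intro mult_left_mono) auto
    also have "\<dots> \<le> a (2 * (2 ^ n * x))" by (rule X) fact
    finally show ?case by (simp add: mult.assoc)
  qed simp
  have big: "(y / x) powr (-(\<alpha>/2)) * a y \<le> 2 * a x" if "X \<le> y" "y \<le> x" for x y
  proof -
    have "1 \<le> x / y" using that X1 by simp
    \<comment> \<open>The number of doublings of y that stay below x, so 2^n \<le> x/y < 2^(n+1);
      the unfinished last doubling costs at most the factor 2.\<close>
    define n where "n = nat \<lfloor>log 2 (x / y)\<rfloor>"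
    have l0: "0 \<le> log 2 (x / y)" using \<open>1 \<le> x / y\<close> by simp
    then have n: "real n \<le> log 2 (x / y)" "log 2 (x / y) < real n + 1" unfolding n_def by linarith+
    have n1: "2 ^ n \<le> x / y"
      using n(1) \<open>1 \<le> x / y\<close> by (simp add: le_log_iff powr_realpow)
    have n2: "x / y < 2 ^ (Suc n)"
    proof -
      have "x / y < 2 powr (real n + 1)" using n(2) \<open>1 \<le> x / y\<close> by (simp add: log_less_iff)
      also have "\<dots> = 2 ^ Suc n" by (simp add: powr_add powr_realpow)
      finally show ?thesis .
    qed
    have y0: "0 < y" using that X1 by simp
    have "(y / x) powr (-(\<alpha>/2)) = (x / y) powr (\<alpha>/2)"
      using y0 that by (simp add: powr_minus powr_divide)
    also have "\<dots> \<le> (2 ^ Suc n) powr (\<alpha>/2)" using n2 \<open>1 \<le> x / y\<close> alpha by (intro powr_mono2) auto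
    also have "\<dots> = 2 powr (\<alpha>/2) * (2 ^ n) powr (\<alpha>/2)" by (simp add: powr_mult)
    also have "\<dots> \<le> 2 * (2 ^ n) powr (\<alpha>/2)"
      using powr_mono[of "\<alpha>/2" 1 2] alpha by (intro mult_right_mono) auto
    finally have "(y / x) powr (-(\<alpha>/2)) * a y \<le> 2 * (2 ^ n) powr (\<alpha>/2) * a y"
      using a_pos[OF y0] by (intro mult_right_mono) auto
    also have "\<dots> \<le> 2 * a (2 ^ n * y)" using it[OF that(1), of n] by (simp add: mult.assoc)
    also have "\<dots> \<le> 2 * a x" using n1 y0 by (intro mult_left_mono a_mono) (auto simp: field_simps)
    finally show ?thesis .
  qed
  \<comment> \<open>X^(\<alpha>/2) pays for replacing an argument in [1, X) by \<open>X\<close>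
    itself.\<close>
  define C where "C = 2 * X powr (\<alpha>/2)"
  have Xp: "1 \<le> X powr (\<alpha>/2)" using X1 alpha by (intro ge_one_powr_ge_zero) auto
  have "a y \<le> C * (y / x) powr (\<alpha>/2) * a x" if "1 \<le> y" "y \<le> x" for x y
  proof -
    have ax: "0 < a x" using that by (intro a_pos) auto
    have e: "a z \<le> 2 * (z / x) powr (\<alpha>/2) * a x" if "X \<le> z" "z \<le> x" for z
    proof -
      have "0 < (z / x) powr (\<alpha>/2)" using that X1 by simp
      then show ?thesis using big[OF that] by (simp add: powr_minus field_simps)
    qed
    consider "X \<le> y" | "y < X" "X \<le> x" | "x < X" by linarith
    then show ?thesis
    proof cases
      case 1
      have "2 * (y / x) powr (\<alpha>/2) * a x \<le> C * (y / x) powr (\<alpha>/2) * a x"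
        using Xp ax unfolding C_def by (intro mult_right_mono) auto
      then show ?thesis using e[OF 1 that(2)] by linarith
    next
      case 2
      have "a y \<le> a X" using 2 that by (intro a_mono) auto
      also have "\<dots> \<le> 2 * (X / x) powr (\<alpha>/2) * a x" using e[of X] 2 by simp
      also have "\<dots> \<le> C * (y / x) powr (\<alpha>/2) * a x"
      proof -
        have "(X / x) powr (\<alpha>/2) \<le> (X * (y / x)) powr (\<alpha>/2)"
          using that X1 alpha by (intro powr_mono2) (auto simp: field_simps)
        also have "\<dots> = X powr (\<alpha>/2) * (y / x) powr (\<alpha>/2)" using that X1 by (intro powr_mult)
        finally show ?thesis using ax unfolding C_def by (simp add: mult.assoc)
      qed
      finally show ?thesis .
    next
      case 3
      have "1 = (1::real) powr (\<alpha>/2)" by simp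
      also have "1 powr (\<alpha>/2) \<le> (X * (y / x)) powr (\<alpha>/2)"
        using that X1 alpha 3 mult_mono[of 1 y x X] by (intro powr_mono2) (auto simp: field_simps)
      also have "\<dots> = X powr (\<alpha>/2) * (y / x) powr (\<alpha>/2)" using that X1 by (intro powr_mult)
      finally have "1 \<le> C * (y / x) powr (\<alpha>/2)" unfolding C_def by simp
      then have "1 * a x \<le> C * (y / x) powr (\<alpha>/2) * a x" using ax by (intro mult_right_mono) auto
      then show ?thesis using a_mono[of y x] that by simp
    qed
  qed
  moreover have "1 \<le> C" using Xp by (simp add: C_def)
  ultimately show ?thesis by blast
qed

text \<open>The Potter bound with smaller argument 1.\<close>

lemma a_lower: "\<exists>c>0. \<forall>x\<ge>1. c * x powr (\<alpha>/2) \<le> a x"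
proof -
  obtain C where C: "C \<ge> 1" "\<And>x y. 1 \<le> y \<Longrightarrow> y \<le> x \<Longrightarrow> a y \<le> C * (y / x) powr (\<alpha>/2) * a x"
    using a_potter by blast
  have "a 1 / C * x powr (\<alpha>/2) \<le> a x" if "1 \<le> x" for x
    using C(2)[of 1 x] that C(1) by (simp add: powr_divide field_simps)
  moreover have "0 < a 1 / C" using C(1) a_pos[of 1] by simp
  ultimately show ?thesis by blast
qed

lemma a_at_top: "filterlim a at_top at_top"
proof -
  obtain c where c: "c > 0" "\<And>x. 1 \<le> x \<Longrightarrow> c * x powr (\<alpha>/2) \<le> a x" using a_lower by blast
  have "filterlim (\<lambda>x. c * x powr (\<alpha>/2)) at_top at_top"
    using c alpha by real_asymp
  then show ?thesis
    by (rule filterlim_at_top_mono) (use c in \<open>auto intro!: eventually_at_top_linorderI[of 1]\<close>)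
qed

end

section \<open>Convolution powers of the renewal measure\<close>

text \<open>The coefficient of z^n in (1 - z)^-(k+1), that is, the number of ways to write n as an
  ordered sum of k + 1 naturals. The shift of the index makes k = 0 the plain renewal
  measure.\<close>

definition multichoose :: "nat \<Rightarrow> nat \<Rightarrow> real" where
  "multichoose k n = real ((n + k) choose n)"

lemma multichoose_nonneg [simp]: "0 \<le> multichoose k n"
  by (simp add: multichoose_def)

lemma multichoose_0 [simp]: "multichoose 0 n = 1"
  by (simp add: multichoose_def)

text \<open>Coefficient form of d/dz (1 - z)^-(k+1) = (k + 1) (1 - z)^-(k+2).\<close>

lemma multichoose_Suc: "real (Suc n) * multichoose k (Suc n) = real (Suc k) * multichoose (Suc k) n"
proof -
  have "Suc n * (Suc (n + k) choose Suc n) = (Suc (n + k) - n) * (Suc (n + k) choose n)"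
    using binomial_absorb_comp[of "Suc (n + k)" n] binomial_absorption[of n "n + k"]
    by (metis Suc_times_binomial diff_Suc_1)
  then show ?thesis
    unfolding multichoose_def of_nat_mult[symmetric] by (simp add: Suc_diff_le del: of_nat_mult mult_Suc binomial_Suc_Suc)
qed

text \<open>Induction by the Cauchy product with the geometric series; the coefficients add up by
  the hockey-stick identity. Real z serves for mass bounds, complex z for transforms.\<close>

lemma multichoose_sums:
  fixes z :: "'a::{real_normed_field,banach}"
  assumes z: "norm z < 1"
  shows "(\<lambda>n. of_real (multichoose k n) * z ^ n) sums (1 / (1 - z) ^ Suc k)"
    and "summable (\<lambda>n. norm (of_real (multichoose k n) * z ^ n))"
proof -
  have "(\<lambda>n. of_real (multichoose k n) * z ^ n) sums (1 / (1 - z) ^ Suc k) \<and>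
    summable (\<lambda>n. norm (of_real (multichoose k n) * z ^ n))"
  proof (induction k)
    case 0
    show ?case using geometric_sums[OF z] summable_geometric[of "norm z"] z by (simp add: norm_power)
  next
    case (Suc k)
    have g: "summable (\<lambda>n. norm (z ^ n))" using summable_geometric[of "norm z"] z by (simp add: norm_power)
    have eq: "(\<Sum>i\<le>n. (of_real (multichoose k i) * z ^ i) * z ^ (n - i)) = of_real (multichoose (Suc k) n) * z ^ n" for n
    proof -
      have "(\<Sum>i\<le>n. (of_real (multichoose k i) * z ^ i) * z ^ (n - i)) = (\<Sum>i\<le>n. of_real (multichoose k i) * z ^ n)"
        by (intro sum.cong) (auto simp: mult.assoc simp flip: power_add)
      also have "\<dots> = of_real (\<Sum>i\<le>n. multichoose k i) * z ^ n" by (simp add: sum_distrib_right)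
      also have "(\<Sum>i\<le>n. multichoose k i) = multichoose (Suc k) n"
        unfolding multichoose_def using sum_choose_lower[of k n]
        by (simp add: add.commute del: binomial_Suc_Suc flip: of_nat_sum)
      finally show ?thesis .
    qed
    have "(\<lambda>n. \<Sum>i\<le>n. (of_real (multichoose k i) * z ^ i) * z ^ (n - i)) sums
      ((\<Sum>n. of_real (multichoose k n) * z ^ n) * (\<Sum>n. z ^ n))"
      using Suc g by (intro Cauchy_product_sums) auto
    moreover have "(\<Sum>n. of_real (multichoose k n) * z ^ n) = 1 / (1 - z) ^ Suc k" using Suc sums_unique by metis
    moreover have "(\<Sum>n. z ^ n) = 1 / (1 - z)" using suminf_geometric[OF z] .
    ultimately have 1: "(\<lambda>n. of_real (multichoose (Suc k) n) * z ^ n) sums (1 / (1 - z) ^ Suc (Suc k))"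
      unfolding eq by (simp add: mult.commute)
    have "summable (\<lambda>n. norm (of_real (multichoose k n) * z ^ n))" using Suc by blast
    then have s: "summable (\<lambda>n. norm (multichoose k n * norm z ^ n))" by (simp add: norm_mult norm_power)
    have g': "summable (\<lambda>n. norm (norm z ^ n))" using g by (simp add: norm_power)
    have eq': "(\<Sum>i\<le>n. (multichoose k i * norm z ^ i) * norm z ^ (n - i)) = multichoose (Suc k) n * norm z ^ n" for n
    proof -
      have "(\<Sum>i\<le>n. (multichoose k i * norm z ^ i) * norm z ^ (n - i)) = (\<Sum>i\<le>n. multichoose k i * norm z ^ n)"
        by (intro sum.cong) (auto simp: mult.assoc simp flip: power_add)
      also have "\<dots> = (\<Sum>i\<le>n. multichoose k i) * norm z ^ n" by (simp add: sum_distrib_right)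
      also have "(\<Sum>i\<le>n. multichoose k i) = multichoose (Suc k) n"
        unfolding multichoose_def using sum_choose_lower[of k n]
        by (simp add: add.commute del: binomial_Suc_Suc flip: of_nat_sum)
      finally show ?thesis .
    qed
    have "summable (\<lambda>n. multichoose (Suc k) n * norm z ^ n)"
      using summable_Cauchy_product[OF s g'] unfolding eq' .
    then have "summable (\<lambda>n. norm (of_real (multichoose (Suc k) n) * z ^ n))"
      by (simp add: norm_mult norm_power)
    then show ?case using 1 by blast
  qed
  then show "(\<lambda>n. of_real (multichoose k n) * z ^ n) sums (1 / (1 - z) ^ Suc k)"
    "summable (\<lambda>n. norm (of_real (multichoose k n) * z ^ n))" by auto
qed

section \<open>Exponential moments of the step law\<close>

context heavy_step begin

text \<open>Half of \<kappa>, because \<open>psi \<kappa>\<close> may equal 1 whereas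
  \<open>psi r\<close> is strictly smaller; the margin between \<open>r\<close> and \<kappa> also
  absorbs polynomial factors on the negative half-line.\<close>

definition r :: real where "r = \<kappa> / 2"

lemma r_pos: "0 < r" using kappa by (simp add: r_def)

lemma r_le: "r \<le> \<kappa>" using kappa by (simp add: r_def)

lemma exp_kappa_integrable: "integrable F (\<lambda>z. exp (- (\<kappa> * z)))"
  using left_tail by (intro integrableI_bounded) (auto intro: le_less_trans)

lemma exp_kappa_integral: "(LINT z|F. exp (- (\<kappa> * z))) \<le> 1"
proof -
  have "ennreal (LINT z|F. exp (- (\<kappa> * z))) \<le> 1"
    using left_tail by (subst nn_integral_eq_integral[symmetric]) (auto intro: exp_kappa_integrable)
  then show ?thesis by (simp add: ennreal_le_1)
qed

lemma exp_le_1_plus: assumes "0 \<le> l" "l \<le> \<kappa>" shows "exp (- (l * z)) \<le> 1 + exp (- (\<kappa> * z))"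
proof (cases "0 \<le> z")
  case True
  then have "exp (- (l * z)) \<le> 1" using assms by simp
  moreover have "0 < exp (- (\<kappa> * z))" by simp
  ultimately show ?thesis by linarith
next
  case False
  then have "l * (- z) \<le> \<kappa> * (- z)" using assms by (intro mult_right_mono) auto
  then have "exp (- (l * z)) \<le> exp (- (\<kappa> * z))" by simp
  then show ?thesis by linarith
qed

lemma exp_integrable: "0 \<le> l \<Longrightarrow> l \<le> \<kappa> \<Longrightarrow> integrable F (\<lambda>z. exp (- (l * z)))"
  by (rule Bochner_Integration.integrable_bound[where f="\<lambda>z. 1 + exp (- (\<kappa> * z))"])
     (auto intro!: exp_kappa_integrable always_eventually exp_le_1_plus order_trans[OF exp_le_1_plus])

definition psi :: "real \<Rightarrow> real" where "psi l = (LINT z|F. exp (- (l * z)))"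

lemma psi_nonneg: "0 \<le> psi l" unfolding psi_def by (intro Bochner_Integration.integral_nonneg) auto

text \<open>Strict Cauchy-Schwarz: as \<kappa> = 2 r, the square of 1 - exp(-r z) has mean 1 +
  \<open>psi \<kappa>\<close> - 2 \<open>psi r\<close>, and this is positive because F charges the
  positive half-line.\<close>

lemma psi_r: "psi r < 1"
proof -
  have i: "integrable F (\<lambda>z. exp (- (r * z)))" using kappa by (intro exp_integrable) (auto simp: r_def)
  have sq: "(1 - exp (- (r * z)))\<^sup>2 = 1 + exp (- (\<kappa> * z)) - 2 * exp (- (r * z))" for z
  proof -
    have "exp (- (\<kappa> * z)) = exp (- (r * z) + - (r * z))" by (simp add: r_def)
    also have "\<dots> = (exp (- (r * z)))\<^sup>2" by (simp only: exp_add power2_eq_square)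
    finally show ?thesis by (simp add: power2_diff)
  qed
  have i2: "integrable F (\<lambda>z. (1 - exp (- (r * z)))\<^sup>2)" unfolding sq
    by (intro Bochner_Integration.integrable_diff Bochner_Integration.integrable_add integrable_mult_right i exp_kappa_integrable) auto
  have "(LINT z|F. 0) < (LINT z|F. (1 - exp (- (r * z)))\<^sup>2)"
    using Fb_pos[of 0] r_pos by (intro integral_less_AE[where A="{0<..}"] i2) (auto simp: Fb_def emeasure_eq_measure)
  also have "\<dots> = 1 + (LINT z|F. exp (- (\<kappa> * z))) - 2 * psi r"
    unfolding sq psi_def using i exp_kappa_integrable prob_space by simp
  finally show ?thesis using exp_kappa_integral by simp
qed

text \<open>Convexity of the exponential interpolates between the value 1 at 0 and
  \<open>psi r\<close> < 1 at \<open>r\<close>.\<close>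

lemma psi_lt_1: assumes "0 < l" "l \<le> r" shows "psi l < 1"
proof -
  have r0: "0 < r" by (rule r_pos)
  have "psi l \<le> (LINT z|F. (1 - l/r) + l/r * exp (- (r * z)))"
    unfolding psi_def
  proof (rule integral_mono)
    show "integrable F (\<lambda>z. exp (- (l * z)))" using assms kappa by (intro exp_integrable) (auto simp: r_def)
    show "integrable F (\<lambda>z. (1 - l/r) + l/r * exp (- (r * z)))"
      using kappa by (intro Bochner_Integration.integrable_add integrable_mult_right exp_integrable) (auto simp: r_def)
    fix z
    have "exp ((1 - l/r) *\<^sub>R 0 + (l/r) *\<^sub>R (- (r * z))) \<le> (1 - l/r) * exp 0 + l/r * exp (- (r * z))"
      using assms r0 by (intro convex_onD[OF exp_convex]) (auto simp: field_simps)
    then show "exp (- (l * z)) \<le> (1 - l/r) + l/r * exp (- (r * z))" using r0 by simp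
  qed
  also have "\<dots> = (1 - l/r) + l/r * psi r"
    using exp_integrable[of r] kappa prob_space unfolding psi_def by (simp add: r_def)
  also have "\<dots> < (1 - l/r) + l/r * 1"
    using psi_r assms r0 by (intro add_strict_left_mono mult_strict_left_mono) auto
  finally show ?thesis by simp
qed

lemma abs_exp_le: "\<bar>z\<bar> * exp (- (r * z)) \<le> (1 + exp (- (\<kappa> * z))) / r"
proof -
  have "r * \<bar>z\<bar> \<le> exp (r * \<bar>z\<bar>)" using exp_ge_add_one_self[of "r * \<bar>z\<bar>"] by linarith
  then have "r * \<bar>z\<bar> * exp (- (r * z)) \<le> exp (r * \<bar>z\<bar>) * exp (- (r * z))" by (intro mult_right_mono) auto
  also have "\<dots> = exp (r * \<bar>z\<bar> - (r * z))" by (simp flip: exp_add)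
  also have "\<dots> \<le> 1 + exp (- (\<kappa> * z))"
    by (cases "0 \<le> z") (auto simp: r_def)
  finally show ?thesis using r_pos by (simp add: field_simps)
qed

lemma abs_exp_integrable: "integrable F (\<lambda>z. \<bar>z\<bar> * exp (- (r * z)))"
  by (rule Bochner_Integration.integrable_bound[where f="\<lambda>z. (1 + exp (- (\<kappa> * z))) / r"])
     (use r_pos in \<open>auto intro!: exp_kappa_integrable always_eventually order_trans[OF abs_exp_le] simp: abs_mult\<close>)

section \<open>Convolution powers of F and their interval masses\<close>

primrec pw :: "nat \<Rightarrow> real measure" where
  "pw 0 = return borel 0"
| "pw (Suc n) = convolution F (pw n)"

lemma sets_pw [simp, measurable_cong]: "sets (pw n) = sets borel" and space_pw [simp]: "space (pw n) = UNIV"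
  by (cases n; simp)+

lemma prob_space_pw: "prob_space (pw n)"
proof (induction n)
  case 0 show ?case unfolding pw.simps by (rule prob_space_return) simp
next
  case (Suc n)
  interpret P: prob_space "pw n" by fact
  interpret FP: pair_prob_space F "pw n" ..
  show ?case unfolding pw.simps convolution_def by (intro FP.prob_space_distr) measurable
qed

lemma finite_measure_pw [simp]: "finite_measure (pw n)"
  using prob_space_pw by (simp add: prob_space_def)

lemma nn_integral_pw_Suc:
  "f \<in> borel_measurable borel \<Longrightarrow> (\<integral>\<^sup>+y. f y \<partial>pw (Suc n)) = (\<integral>\<^sup>+z. (\<integral>\<^sup>+y. f (z + y) \<partial>pw n) \<partial>F)"
  by (simp add: nn_integral_convolution)

lemma integral_pw_Suc:
  fixes f :: "real \<Rightarrow> 'a::{banach,second_countable_topology}"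
  assumes [measurable]: "f \<in> borel_measurable borel" and f: "integrable (pw (Suc n)) f"
  shows "(\<integral>y. f y \<partial>pw (Suc n)) = (\<integral>z. (\<integral>y. f (z + y) \<partial>pw n) \<partial>F)"
    and "integrable F (\<lambda>z. (\<integral>y. f (z + y) \<partial>pw n))"
proof -
  interpret P: prob_space "pw n" by (rule prob_space_pw)
  interpret FP: pair_prob_space F "pw n" ..
  have i: "integrable (F \<Otimes>\<^sub>M pw n) (\<lambda>(z, y). f (z + y))"
    using f unfolding pw.simps convolution_def
    by (subst (asm) integrable_distr_eq) (auto simp: case_prod_unfold)
  have "(\<integral>y. f y \<partial>pw (Suc n)) = (\<integral>p. f (fst p + snd p) \<partial>(F \<Otimes>\<^sub>M pw n))"
    unfolding pw.simps convolution_def by (subst integral_distr) (auto simp: case_prod_unfold)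
  also have "\<dots> = (\<integral>z. (\<integral>y. f (z + y) \<partial>pw n) \<partial>F)"
    using FP.integral_fst'[OF i] by (simp add: case_prod_unfold)
  finally show "(\<integral>y. f y \<partial>pw (Suc n)) = (\<integral>z. (\<integral>y. f (z + y) \<partial>pw n) \<partial>F)" .
  show "integrable F (\<lambda>z. (\<integral>y. f (z + y) \<partial>pw n))"
    using FP.integrable_fst'[OF i] by simp
qed

lemma nn_exp_pw: assumes "0 \<le> l" "l \<le> \<kappa>"
  shows "(\<integral>\<^sup>+y. ennreal (exp (- (l * y))) \<partial>pw n) = ennreal (psi l ^ n)"
proof (induction n)
  case 0 show ?case unfolding pw.simps by (subst nn_integral_return) auto
next
  case (Suc n)
  have "(\<integral>\<^sup>+y. ennreal (exp (- (l * y))) \<partial>pw (Suc n)) = (\<integral>\<^sup>+z. (\<integral>\<^sup>+y. ennreal (exp (- (l * z))) * ennreal (exp (- (l * y))) \<partial>pw n) \<partial>F)"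
    by (subst nn_integral_pw_Suc) (auto simp: algebra_simps exp_add exp_diff exp_minus ennreal_mult' field_simps intro!: nn_integral_cong simp flip: ennreal_mult')
  also have "\<dots> = (\<integral>\<^sup>+z. ennreal (exp (- (l * z))) * ennreal (psi l ^ n) \<partial>F)"
    by (simp add: nn_integral_cmult Suc)
  also have "\<dots> = ennreal (psi l) * ennreal (psi l ^ n)"
    unfolding psi_def using assms by (simp add: nn_integral_multc nn_integral_eq_integral exp_integrable)
  finally show ?case by (simp add: ennreal_mult psi_nonneg)
qed

lemma exp_pw_integrable: "0 \<le> l \<Longrightarrow> l \<le> \<kappa> \<Longrightarrow> integrable (pw n) (\<lambda>y. exp (- (l * y)))"
  using nn_exp_pw[of l n] by (intro integrableI_bounded) auto

lemma exp_pw_integral: "0 \<le> l \<Longrightarrow> l \<le> \<kappa> \<Longrightarrow> (LINT y|pw n. exp (- (l * y))) = psi l ^ n"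
  using nn_exp_pw[of l n] by (subst integral_eq_nn_integral) (auto simp: psi_nonneg)

definition ivl :: "nat \<Rightarrow> real \<Rightarrow> real \<Rightarrow> real" where
  "ivl n h x = measure (pw n) {x<..x + h}"

definition fm :: "nat \<Rightarrow> real \<Rightarrow> real \<Rightarrow> real" where
  "fm n h x = (LINT y|pw n. y * indicator {x<..x + h} y)"

lemma ivl_nonneg [simp]: "0 \<le> ivl n h x" by (simp add: ivl_def)

lemma indicator_pw_integrable [simp]: "A \<in> sets borel \<Longrightarrow> integrable (pw n) (indicator A :: real \<Rightarrow> real)"
  using finite_measure.emeasure_finite[OF finite_measure_pw, of n A]
  by (simp add: less_top[symmetric])

lemma ivl_measurable [measurable]: assumes "0 \<le> h" shows "ivl n h \<in> borel_measurable borel"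
proof -
  interpret P: real_distribution "pw n"
    using prob_space_pw[of n] by (simp add: real_distribution_def real_distribution_axioms_def)
  have "ivl n h x = cdf (pw n) (x + h) - cdf (pw n) x" for x
  proof (cases "h = 0")
    case False
    then show ?thesis using assms P.cdf_diff_eq[of x "x + h"] by (simp add: ivl_def)
  qed (simp add: ivl_def)
  then have eq: "ivl n h = (\<lambda>x. cdf (pw n) (x + h) - cdf (pw n) x)" by auto
  have [measurable]: "cdf (pw n) \<in> borel_measurable borel"
    by (intro borel_measurable_mono monoI P.cdf_nondecreasing)
  show ?thesis unfolding eq by measurable
qed

text \<open>Exponential Markov inequality at the right end of the interval; geometric in n once
  \<open>psi l\<close> < 1.\<close>

lemma ivl_bound: assumes "0 \<le> l" "l \<le> \<kappa>" shows "ivl n h x \<le> exp (l * (x + h)) * psi l ^ n"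
proof -
  have "ivl n h x = (LINT y|pw n. indicator {x<..x + h} y)" by (simp add: ivl_def)
  also have "\<dots> \<le> (LINT y|pw n. exp (l * (x + h)) * exp (- (l * y)))"
  proof (rule integral_mono)
    show "integrable (pw n) (\<lambda>y. exp (l * (x + h)) * exp (- (l * y)))"
      using assms by (intro integrable_mult_right exp_pw_integrable)
    fix y show "indicator {x<..x + h} y \<le> exp (l * (x + h)) * exp (- (l * y))"
    proof (cases "y \<le> x + h")
      case True
      then have "l * y \<le> l * (x + h)" using assms by (intro mult_left_mono)
      then have "1 \<le> exp (l * (x + h) - l * y)" by simp
      also have "\<dots> = exp (l * (x + h)) * exp (- (l * y))" by (simp add: exp_diff exp_minus divide_inverse)
      finally show ?thesis by (auto split: split_indicator)
    qed (simp add: indicator_def)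
  qed simp
  also have "\<dots> = exp (l * (x + h)) * psi l ^ n" using assms by (simp add: exp_pw_integral)
  finally show ?thesis .
qed

lemma indicator_shift: "indicator {x<..x + h} (z + y :: real) = (indicator {x - z<..x - z + h} y :: real)"
  by (auto split: split_indicator)

lemma ivl_Suc: "ivl (Suc n) h x = (LINT z|F. ivl n h (x - z))"
proof -
  have eq: "(LINT y|pw n. indicator {x<..x + h} (z + y)) = ivl n h (x - z)" for z
    unfolding indicator_shift by (simp add: ivl_def)
  show "ivl (Suc n) h x = (LINT z|F. ivl n h (x - z))"
    using integral_pw_Suc(1)[of "indicator {x<..x + h} :: real \<Rightarrow> real" n] indicator_pw_integrable[of "{x<..x + h}" "Suc n"]
    unfolding eq by (simp add: ivl_def)
qed

lemma ivl_r_bound: "ivl n h x \<le> exp (r * (x + h)) * psi r ^ n"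
  using kappa by (intro ivl_bound) (auto simp: r_def)

lemma z_ivl_bound: "\<bar>z * ivl n h (x - z)\<bar> \<le> exp (r * (x + h)) * psi r ^ n * (\<bar>z\<bar> * exp (- (r * z)))"
proof -
  have "\<bar>z\<bar> * ivl n h (x - z) \<le> \<bar>z\<bar> * (exp (r * (x - z + h)) * psi r ^ n)"
    by (intro mult_left_mono ivl_r_bound) auto
  also have "exp (r * (x - z + h)) = exp (r * (x + h)) * exp (- (r * z))"
    by (simp add: algebra_simps flip: exp_add)
  finally show ?thesis by (simp add: abs_mult algebra_simps)
qed

lemma z_ivl_integrable: "0 \<le> h \<Longrightarrow> integrable F (\<lambda>z. z * ivl n h (x - z))"
  by (rule Bochner_Integration.integrable_bound[where f="\<lambda>z. exp (r * (x + h)) * psi r ^ n * (\<bar>z\<bar> * exp (- (r * z)))"])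
     (use z_ivl_bound[of _ n h x] in \<open>auto intro!: always_eventually integrable_mult_right abs_exp_integrable
        simp: abs_mult psi_nonneg\<close>)

lemma fm_integrable: "0 \<le> h \<Longrightarrow> integrable (pw n) (\<lambda>y. y * indicator {x<..x + h} y)"
  by (rule finite_measure.integrable_const_bound[OF finite_measure_pw, where B="\<bar>x\<bar> + h"])
     (auto split: split_indicator)

lemma fm_Suc: assumes h: "0 \<le> h"
  shows "fm (Suc n) h x = (LINT z|F. z * ivl n h (x - z)) + (LINT z|F. fm n h (x - z))"
    and "integrable F (\<lambda>z. fm n h (x - z))"
proof -
  have eq: "(LINT y|pw n. (z + y) * indicator {x<..x + h} (z + y)) = z * ivl n h (x - z) + fm n h (x - z)" for z
  proof -
    have "(LINT y|pw n. (z + y) * indicator {x<..x + h} (z + y)) =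
      (LINT y|pw n. z * indicator {x - z<..x - z + h} y + y * indicator {x - z<..x - z + h} y)"
      unfolding indicator_shift by (simp add: algebra_simps)
    also have "\<dots> = z * ivl n h (x - z) + fm n h (x - z)"
      using fm_integrable[OF h, of n "x - z"] by (subst Bochner_Integration.integral_add) (auto simp: ivl_def fm_def)
    finally show ?thesis .
  qed
  have I: "integrable F (\<lambda>z. z * ivl n h (x - z) + fm n h (x - z))"
    using integral_pw_Suc(2)[of "\<lambda>y. y * indicator {x<..x + h} y" n] fm_integrable[OF h, of "Suc n" x]
    unfolding eq by simp
  from Bochner_Integration.integrable_diff[OF I z_ivl_integrable[OF h, of n x]]
  show J: "integrable F (\<lambda>z. fm n h (x - z))" by simp
  have "fm (Suc n) h x = (LINT z|F. z * ivl n h (x - z) + fm n h (x - z))"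
    using integral_pw_Suc(1)[of "\<lambda>y. y * indicator {x<..x + h} y" n] fm_integrable[OF h, of "Suc n" x]
    unfolding eq by (simp add: fm_def)
  then show "fm (Suc n) h x = (LINT z|F. z * ivl n h (x - z)) + (LINT z|F. fm n h (x - z))"
    using J z_ivl_integrable[OF h, of n x] by simp
qed

text \<open>Exchangeability: in a sum S of n + 1 steps each step contributes equally to
  E[S; x < S \<le> x + h], so this is n + 1 times the contribution of one step z, the other n
  landing in the interval shifted by z. The induction splits off a step and swaps it with the
  distinguished one by Fubini.\<close>

lemma fm_eq: assumes h: "0 \<le> h" shows "fm (Suc n) h x = real (Suc n) * (LINT z|F. z * ivl n h (x - z))"
proof (induction n arbitrary: x)
  case 0
  have "fm 0 h y = y * 0 ^ 0 * 0 + 0 * indicator {y<..y + h} 0" for y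
    unfolding fm_def pw.simps by (subst integral_return) auto
  then show ?case using fm_Suc(1)[OF h, of 0 x] by simp
next
  case (Suc n)
  interpret FF: pair_prob_space F F ..
  have [measurable]: "ivl n h \<in> borel_measurable borel" by (rule ivl_measurable[OF h])
  have i: "integrable (F \<Otimes>\<^sub>M F) (\<lambda>(z, w). w * ivl n h (x - z - w))"
  proof (rule Bochner_Integration.integrable_bound)
    show "integrable (F \<Otimes>\<^sub>M F) (\<lambda>(z, w). (exp (r * (x + h)) * psi r ^ n * exp (- (r * z))) * (\<bar>w\<bar> * exp (- (r * w))))"
    proof (rule FF.Fubini_integrable)
      show "integrable F (\<lambda>z. LINT w|F. norm (case (z, w) of (z, w) \<Rightarrow> (exp (r * (x + h)) * psi r ^ n * exp (- (r * z))) * (\<bar>w\<bar> * exp (- (r * w)))))"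
        using exp_integrable[of r] r_pos r_le by (simp add: abs_mult psi_nonneg)
    qed (use abs_exp_integrable in auto)
    have "\<bar>w * ivl n h (x - z - w)\<bar> \<le> (exp (r * (x + h)) * psi r ^ n * exp (- (r * z))) * (\<bar>w\<bar> * exp (- (r * w)))" for z w
      using z_ivl_bound[of w n h "x - z"] by (simp add: algebra_simps exp_add exp_diff exp_minus field_simps)
    then show "AE p in F \<Otimes>\<^sub>M F. norm (case p of (z, w) \<Rightarrow> w * ivl n h (x - z - w)) \<le>
        norm (case p of (z, w) \<Rightarrow> (exp (r * (x + h)) * psi r ^ n * exp (- (r * z))) * (\<bar>w\<bar> * exp (- (r * w))))"
      by (intro always_eventually) (auto simp: abs_mult psi_nonneg)
  qed measurable
  have "(LINT z|F. fm (Suc n) h (x - z)) = real (Suc n) * (LINT z|F. LINT w|F. w * ivl n h (x - z - w))"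
    unfolding Suc by simp
  also have "(LINT z|F. LINT w|F. w * ivl n h (x - z - w)) = (LINT w|F. LINT z|F. w * ivl n h (x - z - w))"
    using FF.Fubini_integral[OF i] by simp
  also have "\<dots> = (LINT w|F. w * ivl (Suc n) h (x - w))"
  proof (intro Bochner_Integration.integral_cong refl)
    fix w
    have "x - z - w = x - w - z" for z by simp
    then show "(LINT z|F. w * ivl n h (x - z - w)) = w * ivl (Suc n) h (x - w)"
      unfolding ivl_Suc by (simp only: integral_mult_right_zero)
  qed
  finally show ?case using fm_Suc(1)[OF h, of "Suc n" x] by (simp add: algebra_simps)
qed

text \<open>The mass of \<open>{x<..x+h}\<close> under the \<open>(k+1)\<close>-fold convolution power of the renewal measure of \<open>F\<close>.\<close>

definition V :: "nat \<Rightarrow> real \<Rightarrow> real \<Rightarrow> real" where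
  "V k h x = (\<Sum>n. multichoose k n * ivl n h x)"

lemma V_summable: "summable (\<lambda>n. multichoose k n * ivl n h x)"
  and V_bound: "0 < l \<Longrightarrow> l \<le> r \<Longrightarrow> V k h x \<le> exp (l * (x + h)) / (1 - psi l) ^ Suc k"
proof -
  have 1: "summable (\<lambda>n. multichoose k n * ivl n h x) \<and> V k h x \<le> exp (l * (x + h)) / (1 - psi l) ^ Suc k" if l: "0 < l" "l \<le> r" for l
  proof -
    have n: "norm (psi l) < 1" using psi_lt_1[OF l] psi_nonneg[of l] by simp
    have s: "(\<lambda>n. exp (l * (x + h)) * (multichoose k n * psi l ^ n)) sums (exp (l * (x + h)) * (1 / (1 - psi l) ^ Suc k))"
      using multichoose_sums(1)[OF n, of k] by (intro sums_mult) simp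
    have b: "multichoose k n * ivl n h x \<le> exp (l * (x + h)) * (multichoose k n * psi l ^ n)" for n
      using mult_left_mono[OF ivl_bound[of l n h x], of "multichoose k n"] l kappa
      by (simp add: r_def algebra_simps)
    have sm: "summable (\<lambda>n. multichoose k n * ivl n h x)"
      by (rule summable_comparison_test'[OF sums_summable[OF s], of 0]) (use b in auto)
    then have "V k h x \<le> (\<Sum>n. exp (l * (x + h)) * (multichoose k n * psi l ^ n))"
      unfolding V_def using b by (intro suminf_le sums_summable[OF s])
    then show ?thesis using sm sums_unique[OF s] by simp
  qed
  show "summable (\<lambda>n. multichoose k n * ivl n h x)" using 1[of r] r_pos by simp
  show "0 < l \<Longrightarrow> l \<le> r \<Longrightarrow> V k h x \<le> exp (l * (x + h)) / (1 - psi l) ^ Suc k" using 1 by blast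
qed

lemma V_nonneg: "0 \<le> V k h x"
  unfolding V_def by (intro suminf_nonneg V_summable) simp

lemma V_measurable: "0 \<le> h \<Longrightarrow> V k h \<in> borel_measurable borel"
  unfolding V_def[abs_def] by (intro borel_measurable_suminf borel_measurable_times ivl_measurable) auto

lemma V_moment_sums: assumes h: "0 \<le> h"
  shows "(\<lambda>n. multichoose k n * (LINT z|F. z * ivl n h (x - z))) sums (LINT z|F. z * V k h (x - z))"
    and "integrable F (\<lambda>z. z * V k h (x - z))"
proof -
  let ?f = "\<lambda>n z. multichoose k n * (z * ivl n h (x - z))"
  have i: "integrable F (?f n)" for n by (intro integrable_mult_right z_ivl_integrable h)
  have n: "norm (psi r) < 1" using psi_r psi_nonneg[of r] by simp
  have s: "summable (\<lambda>n. norm (?f n z))" for z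
    using summable_mult[OF V_summable, of "\<bar>z\<bar>" k h "x - z"] by (simp add: abs_mult algebra_simps)
  have eq: "(\<Sum>n. ?f n z) = z * V k h (x - z)" for z
    using suminf_mult[OF V_summable, of z k h "x - z"] unfolding V_def by (simp add: algebra_simps)
  define C where "C = exp (r * (x + h)) * (LINT z|F. \<bar>z\<bar> * exp (- (r * z)))"
  have t: "summable (\<lambda>n. LINT z|F. norm (?f n z))"
  proof (rule summable_comparison_test'[where N=0])
    show "summable (\<lambda>n. C * (multichoose k n * psi r ^ n))"
      using multichoose_sums(1)[OF n, of k] by (intro summable_mult) (simp add: sums_iff)
    fix n
    have "(LINT z|F. norm (?f n z)) \<le> (LINT z|F. multichoose k n * (exp (r * (x + h)) * psi r ^ n * (\<bar>z\<bar> * exp (- (r * z)))))"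
    proof (rule integral_mono)
      show "norm (?f n z) \<le> multichoose k n * (exp (r * (x + h)) * psi r ^ n * (\<bar>z\<bar> * exp (- (r * z))))" for z
        using z_ivl_bound[of z n h x] by (simp add: abs_mult mult_left_mono)
    qed (use i in \<open>auto intro!: integrable_mult_right abs_exp_integrable\<close>)
    also have "\<dots> = C * (multichoose k n * psi r ^ n)" by (simp add: C_def)
    finally show "norm (LINT z|F. norm (?f n z)) \<le> C * (multichoose k n * psi r ^ n)" by simp
  qed
  have "(\<lambda>n. LINT z|F. ?f n z) sums (LINT z|F. (\<Sum>n. ?f n z))"
    by (rule sums_integral) (use i s t in auto)
  then show "(\<lambda>n. multichoose k n * (LINT z|F. z * ivl n h (x - z))) sums (LINT z|F. z * V k h (x - z))"
    unfolding eq by simp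
  have "integrable F (\<lambda>z. \<Sum>n. ?f n z)"
    by (rule integrable_suminf) (use i s t in auto)
  then show "integrable F (\<lambda>z. z * V k h (x - z))" unfolding eq .
qed

lemma fm_ivl: assumes "0 \<le> h" shows "x * ivl n h x \<le> fm n h x" "fm n h x \<le> (x + h) * ivl n h x"
proof -
  have eq: "c * ivl n h x = (LINT y|pw n. c * indicator {x<..x + h} y)" for c by (simp add: ivl_def)
  show "x * ivl n h x \<le> fm n h x" unfolding eq fm_def
    by (intro integral_mono fm_integrable assms) (auto split: split_indicator)
  show "fm n h x \<le> (x + h) * ivl n h x" unfolding eq fm_def
    by (intro integral_mono fm_integrable assms) (auto split: split_indicator)
qed

text \<open>The measure-level form of \<open>(d/dt) (1 - f) ^ - (k + 1) = (k + 1) f' (1 - f) ^ - (k + 2)\<close>, \<open>f\<close> being the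
  Fourier transform of \<open>F\<close>; the factor \<open>y\<close> on the left is between \<open>x\<close> and \<open>x + h\<close>.\<close>

lemma V_recursion: assumes h: "0 \<le> h"
  shows "x * V k h x \<le> real (Suc k) * (LINT z|F. z * V (Suc k) h (x - z))" (is ?A)
    and "real (Suc k) * (LINT z|F. z * V (Suc k) h (x - z)) \<le> (x + h) * V k h x" (is ?B)
proof -
  have "(\<lambda>n. real (Suc k) * (multichoose (Suc k) n * (LINT z|F. z * ivl n h (x - z)))) sums
      (real (Suc k) * (LINT z|F. z * V (Suc k) h (x - z)))"
    by (intro sums_mult V_moment_sums h)
  moreover have "real (Suc k) * (multichoose (Suc k) n * (LINT z|F. z * ivl n h (x - z))) = multichoose k (Suc n) * fm (Suc n) h x" for n
    unfolding fm_eq[OF h] using multichoose_Suc[of n k] by (metis mult.assoc mult.commute)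
  ultimately have "(\<lambda>n. multichoose k (Suc n) * fm (Suc n) h x) sums (real (Suc k) * (LINT z|F. z * V (Suc k) h (x - z)))"
    by simp
  \<comment> \<open>The 0-fold power sits at 0, so its first moment vanishes; hence the series may
    start at n = 1, as the index shift of \<open>multichoose_Suc\<close> requires.\<close>
  moreover have "fm 0 h x = 0" unfolding fm_def pw.simps by (subst integral_return) auto
  ultimately have s: "(\<lambda>n. multichoose k n * fm n h x) sums (real (Suc k) * (LINT z|F. z * V (Suc k) h (x - z)))"
    using sums_Suc_iff[of "\<lambda>n. multichoose k n * fm n h x"] by simp
  have V: "(\<lambda>n. c * (multichoose k n * ivl n h x)) sums (c * V k h x)" for c
    unfolding V_def by (intro sums_mult summable_sums V_summable)
  show ?A by (rule sums_le[OF _ V s]) (use mult_left_mono[OF fm_ivl(1)[OF h, of x] multichoose_nonneg] in \<open>simp add: mult.left_commute\<close>)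
  show ?B by (rule sums_le[OF _ s V]) (use mult_left_mono[OF fm_ivl(2)[OF h] multichoose_nonneg] in \<open>simp add: mult.left_commute\<close>)
qed

end

section \<open>Passing from one convolution power to the previous one\<close>

text \<open>A Cauchy criterion at infinity that asks for no candidate limit. It lets the descent
  through the convolution powers speak of existence only.\<close>

lemma converges_if_approximable:
  fixes f :: "real \<Rightarrow> real"
  assumes "\<And>e. 0 < e \<Longrightarrow> \<exists>g L. (g \<longlongrightarrow> L) at_top \<and> eventually (\<lambda>x. \<bar>f x - g x\<bar> \<le> e) at_top"
  shows "\<exists>L. (f \<longlongrightarrow> L) at_top"
proof -
  have ex: "\<exists>L. eventually (\<lambda>x. \<bar>f x - L\<bar> \<le> 2 * e) at_top" if e: "0 < e" for e
  proof -
    obtain g L where g: "(g \<longlongrightarrow> L) at_top" "eventually (\<lambda>x. \<bar>f x - g x\<bar> \<le> e) at_top" using assms[OF e] by blast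
    have "eventually (\<lambda>x. dist (g x) L < e) at_top" using tendstoD[OF g(1) e] .
    with g(2) have "eventually (\<lambda>x. \<bar>f x - L\<bar> \<le> 2 * e) at_top"
      by eventually_elim (auto simp: dist_real_def)
    then show ?thesis by blast
  qed
  have "\<forall>n. \<exists>L. eventually (\<lambda>x. \<bar>f x - L\<bar> \<le> 2 / real (Suc n)) at_top"
    using ex[of "1 / real (Suc n)" for n] by simp
  then obtain L where L: "\<And>n. eventually (\<lambda>x. \<bar>f x - L n\<bar> \<le> 2 / real (Suc n)) at_top"
    unfolding choice_iff by auto
  have close: "\<bar>L n - L k\<bar> \<le> 2 / real (Suc n) + 2 / real (Suc k)" for n k
  proof -
    have "eventually (\<lambda>x. \<bar>L n - L k\<bar> \<le> 2 / real (Suc n) + 2 / real (Suc k)) (at_top :: real filter)"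
      using L[of n] L[of k] by eventually_elim linarith
    then show ?thesis by simp
  qed
  have lim: "(\<lambda>n. 2 / real (Suc n)) \<longlonglongrightarrow> 0" by real_asymp
  have "Cauchy L"
  proof (rule CauchyI)
    fix e :: real assume e: "0 < e"
    obtain N where N: "\<And>n. n \<ge> N \<Longrightarrow> 2 / real (Suc n) < e / 2"
      using order_tendstoD(2)[OF lim, of "e/2"] e by (auto simp: eventually_sequentially)
    show "\<exists>M. \<forall>m\<ge>M. \<forall>n\<ge>M. norm (L m - L n) < e"
    proof (intro exI[of _ N] allI impI)
      fix p q assume "N \<le> p" "N \<le> q"
      from N[OF this(1)] N[OF this(2)] close[of p q] show "norm (L p - L q) < e" by simp
    qed
  qed
  then obtain l where l: "L \<longlonglongrightarrow> l" by (auto simp: Cauchy_convergent_iff convergent_def)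
  have "(f \<longlongrightarrow> l) at_top"
  proof (rule tendstoI)
    fix e :: real assume e: "0 < e"
    have "eventually (\<lambda>n. 2 / real (Suc n) < e / 2 \<and> dist (L n) l < e / 2) sequentially"
      using order_tendstoD(2)[OF lim, of "e/2"] tendstoD[OF l, of "e/2"] e by (simp add: eventually_conj)
    then obtain n where n: "2 / real (Suc n) < e / 2" "dist (L n) l < e / 2" by (auto simp: eventually_sequentially)
    from L[of n] show "eventually (\<lambda>x. dist (f x) l < e) at_top"
    proof eventually_elim
      case (elim x)
      then show ?case using n unfolding dist_real_def by linarith
    qed
  qed
  then show ?thesis by blast
qed

text \<open>Raise c u/n \<le> exp(c u/n) to the power n.\<close>

lemma power_le_exp:
  fixes u c :: real
  assumes "0 \<le> u" "0 < c" "0 < n"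
  shows "u ^ n \<le> (real n / c) ^ n * exp (c * u)"
proof -
  have "c * u / real n \<le> exp (c * u / real n)" using exp_ge_add_one_self[of "c * u / real n"] by linarith
  then have "u \<le> real n / c * exp (c * u / real n)" using assms by (simp add: field_simps)
  then have "u ^ n \<le> (real n / c * exp (c * u / real n)) ^ n" using assms by (intro power_mono)
  also have "exp (c * u / real n) ^ n = exp (c * u)" using assms by (simp flip: exp_of_nat_mult)
  then have "(real n / c * exp (c * u / real n)) ^ n = (real n / c) ^ n * exp (c * u)" by (simp only: power_mult_distrib)
  finally show ?thesis .
qed

text \<open>The integral condition in \<epsilon>-\<delta> form; d < 1/2 is a normalisation obtained
  by taking d close to 0.\<close>

locale strong_step = heavy_step +
  assumes small_steps: "\<And>e. 0 < e \<Longrightarrow> \<exists>d>0. d < 1/2 \<and> eventually (\<lambda>x.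
      ennreal (x * measure F {x<..}) *
        (\<integral>\<^sup>+z. ennreal (1 / ((x - z) * (measure F {x - z<..})\<^sup>2)) * indicator {1..d * x} (x - z) \<partial>F) \<le> ennreal e) at_top"
begin

text \<open>Converse of \<open>a_le_inverse_Fb\<close> up to a constant: for \<alpha> < 1 the
  normalisations \<open>a\<close> and \<open>1 / Fb\<close> are interchangeable.\<close>

lemma inverse_Fb_le: assumes "\<alpha> < 1"
  shows "eventually (\<lambda>x. 1 / Fb x \<le> 2 / (1 - \<alpha>) * a x) at_top"
proof -
  have "eventually (\<lambda>x. (1 - \<alpha>) / 2 < x * Fb x / m x) at_top"
    using assms by (intro order_tendstoD(1)[OF Fb_m_ratio]) auto
  then show ?thesis using eventually_gt_at_top[of 0]
  proof eventually_elim
    case (elim x)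
    then show ?case using assms Fb_pos[of x] m_pos[of x] by (simp add: a_def field_simps)
  qed
qed

text \<open>Needed for steps that reach or pass x. For \<alpha> < 1 a unit window inside the range
  of the integral condition already yields x Fb(x) F(window) -> 0, and x Fb(x) has the order of
  \<open>m x\<close>. For \<alpha> = 1 the Potter bound gives m(x)^2 = O(x), while F(window) \<le>
  Fb(x - 2) = o(m(x)/x).\<close>

lemma unit_interval_mass: "((\<lambda>x. m x * measure F {x - 1..x}) \<longlongrightarrow> 0) at_top"
proof (cases "\<alpha> < 1")
  case True
  have "((\<lambda>x. (x * Fb x) * measure F {x - 2..x - 1}) \<longlongrightarrow> 0) at_top"
  proof (rule tendstoI)
    fix e :: real assume e: "0 < e"
    from small_steps[of "e/4"] e obtain d where d: "0 < d" and ev: "eventually (\<lambda>x.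
      ennreal (x * Fb x) * (\<integral>\<^sup>+z. ennreal (1 / ((x - z) * (Fb (x - z))\<^sup>2)) * indicator {1..d * x} (x - z) \<partial>F) \<le> ennreal (e/4)) at_top"
      unfolding Fb_def by auto
    from ev eventually_ge_at_top[of "2/d"] eventually_gt_at_top[of 0]
    show "eventually (\<lambda>x. dist ((x * Fb x) * measure F {x - 2..x - 1}) 0 < e) at_top"
    proof eventually_elim
      case (elim x)
      have "ennreal (1/2 * measure F {x - 2..x - 1}) = ennreal (1/2) * ennreal (measure F {x - 2..x - 1})"
        by (rule ennreal_mult) auto
      also have "\<dots> = (\<integral>\<^sup>+z. ennreal (1/2) * indicator {x - 2..x - 1} z \<partial>F)"
        by (simp add: nn_integral_cmult emeasure_eq_measure)
      also have "\<dots> \<le> (\<integral>\<^sup>+z. ennreal (1 / ((x - z) * (Fb (x - z))\<^sup>2)) * indicator {1..d * x} (x - z) \<partial>F)"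
      proof (rule nn_integral_mono)
        fix z
        show "ennreal (1/2) * indicator {x - 2..x - 1} z \<le> ennreal (1 / ((x - z) * (Fb (x - z))\<^sup>2)) * indicator {1..d * x} (x - z)"
        proof (cases "z \<in> {x - 2..x - 1}")
          case True
          have "2 \<le> d * x" using elim d by (simp add: field_simps)
          then have i1: "indicator {1..d * x} (x - z) = (1::ennreal)" using True by (auto simp: indicator_def)
          have i2: "indicator {x - 2..x - 1} z = (1::ennreal)" using True by simp
          \<comment> \<open>On the window 1 \<le> x - z \<le> 2 and \<open>Fb\<close> is at most 1,
            so the kernel is at least 1/2.\<close>
          have le: "1 / 2 \<le> 1 / ((x - z) * (Fb (x - z))\<^sup>2)"
          proof -
            have "(x - z) * (Fb (x - z))\<^sup>2 \<le> 2 * 1"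
              using True Fb_le_1[of "x - z"] Fb_nonneg[of "x - z"] by (intro mult_mono power_le_one) auto
            then show ?thesis using True Fb_pos[of "x - z"] by (intro divide_left_mono) auto
          qed
          show ?thesis unfolding i1 i2 mult_1_right using le by (rule ennreal_leI)
        qed simp
      qed
      finally have "ennreal (x * Fb x) * ennreal (1/2 * measure F {x - 2..x - 1}) \<le> ennreal (e/4)"
        using elim(1) mult_left_mono[of _ _ "ennreal (x * Fb x)"] by (meson order_trans zero_le)
      then have "ennreal ((x * Fb x) * (1/2 * measure F {x - 2..x - 1})) \<le> ennreal (e/4)"
        using elim Fb_nonneg by (subst ennreal_mult) auto
      then have "(x * Fb x) * (1/2 * measure F {x - 2..x - 1}) \<le> e/4"
        using e by (simp add: ennreal_le_iff)
      moreover have "0 \<le> (x * Fb x) * measure F {x - 2..x - 1}" using elim Fb_nonneg by simp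
      ultimately show ?case using e by (simp add: dist_real_def)
    qed
  qed
  \<comment> \<open>The condition only sees x - z \<ge> 1, which forced the window {x - 2..x - 1};
    translating by 1 moves it to {x - 1..x}.\<close>
  then have "((\<lambda>x. ((x + 1) * Fb (x + 1)) * measure F {(x + 1) - 2..(x + 1) - 1}) \<longlongrightarrow> 0) at_top"
    by (rule filterlim_compose) real_asymp
  then have "((\<lambda>x. 2 / (1 - \<alpha>) * (((x + 1) * Fb (x + 1)) * measure F {x - 1..x})) \<longlongrightarrow> 2 / (1 - \<alpha>) * 0) at_top"
    by (intro tendsto_intros) simp
  then show ?thesis unfolding mult_zero_right
  proof (rule Lim_null_comparison[rotated])
    have "eventually (\<lambda>x. 1 / Fb (x + 1) \<le> 2 / (1 - \<alpha>) * a (x + 1)) at_top"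
      using inverse_Fb_le[OF True] by (rule eventually_compose_filterlim) real_asymp
    then show "eventually (\<lambda>x. norm (m x * measure F {x - 1..x}) \<le> 2 / (1 - \<alpha>) * (((x + 1) * Fb (x + 1)) * measure F {x - 1..x})) at_top"
      using eventually_gt_at_top[of 0]
    proof eventually_elim
      case (elim x)
      have "m x \<le> m (x + 1)" by (intro m_mono) simp
      also have "\<dots> \<le> 2 / (1 - \<alpha>) * ((x + 1) * Fb (x + 1))"
        using elim True Fb_pos[of "x+1"] m_pos[of "x+1"] by (simp add: a_def field_simps)
      finally have "m x * measure F {x - 1..x} \<le> 2 / (1 - \<alpha>) * ((x + 1) * Fb (x + 1)) * measure F {x - 1..x}"
        by (intro mult_right_mono) auto
      then show ?case using m_nonneg[of x] by (simp add: mult.assoc)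
    qed
  qed
next
  case False
  then have a1: "\<alpha> = 1" using alpha by simp
  obtain c where c: "0 < c" "\<And>x. 1 \<le> x \<Longrightarrow> c * x powr (1/2) \<le> a x" using a_lower a1 by auto
  have sq: "m x * m x \<le> x / c\<^sup>2" if "1 \<le> x" for x
  proof -
    have "(c * x powr (1/2))\<^sup>2 \<le> (a x)\<^sup>2" using c that by (intro power_mono) auto
    moreover have "(x powr (1/2))\<^sup>2 = x" using that by (simp add: powr_half_sqrt)
    ultimately have "c\<^sup>2 * x \<le> x\<^sup>2 / (m x)\<^sup>2" by (simp add: a_def power_mult_distrib power_divide)
    then have "c\<^sup>2 * x * (m x)\<^sup>2 \<le> x * x" using m_pos[of x] that by (simp add: pos_le_divide_eq power2_eq_square)
    then have "c\<^sup>2 * (m x)\<^sup>2 \<le> x" using that by (simp add: mult.commute mult.left_commute)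
    then show ?thesis using c by (simp add: field_simps power2_eq_square)
  qed
  have "((\<lambda>x. 2 / c\<^sup>2 * (x * Fb x / m x)) \<longlongrightarrow> 2 / c\<^sup>2 * 0) at_top"
    using Fb_m_ratio a1 by (intro tendsto_intros) auto
  then have "((\<lambda>x. 2 / c\<^sup>2 * ((x - 2) * Fb (x - 2) / m (x - 2))) \<longlongrightarrow> 2 / c\<^sup>2 * 0) at_top"
    by (rule filterlim_compose) real_asymp
  then show ?thesis unfolding mult_zero_right
  proof (rule Lim_null_comparison[rotated])
    show "eventually (\<lambda>x. norm (m x * measure F {x - 1..x}) \<le> 2 / c\<^sup>2 * ((x - 2) * Fb (x - 2) / m (x - 2))) at_top"
      using eventually_ge_at_top[of 4]
    proof eventually_elim
      case (elim x)
      have "m x \<le> m (2 * (x - 2))" using elim by (intro m_mono) auto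
      also have "\<dots> \<le> 2 * m (x - 2)" using elim by (intro m_scale) auto
      finally have mm: "m x \<le> 2 * m (x - 2)" .
      have "measure F {x - 1..x} \<le> Fb (x - 2)" unfolding Fb_def by (intro finite_measure_mono) auto
      then have "m x * measure F {x - 1..x} \<le> 2 * m (x - 2) * Fb (x - 2)"
        using mm m_nonneg by (intro mult_mono) auto
      \<comment> \<open>Writing m as m^2 / m brings in the bound on m^2.\<close>
      also have "\<dots> = 2 * (m (x - 2) * m (x - 2)) * Fb (x - 2) / m (x - 2)"
        using m_pos[of "x - 2"] elim by simp
      also have "\<dots> \<le> 2 * ((x - 2) / c\<^sup>2) * Fb (x - 2) / m (x - 2)"
        using sq[of "x - 2"] elim Fb_nonneg m_nonneg by (intro divide_right_mono mult_right_mono mult_left_mono) auto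
      also have "\<dots> = 2 / c\<^sup>2 * ((x - 2) * Fb (x - 2) / m (x - 2))" by simp
      finally show ?case using m_nonneg by simp
    qed
  qed
qed

text \<open>The integral condition in the normalisation \<open>a\<close>. For \<alpha> < 1 bound
  \<open>a\<close> by \<open>1 / Fb\<close> inside the integral and \<open>1 / Fb\<close> by a
  multiple of \<open>a\<close> outside. For \<alpha> = 1 the Potter exponent is 1/2, so a(y)^2/y is
  at most C^2 a(x)^2/x, constant in y; the integral is then at most this times Fb(x/4), and a(x)
  Fb(x/4) -> 0.\<close>

lemma small_steps_a: assumes e: "0 < e"
  shows "\<exists>d>0. d < 1/2 \<and> eventually (\<lambda>x.
    (\<integral>\<^sup>+z. ennreal ((a (x - z))\<^sup>2 / (x - z)) * indicator {1..d * x} (x - z) \<partial>F) \<le> ennreal (e * a x / x)) at_top"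
proof (cases "\<alpha> < 1")
  case True
  \<comment> \<open>Absorbs the factor 2/(1 - \<alpha>) of \<open>inverse_Fb_le\<close>.\<close>
  define e' where "e' = e * (1 - \<alpha>) / 2"
  have e': "0 < e'" using e True by (simp add: e'_def)
  from small_steps[OF e'] obtain d where d: "0 < d" "d < 1/2" and ev: "eventually (\<lambda>x.
      ennreal (x * Fb x) * (\<integral>\<^sup>+z. ennreal (1 / ((x - z) * (Fb (x - z))\<^sup>2)) * indicator {1..d * x} (x - z) \<partial>F) \<le> ennreal e') at_top"
    unfolding Fb_def by auto
  from ev inverse_Fb_le[OF True] eventually_gt_at_top[of 0]
  have "eventually (\<lambda>x. (\<integral>\<^sup>+z. ennreal ((a (x - z))\<^sup>2 / (x - z)) * indicator {1..d * x} (x - z) \<partial>F) \<le> ennreal (e * a x / x)) at_top"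
  proof eventually_elim
    case (elim x)
    let ?I = "\<integral>\<^sup>+z. ennreal (1 / ((x - z) * (Fb (x - z))\<^sup>2)) * indicator {1..d * x} (x - z) \<partial>F"
    have "(\<integral>\<^sup>+z. ennreal ((a (x - z))\<^sup>2 / (x - z)) * indicator {1..d * x} (x - z) \<partial>F) \<le> ?I"
    proof (rule nn_integral_mono)
      fix z
      have "(a (x - z))\<^sup>2 / (x - z) \<le> 1 / ((x - z) * (Fb (x - z))\<^sup>2)" if "1 \<le> x - z"
      proof -
        have "(a (x - z))\<^sup>2 \<le> (1 / Fb (x - z))\<^sup>2" using that a_le_inverse_Fb[of "x - z"] a_pos[of "x - z"] by (intro power_mono) auto
        then have "(a (x - z))\<^sup>2 / (x - z) \<le> (1 / Fb (x - z))\<^sup>2 / (x - z)" using that by (intro divide_right_mono) auto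
        then show ?thesis by (simp add: power_divide mult.commute)
      qed
      then show "ennreal ((a (x - z))\<^sup>2 / (x - z)) * indicator {1..d * x} (x - z) \<le> ennreal (1 / ((x - z) * (Fb (x - z))\<^sup>2)) * indicator {1..d * x} (x - z)"
        by (auto split: split_indicator intro!: ennreal_leI)
    qed
    also have "?I = ennreal (1 / (x * Fb x)) * (ennreal (x * Fb x) * ?I)"
    proof -
      have "ennreal (1 / (x * Fb x)) * ennreal (x * Fb x) = 1"
        using elim Fb_pos[of x] by (subst ennreal_mult[symmetric]) auto
      then show ?thesis by (simp add: mult.assoc[symmetric])
    qed
    also have "\<dots> \<le> ennreal (1 / (x * Fb x)) * ennreal e'" using elim(1) by (intro mult_left_mono) auto
    also have "\<dots> = ennreal (1 / Fb x * (e' / x))"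
      using elim Fb_pos[of x] e' by (subst ennreal_mult[symmetric]) (auto simp: field_simps)
    also have "\<dots> \<le> ennreal ((2 / (1 - \<alpha>) * a x) * (e' / x))"
      using elim e' by (intro ennreal_leI mult_right_mono) auto
    also have "(2 / (1 - \<alpha>) * a x) * (e' / x) = e * a x / x" using True by (simp add: e'_def)
    finally show ?case .
  qed
  then show ?thesis using d by blast
next
  case False
  then have a1: "\<alpha> = 1" using alpha by simp
  obtain C where C: "1 \<le> C" "\<And>x y. 1 \<le> y \<Longrightarrow> y \<le> x \<Longrightarrow> a y \<le> C * (y / x) powr (1/2) * a x" using a_potter a1 by auto
  have "((\<lambda>x. C\<^sup>2 * 4 * (x * Fb x / m x)) \<longlongrightarrow> C\<^sup>2 * 4 * 0) at_top"
    using Fb_m_ratio a1 by (intro tendsto_intros) auto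
  then have "((\<lambda>x. C\<^sup>2 * 4 * ((x/4) * Fb (x/4) / m (x/4))) \<longlongrightarrow> C\<^sup>2 * 4 * 0) at_top"
    by (rule filterlim_compose) real_asymp
  then have "eventually (\<lambda>x. C\<^sup>2 * 4 * ((x/4) * Fb (x/4) / m (x/4)) < e) at_top"
    using e by (intro order_tendstoD(2)) auto
  then have "eventually (\<lambda>x. (\<integral>\<^sup>+z. ennreal ((a (x - z))\<^sup>2 / (x - z)) * indicator {1..1/3 * x} (x - z) \<partial>F) \<le> ennreal (e * a x / x)) at_top"
    using eventually_ge_at_top[of 1]
  proof eventually_elim
    case (elim x)
    have ax: "0 < a x" using elim by (intro a_pos) auto
    have "(\<integral>\<^sup>+z. ennreal ((a (x - z))\<^sup>2 / (x - z)) * indicator {1..1/3 * x} (x - z) \<partial>F) \<le>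
      (\<integral>\<^sup>+z. ennreal (C\<^sup>2 * (a x)\<^sup>2 / x) * indicator {x/4<..} z \<partial>F)"
    proof (rule nn_integral_mono)
      fix z
      show "ennreal ((a (x - z))\<^sup>2 / (x - z)) * indicator {1..1/3 * x} (x - z) \<le> ennreal (C\<^sup>2 * (a x)\<^sup>2 / x) * indicator {x/4<..} z"
      proof (cases "x - z \<in> {1..1/3 * x}")
        case True
        then have y: "1 \<le> x - z" "x - z \<le> x" "x / 4 < z" using elim by auto
        have "(a (x - z))\<^sup>2 \<le> (C * ((x - z) / x) powr (1/2) * a x)\<^sup>2"
          using C(2)[OF y(1,2)] a_pos[of "x - z"] y by (intro power_mono) auto
        also have "\<dots> = C\<^sup>2 * ((x - z) / x) * (a x)\<^sup>2"
          using y by (simp add: power_mult_distrib powr_half_sqrt)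
        finally have "(a (x - z))\<^sup>2 / (x - z) \<le> C\<^sup>2 * ((x - z) / x) * (a x)\<^sup>2 / (x - z)"
          using y by (intro divide_right_mono) auto
        also have "\<dots> = C\<^sup>2 * (a x)\<^sup>2 / x" using y by simp
        finally show ?thesis using y True by (simp add: ennreal_leI)
      qed simp
    qed
    also have "\<dots> = ennreal (C\<^sup>2 * (a x)\<^sup>2 / x) * ennreal (Fb (x/4))"
      by (simp add: nn_integral_cmult emeasure_eq_measure Fb_def)
    also have "\<dots> = ennreal (C\<^sup>2 * (a x)\<^sup>2 / x * Fb (x/4))"
      using elim Fb_nonneg by (intro ennreal_mult[symmetric]) auto
    also have "\<dots> \<le> ennreal (e * a x / x)"
    proof (rule ennreal_leI)
      have "m (x/4) \<le> m x" using elim by (intro m_mono) auto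
      then have "(C\<^sup>2 * x * Fb (x/4)) / m x \<le> (C\<^sup>2 * x * Fb (x/4)) / m (x/4)"
        using elim m_pos[of "x/4"] Fb_nonneg by (intro divide_left_mono mult_nonneg_nonneg mult_pos_pos m_pos) auto
      then have "C\<^sup>2 * a x * Fb (x/4) \<le> C\<^sup>2 * 4 * ((x/4) * Fb (x/4) / m (x/4))"
        by (simp add: a_def mult_ac)
      also have "\<dots> \<le> e" using elim by simp
      finally have "C\<^sup>2 * a x * Fb (x/4) * (a x / x) \<le> e * (a x / x)" using ax elim by (intro mult_right_mono) auto
      then show "C\<^sup>2 * (a x)\<^sup>2 / x * Fb (x/4) \<le> e * a x / x" by (simp add: power2_eq_square mult_ac)
    qed
    finally show ?case .
  qed
  then show ?thesis by (intro exI[of _ "1/3"]) auto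
qed

text \<open>Monotonicity of \<open>a\<close> upgrades pointwise regular variation to a limit joint
  in x and t, hence locally uniform in t: every t near s is compared with one fixed ratio on either
  side.\<close>

lemma a_rv_local: assumes s: "0 < s"
  shows "((\<lambda>(x, t). a (t * x) / a x) \<longlongrightarrow> s powr \<alpha>) (at_top \<times>\<^sub>F nhds s)"
proof -
  have cont: "((\<lambda>t. t powr \<alpha>) \<longlongrightarrow> s powr \<alpha>) (at s)"
    using s by (intro tendsto_intros) auto
  show ?thesis
  proof (rule order_tendstoI)
    fix l assume l: "l < s powr \<alpha>"
    have "eventually (\<lambda>t. l < t powr \<alpha>) (at_left s)"
      using tendsto_mono[OF at_le[OF subset_UNIV] cont] l by (rule order_tendstoD(1))
    moreover have "eventually (\<lambda>t. t \<in> {0<..<s}) (at_left s)" using s by (rule eventually_at_left_real)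
    ultimately have "eventually (\<lambda>t. 0 < t \<and> t < s \<and> l < t powr \<alpha>) (at_left s)" by eventually_elim auto
    then obtain t where t: "0 < t" "t < s" "l < t powr \<alpha>" using eventually_happens'[OF trivial_limit_at_left_real] by blast
    have "eventually (\<lambda>x. l < a (t * x) / a x \<and> 0 < x) at_top"
      using order_tendstoD(1)[OF a_rv[OF t(1)] t(3)] eventually_gt_at_top[of 0] by eventually_elim auto
    moreover have "eventually (\<lambda>u. t < u) (nhds s)" using t by (intro order_tendstoD(1)[OF filterlim_ident])
    ultimately show "eventually (\<lambda>p. l < (case p of (x, t) \<Rightarrow> a (t * x) / a x)) (at_top \<times>\<^sub>F nhds s)"
      unfolding eventually_prod_filter
    proof (intro exI conjI)
      show "\<forall>x y. l < a (t * x) / a x \<and> 0 < x \<longrightarrow> t < y \<longrightarrow> l < (case (x, y) of (x, t) \<Rightarrow> a (t * x) / a x)"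
      proof (intro allI impI)
        fix x y assume x: "l < a (t * x) / a x \<and> 0 < x" and y: "t < y"
        have "a (t * x) / a x \<le> a (y * x) / a x"
          using x y t by (intro divide_right_mono a_mono) (auto intro!: mult_right_mono less_imp_le[OF a_pos])
        then show "l < (case (x, y) of (x, t) \<Rightarrow> a (t * x) / a x)" using x by simp
      qed
    qed
  next
    fix l assume l: "l > s powr \<alpha>"
    have "eventually (\<lambda>t. l > t powr \<alpha>) (at_right s)"
      using tendsto_mono[OF at_le[OF subset_UNIV] cont] l by (rule order_tendstoD(2))
    moreover have "eventually (\<lambda>t. s < t) (at_right s)" by (simp add: eventually_at_right_less)
    ultimately have "eventually (\<lambda>t. s < t \<and> l > t powr \<alpha>) (at_right s)" by eventually_elim auto
    then obtain t where t: "s < t" "l > t powr \<alpha>" using eventually_happens'[OF trivial_limit_at_right_real] by blast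
    have "eventually (\<lambda>x. l > a (t * x) / a x \<and> 0 < x) at_top"
      using order_tendstoD(2)[OF a_rv t(2)] t s eventually_gt_at_top[of 0] by (auto elim!: eventually_elim2)
    moreover have "eventually (\<lambda>u. u < t \<and> 0 < u) (nhds s)"
      using t s by (intro eventually_conj order_tendstoD[OF filterlim_ident])
    ultimately show "eventually (\<lambda>p. l > (case p of (x, t) \<Rightarrow> a (t * x) / a x)) (at_top \<times>\<^sub>F nhds s)"
      unfolding eventually_prod_filter
    proof (intro exI conjI)
      show "\<forall>x y. l > a (t * x) / a x \<and> 0 < x \<longrightarrow> y < t \<and> 0 < y \<longrightarrow> l > (case (x, y) of (x, t) \<Rightarrow> a (t * x) / a x)"
      proof (intro allI impI)
        fix x y assume x: "l > a (t * x) / a x \<and> 0 < x" and y: "y < t \<and> 0 < y"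
        have "a (y * x) / a x \<le> a (t * x) / a x"
          using x y t by (intro divide_right_mono a_mono) (auto intro!: mult_right_mono less_imp_le[OF a_pos])
        then show "l > (case (x, y) of (x, t) \<Rightarrow> a (t * x) / a x)" using x by simp
      qed
    qed
  qed
qed

section \<open>Truncated means on the scale x\<close>

lemma truncated_mean: assumes "0 \<le> y"
  shows "integrable F (\<lambda>z. z * indicator {0<..y} z)" "(LINT z|F. z * indicator {0<..y} z) = m y - y * Fb y"
proof -
  show i: "integrable F (\<lambda>z. z * indicator {0<..y} z)"
    by (rule integrable_const_bound[where B=y]) (use assms in \<open>auto split: split_indicator\<close>)
  have "m y = (LINT z|F. z * indicator {0<..y} z + y * indicator {y<..} z)"
    unfolding m_def by (intro Bochner_Integration.integral_cong) (use assms in \<open>auto split: split_indicator simp: max_def min_def\<close>)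
  also have "\<dots> = (LINT z|F. z * indicator {0<..y} z) + y * Fb y"
    using i by (subst Bochner_Integration.integral_add) (auto simp: Fb_def)
  finally show "(LINT z|F. z * indicator {0<..y} z) = m y - y * Fb y" by simp
qed

text \<open>The measure z F(dz) / m(x) seen on the scale x. Its mass on (0, x] is at most 1 and its
  mass on each rescaled interval converges; at \<alpha> = 1 the limit is concentrated at 0.\<close>

definition W :: "real \<Rightarrow> real \<Rightarrow> real \<Rightarrow> real" where
  "W x p q = (LINT z|F. z * indicator {p * x<..q * x} z) / m x"

lemma W_integrable: assumes "0 \<le> p" "0 < x" "p \<le> q" shows "integrable F (\<lambda>z. z * indicator {p * x<..q * x} z)"
proof -
  have "0 \<le> p * x" "0 \<le> q * x" using assms by auto
  then show ?thesis
    by (intro Bochner_Integration.integrable_bound[OF truncated_mean(1)[of "q * x"]])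
       (auto split: split_indicator intro!: always_eventually)
qed

lemma W_eq: assumes "0 \<le> p" "0 < x" "p \<le> q"
  shows "W x p q = ((m (q * x) - q * x * Fb (q * x)) - (m (p * x) - p * x * Fb (p * x))) / m x"
proof -
  have le: "p * x \<le> q * x" "0 \<le> p * x" using assms by (auto intro: mult_right_mono)
  have "(LINT z|F. z * indicator {0<..q * x} z) = (LINT z|F. z * indicator {0<..p * x} z + z * indicator {p * x<..q * x} z)"
    by (intro Bochner_Integration.integral_cong) (use le in \<open>auto split: split_indicator\<close>)
  also have "\<dots> = (LINT z|F. z * indicator {0<..p * x} z) + (LINT z|F. z * indicator {p * x<..q * x} z)"
    using assms by (intro Bochner_Integration.integral_add W_integrable truncated_mean) auto
  finally show ?thesis using truncated_mean(2)[of "q * x"] truncated_mean(2)[of "p * x"] le by (simp add: W_def)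
qed

lemma W_add: "0 \<le> p \<Longrightarrow> 0 < x \<Longrightarrow> p \<le> q \<Longrightarrow> q \<le> s \<Longrightarrow> W x p s = W x p q + W x q s"
  by (simp add: W_eq add_divide_distrib diff_divide_distrib)

lemma W_le_1: assumes "0 < x" "0 \<le> q" "q \<le> 1" shows "W x 0 q \<le> 1"
proof -
  have "q * x \<le> x" using assms by (simp add: mult_left_le_one_le)
  then have "m (q * x) - q * x * Fb (q * x) \<le> m x"
    using assms m_mono[of "q * x" x] Fb_nonneg[of "q * x"] by (smt (verit) mult_nonneg_nonneg)
  moreover have "m 0 = 0" by (simp add: m_def)
  ultimately show ?thesis using assms m_pos[of x] by (simp add: W_eq)
qed

lemma W_tendsto: assumes "0 \<le> p" "p \<le> q" shows "\<exists>L. ((\<lambda>x. W x p q) \<longlongrightarrow> L) at_top"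
proof -
  have 1: "\<exists>L. ((\<lambda>x. (m (q * x) - q * x * Fb (q * x)) / m x) \<longlongrightarrow> L) at_top" if "0 \<le> q" for q
  proof (cases "q = 0")
    case True then show ?thesis by (auto simp: m_def)
  next
    case False
    with that have q: "0 < q" by simp
    have f: "filterlim (\<lambda>x. q * x) at_top at_top"
      using q by (intro filterlim_tendsto_pos_mult_at_top[OF tendsto_const] filterlim_ident)
    have "((\<lambda>x. m (q * x) / m x * (1 - q * x * Fb (q * x) / m (q * x))) \<longlongrightarrow> q powr (1 - \<alpha>) * (1 - (1 - \<alpha>))) at_top"
      by (intro tendsto_intros m_rv q filterlim_compose[OF Fb_m_ratio f])
    moreover have "eventually (\<lambda>x. m (q * x) / m x * (1 - q * x * Fb (q * x) / m (q * x)) = (m (q * x) - q * x * Fb (q * x)) / m x) at_top"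
      using eventually_gt_at_top[of 0]
    proof eventually_elim
      case (elim x)
      then have "m (q * x) \<noteq> 0" using m_pos[of "q * x"] q by simp
      then show ?case by (simp add: right_diff_distrib diff_divide_distrib)
    qed
    ultimately show ?thesis using tendsto_cong by fast
  qed
  obtain L1 where L1: "((\<lambda>x. (m (q * x) - q * x * Fb (q * x)) / m x) \<longlongrightarrow> L1) at_top" using 1[of q] assms by auto
  obtain L2 where L2: "((\<lambda>x. (m (p * x) - p * x * Fb (p * x)) / m x) \<longlongrightarrow> L2) at_top" using 1[of p] assms by auto
  have "((\<lambda>x. (m (q * x) - q * x * Fb (q * x)) / m x - (m (p * x) - p * x * Fb (p * x)) / m x) \<longlongrightarrow> L1 - L2) at_top"
    by (intro tendsto_diff L1 L2)
  then have "((\<lambda>x. W x p q) \<longlongrightarrow> L1 - L2) at_top"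
    by (rule Lim_transform_eventually) (use eventually_gt_at_top[of 0] in eventually_elim, simp add: W_eq assms diff_divide_distrib)
  then show ?thesis by blast
qed

section \<open>Integrals of z v(x - z) against F on the scale a(x)^K\<close>

context
  fixes v :: "real \<Rightarrow> real" and K :: nat and c D :: real
  assumes v_meas [measurable]: "v \<in> borel_measurable borel"
    and v_nonneg: "\<And>y. 0 \<le> v y"
    and K: "1 \<le> K"
    and v_lim: "((\<lambda>y. v y * y / a y ^ Suc K) \<longlongrightarrow> c) at_top"
    and v_exp: "\<And>y. v y \<le> D * exp (r * y)"
begin

definition J :: "real set \<Rightarrow> real \<Rightarrow> real" where
  "J S x = (LINT z|F. z * v (x - z) * indicator S z)"

lemma D_nonneg: "0 \<le> D"
  using v_nonneg[of 0] v_exp[of 0] by simp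

lemma v_integrable: "integrable F (\<lambda>z. z * v (x - z))"
proof (rule Bochner_Integration.integrable_bound)
  show "integrable F (\<lambda>z. D * exp (r * x) * (\<bar>z\<bar> * exp (- (r * z))))"
    by (intro integrable_mult_right abs_exp_integrable)
  have "\<bar>z * v (x - z)\<bar> \<le> D * exp (r * x) * (\<bar>z\<bar> * exp (- (r * z)))" for z
  proof -
    have "\<bar>z\<bar> * v (x - z) \<le> \<bar>z\<bar> * (D * exp (r * (x - z)))" by (intro mult_left_mono v_exp) auto
    also have "exp (r * (x - z)) = exp (r * x) * exp (- (r * z))" by (simp add: algebra_simps flip: exp_add)
    finally show ?thesis using v_nonneg by (simp add: abs_mult mult_ac)
  qed
  then show "AE z in F. norm (z * v (x - z)) \<le> norm (D * exp (r * x) * (\<bar>z\<bar> * exp (- (r * z))))"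
    using D_nonneg by (intro always_eventually) (auto simp: abs_mult)
qed measurable

lemma J_integrable: "S \<in> sets borel \<Longrightarrow> integrable F (\<lambda>z. z * v (x - z) * indicator S z)"
  using v_integrable by (intro integrable_real_mult_indicator) auto

lemma J_Un: "S \<in> sets borel \<Longrightarrow> T \<in> sets borel \<Longrightarrow> S \<inter> T = {} \<Longrightarrow> J (S \<union> T) x = J S x + J T x"
  unfolding J_def
  by (subst Bochner_Integration.integral_add[symmetric, OF J_integrable J_integrable])
     (auto intro!: Bochner_Integration.integral_cong simp: indicator_def)

text \<open>For large y from the limit; for the remaining y \<ge> 1 from the exponential bound, as
  a(y)^(K+1)/y is bounded away from 0 there.\<close>

lemma v_bound: obtains C where "0 \<le> C" "\<And>y. 1 \<le> y \<Longrightarrow> v y \<le> C * (a y ^ Suc K / y)"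
proof -
  have "eventually (\<lambda>y. v y * y / a y ^ Suc K < c + 1) at_top"
    by (rule order_tendstoD(2)[OF v_lim]) simp
  then obtain Y where Y: "\<And>y. Y \<le> y \<Longrightarrow> v y * y / a y ^ Suc K < c + 1" by (auto simp: eventually_at_top_linorder)
  define C where "C = max (c + 1) (D * exp (r * Y) * max Y 1 / a 1 ^ Suc K)"
  have a1: "0 < a 1 ^ Suc K" using a_pos[of 1] by simp
  have "0 \<le> D * exp (r * Y) * max Y 1 / a 1 ^ Suc K" using D_nonneg a1 by simp
  then have "0 \<le> C" by (simp add: C_def)
  moreover have "v y \<le> C * (a y ^ Suc K / y)" if y: "1 \<le> y" for y
  proof -
    have ay: "0 < a y ^ Suc K" using y a_pos[of y] by simp
    show ?thesis
    proof (cases "Y \<le> y")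
      case True
      then have "v y * y / a y ^ Suc K \<le> C" using Y[of y] by (simp add: C_def)
      then have "v y * y \<le> C * a y ^ Suc K" by (simp only: pos_divide_le_eq[OF ay])
      then show ?thesis using y by (simp add: pos_le_divide_eq)
    next
      case False
      then have Yy: "y \<le> Y" "1 \<le> Y" using y by auto
      have "v y \<le> D * exp (r * y)" by (rule v_exp)
      also have "\<dots> \<le> D * exp (r * Y)" using D_nonneg Yy r_pos by (intro mult_left_mono) auto
      also have "\<dots> = (D * exp (r * Y) * max Y 1 / a 1 ^ Suc K) * (a 1 ^ Suc K / Y)"
        using a_pos[of 1] Yy by simp
      also have "\<dots> \<le> C * (a y ^ Suc K / y)"
      proof (intro mult_mono)
        show "a 1 ^ Suc K / Y \<le> a y ^ Suc K / y"
          using y Yy a_pos[of 1] a_pos[of y] by (intro frac_le power_mono a_mono) auto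
      qed (use \<open>0 \<le> C\<close> a1 Yy a_pos[of y] in \<open>auto simp: C_def simp del: power_Suc\<close>)
      finally show ?thesis .
    qed
  qed
  ultimately show ?thesis using that by blast
qed

text \<open>For z \<le> 0 scaling gives a(x - z) \<le> (1 + |z|) a(x), and the resulting polynomial
  in |z| is integrable by the exponential left tail. After division by a(x)^K there remains a(x)/x =
  1/m(x).\<close>

lemma J_negative: "((\<lambda>x. J {..0} x / a x ^ K) \<longlongrightarrow> 0) at_top"
proof -
  obtain C where C: "0 \<le> C" "\<And>y. 1 \<le> y \<Longrightarrow> v y \<le> C * (a y ^ Suc K / y)" using v_bound by blast
  define f where "f z = \<bar>z\<bar> * (1 + \<bar>z\<bar>) ^ Suc K * indicator {..0} z" for z :: real
  have fi: "integrable F f"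
  proof (rule Bochner_Integration.integrable_bound)
    \<comment> \<open>The constant of \<open>power_le_exp\<close> for the power K + 2 and the rate
      \<kappa>; exp \<kappa> accounts for the 1 in 1 + |z|.\<close>
    define B where "B = (real (Suc (Suc K)) / \<kappa>) ^ Suc (Suc K) * exp \<kappa>"
    show "integrable F (\<lambda>z. B * exp (- (\<kappa> * z)))" by (intro integrable_mult_right exp_kappa_integrable)
    have "norm (f z) \<le> norm (B * exp (- (\<kappa> * z)))" for z
    proof (cases "z \<le> 0")
      case True
      have "\<bar>z\<bar> * (1 + \<bar>z\<bar>) ^ Suc K \<le> (1 + \<bar>z\<bar>) * (1 + \<bar>z\<bar>) ^ Suc K" by (intro mult_right_mono) auto
      also have "\<dots> = (1 + \<bar>z\<bar>) ^ Suc (Suc K)" by simp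
      also have "\<dots> \<le> (real (Suc (Suc K)) / \<kappa>) ^ Suc (Suc K) * exp (\<kappa> * (1 + \<bar>z\<bar>))"
        using kappa by (intro power_le_exp) auto
      also have "exp (\<kappa> * (1 + \<bar>z\<bar>)) = exp \<kappa> * exp (- (\<kappa> * z))" using True by (simp add: algebra_simps flip: exp_add)
      finally have "\<bar>z\<bar> * (1 + \<bar>z\<bar>) ^ Suc K \<le> B * exp (- (\<kappa> * z))" by (simp add: B_def mult.assoc)
      moreover have "0 \<le> \<bar>z\<bar> * (1 + \<bar>z\<bar>) ^ Suc K" by simp
      ultimately show ?thesis unfolding f_def real_norm_def using True by (metis abs_of_nonneg indicator_simps(1) atMost_iff mult_1_right order_trans)
    qed (simp add: f_def)
    then show "AE z in F. norm (f z) \<le> norm (B * exp (- (\<kappa> * z)))" by (intro always_eventually) blast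
    show "f \<in> borel_measurable F" unfolding f_def by measurable
  qed
  have "((\<lambda>x. C * (LINT z|F. f z) * inverse (m x)) \<longlongrightarrow> C * (LINT z|F. f z) * 0) at_top"
    by (intro tendsto_intros tendsto_inverse_0_at_top m_at_top)
  then show ?thesis unfolding mult_zero_right
  proof (rule Lim_null_comparison[rotated])
    show "eventually (\<lambda>x. norm (J {..0} x / a x ^ K) \<le> C * (LINT z|F. f z) * inverse (m x)) at_top"
      using eventually_ge_at_top[of 1]
    proof eventually_elim
      case (elim x)
      have ax: "0 < a x" using elim by (intro a_pos) auto
      have "\<bar>J {..0} x\<bar> \<le> (LINT z|F. \<bar>z * v (x - z) * indicator {..0} z\<bar>)"
        unfolding J_def by (rule integral_abs_bound)
      also have "\<dots> \<le> (LINT z|F. C * (a x ^ Suc K / x) * f z)"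
      proof (rule integral_mono)
        show "integrable F (\<lambda>z. \<bar>z * v (x - z) * indicator {..0} z\<bar>)" by (intro integrable_abs J_integrable) simp
        show "integrable F (\<lambda>z. C * (a x ^ Suc K / x) * f z)" by (intro integrable_mult_right fi)
        fix z
        show "\<bar>z * v (x - z) * indicator {..0} z\<bar> \<le> C * (a x ^ Suc K / x) * f z"
        proof (cases "z \<le> 0")
          case True
          then have y: "1 \<le> x - z" "x \<le> x - z" using elim by auto
          have "a (x - z) = a ((1 + \<bar>z\<bar> / x) * x)" using True elim by (simp add: algebra_simps)
          also have "\<dots> \<le> (1 + \<bar>z\<bar> / x) * a x" using elim by (intro a_scale) auto
          also have "\<dots> \<le> (1 + \<bar>z\<bar>) * a x"
          proof -
            have "\<bar>z\<bar> / x \<le> \<bar>z\<bar> / 1" using elim by (intro divide_left_mono) auto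
            then show ?thesis using ax by (intro mult_right_mono) auto
          qed
          finally have "a (x - z) ^ Suc K \<le> ((1 + \<bar>z\<bar>) * a x) ^ Suc K"
            using a_pos[of "x - z"] y elim by (intro power_mono) auto
          then have "a (x - z) ^ Suc K / (x - z) \<le> ((1 + \<bar>z\<bar>) * a x) ^ Suc K / x"
            using y elim ax by (intro frac_le) auto
          then have "v (x - z) \<le> C * (((1 + \<bar>z\<bar>) * a x) ^ Suc K / x)"
            using C y by (meson mult_left_mono order_trans)
          then have "\<bar>z\<bar> * v (x - z) \<le> \<bar>z\<bar> * (C * (((1 + \<bar>z\<bar>) * a x) ^ Suc K / x))"
            by (intro mult_left_mono) auto
          then show ?thesis using True v_nonneg by (simp add: f_def abs_mult power_mult_distrib mult_ac)
        qed (simp add: f_def)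
      qed
      also have "\<dots> = C * (a x ^ Suc K / x) * (LINT z|F. f z)" by simp
      finally have "\<bar>J {..0} x\<bar> / a x ^ K \<le> C * (a x ^ Suc K / x) * (LINT z|F. f z) / a x ^ K"
        using ax by (intro divide_right_mono) auto
      also have "\<dots> = C * (LINT z|F. f z) * (a x / x)" using ax by simp
      also have "a x / x = inverse (m x)" using elim by (simp add: a_def field_simps)
      finally show ?case using ax by (simp add: abs_mult)
    qed
  qed
qed

lemma J_nonneg: "S \<subseteq> {0..} \<Longrightarrow> 0 \<le> J S x"
  unfolding J_def by (intro Bochner_Integration.integral_nonneg) (auto split: split_indicator intro!: mult_nonneg_nonneg v_nonneg)

text \<open>The critical region of small y = x - z. As v(y) = O(a(y)^(K+1)/y) and \<open>a\<close>
  is monotone, K - 1 factors come out as a(x)^(K-1) and leave the integrand of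
  \<open>small_steps_a\<close>; the factor z \<le> x cancels the 1/x of its bound.\<close>

lemma J_close: assumes e: "0 < e"
  shows "\<exists>d>0. d < 1/2 \<and> eventually (\<lambda>x. \<bar>J {(1 - d) * x<..x - 1} x\<bar> \<le> e * a x ^ K) at_top"
proof -
  obtain C where C: "0 \<le> C" "\<And>y. 1 \<le> y \<Longrightarrow> v y \<le> C * (a y ^ Suc K / y)" using v_bound by blast
  have e': "0 < e / (C + 1)" using e C by simp
  from small_steps_a[OF e'] obtain d where d: "0 < d" "d < 1/2" and ev: "eventually (\<lambda>x.
    (\<integral>\<^sup>+z. ennreal ((a (x - z))\<^sup>2 / (x - z)) * indicator {1..d * x} (x - z) \<partial>F) \<le> ennreal (e / (C + 1) * a x / x)) at_top" by blast
  from ev eventually_ge_at_top[of 1]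
  have "eventually (\<lambda>x. \<bar>J {(1 - d) * x<..x - 1} x\<bar> \<le> e * a x ^ K) at_top"
  proof eventually_elim
    case (elim x)
    have ax: "0 < a x" using elim by (intro a_pos) auto
    have "J {(1 - d) * x<..x - 1} x \<le> e * a x ^ K"
      unfolding J_def
    proof (rule integral_real_bounded)
      have "(\<integral>\<^sup>+z. ennreal (z * v (x - z) * indicator {(1 - d) * x<..x - 1} z) \<partial>F) \<le>
          (\<integral>\<^sup>+z. ennreal (x * C * a x ^ (K - 1)) * (ennreal ((a (x - z))\<^sup>2 / (x - z)) * indicator {1..d * x} (x - z)) \<partial>F)"
      proof (rule nn_integral_mono)
        fix z
        show "ennreal (z * v (x - z) * indicator {(1 - d) * x<..x - 1} z) \<le>
            ennreal (x * C * a x ^ (K - 1)) * (ennreal ((a (x - z))\<^sup>2 / (x - z)) * indicator {1..d * x} (x - z))"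
        proof (cases "z \<in> {(1 - d) * x<..x - 1}")
          case True
          then have y: "1 \<le> x - z" "x - z \<le> d * x" by (auto simp: algebra_simps)
          have "0 \<le> (1 - d) * x" using d elim by simp
          then have z: "0 < z" "z \<le> x" using True elim by auto
          have ay: "0 < a (x - z)" "a (x - z) \<le> a x" using y z by (auto intro!: a_pos a_mono)
          \<comment> \<open>Here K \<ge> 1 matters: two factors a(y) must remain under the
            integral.\<close>
          have "a (x - z) ^ Suc K = a (x - z) ^ (K - 1) * (a (x - z))\<^sup>2"
            using K by (simp flip: power_add)
          also have "\<dots> \<le> a x ^ (K - 1) * (a (x - z))\<^sup>2" using ay by (intro mult_right_mono power_mono) auto
          finally have "a (x - z) ^ Suc K / (x - z) \<le> a x ^ (K - 1) * (a (x - z))\<^sup>2 / (x - z)"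
            using y by (intro divide_right_mono) auto
          then have "v (x - z) \<le> C * (a x ^ (K - 1) * (a (x - z))\<^sup>2 / (x - z))"
            using C y by (meson mult_left_mono order_trans)
          then have "z * v (x - z) \<le> x * (C * (a x ^ (K - 1) * (a (x - z))\<^sup>2 / (x - z)))"
            using z v_nonneg elim by (intro mult_mono) auto
          also have "\<dots> = (x * C * a x ^ (K - 1)) * ((a (x - z))\<^sup>2 / (x - z))" by simp
          finally have "ennreal (z * v (x - z)) \<le> ennreal (x * C * a x ^ (K - 1)) * ennreal ((a (x - z))\<^sup>2 / (x - z))"
            using C elim ax y by (subst ennreal_mult[symmetric]) (auto intro!: ennreal_leI mult_nonneg_nonneg)
          then show ?thesis using True y by simp
        qed simp
      qed
      also have "\<dots> = ennreal (x * C * a x ^ (K - 1)) * (\<integral>\<^sup>+z. (ennreal ((a (x - z))\<^sup>2 / (x - z)) * indicator {1..d * x} (x - z)) \<partial>F)"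
        by (rule nn_integral_cmult) measurable
      also have "\<dots> \<le> ennreal (x * C * a x ^ (K - 1)) * ennreal (e / (C + 1) * a x / x)"
        using elim(1) by (intro mult_left_mono) auto
      also have "\<dots> = ennreal ((x * C * a x ^ (K - 1)) * (e / (C + 1) * a x / x))"
        using C elim ax e by (intro ennreal_mult[symmetric]) (auto intro!: mult_nonneg_nonneg)
      also have "\<dots> \<le> ennreal (e * a x ^ K)"
      proof (rule ennreal_leI)
        have "(x * C * a x ^ (K - 1)) * (e / (C + 1) * a x / x) = C / (C + 1) * (e * (a x ^ (K - 1) * a x))"
          using elim by simp
        also have "a x ^ (K - 1) * a x = a x ^ K" using K by (metis power_minus_mult zero_less_one less_le_trans)
        also have "C / (C + 1) * (e * a x ^ K) \<le> 1 * (e * a x ^ K)"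
          using C e ax by (intro mult_right_mono) auto
        finally show "(x * C * a x ^ (K - 1)) * (e / (C + 1) * a x / x) \<le> e * a x ^ K" by simp
      qed
      finally show "(\<integral>\<^sup>+z. ennreal (z * v (x - z) * indicator {(1 - d) * x<..x - 1} z) \<partial>F) \<le> ennreal (e * a x ^ K)" .
    qed (use e ax in simp)
    moreover have "0 \<le> (1 - d) * x" using d elim by simp
    then have "0 \<le> J {(1 - d) * x<..x - 1} x" by (intro J_nonneg) auto
    ultimately show ?case by simp
  qed
  then show ?thesis using d by blast
qed

text \<open>Mass of the majorant in \<open>J_far\<close>: the exponential bounds v, and 2 + s - x
  bounds the growth of a(s)/a(x).\<close>

lemma overshoot_integral:
  "(\<integral>\<^sup>+s. ennreal (exp (r * (x + 1 - s)) * (2 + s - x)) * indicator {x - 1..} s \<partial>lborel) = ennreal (exp (2 * r) * (1 / r + 1 / r\<^sup>2))"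
proof -
  have "(\<integral>\<^sup>+s. ennreal (exp (r * (x + 1 - s)) * (2 + s - x)) * indicator {x - 1..} s \<partial>lborel) =
     ennreal (0 - (- exp (r * (x + 1 - (x - 1))) * ((2 + (x - 1) - x) / r + 1 / r\<^sup>2)))"
  proof (rule nn_integral_FTC_atLeast)
    show "((\<lambda>s. - exp (r * (x + 1 - s)) * ((2 + s - x) / r + 1 / r\<^sup>2)) has_real_derivative exp (r * (x + 1 - s)) * (2 + s - x)) (at s)" for s
      using r_pos by (auto intro!: derivative_eq_intros simp: field_simps power2_eq_square)
    show "((\<lambda>s. - exp (r * (x + 1 - s)) * ((2 + s - x) / r + 1 / r\<^sup>2)) \<longlongrightarrow> 0) at_top"
      using r_pos by real_asymp
  qed auto
  then show ?thesis by (simp add: mult.commute)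
qed

text \<open>For z > x - 1 the function v decays exponentially in z - x, but F may cluster there.
  Averaging over s in [z, z + 1] trades the integral against F for a Lebesgue integral of
  F[s - 1, s], to which \<open>unit_interval_mass\<close> applies; a(s)/a(x) grows at most linearly
  in s - x, which the exponential absorbs.\<close>

lemma J_far: "((\<lambda>x. J {x - 1<..} x / a x ^ K) \<longlongrightarrow> 0) at_top"
proof (rule tendstoI)
  fix e :: real assume e: "0 < e"
  define M where "M = exp (2 * r) * (1 / r + 1 / r\<^sup>2)"
  have M: "0 < M" using r_pos by (simp add: M_def add_pos_pos)
  \<comment> \<open>Chosen so that D e' M \<le> e/2; D + 1 in place of D avoids a zero
    denominator.\<close>
  define e' where "e' = e / (2 * (D + 1) * M)"
  have e': "0 < e'" using e M D_nonneg by (simp add: e'_def)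
  obtain S where S: "\<And>s. S \<le> s \<Longrightarrow> m s * measure F {s - 1..s} < e'"
    using order_tendstoD(2)[OF unit_interval_mass e'] by (auto simp: eventually_at_top_linorder)
  have "eventually (\<lambda>x. 1 \<le> a x) at_top" using a_at_top by (simp add: filterlim_at_top)
  then show "eventually (\<lambda>x. dist (J {x - 1<..} x / a x ^ K) 0 < e) at_top"
    using eventually_ge_at_top[of "max S 1 + 1"]
  proof eventually_elim
    case (elim x)
    then have x: "2 \<le> x" "S \<le> x - 1" by auto
    have ax: "0 < a x" using x by (intro a_pos) auto
    have "J {x - 1<..} x \<le> e / 2 * a x"
      unfolding J_def
    proof (rule integral_real_bounded)
      let ?g = "\<lambda>s. ennreal (D * s * exp (r * (x + 1 - s))) * indicator {x - 1..} s"
      have "(\<integral>\<^sup>+z. ennreal (z * v (x - z) * indicator {x - 1<..} z) \<partial>F) \<le>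
        (\<integral>\<^sup>+z. (\<integral>\<^sup>+s. ?g s * indicator {p. fst p \<le> snd p \<and> snd p \<le> fst p + 1} (z, s) \<partial>lborel) \<partial>F)"
      proof (rule nn_integral_mono)
        fix z
        show "ennreal (z * v (x - z) * indicator {x - 1<..} z) \<le>
          (\<integral>\<^sup>+s. ?g s * indicator {p. fst p \<le> snd p \<and> snd p \<le> fst p + 1} (z, s) \<partial>lborel)"
        proof (cases "x - 1 < z")
          case True
          \<comment> \<open>The window {z..z + 1} has Lebesgue measure 1, so inserting the integral
            over s changes nothing.\<close>
          have "ennreal (z * v (x - z)) = (\<integral>\<^sup>+s. ennreal (z * v (x - z)) * indicator {z..z + 1} s \<partial>lborel)"
            by (simp add: nn_integral_cmult)
          also have "\<dots> \<le> (\<integral>\<^sup>+s. ?g s * indicator {p. fst p \<le> snd p \<and> snd p \<le> fst p + 1} (z, s) \<partial>lborel)"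
          proof (rule nn_integral_mono)
            fix s
            show "ennreal (z * v (x - z)) * indicator {z..z + 1} s \<le> ?g s * indicator {p. fst p \<le> snd p \<and> snd p \<le> fst p + 1} (z, s)"
            proof (cases "s \<in> {z..z + 1}")
              case s: True
              have "z * v (x - z) \<le> s * (D * exp (r * (x + 1 - s)))"
              proof (intro mult_mono)
                have "r * (x - z) \<le> r * (x + 1 - s)" using s r_pos by (intro mult_left_mono) auto
                then have "D * exp (r * (x - z)) \<le> D * exp (r * (x + 1 - s))" using D_nonneg by (intro mult_left_mono) auto
                then show "v (x - z) \<le> D * exp (r * (x + 1 - s))" using v_exp order_trans by blast
              qed (use s True x v_nonneg in auto)
              then show ?thesis using s True by (auto intro!: ennreal_leI simp: mult_ac)
            qed simp
          qed
          finally show ?thesis using True by simp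
        qed simp
      qed
      also have "\<dots> = (\<integral>\<^sup>+s. (\<integral>\<^sup>+z. ?g s * indicator {p. fst p \<le> snd p \<and> snd p \<le> fst p + 1} (z, s) \<partial>F) \<partial>lborel)"
      proof -
        interpret P: pair_sigma_finite F lborel ..
        show ?thesis by (rule P.Fubini'[symmetric]) measurable
      qed
      also have "\<dots> \<le> (\<integral>\<^sup>+s. ennreal (D * e' * a x) * (ennreal (exp (r * (x + 1 - s)) * (2 + s - x)) * indicator {x - 1..} s) \<partial>lborel)"
      proof (rule nn_integral_mono)
        fix s
        have "(\<integral>\<^sup>+z. ?g s * indicator {p. fst p \<le> snd p \<and> snd p \<le> fst p + 1} (z, s) \<partial>F) = (\<integral>\<^sup>+z. ?g s * indicator {s - 1..s} z \<partial>F)"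
          by (intro nn_integral_cong) (auto split: split_indicator)
        also have "\<dots> = ?g s * ennreal (measure F {s - 1..s})" by (simp add: nn_integral_cmult emeasure_eq_measure)
        also have "\<dots> \<le> ennreal (D * e' * a x) * (ennreal (exp (r * (x + 1 - s)) * (2 + s - x)) * indicator {x - 1..} s)"
        proof (cases "x - 1 \<le> s")
          case True
          then have s: "1 \<le> s" "S \<le> s" using x by auto
          have "a s \<le> (2 + s - x) * a x"
          proof (cases "s \<le> x")
            case sx: True
            have "a s \<le> 1 * a x" using s sx by (simp add: a_mono)
            also have "\<dots> \<le> (2 + s - x) * a x" using True ax by (intro mult_right_mono) auto
            finally show ?thesis .
          next
            case False
            have "a s = a ((s / x) * x)" using x by simp
            also have "\<dots> \<le> (s / x) * a x" using False x by (intro a_scale) auto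
            also have "s / x \<le> 2 + s - x"
            proof -
              have "s / x = 1 + (s - x) / x" using x by (simp add: field_simps)
              also have "(s - x) / x \<le> (s - x) / 1" using False x by (intro divide_left_mono) auto
              finally show ?thesis by simp
            qed
            then have "(s / x) * a x \<le> (2 + s - x) * a x" using ax by (intro mult_right_mono) auto
            finally show ?thesis .
          qed
          moreover have "s * measure F {s - 1..s} \<le> e' * a s"
          proof -
            have "s * measure F {s - 1..s} = a s * (m s * measure F {s - 1..s})" using m_pos[of s] s by (simp add: a_def)
            also have "\<dots> \<le> a s * e'" using S[OF s(2)] a_pos[of s] s by (intro mult_left_mono) auto
            finally show ?thesis by (simp add: mult.commute)
          qed
          ultimately have "s * measure F {s - 1..s} \<le> e' * ((2 + s - x) * a x)"
            using e' by (meson mult_left_mono less_imp_le order_trans)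
          then have "D * exp (r * (x + 1 - s)) * (s * measure F {s - 1..s}) \<le> D * exp (r * (x + 1 - s)) * (e' * ((2 + s - x) * a x))"
            using D_nonneg by (intro mult_left_mono) auto
          then have "D * s * exp (r * (x + 1 - s)) * measure F {s - 1..s} \<le> (D * e' * a x) * (exp (r * (x + 1 - s)) * (2 + s - x))"
            by (simp add: mult_ac)
          then show ?thesis using True D_nonneg s ax e'
            by (simp add: ennreal_mult[symmetric] ennreal_leI)
        qed simp
        finally show "(\<integral>\<^sup>+z. ?g s * indicator {p. fst p \<le> snd p \<and> snd p \<le> fst p + 1} (z, s) \<partial>F) \<le>
          ennreal (D * e' * a x) * (ennreal (exp (r * (x + 1 - s)) * (2 + s - x)) * indicator {x - 1..} s)" .
      qed
      also have "\<dots> = ennreal (D * e' * a x) * ennreal M"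
        unfolding M_def overshoot_integral[symmetric, of x] by (rule nn_integral_cmult) measurable
      also have "\<dots> = ennreal (D * e' * a x * M)" using D_nonneg e' ax M by (intro ennreal_mult[symmetric]) auto
      also have "\<dots> \<le> ennreal (e / 2 * a x)"
      proof (rule ennreal_leI)
        have "e' * M = e / (2 * (D + 1))" using M by (simp add: e'_def)
        then have "D * e' * M = D / (D + 1) * (e / 2)" by (simp add: mult.assoc)
        also have "\<dots> \<le> 1 * (e / 2)" using D_nonneg e by (intro mult_right_mono) auto
        finally have "D * e' * M * a x \<le> 1 * (e / 2) * a x" using ax by (intro mult_right_mono) auto
        then show "D * e' * a x * M \<le> e / 2 * a x" by (simp add: mult_ac)
      qed
      finally show "(\<integral>\<^sup>+z. ennreal (z * v (x - z) * indicator {x - 1<..} z) \<partial>F) \<le> ennreal (e / 2 * a x)" .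
    qed (use e ax in simp)
    \<comment> \<open>From 1 \<le> a(x) and K \<ge> 1.\<close>
    also have "\<dots> \<le> e / 2 * a x ^ K"
      using e elim K by (intro mult_left_mono self_le_power) auto
    finally have "J {x - 1<..} x / a x ^ K \<le> e / 2" using ax by (simp add: pos_divide_le_eq)
    moreover have "0 \<le> J {x - 1<..} x / a x ^ K" using x ax by (intro divide_nonneg_nonneg J_nonneg) auto
    ultimately show ?case using e unfolding dist_real_def by linarith
  qed
qed

text \<open>With y = t x and m(x) = x/a(x) the expression factors as v(y) y/a(y)^(K+1) times 1/t
  times (a(t x)/a(x))^(K+1). The limit is taken jointly in x and t so that it can be used on a whole
  short range of t; it needs s > 0, which is why \<open>J_main\<close> stays away from z =
  x.\<close>

lemma v_profile_local: assumes "0 < s"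
  shows "((\<lambda>(x, t). v (t * x) * m x / a x ^ K) \<longlongrightarrow> c * inverse s * (s powr \<alpha>) ^ Suc K) (at_top \<times>\<^sub>F nhds s)"
proof -
  have 1: "filterlim (\<lambda>p. snd p * fst p) at_top (at_top \<times>\<^sub>F nhds s :: (real \<times> real) filter)"
    using filterlim_tendsto_pos_mult_at_top[OF _ assms filterlim_fst] filterlim_snd by blast
  have 2: "((\<lambda>p. v (snd p * fst p) * (snd p * fst p) / a (snd p * fst p) ^ Suc K) \<longlongrightarrow> c) (at_top \<times>\<^sub>F nhds s)"
    by (rule filterlim_compose[OF v_lim 1])
  have 3: "((\<lambda>p. inverse (snd p)) \<longlongrightarrow> inverse s) (at_top \<times>\<^sub>F nhds s :: (real \<times> real) filter)"
    using assms by (intro tendsto_inverse filterlim_snd) auto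
  have 4: "((\<lambda>p. a (snd p * fst p) / a (fst p)) \<longlongrightarrow> s powr \<alpha>) (at_top \<times>\<^sub>F nhds s)"
    using a_rv_local[OF assms] by (simp add: case_prod_unfold)
  have "((\<lambda>p. v (snd p * fst p) * (snd p * fst p) / a (snd p * fst p) ^ Suc K * inverse (snd p) * (a (snd p * fst p) / a (fst p)) ^ Suc K)
      \<longlongrightarrow> c * inverse s * (s powr \<alpha>) ^ Suc K) (at_top \<times>\<^sub>F nhds s)"
    by (intro tendsto_mult tendsto_power 2 3 4)
  moreover have "eventually (\<lambda>p. v (snd p * fst p) * (snd p * fst p) / a (snd p * fst p) ^ Suc K * inverse (snd p) * (a (snd p * fst p) / a (fst p)) ^ Suc K
     = (case p of (x, t) \<Rightarrow> v (t * x) * m x / a x ^ K)) (at_top \<times>\<^sub>F nhds s)"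
  proof -
    have "eventually (\<lambda>x::real. 0 < x) at_top" "eventually (\<lambda>t. 0 < t) (nhds s)"
      using assms by (auto intro: eventually_gt_at_top order_tendstoD(1)[OF filterlim_ident])
    then show ?thesis unfolding eventually_prod_filter
    proof (intro exI conjI allI impI)
      fix x t :: real assume "0 < x" "0 < t"
      then have "0 < a (t * x)" "0 < a x" "0 < m x" by (auto intro!: a_pos m_pos)
      moreover have "m x = x / a x" using \<open>0 < x\<close> by (simp add: a_def)
      ultimately show "v (snd (x, t) * fst (x, t)) * (snd (x, t) * fst (x, t)) / a (snd (x, t) * fst (x, t)) ^ Suc K * inverse (snd (x, t)) * (a (snd (x, t) * fst (x, t)) / a (fst (x, t))) ^ Suc K
        = (case (x, t) of (x, t) \<Rightarrow> v (t * x) * m x / a x ^ K)"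
        using \<open>0 < x\<close> \<open>0 < t\<close> by (simp add: power_divide)
    qed
  qed
  ultimately show ?thesis by (rule Lim_transform_eventually)
qed

lemma J_eq_profile:
  assumes "0 < x"
  shows "J {p * x<..q * x} x / a x ^ K = (LINT z|F. (v (x - z) * m x / a x ^ K) * (z * indicator {p * x<..q * x} z)) / m x"
proof -
  have "(LINT z|F. (v (x - z) * m x / a x ^ K) * (z * indicator {p * x<..q * x} z)) =
      (LINT z|F. (m x / a x ^ K) * (z * v (x - z) * indicator {p * x<..q * x} z))"
    by (intro Bochner_Integration.integral_cong) auto
  also have "\<dots> = (m x / a x ^ K) * J {p * x<..q * x} x" unfolding J_def by (rule integral_mult_right_zero)
  finally show ?thesis using m_pos[OF assms] by (simp only:) simp
qed

text \<open>A Riemann-sum argument run by bisection. Near each ratio t = z/x the profile of v is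
  within e of a constant \<open>l\<close>, so J over a short interval is within e \<open>W\<close>
  of \<open>l\<close> \<open>W\<close>, which converges. The error e \<open>W x p q\<close> is
  additive over adjacent intervals, so the property spreads to [0, 1 - d], where \<open>W\<close> is
  at most 1.\<close>

lemma J_main: assumes d: "0 < d" "d < 1"
  shows "\<exists>L. ((\<lambda>x. J {0 * x<..(1 - d) * x} x / a x ^ K) \<longlongrightarrow> L) at_top"
proof (rule converges_if_approximable)
  fix e :: real assume e: "0 < e"
  define P where "P p q \<longleftrightarrow> (0 \<le> p \<longrightarrow> q \<le> 1 - d \<longrightarrow> (\<exists>g L. (g \<longlongrightarrow> L) at_top \<and>
    eventually (\<lambda>x. \<bar>J {p * x<..q * x} x / a x ^ K - g x\<bar> \<le> e * W x p q) at_top))" for p q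
  have "0 \<le> 1 - d" using d by simp
  then have "P 0 (1 - d)"
  proof (induction rule: Bolzano)
    case (trans p q s)
    show ?case unfolding P_def
    proof (intro impI)
      assume ps: "0 \<le> p" "s \<le> 1 - d"
      obtain g1 L1 where g1: "(g1 \<longlongrightarrow> L1) at_top" "eventually (\<lambda>x. \<bar>J {p * x<..q * x} x / a x ^ K - g1 x\<bar> \<le> e * W x p q) at_top"
        using trans ps unfolding P_def by force
      obtain g2 L2 where g2: "(g2 \<longlongrightarrow> L2) at_top" "eventually (\<lambda>x. \<bar>J {q * x<..s * x} x / a x ^ K - g2 x\<bar> \<le> e * W x q s) at_top"
        using trans ps unfolding P_def by force
      have "((\<lambda>x. g1 x + g2 x) \<longlongrightarrow> L1 + L2) at_top" by (intro tendsto_add g1 g2)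
      moreover have "eventually (\<lambda>x. \<bar>J {p * x<..s * x} x / a x ^ K - (g1 x + g2 x)\<bar> \<le> e * W x p s) at_top"
        using g1(2) g2(2) eventually_gt_at_top[of 0]
      proof eventually_elim
        case (elim x)
        have le: "p * x \<le> q * x" "q * x \<le> s * x" using trans elim by (auto intro: mult_right_mono)
        have "{p * x<..s * x} = {p * x<..q * x} \<union> {q * x<..s * x}" using le by auto
        then have "J {p * x<..s * x} x = J {p * x<..q * x} x + J {q * x<..s * x} x"
          using le by (simp add: J_Un)
        then have "J {p * x<..s * x} x / a x ^ K - (g1 x + g2 x) = (J {p * x<..q * x} x / a x ^ K - g1 x) + (J {q * x<..s * x} x / a x ^ K - g2 x)"
          by (simp add: add_divide_distrib)
        also have "\<bar>\<dots>\<bar> \<le> e * W x p q + e * W x q s" using elim by linarith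
        also have "\<dots> = e * W x p s" using W_add[of p x q s] trans ps elim by (simp add: distrib_left)
        finally show ?case .
      qed
      ultimately show "\<exists>g L. (g \<longlongrightarrow> L) at_top \<and> eventually (\<lambda>x. \<bar>J {p * x<..s * x} x / a x ^ K - g x\<bar> \<le> e * W x p s) at_top" by blast
    qed
  next
    case (local t)
    \<comment> \<open>For z = t x the argument of v is x - z = s x.\<close>
    define s where "s = 1 - t"
    have s: "0 < s" using local d by (simp add: s_def)
    define l where "l = c * inverse s * (s powr \<alpha>) ^ Suc K"
    have "eventually (\<lambda>p. dist ((\<lambda>(x, t). v (t * x) * m x / a x ^ K) p) l < e) (at_top \<times>\<^sub>F nhds s)"
      unfolding l_def by (rule tendstoD[OF v_profile_local[OF s] e])
    then obtain A B where A: "eventually A at_top" and B: "eventually B (nhds s)"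
      and AB: "\<And>x t. A x \<Longrightarrow> B t \<Longrightarrow> \<bar>v (t * x) * m x / a x ^ K - l\<bar> < e"
      unfolding eventually_prod_filter by (auto simp: dist_real_def)
    obtain h where h: "0 < h" "\<And>u. dist u s < h \<Longrightarrow> B u" using B unfolding eventually_nhds_metric by blast
    show ?case
    proof (intro exI[of _ h] conjI allI impI)
      fix p q assume pq: "p \<le> t \<and> t \<le> q \<and> q - p < h"
      show "P p q" unfolding P_def
      proof (intro impI)
        assume ps: "0 \<le> p" "q \<le> 1 - d"
        have pq': "p \<le> q" using pq by simp
        obtain L where L: "((\<lambda>x. W x p q) \<longlongrightarrow> L) at_top" using W_tendsto[of p q] ps pq by auto
        have "eventually (\<lambda>x. \<bar>J {p * x<..q * x} x / a x ^ K - l * W x p q\<bar> \<le> e * W x p q) at_top"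
          using A eventually_gt_at_top[of 0]
        proof eventually_elim
          case (elim x)
          let ?w = "\<lambda>z. z * indicator {p * x<..q * x} z"
          let ?f = "\<lambda>z. v (x - z) * m x / a x ^ K"
          have w: "integrable F ?w" using ps pq' elim by (intro W_integrable) auto
          have fw: "integrable F (\<lambda>z. ?f z * ?w z)"
          proof -
            have "integrable F (\<lambda>z. (m x / a x ^ K) * (z * v (x - z) * indicator {p * x<..q * x} z))"
              by (intro integrable_mult_right J_integrable) simp
            then show ?thesis by (simp add: mult_ac)
          qed
          have "J {p * x<..q * x} x / a x ^ K - l * W x p q = ((LINT z|F. ?f z * ?w z) - l * (LINT z|F. ?w z)) / m x"
            using elim by (subst J_eq_profile) (auto simp: W_def diff_divide_distrib)
          also have "(LINT z|F. ?f z * ?w z) - l * (LINT z|F. ?w z) = (LINT z|F. ?f z * ?w z - l * ?w z)"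
            using w fw by simp
          finally have "\<bar>J {p * x<..q * x} x / a x ^ K - l * W x p q\<bar> = \<bar>LINT z|F. ?f z * ?w z - l * ?w z\<bar> / m x"
            using m_nonneg[of x] by (simp add: abs_divide)
          also have "\<dots> \<le> (LINT z|F. e * ?w z) / m x"
          proof (intro divide_right_mono m_nonneg order_trans[OF integral_abs_bound] integral_mono)
            show "integrable F (\<lambda>z. \<bar>?f z * ?w z - l * ?w z\<bar>)" using w fw by (intro integrable_abs Bochner_Integration.integrable_diff integrable_mult_right)
            show "integrable F (\<lambda>z. e * ?w z)" using w by (intro integrable_mult_right)
            fix z
            show "\<bar>?f z * ?w z - l * ?w z\<bar> \<le> e * ?w z"
            proof (cases "z \<in> {p * x<..q * x}")
              case True
              have "0 \<le> p * x" using ps elim by simp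
              then have z: "0 \<le> z" using True by simp
              have "\<bar>(1 - z / x) - s\<bar> < h"
              proof -
                have "p < z / x" "z / x \<le> q" using True elim by (auto simp: pos_less_divide_eq pos_divide_le_eq)
                then show ?thesis using pq unfolding s_def by auto
              qed
              then have "\<bar>v ((1 - z / x) * x) * m x / a x ^ K - l\<bar> < e" using AB h(2) elim by (simp add: dist_real_def)
              moreover have "(1 - z / x) * x = x - z" using elim by (simp add: field_simps)
              ultimately have "\<bar>?f z - l\<bar> * z \<le> e * z" using z by (intro mult_right_mono) auto
              moreover have "\<bar>?f z * z - l * z\<bar> = \<bar>?f z - l\<bar> * z"
                using z by (metis abs_mult abs_of_nonneg left_diff_distrib)
              ultimately show ?thesis using True by simp
            qed simp
          qed
          also have "\<dots> = e * W x p q" by (simp add: W_def)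
          finally show ?case .
        qed
        moreover have "((\<lambda>x. l * W x p q) \<longlongrightarrow> l * L) at_top" by (intro tendsto_intros L)
        ultimately show "\<exists>g L. (g \<longlongrightarrow> L) at_top \<and> eventually (\<lambda>x. \<bar>J {p * x<..q * x} x / a x ^ K - g x\<bar> \<le> e * W x p q) at_top"
          by (intro exI[of _ "\<lambda>x. l * W x p q"] exI[of _ "l * L"]) auto
      qed
    qed (rule h)
  qed
  then obtain g L where g: "(g \<longlongrightarrow> L) at_top" "eventually (\<lambda>x. \<bar>J {0 * x<..(1 - d) * x} x / a x ^ K - g x\<bar> \<le> e * W x 0 (1 - d)) at_top"
    unfolding P_def by auto
  have "eventually (\<lambda>x. \<bar>J {0 * x<..(1 - d) * x} x / a x ^ K - g x\<bar> \<le> e) at_top"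
    using g(2) eventually_gt_at_top[of 0]
  proof eventually_elim
    case (elim x)
    have "e * W x 0 (1 - d) \<le> e * 1" using W_le_1[of x "1 - d"] elim d e by (intro mult_left_mono) auto
    then show ?case using elim by linarith
  qed
  with g(1) show "\<exists>g L. (g \<longlongrightarrow> L) at_top \<and> eventually (\<lambda>x. \<bar>J {0 * x<..(1 - d) * x} x / a x ^ K - g x\<bar> \<le> e) at_top" by blast
qed

text \<open>Cut the line at 0, (1 - d) x and x - 1. The main piece converges for every d, the two
  outer pieces vanish, and the piece just left of x is at most e/3 for a suitable d; thus the whole
  is approximable by convergent functions.\<close>

lemma moment_converges: "\<exists>L. ((\<lambda>x. (LINT z|F. z * v (x - z)) / a x ^ K) \<longlongrightarrow> L) at_top"
proof (rule converges_if_approximable)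
  fix e :: real assume e: "0 < e"
  then have "0 < e / 3" by simp
  from J_close[OF this] obtain d where d: "0 < d" "d < 1/2"
    and close: "eventually (\<lambda>x. \<bar>J {(1 - d) * x<..x - 1} x\<bar> \<le> e / 3 * a x ^ K) at_top" by blast
  obtain L where L: "((\<lambda>x. J {0 * x<..(1 - d) * x} x / a x ^ K) \<longlongrightarrow> L) at_top" using J_main[of d] d by auto
  have neg: "eventually (\<lambda>x. \<bar>J {..0} x / a x ^ K\<bar> < e / 3) at_top"
    using tendstoD[OF J_negative, of "e / 3"] e by simp
  have far: "eventually (\<lambda>x. \<bar>J {x - 1<..} x / a x ^ K\<bar> < e / 3) at_top"
    using tendstoD[OF J_far, of "e / 3"] e by simp
  have "eventually (\<lambda>x. \<bar>(LINT z|F. z * v (x - z)) / a x ^ K - J {0 * x<..(1 - d) * x} x / a x ^ K\<bar> \<le> e) at_top"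
    using close neg far eventually_ge_at_top[of "1 / d"] eventually_gt_at_top[of 0]
  proof eventually_elim
    case (elim x)
    have ax: "0 < a x" using elim by (intro a_pos)
    \<comment> \<open>x \<ge> 1/d puts the cut (1 - d) x below the cut x - 1.\<close>
    have le: "(1 - d) * x \<le> x - 1" "0 \<le> (1 - d) * x" using elim d by (auto simp: field_simps)
    have "UNIV = (({..0} \<union> {0 * x<..(1 - d) * x}) \<union> {(1 - d) * x<..x - 1}) \<union> {x - 1<..}" using le by auto
    moreover have "(LINT z|F. z * v (x - z)) = J UNIV x" by (simp add: J_def)
    ultimately have "(LINT z|F. z * v (x - z)) = J ((({..0} \<union> {0 * x<..(1 - d) * x}) \<union> {(1 - d) * x<..x - 1}) \<union> {x - 1<..}) x" by simp
    also have "\<dots> = J {..0} x + J {0 * x<..(1 - d) * x} x + J {(1 - d) * x<..x - 1} x + J {x - 1<..} x"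
    proof -
      have "J ((({..0} \<union> {0 * x<..(1 - d) * x}) \<union> {(1 - d) * x<..x - 1}) \<union> {x - 1<..}) x =
          J (({..0} \<union> {0 * x<..(1 - d) * x}) \<union> {(1 - d) * x<..x - 1}) x + J {x - 1<..} x" using le by (intro J_Un) auto
      also have "J (({..0} \<union> {0 * x<..(1 - d) * x}) \<union> {(1 - d) * x<..x - 1}) x = J ({..0} \<union> {0 * x<..(1 - d) * x}) x + J {(1 - d) * x<..x - 1} x"
        using le by (intro J_Un) auto
      also have "J ({..0} \<union> {0 * x<..(1 - d) * x}) x = J {..0} x + J {0 * x<..(1 - d) * x} x" by (intro J_Un) auto
      finally show ?thesis .
    qed
    finally have eq: "(LINT z|F. z * v (x - z)) / a x ^ K - J {0 * x<..(1 - d) * x} x / a x ^ K =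
        J {..0} x / a x ^ K + J {(1 - d) * x<..x - 1} x / a x ^ K + J {x - 1<..} x / a x ^ K"
      by (simp add: add_divide_distrib)
    have "\<bar>J {(1 - d) * x<..x - 1} x / a x ^ K\<bar> \<le> e / 3"
      using elim(1) ax by (simp add: abs_divide pos_divide_le_eq)
    then show ?case unfolding eq using elim by linarith
  qed
  with L show "\<exists>g L. (g \<longlongrightarrow> L) at_top \<and> eventually (\<lambda>x. \<bar>(LINT z|F. z * v (x - z)) / a x ^ K - g x\<bar> \<le> e) at_top" by blast
qed

end

text \<open>Existence only; for k = 0 the limit is identified at the very end. The exponent is
  \<open>Suc k\<close> because \<open>V k\<close> belongs to the power k + 1.\<close>

definition strong_renewal :: "nat \<Rightarrow> real \<Rightarrow> bool" where
  "strong_renewal k h \<longleftrightarrow> (\<exists>c. ((\<lambda>x. V k h x * x / a x ^ Suc k) \<longlongrightarrow> c) at_top)"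

text \<open>\<open>V_recursion\<close> encloses \<open>V k h x\<close> between two multiples of one
  integral whose ratio x/(x + h) tends to 1. \<open>moment_converges\<close> then applies with v =
  \<open>V (Suc k) h\<close> and K = \<open>Suc k\<close>, which is at least 1.\<close>

lemma strong_renewal_step: assumes h: "0 \<le> h" and "strong_renewal (Suc k) h" shows "strong_renewal k h"
proof -
  obtain c where c: "((\<lambda>x. V (Suc k) h x * x / a x ^ Suc (Suc k)) \<longlongrightarrow> c) at_top" using assms by (auto simp: strong_renewal_def)
  let ?I = "\<lambda>x. LINT z|F. z * V (Suc k) h (x - z)"
  have bd: "V (Suc k) h y \<le> exp (r * h) / (1 - psi r) ^ Suc (Suc k) * exp (r * y)" for y
    using V_bound[of r "Suc k" h y] r_pos by (simp add: distrib_left exp_add mult.commute)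
  obtain L where L: "((\<lambda>x. ?I x / a x ^ Suc k) \<longlongrightarrow> L) at_top"
    using moment_converges[of "V (Suc k) h" "Suc k" c, OF _ _ _ c bd] V_nonneg V_measurable[OF h] by auto
  then have I: "((\<lambda>x. real (Suc k) * (?I x / a x ^ Suc k)) \<longlongrightarrow> real (Suc k) * L) at_top" by (rule tendsto_mult_left)
  have I': "((\<lambda>x. (real (Suc k) * (?I x / a x ^ Suc k)) * (x / (x + h))) \<longlongrightarrow> (real (Suc k) * L) * 1) at_top"
  proof (rule tendsto_mult[OF I])
    show "((\<lambda>x. x / (x + h)) \<longlongrightarrow> 1) at_top" by real_asymp
  qed
  have "((\<lambda>x. V k h x * x / a x ^ Suc k) \<longlongrightarrow> real (Suc k) * L) at_top"
  proof (rule tendsto_sandwich)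
    show "eventually (\<lambda>x. V k h x * x / a x ^ Suc k \<le> real (Suc k) * (?I x / a x ^ Suc k)) at_top"
      using eventually_gt_at_top[of 0]
    proof eventually_elim
      case (elim x)
      have "V k h x * x / a x ^ Suc k \<le> (real (Suc k) * ?I x) / a x ^ Suc k"
        using V_recursion(1)[OF h, of x k] a_pos[OF elim] by (intro divide_right_mono) (auto simp: mult.commute)
      then show ?case by simp
    qed
    show "eventually (\<lambda>x. (real (Suc k) * (?I x / a x ^ Suc k)) * (x / (x + h)) \<le> V k h x * x / a x ^ Suc k) at_top"
      using eventually_gt_at_top[of 0]
    proof eventually_elim
      case (elim x)
      have "(real (Suc k) * ?I x) * (x / ((x + h) * a x ^ Suc k)) \<le> ((x + h) * V k h x) * (x / ((x + h) * a x ^ Suc k))"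
        using V_recursion(2)[OF h, of k x] a_pos[OF elim] elim h by (intro mult_right_mono) auto
      then show ?case using elim h by (simp add: mult_ac)
    qed
  qed (use I I' in auto)
  then show ?thesis unfolding strong_renewal_def by blast
qed

lemma strong_renewal_downward: "0 \<le> h \<Longrightarrow> strong_renewal k h \<Longrightarrow> strong_renewal 0 h"
  by (induction k) (auto intro: strong_renewal_step)

end

section \<open>The Fourier transform of the step law\<close>

lemma sin_ge_half: assumes "0 \<le> u" "u \<le> 1" shows "u / 2 \<le> sin (u::real)"
proof -
  have "\<bar>sin u - (\<Sum>k<3. sin_coeff k * u ^ k)\<bar> \<le> inverse (fact 3) * \<bar>u\<bar> ^ 3" by (rule Maclaurin_sin_bound)
  moreover have "(\<Sum>k<3. sin_coeff k * u ^ k) = u" by (simp add: sin_coeff_def numeral_3_eq_3)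
  moreover have "inverse (fact 3) * \<bar>u\<bar> ^ 3 \<le> u / 2"
  proof -
    have "u ^ 3 \<le> u ^ 1" using assms by (intro power_decreasing) auto
    then show ?thesis using assms by (simp add: fact_numeral)
  qed
  ultimately show ?thesis by linarith
qed

lemma one_minus_exp_ge: assumes "0 \<le> u" shows "min u 1 / 2 \<le> 1 - exp (- u::real)"
proof -
  have "1 + u \<le> exp u" by (rule exp_ge_add_one_self)
  then have "exp (- u) \<le> 1 / (1 + u)" using assms by (simp add: exp_minus divide_simps)
  moreover have "1 / (1 + u) \<le> 1 - min u 1 / 2"
  proof (cases "u \<le> 1")
    case True
    then have "u * u \<le> u * 1" using assms by (intro mult_left_mono)
    then have "1 \<le> (1 - u / 2) * (1 + u)" by (simp add: algebra_simps)
    then show ?thesis using True assms by (simp add: pos_divide_le_eq)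
  next
    case False then show ?thesis by (simp add: pos_divide_le_eq)
  qed
  ultimately show ?thesis by linarith
qed

lemma exp_minus_1_le: "exp u - 1 \<le> u * exp (u::real)"
proof -
  have "1 + - u \<le> exp (- u)" by (rule exp_ge_add_one_self)
  then have "(1 - u) * exp u \<le> exp (- u) * exp u" by (intro mult_right_mono) auto
  then show ?thesis by (simp add: algebra_simps flip: exp_add)
qed

text \<open>Mean value inequality along the segment from 0 to w, where |exp| is at most its larger
  end value.\<close>

lemma cmod_exp_minus_1_le: "cmod (exp w - 1) \<le> cmod w * max 1 (exp (Re w))"
proof -
  have "cmod (exp w - exp 0) \<le> max 1 (exp (Re w)) * cmod (w - 0)"
  proof (rule field_differentiable_bound[where S="closed_segment 0 w" and f' = exp])
    fix z assume "z \<in> closed_segment 0 w"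
    then obtain u where u: "0 \<le> u" "u \<le> 1" "z = u *\<^sub>R w" by (auto simp: in_segment)
    have "u * Re w \<le> max 0 (Re w)"
      using u by (cases "0 \<le> Re w") (auto simp: mult_left_le_one_le mult_nonneg_nonpos max_def)
    then show "cmod (exp z) \<le> max 1 (exp (Re w))" using u
      by (auto simp: max_def split: if_splits)
  qed (auto intro!: derivative_eq_intros)
  then show ?thesis by (simp add: mult.commute)
qed

section \<open>Lower bounds for one minus the transform\<close>

locale nonarithmetic_step = strong_step +
  assumes nonarith: "\<not> arithmetic_law F"
begin

text \<open>The transform at -l + i t. For l = 0 it is the characteristic function of F; l > 0 damps
  it to modulus at most \<open>psi l\<close>, so that its powers can be summed.\<close>

definition cf :: "real \<Rightarrow> real \<Rightarrow> complex" where
  "cf l t = (CLINT z|F. exp (of_real z * Complex (- l) t))"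

lemma norm_cf_integrand: "cmod (exp (of_real z * Complex (- l) t)) = exp (- (l * z))"
  by (simp add: norm_exp_eq_Re mult.commute)

lemma cf_integrable: "0 \<le> l \<Longrightarrow> l \<le> \<kappa> \<Longrightarrow> integrable F (\<lambda>z. exp (of_real z * Complex (- l) t))"
  by (rule Bochner_Integration.integrable_bound[OF exp_integrable[of l]])
     (auto simp del: complex_of_real_mult_Complex simp: norm_cf_integrand)

lemma norm_cf_le: "cmod (cf l t) \<le> psi l"
proof -
  have "cmod (cf l t) \<le> (LINT z|F. cmod (exp (of_real z * Complex (- l) t)))" unfolding cf_def by (rule integral_norm_bound)
  then show ?thesis by (simp only: norm_cf_integrand psi_def)
qed

lemma cf_minus: "cf l (- t) = cnj (cf l t)"
proof -
  have eq: "exp (of_real z * Complex (- l) (- t)) = cnj (exp (of_real z * Complex (- l) t))" for z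
    by (simp add: complex_eq_iff Re_exp Im_exp)
  show ?thesis unfolding cf_def eq by (rule Bochner_Integration.integral_cnj)
qed

lemma Re_Im_cf: assumes "0 \<le> l" "l \<le> \<kappa>"
  shows "Re (1 - cf l t) = (LINT z|F. 1 - exp (- (l * z)) * cos (t * z))"
    and "Im (cf l t) = (LINT z|F. exp (- (l * z)) * sin (t * z))"
    and "integrable F (\<lambda>z. 1 - exp (- (l * z)) * cos (t * z))"
    and "integrable F (\<lambda>z. exp (- (l * z)) * sin (t * z))"
proof -
  have re: "Re (exp (of_real z * Complex (- l) t)) = exp (- (l * z)) * cos (t * z)"
    and im: "Im (exp (of_real z * Complex (- l) t)) = exp (- (l * z)) * sin (t * z)" for z
    by (simp_all add: Re_exp Im_exp mult.commute)
  have ire: "integrable F (\<lambda>z. exp (- (l * z)) * cos (t * z))"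
    using integrable_Re[OF cf_integrable[OF assms, of t]] unfolding re .
  show iim: "integrable F (\<lambda>z. exp (- (l * z)) * sin (t * z))"
    using integrable_Im[OF cf_integrable[OF assms, of t]] unfolding im .
  show "integrable F (\<lambda>z. 1 - exp (- (l * z)) * cos (t * z))" using ire by simp
  show "Re (1 - cf l t) = (LINT z|F. 1 - exp (- (l * z)) * cos (t * z))"
    using ire integral_Re[OF cf_integrable[OF assms, of t]] prob_space unfolding re cf_def by simp
  show "Im (cf l t) = (LINT z|F. exp (- (l * z)) * sin (t * z))"
    using integral_Im[OF cf_integrable[OF assms, of t]] unfolding im cf_def by simp
qed

text \<open>The cost of the negative half-line: the estimates lose l \<open>C0\<close> or t
  \<open>C0\<close>, which is of smaller order than l m(1/l) or t m(1/t) because \<open>m\<close>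
  diverges.\<close>

definition C0 :: real where "C0 = (LINT z|F. \<bar>z\<bar> * exp (- (r * z)))"

lemma C0_nonneg: "0 \<le> C0" unfolding C0_def by (intro Bochner_Integration.integral_nonneg) auto

lemma negative_part_bound: assumes "z \<le> 0" "0 \<le> l" "l \<le> r"
  shows "\<bar>z\<bar> * exp (- (l * z)) \<le> \<bar>z\<bar> * exp (- (r * z))"
  using assms by (intro mult_left_mono) (auto intro: mult_right_mono_neg)

text \<open>On z \<ge> 0 the real part of the integrand is minorised by g; on z < 0 the damping
  factor exceeds 1 by at most l |z| exp(-l z), which costs l \<open>C0\<close> in total.\<close>

lemma Re_lower: assumes "0 \<le> l" "l \<le> r"
  and "\<And>z. 0 \<le> z \<Longrightarrow> g z \<le> 1 - exp (- (l * z)) * cos (t * z)" "\<And>z. z < 0 \<Longrightarrow> g z \<le> 0" and g: "integrable F g"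
  shows "(LINT z|F. g z) - l * C0 \<le> cmod (1 - cf l t)"
proof -
  have lk: "l \<le> \<kappa>" using assms r_le by linarith
  have "(LINT z|F. g z) - l * C0 = (LINT z|F. g z - l * (\<bar>z\<bar> * exp (- (r * z))))"
    using g abs_exp_integrable by (simp add: C0_def)
  also have "\<dots> \<le> (LINT z|F. 1 - exp (- (l * z)) * cos (t * z))"
  proof (intro integral_mono Re_Im_cf lk assms)
    show "integrable F (\<lambda>z. g z - l * (\<bar>z\<bar> * exp (- (r * z))))" using g abs_exp_integrable by simp
    fix z
    show "g z - l * (\<bar>z\<bar> * exp (- (r * z))) \<le> 1 - exp (- (l * z)) * cos (t * z)"
    proof (cases "0 \<le> z")
      case True
      then have "0 \<le> l * (\<bar>z\<bar> * exp (- (r * z)))" using assms by simp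
      then show ?thesis using assms(3)[OF True] by linarith
    next
      case False
      have "exp (- (l * z)) * cos (t * z) \<le> exp (- (l * z)) * 1" by (intro mult_left_mono) auto
      also have "\<dots> \<le> 1 + (- (l * z)) * exp (- (l * z))" using exp_minus_1_le[of "- (l * z)"] by simp
      also have "(- (l * z)) * exp (- (l * z)) = l * (\<bar>z\<bar> * exp (- (l * z)))" using False by simp
      also have "\<dots> \<le> l * (\<bar>z\<bar> * exp (- (r * z)))"
        using assms False by (intro mult_left_mono negative_part_bound) auto
      finally show ?thesis using assms(4)[of z] False by simp
    qed
  qed
  also have "\<dots> = Re (1 - cf l t)" using assms lk by (intro Re_Im_cf(1)[symmetric])
  also have "\<dots> \<le> cmod (1 - cf l t)" by (rule complex_Re_le_cmod)
  finally show ?thesis .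
qed

lemma exp_cos_le: fixes l z c :: real assumes "0 \<le> l" "0 \<le> z" shows "exp (- (l * z)) * c \<le> max 0 c"
proof (cases "0 \<le> c")
  case True
  have "exp (- (l * z)) * c \<le> 1 * c" using True assms by (intro mult_right_mono) auto
  then show ?thesis using True by simp
next
  case False
  then have "exp (- (l * z)) * c \<le> 0" by (intro mult_nonneg_nonpos) auto
  then show ?thesis by simp
qed

text \<open>Serves the regime |t| \<le> l: damping alone gives the bound, through 1 - exp(-l z)
  \<ge> min(l z, 1)/2.\<close>

lemma cf_lower_1: assumes "0 < l" "l \<le> r"
  shows "1/2 * (l * m (1 / l)) - l * C0 \<le> cmod (1 - cf l t)"
proof -
  have "1/2 * (l * m (1 / l)) = l / 2 * m (1 / l)" by simp
  also have "\<dots> = (LINT z|F. l / 2 * max 0 (min z (1 / l)))" by (simp only: m_def integral_mult_right_zero)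
  finally have "1/2 * (l * m (1 / l)) = (LINT z|F. l / 2 * max 0 (min z (1 / l)))" .
  moreover have "(LINT z|F. l / 2 * max 0 (min z (1 / l))) - l * C0 \<le> cmod (1 - cf l t)"
  proof (rule Re_lower)
    show "integrable F (\<lambda>z. l / 2 * max 0 (min z (1 / l)))" by (intro integrable_mult_right m_integrable)
    fix z :: real assume z: "0 \<le> z"
    have "l / 2 * max 0 (min z (1 / l)) = min (l * z) 1 / 2"
      using z assms by (auto simp: min_def max_def field_simps)
    also have "\<dots> \<le> 1 - exp (- (l * z))" using z assms by (intro one_minus_exp_ge) auto
    also have "\<dots> \<le> 1 - exp (- (l * z)) * cos (t * z)" by simp
    finally show "l / 2 * max 0 (min z (1 / l)) \<le> 1 - exp (- (l * z)) * cos (t * z)" .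
  qed (use assms in auto)
  ultimately show ?thesis by (simp only:)
qed

text \<open>Oscillation seen by the real part: for 1 < t z \<le> 2 the cosine is at most cos 1. This
  controls \<open>Fb (1 / t)\<close>, the quantity lost in \<open>cf_lower_3\<close>.\<close>

lemma cf_lower_2: assumes "0 < l" "l \<le> r" "0 < t"
  shows "(1 - cos 1) * (Fb (1 / t) - Fb (2 / t)) - l * C0 \<le> cmod (1 - cf l t)"
proof -
  have le: "1 / t \<le> 2 / t" using assms by (simp add: divide_right_mono)
  have "Fb (1 / t) - Fb (2 / t) = measure F {1 / t<..2 / t}"
  proof -
    have "{1 / t<..} = {1 / t<..2 / t} \<union> {2 / t<..}" using le by auto
    then have "Fb (1 / t) = measure F {1 / t<..2 / t} + Fb (2 / t)" unfolding Fb_def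
      by (metis (no_types) finite_measure_Union greaterThan_borel greaterThanAtMost_borel sets_F ivl_disj_int_two(7) Int_greaterThanAtMost Int_commute disjoint_iff greaterThanAtMost_iff greaterThan_iff linorder_not_le)
    then show ?thesis by simp
  qed
  then have "(1 - cos 1) * (Fb (1 / t) - Fb (2 / t)) = (LINT z|F. (1 - cos 1) * indicator {1 / t<..2 / t} z)" by simp
  moreover have "(LINT z|F. (1 - cos 1) * indicator {1 / t<..2 / t} z) - l * C0 \<le> cmod (1 - cf l t)"
  proof (rule Re_lower)
    fix z :: real assume z: "0 \<le> z"
    show "(1 - cos 1) * indicator {1 / t<..2 / t} z \<le> 1 - exp (- (l * z)) * cos (t * z)"
    proof (cases "z \<in> {1 / t<..2 / t}")
      case True
      then have u: "1 \<le> t * z" "t * z \<le> 2" using assms by (auto simp: field_simps)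
      have "cos (t * z) \<le> cos 1" using u pi_gt3 by (subst cos_mono_le_eq) auto
      moreover have "0 \<le> cos (1::real)" using pi_gt3 by (intro cos_ge_zero) auto
      ultimately have "max 0 (cos (t * z)) \<le> cos 1" by simp
      then have "exp (- (l * z)) * cos (t * z) \<le> cos 1" using exp_cos_le[of l z "cos (t * z)"] z assms by linarith
      then show ?thesis using True by simp
    next
      case False
      have "exp (- (l * z)) * cos (t * z) \<le> 1" using exp_cos_le[of l z "cos (t * z)"] z assms cos_le_one[of "t * z"] by linarith
      then show ?thesis using False by simp
    qed
  next
    fix z :: real assume "z < 0"
    moreover have "0 < 1 / t" using assms by simp
    ultimately have "z \<notin> {1 / t<..2 / t}" by auto
    then show "(1 - cos 1) * indicator {1 / t<..2 / t} z \<le> (0::real)" by simp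
  qed (use assms in auto)
  ultimately show ?thesis by (simp only:)
qed

text \<open>The imaginary part sees t m(1/t) itself, which the real part need not do at \<alpha> =
  1. Up to 1/t the integrand is at least t z/6, since sin u \<ge> u/2 and, by l \<le> t, the damping
  is at least exp(-1) \<ge> 1/3. Beyond 1/t it may approach -1 while the m-term counts 1/6, whence
  7/6.\<close>

lemma cf_lower_3: assumes "0 < l" "l \<le> r" "l \<le> t"
  shows "1/6 * (t * m (1 / t)) - 7/6 * Fb (1 / t) - t * C0 \<le> cmod (1 - cf l t)"
proof -
  have t: "0 < t" using assms by simp
  have lk: "0 \<le> l" "l \<le> \<kappa>" using assms r_le by auto
  let ?g = "\<lambda>z. t / 6 * max 0 (min z (1 / t)) - 7/6 * indicator {1 / t<..} z - t * (\<bar>z\<bar> * exp (- (r * z)))"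
  have "1/6 * (t * m (1 / t)) - 7/6 * Fb (1 / t) - t * C0 = (LINT z|F. ?g z)"
    using m_integrable abs_exp_integrable by (simp add: m_def C0_def Fb_def)
  also have "\<dots> \<le> (LINT z|F. exp (- (l * z)) * sin (t * z))"
  proof (intro integral_mono Re_Im_cf lk)
    show "integrable F ?g" using m_integrable abs_exp_integrable by simp
    fix z
    consider "z < 0" | "0 \<le> z" "z \<le> 1 / t" | "1 / t < z" by linarith
    then show "?g z \<le> exp (- (l * z)) * sin (t * z)"
    proof cases
      case 1
      have "\<bar>sin (t * z)\<bar> \<le> \<bar>t * z\<bar>" by (rule abs_sin_x_le_abs_x)
      then have "\<bar>exp (- (l * z)) * sin (t * z)\<bar> \<le> exp (- (l * z)) * \<bar>t * z\<bar>" by (simp add: abs_mult)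
      also have "\<dots> = t * (\<bar>z\<bar> * exp (- (l * z)))" using t by (simp add: abs_mult)
      also have "\<dots> \<le> t * (\<bar>z\<bar> * exp (- (r * z)))"
        using 1 assms t by (intro mult_left_mono negative_part_bound) auto
      finally have "- (t * (\<bar>z\<bar> * exp (- (r * z)))) \<le> exp (- (l * z)) * sin (t * z)" by linarith
      moreover have "0 < 1 / t" using t by simp
      then have "\<not> 1 / t < z" using 1 by linarith
      then have "z \<notin> {1 / t<..}" by simp
      moreover have "max 0 (min z (1 / t)) = 0" using 1 by simp
      ultimately show ?thesis by simp
    next
      case 2
      then have u: "0 \<le> t * z" "t * z \<le> 1" using t by (auto simp: field_simps)
      have "l * z \<le> t * z" using assms 2 by (intro mult_right_mono) auto
      then have "exp (- 1) \<le> exp (- (l * z))" using u by simp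
      moreover have "1 / 3 \<le> exp (- 1 :: real)" using exp_le by (simp add: exp_minus divide_simps)
      ultimately have "1 / 3 \<le> exp (- (l * z))" by linarith
      then have "1 / 3 * (t * z / 2) \<le> exp (- (l * z)) * sin (t * z)"
        using sin_ge_half[OF u] u by (intro mult_mono) auto
      moreover have "max 0 (min z (1 / t)) = z" using 2 by simp
      moreover have "0 \<le> t * (\<bar>z\<bar> * exp (- (r * z)))" using t by simp
      ultimately show ?thesis using 2 by (simp add: not_less)
    next
      case 3
      moreover have "0 < 1 / t" using t by simp
      ultimately have z: "0 < z" by linarith
      have "exp (- (l * z)) * (- sin (t * z)) \<le> 1" using exp_cos_le[of l z "- sin (t * z)"] z assms sin_ge_minus_one[of "t * z"] by linarith
      moreover have "t / 6 * max 0 (min z (1 / t)) = 1 / 6" using 3 z t by (simp add: min_def max_def)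
      moreover have "0 \<le> t * (\<bar>z\<bar> * exp (- (r * z)))" using t by simp
      ultimately show ?thesis using 3 by simp
    qed
  qed
  also have "\<dots> = Im (cf l t)" using lk by (intro Re_Im_cf(2)[symmetric])
  also have "\<dots> \<le> \<bar>Im (1 - cf l t)\<bar>" by simp
  also have "\<dots> \<le> cmod (1 - cf l t)" by (rule abs_Im_le_cmod)
  finally show ?thesis .
qed

text \<open>Near 0 the size of 1 - f is governed by the larger of damping and frequency. If |t|
  \<le> l the damping decides. Otherwise the imaginary part bounds t m(1/t) up to a multiple of
  \<open>Fb (1 / t)\<close>, which the real part bounds in turn.\<close>

lemma cf_lower_small: "\<exists>c>0. \<exists>\<eta>>0. \<eta> \<le> r \<and> \<eta> \<le> 1 \<and> (\<forall>l t. 0 < l \<longrightarrow> l \<le> \<eta> \<longrightarrow> \<bar>t\<bar> \<le> \<eta> \<longrightarrow>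
    c * (max l \<bar>t\<bar> * m (1 / max l \<bar>t\<bar>)) \<le> cmod (1 - cf l t))"
proof -
  \<comment> \<open>Strictly between 2^-\<alpha> and 1, so that Fb(2x) \<le> q Fb(x)
    eventually.\<close>
  define q where "q = (1 + 2 powr (- \<alpha>)) / 2"
  have "(2::real) powr (- \<alpha>) < 2 powr 0" using alpha by (intro powr_less_mono) auto
  then have q: "2 powr (- \<alpha>) < q" "q < 1" by (auto simp: q_def)
  define c1 where "c1 = (1 - cos 1) * (1 - q)"
  have "cos (1::real) < 1" using pi_gt3 using cos_monotone_0_pi[of 0 1] by simp
  then have c1: "0 < c1" using q by (simp add: c1_def)
  \<comment> \<open>6 comes from clearing the 1/6 in \<open>cf_lower_3\<close>, and 7 / c1 from
    eliminating \<open>Fb (1 / t)\<close>.\<close>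
  define A where "A = 6 + 7 / c1"
  have A: "6 < A" using c1 by (simp add: A_def)
  have "eventually (\<lambda>x. Fb (2 * x) / Fb x < q) at_top"
    unfolding Fb_def by (rule order_tendstoD(2)[OF tail_rv q(1)]) simp
  \<comment> \<open>Large enough that A t \<open>C0\<close> is at most half of t m(1/t), and l
    \<open>C0\<close> at most a quarter of l m(1/l).\<close>
  moreover have "eventually (\<lambda>x. 2 * A * C0 + 4 * C0 + 1 \<le> m x) at_top" using m_at_top by (simp add: filterlim_at_top)
  ultimately have "eventually (\<lambda>x. Fb (2 * x) / Fb x < q \<and> 2 * A * C0 + 4 * C0 + 1 \<le> m x) at_top" by eventually_elim auto
  then obtain Y where Y: "\<And>x. Y \<le> x \<Longrightarrow> Fb (2 * x) / Fb x < q \<and> 2 * A * C0 + 4 * C0 + 1 \<le> m x" by (auto simp: eventually_at_top_linorder)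
  define \<eta> where "\<eta> = min (min r 1) (1 / max Y 1)"
  have eta: "0 < \<eta>" "\<eta> \<le> r" "\<eta> \<le> 1" "\<eta> \<le> 1 / max Y 1" using r_pos by (auto simp: \<eta>_def)
  have YY: "Y \<le> 1 / s" if "0 < s" "s \<le> \<eta>" for s
  proof -
    have "s * max Y 1 \<le> 1" using that eta by (metis order_trans pos_le_divide_eq max.strict_coboundedI2 zero_less_one)
    then have "max Y 1 \<le> 1 / s" using that by (simp only: pos_le_divide_eq mult.commute)
    then show ?thesis using max.cobounded1[of Y 1] by linarith
  qed
  define c where "c = 1 / (2 * A)"
  have c: "0 < c" "c \<le> 1/4" using A by (auto simp: c_def field_simps)
  have pos: "c * (max l t * m (1 / max l t)) \<le> cmod (1 - cf l t)" if l: "0 < l" "l \<le> \<eta>" and t: "0 \<le> t" "t \<le> \<eta>" for l t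
  proof (cases "t \<le> l")
    case True
    have "4 * C0 \<le> m (1 / l)" using Y[OF YY[OF l]] C0_nonneg A by (smt (verit) mult_nonneg_nonneg)
    then have "l * (4 * C0) \<le> l * m (1 / l)" using l by (intro mult_left_mono) auto
    then have "1/4 * (l * m (1 / l)) \<le> 1/2 * (l * m (1 / l)) - l * C0" by simp
    also have "\<dots> \<le> cmod (1 - cf l t)" using l eta by (intro cf_lower_1) auto
    finally have "1/4 * (l * m (1 / l)) \<le> cmod (1 - cf l t)" .
    moreover have "c * (l * m (1 / l)) \<le> 1/4 * (l * m (1 / l))" using c l m_nonneg by (intro mult_right_mono) auto
    ultimately show ?thesis using True by (simp add: max_def)
  next
    case False
    then have t0: "0 < t" "l \<le> t" using l by auto
    note Yt = Y[OF YY[OF t0(1) t(2)]]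
    have lC: "l * C0 \<le> t * C0" using t0 C0_nonneg by (intro mult_right_mono) auto
    have "Fb (2 / t) \<le> q * Fb (1 / t)" using Yt Fb_pos[of "1/t"] by (simp add: pos_divide_less_eq)
    then have "c1 * Fb (1 / t) \<le> (1 - cos 1) * (Fb (1 / t) - Fb (2 / t))"
      unfolding c1_def mult.assoc by (intro mult_left_mono) (auto simp: algebra_simps)
    also have "\<dots> \<le> cmod (1 - cf l t) + t * C0" using cf_lower_2[of l t] l eta t0 lC by simp
    finally have F: "Fb (1 / t) \<le> (cmod (1 - cf l t) + t * C0) / c1" using c1 by (simp add: pos_le_divide_eq mult.commute)
    have "t * m (1 / t) \<le> 6 * (cmod (1 - cf l t) + t * C0) + 7 * Fb (1 / t)" using cf_lower_3[of l t] l eta t0 by simp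
    also have "\<dots> \<le> 6 * (cmod (1 - cf l t) + t * C0) + 7 * ((cmod (1 - cf l t) + t * C0) / c1)" by (intro add_left_mono mult_left_mono F) simp
    also have "\<dots> = A * (cmod (1 - cf l t) + t * C0)" by (simp add: A_def distrib_right)
    finally have 1: "t * m (1 / t) \<le> A * cmod (1 - cf l t) + A * (t * C0)" by (simp add: distrib_left)
    have "2 * A * C0 \<le> m (1 / t)" using Yt C0_nonneg by simp
    then have "t * (2 * A * C0) \<le> t * m (1 / t)" using t0 by (intro mult_left_mono) auto
    then have "A * (t * C0) \<le> t * m (1 / t) / 2" by (simp add: mult_ac)
    then have "t * m (1 / t) / 2 \<le> A * cmod (1 - cf l t)" using 1 by simp
    then have "t * m (1 / t) / 2 / A \<le> cmod (1 - cf l t)" using A by (simp add: pos_divide_le_eq mult.commute)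
    then show ?thesis using False by (simp add: c_def max_def mult.commute)
  qed
  show ?thesis
  proof (rule exI[of _ c], rule conjI[OF c(1)], rule exI[of _ \<eta>], intro conjI eta(1-3) allI impI)
    fix l t assume l: "0 < l" "l \<le> \<eta>" and t: "\<bar>t\<bar> \<le> \<eta>"
    have "cmod (1 - cf l t) = cmod (1 - cf l \<bar>t\<bar>)"
    proof (cases "0 \<le> t")
      case False
      then have "cf l t = cnj (cf l \<bar>t\<bar>)" using cf_minus[of l "\<bar>t\<bar>"] by simp
      then have "1 - cf l t = cnj (1 - cf l \<bar>t\<bar>)" by simp
      then show ?thesis by (metis complex_mod_cnj)
    qed simp
    then show "c * (max l \<bar>t\<bar> * m (1 / max l \<bar>t\<bar>)) \<le> cmod (1 - cf l t)" using pos[of l "\<bar>t\<bar>"] l t by simp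
  qed
qed

text \<open>Joint in damping and frequency and including l = 0, so that compactness gives bounds
  that stay uniform as the damping vanishes.\<close>

lemma cf_continuous: "continuous_on ({0..r} \<times> UNIV) (\<lambda>p. cf (fst p) (snd p))"
  unfolding continuous_on_sequentially
proof (intro ballI allI impI)
  fix P :: "nat \<Rightarrow> real \<times> real" and p
  assume p: "p \<in> {0..r} \<times> UNIV" and "(\<forall>n. P n \<in> {0..r} \<times> UNIV) \<and> P \<longlonglongrightarrow> p"
  then have P: "\<And>n. P n \<in> {0..r} \<times> UNIV" "P \<longlonglongrightarrow> p" by auto
  have bd: "0 \<le> fst (P n)" "fst (P n) \<le> \<kappa>" for n using P(1)[of n] r_le by (auto simp: mem_Times_iff)
  show "((\<lambda>p. cf (fst p) (snd p)) \<circ> P) \<longlonglongrightarrow> cf (fst p) (snd p)"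
    unfolding o_def cf_def
  proof (rule integral_dominated_convergence[where w="\<lambda>z. 1 + exp (- (\<kappa> * z))"])
    show "integrable F (\<lambda>z. 1 + exp (- (\<kappa> * z)))" using exp_kappa_integrable by simp
    have "(\<lambda>n. exp (of_real z * Complex (- fst (P n)) (snd (P n)))) \<longlonglongrightarrow> exp (of_real z * Complex (- fst p) (snd p))" for z
      by (intro tendsto_intros P(2))
    then show "AE z in F. (\<lambda>n. exp (of_real z * Complex (- fst (P n)) (snd (P n)))) \<longlonglongrightarrow> exp (of_real z * Complex (- fst p) (snd p))"
      by (intro always_eventually) blast
    show "AE z in F. cmod (exp (of_real z * Complex (- fst (P n)) (snd (P n)))) \<le> 1 + exp (- (\<kappa> * z))" for n
      unfolding norm_cf_integrand using exp_le_1_plus[OF bd[of n]] by (intro always_eventually) blast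
  qed auto
qed

text \<open>For l > 0 the modulus is below 1. For l = 0 equality forces cos(t z) = 1 almost surely,
  so F would live on the lattice of span 2 pi/|t|.\<close>

lemma cf_ne_1: assumes "0 \<le> l" "l \<le> r" "t \<noteq> 0" shows "cf l t \<noteq> 1"
proof (cases "l = 0")
  case False
  then have "cmod (cf l t) < 1" using norm_cf_le[of l t] psi_lt_1[of l] assms by simp
  then show ?thesis by auto
next
  case True
  show ?thesis
  proof
    assume "cf l t = 1"
    then have "(LINT z|F. 1 - cos (t * z)) = 0" and i: "integrable F (\<lambda>z. 1 - cos (t * z))"
      using Re_Im_cf(1,3)[of 0 t] kappa True by auto
    then have "AE z in F. 1 - cos (t * z) = 0"
      using integral_nonneg_eq_0_iff_AE[OF i] by simp
    then have "AE z in F. \<exists>k::int. z = (2 * pi / \<bar>t\<bar>) * of_int k"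
    proof eventually_elim
      case (elim z)
      then have "cos (\<bar>t\<bar> * z) = 1" by (cases "0 \<le> t") auto
      then obtain k :: int where "\<bar>t\<bar> * z = of_int k * (2 * pi)" by (auto simp: cos_one_2pi_int)
      then show ?case using assms by (intro exI[of _ k]) (simp add: field_simps)
    qed
    moreover have "0 < 2 * pi / \<bar>t\<bar>" using assms by simp
    ultimately show False using nonarith unfolding arithmetic_law_def by blast
  qed
qed

lemma cf_lower_compact: assumes "0 < \<eta>"
  shows "\<exists>c>0. \<forall>l t. 0 \<le> l \<longrightarrow> l \<le> r \<longrightarrow> \<eta> \<le> \<bar>t\<bar> \<longrightarrow> \<bar>t\<bar> \<le> T \<longrightarrow> c \<le> cmod (1 - cf l t)"
proof -
  define S where "S = {0..r} \<times> ({-T..-\<eta>} \<union> {\<eta>..T})"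
  have S: "compact S" unfolding S_def by (intro compact_Times compact_Un) auto
  have cont: "continuous_on S (\<lambda>p. cmod (1 - cf (fst p) (snd p)))"
    by (intro continuous_intros continuous_on_subset[OF cf_continuous]) (auto simp: S_def)
  show ?thesis
  proof (cases "S = {}")
    case True
    then have "T < \<eta>" using r_pos by (force simp: S_def)
    then show ?thesis by (intro exI[of _ 1]) auto
  next
    case False
    obtain p where p: "p \<in> S" "\<And>q. q \<in> S \<Longrightarrow> cmod (1 - cf (fst p) (snd p)) \<le> cmod (1 - cf (fst q) (snd q))"
      using continuous_attains_inf[OF S False cont] by blast
    show ?thesis
    proof (intro exI[of _ "cmod (1 - cf (fst p) (snd p))"] conjI allI impI)
      have "cf (fst p) (snd p) \<noteq> 1" using p(1) assms by (intro cf_ne_1) (auto simp: S_def)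
      then show "0 < cmod (1 - cf (fst p) (snd p))" by simp
      fix l t assume "0 \<le> l" "l \<le> r" "\<eta> \<le> \<bar>t\<bar>" "\<bar>t\<bar> \<le> T"
      then have "(l, t) \<in> S" by (auto simp: S_def abs_if split: if_splits)
      from p(2)[OF this] show "cmod (1 - cf (fst p) (snd p)) \<le> cmod (1 - cf l t)" by simp
    qed
  qed
qed

text \<open>In the rescaled frequency s = t x. Up to |s| = \<eta> x, \<open>cf_lower_small\<close>
  together with the Potter bound for a(x)/a(x/u), u = max 1 |s|, gives the power. For \<eta> x < |s|
  \<le> T x compactness bounds the modulus from below, and a(x) itself has at least the order
  x^(\<alpha>/2).\<close>

lemma cf_lower: assumes T: "0 < T"
  shows "\<exists>c>0. eventually (\<lambda>x. \<forall>s. \<bar>s\<bar> \<le> T * x \<longrightarrow> c * (1 + \<bar>s\<bar>) powr (\<alpha>/2) \<le> a x * cmod (1 - cf (1 / x) (s / x))) at_top"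
proof -
  obtain c1 \<eta> where c1: "0 < c1" and eta: "0 < \<eta>" "\<eta> \<le> r" "\<eta> \<le> 1"
    and small: "\<And>l t. 0 < l \<Longrightarrow> l \<le> \<eta> \<Longrightarrow> \<bar>t\<bar> \<le> \<eta> \<Longrightarrow> c1 * (max l \<bar>t\<bar> * m (1 / max l \<bar>t\<bar>)) \<le> cmod (1 - cf l t)"
    using cf_lower_small by blast
  obtain c2 where c2: "0 < c2" "\<And>l t. 0 \<le> l \<Longrightarrow> l \<le> r \<Longrightarrow> \<eta> \<le> \<bar>t\<bar> \<Longrightarrow> \<bar>t\<bar> \<le> T \<Longrightarrow> c2 \<le> cmod (1 - cf l t)"
    using cf_lower_compact[OF eta(1), of T] by blast
  obtain C where C: "C \<ge> 1" "\<And>x y. 1 \<le> y \<Longrightarrow> y \<le> x \<Longrightarrow> a y \<le> C * (y / x) powr (\<alpha>/2) * a x" using a_potter by blast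
  obtain c3 where c3: "0 < c3" "\<And>x. 1 \<le> x \<Longrightarrow> c3 * x powr (\<alpha>/2) \<le> a x" using a_lower by blast
  define c where "c = min (c1 / C / 2 powr (\<alpha>/2)) (c2 * c3 / (1 + T) powr (\<alpha>/2))"
  have c: "0 < c" using c1 C(1) c2 c3 T by (simp add: c_def)
  have "eventually (\<lambda>x. \<forall>s. \<bar>s\<bar> \<le> T * x \<longrightarrow> c * (1 + \<bar>s\<bar>) powr (\<alpha>/2) \<le> a x * cmod (1 - cf (1 / x) (s / x))) at_top"
    using eventually_ge_at_top[of "1 / \<eta>"]
  proof eventually_elim
    case (elim x)
    have "1 \<le> 1 / \<eta>" using eta by simp
    then have x1: "1 \<le> x" using elim by linarith
    have lx: "0 < 1 / x" "1 / x \<le> \<eta>" "1 / x \<le> r" using elim x1 eta by (auto simp: field_simps intro: order_trans[of _ "\<eta> * x"])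
    have ax: "0 < a x" using x1 by (intro a_pos) auto
    show ?case
    proof (intro allI impI)
      fix s assume s: "\<bar>s\<bar> \<le> T * x"
      have sx: "\<bar>s / x\<bar> = \<bar>s\<bar> / x" using x1 by (simp add: abs_divide)
      show "c * (1 + \<bar>s\<bar>) powr (\<alpha>/2) \<le> a x * cmod (1 - cf (1 / x) (s / x))"
      proof (cases "\<bar>s / x\<bar> \<le> \<eta>")
        case True
        define u where "u = max 1 \<bar>s\<bar>"
        have u: "1 \<le> u" by (simp add: u_def)
        have mx: "max (1 / x) \<bar>s / x\<bar> = u / x" using x1 unfolding sx u_def by (simp add: max_divide_distrib_right)
        have "u / x \<le> \<eta>" using True lx mx by (metis max.bounded_iff)
        then have "u / x \<le> 1" using eta by linarith
        then have ux: "1 \<le> x / u" using u x1 by (simp add: field_simps)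
        have "x / u \<le> x" using u x1 by (simp add: field_simps mult_left_le_one_le)
        from C(2)[OF ux this] have "a (x / u) \<le> C * (1 / u) powr (\<alpha>/2) * a x" using x1 by simp
        then have "u powr (\<alpha>/2) * a (x / u) \<le> C * a x"
          using u by (simp add: powr_divide field_simps)
        moreover have "a (x / u) > 0" using ux by (intro a_pos) auto
        ultimately have 1: "u powr (\<alpha>/2) / C \<le> a x / a (x / u)" using C(1) by (simp add: field_simps)
        have eq: "u / x * m (1 / (u / x)) = 1 / a (x / u)" using u x1 by (simp add: a_def)
        have "c1 * (1 / a (x / u)) \<le> cmod (1 - cf (1 / x) (s / x))"
          using small[OF lx(1,2) True] unfolding mx eq .
        then have "a x * (c1 * (1 / a (x / u))) \<le> a x * cmod (1 - cf (1 / x) (s / x))"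
          using ax by (intro mult_left_mono) auto
        moreover have "c1 * (u powr (\<alpha>/2) / C) \<le> c1 * (a x / a (x / u))" using 1 c1 by (intro mult_left_mono) auto
        ultimately have 2: "c1 / C * u powr (\<alpha>/2) \<le> a x * cmod (1 - cf (1 / x) (s / x))" by (simp add: mult_ac)
        have "(1 + \<bar>s\<bar>) powr (\<alpha>/2) \<le> (2 * u) powr (\<alpha>/2)" using alpha by (intro powr_mono2) (auto simp: u_def)
        also have "\<dots> = 2 powr (\<alpha>/2) * u powr (\<alpha>/2)" using u by (simp add: powr_mult)
        finally have "c * (1 + \<bar>s\<bar>) powr (\<alpha>/2) \<le> (c1 / C / 2 powr (\<alpha>/2)) * (2 powr (\<alpha>/2) * u powr (\<alpha>/2))"
          using c c1 C(1) by (intro mult_mono) (auto simp: c_def)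
        then show ?thesis using 2 by simp
      next
        case False
        have "\<bar>s / x\<bar> \<le> T" using s x1 by (simp add: abs_divide pos_divide_le_eq)
        then have "c2 \<le> cmod (1 - cf (1 / x) (s / x))" using False lx by (intro c2) auto
        then have 1: "c3 * x powr (\<alpha>/2) * c2 \<le> a x * cmod (1 - cf (1 / x) (s / x))"
          using c3(2)[OF x1] c2 c3 ax by (intro mult_mono) auto
        have "(1 + \<bar>s\<bar>) powr (\<alpha>/2) \<le> ((1 + T) * x) powr (\<alpha>/2)"
          using s x1 alpha by (intro powr_mono2) (auto simp: distrib_right)
        also have "\<dots> = (1 + T) powr (\<alpha>/2) * x powr (\<alpha>/2)" using T x1 by (simp add: powr_mult)
        finally have "c * (1 + \<bar>s\<bar>) powr (\<alpha>/2) \<le> (c2 * c3 / (1 + T) powr (\<alpha>/2)) * ((1 + T) powr (\<alpha>/2) * x powr (\<alpha>/2))"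
          using c c2 c3 T by (intro mult_mono) (auto simp: c_def)
        then show ?thesis using 1 T by (simp add: mult_ac)
      qed
    qed
  qed
  then show ?thesis using c by blast
qed

end

section \<open>The scaling limit of the transform\<close>

lemma u_exp_integrable: assumes "0 < (l::real)"
  shows "integrable lborel (\<lambda>u. indicator {0..} u * (u * exp (- (l * u))))"
proof (rule integrableI_nonneg)
  have "(\<integral>\<^sup>+u. ennreal (u * exp (- (l * u))) * indicator {0..} u \<partial>lborel) = ennreal (0 - (- (0 / l + 1 / l\<^sup>2) * exp (- (l * 0))))"
  proof (rule nn_integral_FTC_atLeast)
    show "((\<lambda>u. - (u / l + 1 / l\<^sup>2) * exp (- (l * u))) has_real_derivative u * exp (- (l * u))) (at u)" for u
      using assms by (auto intro!: derivative_eq_intros simp: field_simps power2_eq_square)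
    show "((\<lambda>u. - (u / l + 1 / l\<^sup>2) * exp (- (l * u))) \<longlongrightarrow> 0) at_top" using assms by real_asymp
  qed auto
  also have "\<dots> < \<infinity>" by simp
  also have "(\<integral>\<^sup>+u. ennreal (u * exp (- (l * u))) * indicator {0..} u \<partial>lborel) = (\<integral>\<^sup>+u. ennreal (indicator {0..} u * (u * exp (- (l * u)))) \<partial>lborel)"
    by (intro nn_integral_cong) (auto split: split_indicator)
  finally show "(\<integral>\<^sup>+u. ennreal (indicator {0..} u * (u * exp (- (l * u)))) \<partial>lborel) < \<infinity>" .
qed (auto split: split_indicator)

lemma laplace_min_integrable: assumes "Re w < 0"
  shows "integrable lborel (\<lambda>u. indicator {0..} u *\<^sub>R (of_real (max 0 (min z u)) * exp (of_real u * w)))"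
  by (rule Bochner_Integration.integrable_bound[OF u_exp_integrable[of "- Re w"]])
     (use assms in \<open>auto split: split_indicator simp: norm_mult norm_exp_eq_Re mult.commute intro!: mult_right_mono always_eventually\<close>)

text \<open>Two antiderivatives joined at u = z. Integrated against F, the identity expresses the
  positive part of 1 - f through the Laplace transform of \<open>m\<close>, whose regular variation
  covers \<alpha> = 1 as well.\<close>

lemma laplace_min: assumes w: "Re w < 0"
  shows "(CLINT u|lborel. indicator {0..} u *\<^sub>R (of_real (max 0 (min z u)) * exp (of_real u * w))) =
    indicator {0..} z *\<^sub>R ((1 - exp (of_real z * w)) / w\<^sup>2)"
proof (cases "0 \<le> z")
  case False
  then have "max 0 (min z u) = 0" for u by (auto simp: max_def min_def)
  then show ?thesis using False by simp
next
  case True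
  have w0: "w \<noteq> 0" using w by auto
  let ?f = "\<lambda>u. indicator {0..} u *\<^sub>R (of_real (max 0 (min z u)) * exp (of_real u * w))"
  have lim: "((\<lambda>b. CLINT u|lborel. indicator {..b} u *\<^sub>R ?f u) \<longlongrightarrow> (CLINT u|lborel. ?f u)) at_top"
    by (rule tendsto_integral_at_top[OF _ laplace_min_integrable[OF w]]) simp
  define G where "G u = (of_real u / w - 1 / w\<^sup>2) * exp (of_real u * w)" for u :: real
  have p1: "(CLINT u|lborel. indicator {0..z} u *\<^sub>R (of_real u * exp (of_real u * w))) = G z - G 0"
  proof (rule integral_FTC_atLeastAtMost[OF True])
    have "((\<lambda>c. (c / w - 1 / w\<^sup>2) * exp (c * w)) has_field_derivative (of_real u * exp (of_real u * w))) (at (of_real u))" for u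
      using w0 by (auto intro!: derivative_eq_intros simp: field_simps power2_eq_square)
    then show "(G has_vector_derivative (of_real u * exp (of_real u * w))) (at u within {0..z})" for u
      unfolding G_def by (rule has_vector_derivative_real_field)
  qed (auto intro!: continuous_intros)
  have p2: "(CLINT u|lborel. indicator {z..b} u *\<^sub>R (of_real z * exp (of_real u * w))) = of_real z * exp (of_real b * w) / w - of_real z * exp (of_real z * w) / w"
    if "z \<le> b" for b
  proof (rule integral_FTC_atLeastAtMost[OF that])
    show "((\<lambda>u. of_real z * exp (of_real u * w) / w) has_vector_derivative (of_real z * exp (of_real u * w))) (at u within {z..b})" for u
      using w0 by (intro has_vector_derivative_real_field[where f = "\<lambda>c. of_real z * exp (c * w) / w"]) (auto intro!: derivative_eq_intros)
  qed (auto intro!: continuous_intros)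
  have eq: "(CLINT u|lborel. indicator {..b} u *\<^sub>R ?f u) = G z - G 0 + (of_real z * exp (of_real b * w) / w - of_real z * exp (of_real z * w) / w)"
    if b: "z \<le> b" for b
  proof -
    have i1: "integrable lborel (\<lambda>u. indicator {0..z} u *\<^sub>R (of_real u * exp (of_real u * w)))"
      by (rule borel_integrable_compact[of "{0..z}" "\<lambda>u. of_real u * exp (of_real u * w)", simplified set_integrable_def]) (auto intro!: continuous_intros)
    have i2: "integrable lborel (\<lambda>u. indicator {z..b} u *\<^sub>R (of_real z * exp (of_real u * w)))"
      by (rule borel_integrable_compact[of "{z..b}" "\<lambda>u. of_real z * exp (of_real u * w)", simplified set_integrable_def]) (auto intro!: continuous_intros)
    have "(CLINT u|lborel. indicator {..b} u *\<^sub>R ?f u) = (CLINT u|lborel. indicator {0..z} u *\<^sub>R (of_real u * exp (of_real u * w)) + indicator {z..b} u *\<^sub>R (of_real z * exp (of_real u * w)))"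
    proof (rule integral_cong_AE)
      show "AE u in lborel. indicator {..b} u *\<^sub>R ?f u = indicator {0..z} u *\<^sub>R (of_real u * exp (of_real u * w)) + indicator {z..b} u *\<^sub>R (of_real z * exp (of_real u * w))"
        using AE_lborel_singleton[of z]
        by eventually_elim (use True b in \<open>auto split: split_indicator simp: max_def min_def\<close>)
    qed auto
    also have "\<dots> = G z - G 0 + (of_real z * exp (of_real b * w) / w - of_real z * exp (of_real z * w) / w)"
      using i1 i2 p1 p2[OF b] by simp
    finally show ?thesis .
  qed
  have e0: "((\<lambda>b. exp (of_real b * w)) \<longlongrightarrow> 0) at_top"
  proof (rule tendsto_norm_zero_cancel)
    have "((\<lambda>b. exp (Re w * b)) \<longlongrightarrow> 0) at_top" using w by real_asymp
    then show "((\<lambda>b. norm (exp (of_real b * w))) \<longlongrightarrow> 0) at_top" by (simp add: norm_exp_eq_Re mult.commute)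
  qed
  have "((\<lambda>b. G z - G 0 + (of_real z * exp (of_real b * w) / w - of_real z * exp (of_real z * w) / w)) \<longlongrightarrow> G z - G 0 + (of_real z * 0 / w - of_real z * exp (of_real z * w) / w)) at_top"
    using w0 by (intro tendsto_intros e0)
  then have "((\<lambda>b. CLINT u|lborel. indicator {..b} u *\<^sub>R ?f u) \<longlongrightarrow> G z - G 0 + (of_real z * 0 / w - of_real z * exp (of_real z * w) / w)) at_top"
    by (rule Lim_transform_eventually) (use eventually_ge_at_top[of z] in eventually_elim, rule eq[symmetric])
  then have "(CLINT u|lborel. ?f u) = G z - G 0 + (of_real z * 0 / w - of_real z * exp (of_real z * w) / w)"
    using lim tendsto_unique trivial_limit_at_top_linorder by blast
  also have "\<dots> = (1 - exp (of_real z * w)) / w\<^sup>2"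
    using w0 by (simp add: G_def field_simps power2_eq_square)
  finally show ?thesis using True by simp
qed

context nonarithmetic_step begin

text \<open>Equals \<Gamma>(2 - \<alpha>) (1 - i s)^\<alpha>. The integral form is kept because it
  is what the scaling limit produces; what is evaluated later is its value at 0.\<close>

definition Lam :: "real \<Rightarrow> complex" where
  "Lam s = (Complex (- 1) s)\<^sup>2 * (CLINT v|lborel. indicator {0..} v *\<^sub>R (of_real (v powr (1 - \<alpha>)) * exp (of_real v * Complex (- 1) s)))"

lemma positive_part_transform: assumes l: "0 < l"
  shows "(CLINT z|F. indicator {0..} z *\<^sub>R (1 - exp (of_real z * Complex (- l) t))) =
    (Complex (- l) t)\<^sup>2 * (CLINT u|lborel. indicator {0..} u *\<^sub>R (of_real (m u) * exp (of_real u * Complex (- l) t)))"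
proof -
  let ?w = "Complex (- l) t"
  have w: "Re ?w < 0" "?w \<noteq> 0" using l by (auto simp: complex_eq_iff)
  interpret P: pair_sigma_finite F lborel ..
  let ?f = "\<lambda>z u. indicator {0..} u *\<^sub>R (of_real (max 0 (min z u)) * exp (of_real u * ?w))"
  have i: "integrable (F \<Otimes>\<^sub>M lborel) (\<lambda>(z, u). ?f z u)"
  proof (rule Bochner_Integration.integrable_bound)
    show "integrable (F \<Otimes>\<^sub>M lborel) (\<lambda>(z, u). indicator {0..} u * (u * exp (- (l * u))))"
      by (rule P.Fubini_integrable) (use u_exp_integrable[OF l] in auto)
    show "AE p in F \<Otimes>\<^sub>M lborel. norm (case p of (z, u) \<Rightarrow> ?f z u) \<le> norm (case p of (z, u) \<Rightarrow> indicator {0..} u * (u * exp (- (l * u))))"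
      by (intro always_eventually) (auto split: split_indicator simp: norm_mult norm_exp_eq_Re mult.commute intro!: mult_right_mono)
  qed measurable
  have "(CLINT z|F. indicator {0..} z *\<^sub>R (1 - exp (of_real z * ?w))) = (CLINT z|F. ?w\<^sup>2 * (CLINT u|lborel. ?f z u))"
    unfolding laplace_min[OF w(1)] using w by (intro Bochner_Integration.integral_cong) (auto split: split_indicator)
  also have "\<dots> = ?w\<^sup>2 * (CLINT z|F. CLINT u|lborel. ?f z u)" by simp
  also have "(CLINT z|F. CLINT u|lborel. ?f z u) = (CLINT u|lborel. CLINT z|F. ?f z u)"
    using P.Fubini_integral[OF i] by simp
  also have "\<dots> = (CLINT u|lborel. indicator {0..} u *\<^sub>R (of_real (m u) * exp (of_real u * ?w)))"
    unfolding m_def by (intro Bochner_Integration.integral_cong) (auto simp: m_integrable)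
  finally show ?thesis .
qed

text \<open>The negative part of 1 - f is O(1/x), and a(x)/x = 1/m(x) -> 0.\<close>

lemma negative_part_limit: "((\<lambda>x. of_real (a x) * (CLINT z|F. indicator {..<0} z *\<^sub>R (1 - exp (of_real z * Complex (- (1/x)) (s/x))))) \<longlongrightarrow> 0) at_top"
proof -
  have "((\<lambda>x. (1 + \<bar>s\<bar>) * C0 * inverse (m x)) \<longlongrightarrow> (1 + \<bar>s\<bar>) * C0 * 0) at_top"
    by (intro tendsto_intros tendsto_inverse_0_at_top m_at_top)
  then show ?thesis unfolding mult_zero_right
  proof (rule Lim_null_comparison[rotated])
    show "eventually (\<lambda>x. norm (of_real (a x) * (CLINT z|F. indicator {..<0} z *\<^sub>R (1 - exp (of_real z * Complex (- (1/x)) (s/x))))) \<le> (1 + \<bar>s\<bar>) * C0 * inverse (m x)) at_top"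
      using eventually_ge_at_top[of "1 / r"] eventually_gt_at_top[of 0]
    proof eventually_elim
      case (elim x)
      have lx: "0 < 1 / x" "1 / x \<le> r" using elim r_pos by (auto simp: field_simps)
      let ?w = "Complex (- (1/x)) (s/x)"
      have ax: "0 < a x" using elim by (intro a_pos)
      have nw: "cmod ?w \<le> (1 + \<bar>s\<bar>) / x"
        using elim cmod_le[of ?w] by (simp add: add_divide_distrib)
      have bd: "norm (indicator {..<0} z *\<^sub>R (1 - exp (of_real z * ?w))) \<le> (1 + \<bar>s\<bar>) / x * (\<bar>z\<bar> * exp (- (r * z)))" for z
      proof (cases "z < 0")
        case True
        have "cmod (1 - exp (of_real z * ?w)) \<le> cmod (of_real z * ?w) * max 1 (exp (Re (of_real z * ?w)))"
          using cmod_exp_minus_1_le[of "of_real z * ?w"] by (simp add: norm_minus_commute)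
        also have "\<dots> \<le> cmod (of_real z * ?w) * exp (- (r * z))"
        proof (rule mult_left_mono)
          have "r * z \<le> 0" using True r_pos by (intro mult_nonneg_nonpos) auto
          then show "max 1 (exp (Re (of_real z * ?w))) \<le> exp (- (r * z))" using True lx mult_right_mono_neg[of "1/x" r z] by auto
        qed simp
        also have "cmod (of_real z * ?w) = \<bar>z\<bar> * cmod ?w" by (simp only: norm_mult norm_of_real)
        also have "\<bar>z\<bar> * cmod ?w * exp (- (r * z)) \<le> \<bar>z\<bar> * ((1 + \<bar>s\<bar>) / x) * exp (- (r * z))"
          using nw by (intro mult_right_mono mult_left_mono) auto
        finally show ?thesis using True by (simp add: mult_left_mono mult_ac)
      qed (use elim in simp)
      have "norm (CLINT z|F. indicator {..<0} z *\<^sub>R (1 - exp (of_real z * ?w))) \<le> (LINT z|F. (1 + \<bar>s\<bar>) / x * (\<bar>z\<bar> * exp (- (r * z))))"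
        by (rule Bochner_Integration.integral_norm_bound_integral[OF _ integrable_mult_right[OF abs_exp_integrable] bd], rule Bochner_Integration.integrable_bound[OF integrable_mult_right[OF abs_exp_integrable, of "(1 + \<bar>s\<bar>) / x"]])
           (use bd elim in \<open>auto intro!: always_eventually order_trans[OF bd]\<close>)
      also have "\<dots> = (1 + \<bar>s\<bar>) / x * C0" by (simp add: C0_def)
      finally have "a x * norm (CLINT z|F. indicator {..<0} z *\<^sub>R (1 - exp (of_real z * ?w))) \<le> a x * ((1 + \<bar>s\<bar>) / x * C0)"
        using ax by (intro mult_left_mono) auto
      also have "\<dots> = (a x / x) * ((1 + \<bar>s\<bar>) * C0)" by simp
      also have "a x / x = inverse (m x)" using elim by (simp add: a_def inverse_eq_divide)
      also have "inverse (m x) * ((1 + \<bar>s\<bar>) * C0) = (1 + \<bar>s\<bar>) * C0 * inverse (m x)" by (rule mult.commute)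
      finally show ?case using ax by (simp add: norm_mult)
    qed
  qed
qed

lemma exp_1_plus_integrable: "integrable lborel (\<lambda>v. indicator {0..} v * ((1 + v) * exp (- v :: real)))"
proof -
  have "integrable lborel (\<lambda>v. indicator {0..} v * (1 * exp (- v :: real)))"
  proof (rule integrableI_nonneg)
    have "(\<integral>\<^sup>+v. ennreal (exp (- v)) * indicator {0..} v \<partial>lborel) = ennreal (0 - (- exp (- 0 :: real)))"
      by (rule nn_integral_FTC_atLeast) (auto intro!: derivative_eq_intros, real_asymp)
    also have "(\<integral>\<^sup>+v. ennreal (exp (- v)) * indicator {0..} v \<partial>lborel) = (\<integral>\<^sup>+v. ennreal (indicator {0..} v * (1 * exp (- v))) \<partial>lborel)"
      by (intro nn_integral_cong) (auto split: split_indicator)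
    finally show "(\<integral>\<^sup>+v. ennreal (indicator {0..} v * (1 * exp (- v :: real))) \<partial>lborel) < \<infinity>" by simp
  qed auto
  from Bochner_Integration.integrable_add[OF this u_exp_integrable[of 1]] show ?thesis by (simp add: algebra_simps)
qed

lemma m_ratio_bound: assumes "0 < x" "0 \<le> v" shows "m (x * v) / m x \<le> 1 + v"
proof -
  have "m (x * v) \<le> (1 + v) * m x"
  proof -
    have "m (x * v) \<le> m ((1 + v) * x)" using assms by (intro m_mono) (auto simp: algebra_simps)
    also have "\<dots> \<le> (1 + v) * m x" using assms by (intro m_scale) auto
    finally show ?thesis .
  qed
  then show ?thesis using m_pos[OF assms(1)] by (simp add: pos_divide_le_eq)
qed

text \<open>Substitute u = x v in \<open>positive_part_transform\<close>: the powers of x and a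
  factor m(x) cancel against a(x), leaving m(x v)/m(x), which is at most 1 + v and tends to
  v^(1-\<alpha>).\<close>

lemma positive_part_limit: "((\<lambda>x. of_real (a x) * (CLINT z|F. indicator {0..} z *\<^sub>R (1 - exp (of_real z * Complex (- (1/x)) (s/x))))) \<longlongrightarrow> Lam s) at_top"
proof -
  let ?w = "Complex (- 1) s"
  let ?g = "\<lambda>x v. indicator {0..} v *\<^sub>R (of_real (m (x * v) / m x) * exp (of_real v * ?w))"
  have "((\<lambda>x. CLINT v|lborel. ?g x v) \<longlongrightarrow> (CLINT v|lborel. indicator {0..} v *\<^sub>R (of_real (v powr (1 - \<alpha>)) * exp (of_real v * ?w)))) at_top"
  proof (rule integral_dominated_convergence_at_top[OF _ _ exp_1_plus_integrable])
    show "AE v in lborel. ((\<lambda>x. ?g x v) \<longlongrightarrow> indicator {0..} v *\<^sub>R (of_real (v powr (1 - \<alpha>)) * exp (of_real v * ?w))) at_top"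
    proof (intro always_eventually allI)
      fix v :: real
      show "((\<lambda>x. ?g x v) \<longlongrightarrow> indicator {0..} v *\<^sub>R (of_real (v powr (1 - \<alpha>)) * exp (of_real v * ?w))) at_top"
      proof (cases "0 < v")
        case True
        then have "((\<lambda>x. m (x * v) / m x) \<longlongrightarrow> v powr (1 - \<alpha>)) at_top" using m_rv[of v] by (simp add: mult.commute)
        then show ?thesis by (intro tendsto_intros)
      next
        case False
        \<comment> \<open>At v = 0 both sides are 0, even when \<alpha> = 1, by the convention
          \<open>0 powr 0 = 0\<close>.\<close>
        have "m 0 = 0" by (simp add: m_def)
        then show ?thesis using False by (cases "v = 0") auto
      qed
    qed
    show "\<forall>\<^sub>F x in at_top. AE v in lborel. norm (?g x v) \<le> indicator {0..} v * ((1 + v) * exp (- v))"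
      using eventually_gt_at_top[of 0]
    proof eventually_elim
      case (elim x)
      show ?case
      proof (intro always_eventually allI)
        fix v :: real
        show "norm (?g x v) \<le> indicator {0..} v * ((1 + v) * exp (- v))"
        proof (cases "0 \<le> v")
          case True
          then have "norm (?g x v) = m (x * v) / m x * exp (- v)"
            using m_nonneg by (simp add: norm_mult norm_divide norm_exp_eq_Re)
          also have "\<dots> \<le> (1 + v) * exp (- v)" using elim True by (intro mult_right_mono m_ratio_bound) auto
          finally show ?thesis using True by simp
        qed simp
      qed
    qed
  qed auto
  then have "((\<lambda>x. ?w\<^sup>2 * (CLINT v|lborel. ?g x v)) \<longlongrightarrow> Lam s) at_top"
    unfolding Lam_def by (intro tendsto_intros)
  moreover have "eventually (\<lambda>x. ?w\<^sup>2 * (CLINT v|lborel. ?g x v) =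
     of_real (a x) * (CLINT z|F. indicator {0..} z *\<^sub>R (1 - exp (of_real z * Complex (- (1/x)) (s/x))))) at_top"
    using eventually_gt_at_top[of 0]
  proof eventually_elim
    case (elim x)
    have wx: "Complex (- (1/x)) (s/x) = ?w / of_real x" by (simp add: complex_eq_iff)
    have mx: "m x \<noteq> 0" using m_pos[OF elim] by simp
    have "(CLINT u|lborel. indicator {0..} u *\<^sub>R (of_real (m u) * exp (of_real u * Complex (- (1/x)) (s/x)))) =
       x *\<^sub>R (CLINT v|lborel. indicator {0..} (x * v) *\<^sub>R (of_real (m (x * v)) * exp (of_real (x * v) * Complex (- (1/x)) (s/x))))"
      using elim by (subst lborel_integral_real_affine[where c=x and t=0]) auto
    also have "(CLINT v|lborel. indicator {0..} (x * v) *\<^sub>R (of_real (m (x * v)) * exp (of_real (x * v) * Complex (- (1/x)) (s/x)))) =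
       (CLINT v|lborel. of_real (m x) * ?g x v)"
      unfolding wx using elim mx by (intro Bochner_Integration.integral_cong) (auto split: split_indicator simp: zero_le_mult_iff)
    also have "\<dots> = of_real (m x) * (CLINT v|lborel. ?g x v)" by (rule integral_mult_right_zero)
    finally have E: "(CLINT u|lborel. indicator {0..} u *\<^sub>R (of_real (m u) * exp (of_real u * Complex (- (1/x)) (s/x)))) =
       x *\<^sub>R (of_real (m x) * (CLINT v|lborel. ?g x v))" .
    have alg: "W\<^sup>2 * I = of_real (x / m x) * ((W / of_real x)\<^sup>2 * (x *\<^sub>R (of_real (m x) * I)))" for W I :: complex
      using elim mx by (simp add: scaleR_conv_of_real power2_eq_square field_simps)
    show ?case
      unfolding positive_part_transform[of "1/x" "s/x", OF divide_pos_pos[OF zero_less_one elim]] E unfolding wx a_def by (rule alg)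
  qed
  ultimately show ?thesis by (rule Lim_transform_eventually)
qed

lemma cf_limit: "((\<lambda>x. of_real (a x) * (1 - cf (1 / x) (s / x))) \<longlongrightarrow> Lam s) at_top"
proof -
  have "((\<lambda>x. of_real (a x) * (CLINT z|F. indicator {0..} z *\<^sub>R (1 - exp (of_real z * Complex (- (1/x)) (s/x)))) +
      of_real (a x) * (CLINT z|F. indicator {..<0} z *\<^sub>R (1 - exp (of_real z * Complex (- (1/x)) (s/x))))) \<longlongrightarrow> Lam s + 0) at_top"
    by (intro tendsto_add positive_part_limit negative_part_limit)
  moreover have "eventually (\<lambda>x. of_real (a x) * (CLINT z|F. indicator {0..} z *\<^sub>R (1 - exp (of_real z * Complex (- (1/x)) (s/x)))) +
      of_real (a x) * (CLINT z|F. indicator {..<0} z *\<^sub>R (1 - exp (of_real z * Complex (- (1/x)) (s/x)))) = of_real (a x) * (1 - cf (1 / x) (s / x))) at_top"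
    using eventually_ge_at_top[of "1 / \<kappa>"] eventually_gt_at_top[of 0]
  proof eventually_elim
    case (elim x)
    have lx: "0 \<le> 1 / x" "1 / x \<le> \<kappa>" using elim kappa by (auto simp: field_simps)
    let ?h = "\<lambda>z. 1 - exp (of_real z * Complex (- (1/x)) (s/x))"
    have i: "integrable F ?h" using cf_integrable[OF lx, of "s/x"] by simp
    have "1 - cf (1 / x) (s / x) = (CLINT z|F. ?h z)"
      using cf_integrable[OF lx, of "s/x"] prob_space by (simp add: cf_def)
    also have "\<dots> = (CLINT z|F. indicator {0..} z *\<^sub>R ?h z + indicator {..<0} z *\<^sub>R ?h z)"
      by (intro Bochner_Integration.integral_cong) (auto split: split_indicator)
    also have "\<dots> = (CLINT z|F. indicator {0..} z *\<^sub>R ?h z) + (CLINT z|F. indicator {..<0} z *\<^sub>R ?h z)"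
      using integrable_mult_indicator[OF _ i, of "{0..}"] integrable_mult_indicator[OF _ i, of "{..<0}"]
      by (intro Bochner_Integration.integral_add) auto
    finally show ?case by (simp add: distrib_left)
  qed
  ultimately show ?thesis by (simp add: tendsto_cong)
qed

lemma Lam_0: "Lam 0 = of_real (Gamma (2 - \<alpha>))"
proof -
  have "(CLINT v|lborel. indicator {0..} v *\<^sub>R (of_real (v powr (1 - \<alpha>)) * exp (of_real v * Complex (- 1) 0))) =
     (CLINT v|lborel. of_real (indicator {0..} v * v powr (1 - \<alpha>) / exp v))"
  proof (intro Bochner_Integration.integral_cong refl)
    fix v :: real
    have "of_real v * Complex (- 1) 0 = of_real (- v)" by (simp add: complex_eq_iff)
    then have "exp (of_real v * Complex (- 1) 0) = of_real (exp (- v))" by (simp only: exp_of_real)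
    then show "indicator {0..} v *\<^sub>R (of_real (v powr (1 - \<alpha>)) * exp (of_real v * Complex (- 1) 0)) = of_real (indicator {0..} v * v powr (1 - \<alpha>) / exp v)"
      by (simp only:) (simp add: exp_minus field_simps scaleR_conv_of_real)
  qed
  also have "\<dots> = of_real (LINT v|lborel. indicator {0..} v * v powr (1 - \<alpha>) / exp v)" by (rule integral_complex_of_real)
  also have "(LINT v|lborel. indicator {0..} v * v powr (1 - \<alpha>) / exp v) = Gamma (2 - \<alpha>)"
  proof -
    have "ennreal (Gamma (2 - \<alpha>)) = (\<integral>\<^sup>+v. ennreal (indicator {0..} v * v powr (1 - \<alpha>) / exp v) \<partial>lborel)"
      using Gamma_conv_nn_integral_real[of "2 - \<alpha>"] alpha by simp
    then show ?thesis using alpha by (subst integral_eq_nn_integral) (auto simp: Gamma_real_nonneg)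
  qed
  finally show ?thesis unfolding Lam_def by (simp add: complex_eq_iff power2_eq_square)
qed

end

section \<open>High convolution powers\<close>

text \<open>The triangle function is the characteristic function of the probability density
  proportional to \<open>fejer\<close>; its compact support cuts the frequencies down to a range
  where \<open>cf_lower\<close> holds.\<close>

definition tri :: "real \<Rightarrow> real" where "tri t = max 0 (1 - \<bar>t\<bar>)"
definition fejer :: "real \<Rightarrow> real" where "fejer y = (sinc (y / 2))\<^sup>2"

lemma tri_nonneg [simp]: "0 \<le> tri t" by (simp add: tri_def)
lemma tri_le_1: "tri t \<le> 1" by (simp add: tri_def)
lemma tri_continuous: "isCont tri t" unfolding tri_def[abs_def] by (intro continuous_intros)
lemma tri_measurable [measurable]: "tri \<in> borel_measurable borel" unfolding tri_def[abs_def] by measurable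
lemma fejer_nonneg [simp]: "0 \<le> fejer y" by (simp add: fejer_def)

lemma tri_integrable: "integrable lborel tri"
proof (rule Bochner_Integration.integrable_bound[where f="indicator {- 1..1} :: real \<Rightarrow> real"])
  show "integrable lborel (indicator {- 1..1} :: real \<Rightarrow> real)" by (intro integrable_real_indicator) (auto simp: emeasure_lborel_Icc_eq)
qed (auto simp: tri_def indicator_def)

lemma fejer_eq: assumes "y \<noteq> 0" shows "fejer y = 2 * (1 - cos y) / y\<^sup>2"
proof -
  have "cos y = 1 - 2 * (sin (y / 2))\<^sup>2" using cos_double_sin[of "y / 2"] by simp
  then show ?thesis using assms by (simp add: fejer_def power_divide)
qed

lemma fejer_continuous: "isCont fejer y"
proof -
  have "isCont (\<lambda>y. y / 2) y" by (intro continuous_intros) auto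
  from isCont_o2[OF this isCont_sinc] show ?thesis unfolding fejer_def[abs_def] by (rule continuous_power)
qed

lemma fejer_measurable [measurable]: "fejer \<in> borel_measurable borel"
  by (intro borel_measurable_continuous_onI continuous_at_imp_continuous_on ballI fejer_continuous)

lemma fejer_le_1: "fejer y \<le> 1"
proof (cases "y = 0")
  case False
  have "\<bar>sin (y / 2)\<bar> / \<bar>y / 2\<bar> \<le> 1"
    using abs_sin_x_le_abs_x[of "y / 2"] False by (subst divide_le_eq_1_pos) auto
  then have "\<bar>sinc (y / 2)\<bar> \<le> 1" using False by (simp only: abs_divide[symmetric]) simp
  then show ?thesis unfolding fejer_def by (rule abs_square_le_1[THEN iffD2])
qed (simp add: fejer_def)

lemma fejer_lower: assumes "0 \<le> y" "y \<le> 1" shows "1 / 4 \<le> fejer y"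
proof (cases "y = 0")
  case False
  have "1 / 2 * (y / 2) \<le> sin (y / 2)" using sin_ge_half[of "y / 2"] assms by simp
  then have "1 / 2 \<le> sin (y / 2) / (y / 2)" using False assms by (subst pos_le_divide_eq) auto
  then have "(1 / 2)\<^sup>2 \<le> (sin (y / 2) / (y / 2))\<^sup>2" by (intro power_mono) auto
  then show ?thesis using False by (simp add: fejer_def power2_eq_square)
qed (simp add: fejer_def)

lemma inverse_square_integrable: "integrable lborel (\<lambda>y::real. inverse (1 + y\<^sup>2))"
  using integrable_inverse_1_plus_square by (simp add: set_integrable_def)

lemma one_minus_cos_bound: "(1 - cos u) / u\<^sup>2 \<le> 4 * inverse (1 + (u::real)\<^sup>2)"
proof (cases "\<bar>u\<bar> \<le> 1")
  case True
  have "(1 - cos u) / u\<^sup>2 \<le> 1 / 2"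
  proof (cases "u = 0")
    case False then show ?thesis using fejer_eq[of u] fejer_le_1[of u] by simp
  qed simp
  moreover have "1 + u\<^sup>2 \<le> 2" using True by (simp add: abs_square_le_1)
  then have "1 / 2 \<le> inverse (1 + u\<^sup>2)" by (simp add: divide_simps add_pos_nonneg)
  ultimately show ?thesis by linarith
next
  case False
  then have u: "1 \<le> u\<^sup>2" using abs_le_square_iff[of 1 u] by simp
  have "(1 - cos u) / u\<^sup>2 \<le> 2 / u\<^sup>2" using cos_ge_minus_one[of u] by (intro divide_right_mono) auto
  also have "\<dots> \<le> 4 / (1 + u\<^sup>2)" using u by (simp add: divide_simps)
  finally show ?thesis by (simp add: divide_inverse)
qed

lemma one_minus_cos_integrable: "integrable lborel (\<lambda>y::real. (1 - cos (c * y)) / y\<^sup>2)"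
proof (cases "c = 0")
  case False
  have "integrable lborel (\<lambda>u::real. (1 - cos u) / u\<^sup>2)"
    by (rule Bochner_Integration.integrable_bound[OF integrable_mult_right[OF inverse_square_integrable, of 4]])
       (auto intro!: always_eventually order_trans[OF one_minus_cos_bound])
  from lborel_integrable_real_affine[OF this False, of 0] have "integrable lborel (\<lambda>y. c\<^sup>2 * ((1 - cos (c * y)) / (c * y)\<^sup>2))"
    by (intro integrable_mult_right) simp
  then show ?thesis using False by (simp add: power_mult_distrib)
qed simp

text \<open>Its value is 2 pi; what enters is positivity, since the constant cancels in the
  normalised density.\<close>

definition fejer_const :: real where "fejer_const = 2 * (LINT y|lborel. (1 - cos y) / y\<^sup>2)"

lemma one_minus_cos_integral: "2 * (LINT y|lborel. (1 - cos (c * y)) / y\<^sup>2) = \<bar>c\<bar> * fejer_const"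
proof (cases "c = 0")
  case False
  have "(LINT y|lborel. (1 - cos y) / y\<^sup>2) = \<bar>c\<bar> * (LINT y|lborel. (1 - cos (c * y)) / (c * y)\<^sup>2)"
    using lborel_integral_real_affine[OF False, of "\<lambda>y. (1 - cos y) / y\<^sup>2" 0] by simp
  also have "(\<lambda>y. (1 - cos (c * y)) / (c * y)\<^sup>2) = (\<lambda>y. inverse (c\<^sup>2) * ((1 - cos (c * y)) / y\<^sup>2))"
    by (simp add: fun_eq_iff power_mult_distrib divide_inverse)
  also have "(LINT y|lborel. inverse (c\<^sup>2) * ((1 - cos (c * y)) / y\<^sup>2)) = inverse (c\<^sup>2) * (LINT y|lborel. (1 - cos (c * y)) / y\<^sup>2)"
    by (rule integral_mult_right_zero)
  finally have "\<bar>c\<bar> * (LINT y|lborel. (1 - cos y) / y\<^sup>2) = (\<bar>c\<bar> * \<bar>c\<bar>) * inverse (c\<^sup>2) * (LINT y|lborel. (1 - cos (c * y)) / y\<^sup>2)"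
    by (simp only: mult.assoc)
  also have "\<bar>c\<bar> * \<bar>c\<bar> = c\<^sup>2" by (simp add: power2_eq_square)
  finally show ?thesis using False unfolding fejer_const_def by simp
qed simp

lemma fejer_cos_AE: "AE y in lborel. fejer y * cos (c * y) =
    (1 - cos ((1 + c) * y)) / y\<^sup>2 + (1 - cos ((1 - c) * y)) / y\<^sup>2 - 2 * ((1 - cos (c * y)) / y\<^sup>2)"
  using AE_lborel_singleton[of 0]
proof eventually_elim
  case (elim y)
  have "cos ((1 + c) * y) + cos ((1 - c) * y) = 2 * (cos y * cos (c * y))"
    by (simp add: algebra_simps cos_add cos_diff)
  then have "2 * (1 - cos y) * cos (c * y) = (1 - cos ((1 + c) * y)) + (1 - cos ((1 - c) * y)) - 2 * (1 - cos (c * y))"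
    by (simp add: algebra_simps)
  moreover have "fejer y * cos (c * y) = (2 * (1 - cos y) * cos (c * y)) / y\<^sup>2"
    using elim by (simp add: fejer_eq)
  moreover have "(p + q - 2 * u) / d = p / d + q / d - 2 * (u / d)" for p q u d :: real
    by (simp add: add_divide_distrib diff_divide_distrib)
  ultimately show ?case by (simp only:)
qed

text \<open>By product-to-sum the integrand becomes a combination of (1 - cos(b y))/y^2 with b = 1 +
  c, 1 - c and c. Their integrals scale like |b|, and |1 + c| + |1 - c| - 2 |c| is twice
  \<open>tri c\<close>.\<close>

lemma fejer_cos: "integrable lborel (\<lambda>y. fejer y * cos (c * y))" "(LINT y|lborel. fejer y * cos (c * y)) = fejer_const * tri c"
proof -
  let ?R = "\<lambda>y. (1 - cos ((1 + c) * y)) / y\<^sup>2 + (1 - cos ((1 - c) * y)) / y\<^sup>2 - 2 * ((1 - cos (c * y)) / y\<^sup>2)"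
  have i: "integrable lborel ?R"
    by (intro Bochner_Integration.integrable_diff Bochner_Integration.integrable_add integrable_mult_right one_minus_cos_integrable)
  show "integrable lborel (\<lambda>y. fejer y * cos (c * y))"
    by (subst integrable_cong_AE[OF _ _ fejer_cos_AE]) (use i in auto)
  have "(LINT y|lborel. fejer y * cos (c * y)) = (LINT y|lborel. ?R y)"
    by (rule integral_cong_AE[OF _ _ fejer_cos_AE]) auto
  also have "\<dots> = (LINT y|lborel. (1 - cos ((1 + c) * y)) / y\<^sup>2) + (LINT y|lborel. (1 - cos ((1 - c) * y)) / y\<^sup>2) - 2 * (LINT y|lborel. (1 - cos (c * y)) / y\<^sup>2)"
    by (simp only: Bochner_Integration.integral_diff Bochner_Integration.integral_add integral_mult_right_zero
        integrable_mult_right one_minus_cos_integrable Bochner_Integration.integrable_add)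
  also have "2 * \<dots> = \<bar>1 + c\<bar> * fejer_const + \<bar>1 - c\<bar> * fejer_const - 2 * (\<bar>c\<bar> * fejer_const)"
    using one_minus_cos_integral[of "1 + c"] one_minus_cos_integral[of "1 - c"] one_minus_cos_integral[of c] by (simp add: algebra_simps)
  also have "\<dots> = (\<bar>1 + c\<bar> + \<bar>1 - c\<bar> - 2 * \<bar>c\<bar>) * fejer_const" by (simp add: algebra_simps)
  also have "\<bar>1 + c\<bar> + \<bar>1 - c\<bar> - 2 * \<bar>c\<bar> = 2 * tri c" by (auto simp: tri_def max_def abs_if)
  finally show "(LINT y|lborel. fejer y * cos (c * y)) = fejer_const * tri c" by simp
qed

lemma fejer_integrable: "integrable lborel fejer" and fejer_integral: "(LINT y|lborel. fejer y) = fejer_const"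
  using fejer_cos[of 0] by (auto simp: tri_def)

lemma fejer_const_pos: "0 < fejer_const"
proof -
  have "(LINT y::real|lborel. 1 / 4 * indicator {0..1} y) \<le> (LINT y|lborel. fejer y)"
  proof (rule Bochner_Integration.integral_mono)
    show "integrable lborel (\<lambda>y::real. 1 / 4 * indicator {0..1} y :: real)"
      by (intro integrable_mult_right integrable_real_indicator) (auto simp: emeasure_lborel_Icc_eq)
    show "1 / 4 * indicator {0..1} y \<le> fejer y" for y using fejer_lower[of y] by (auto split: split_indicator)
  qed (rule fejer_integrable)
  moreover have "(LINT y::real|lborel. (1 / 4 :: real) * indicator {0..1} y) = 1 / 4" by simp
  ultimately show ?thesis by (simp add: fejer_integral)
qed

definition fejer_law :: "real measure" where
  "fejer_law = density lborel (\<lambda>y. ennreal (fejer y / fejer_const))"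

lemma real_distribution_fejer: "real_distribution fejer_law"
proof -
  have "emeasure fejer_law UNIV = (\<integral>\<^sup>+y. ennreal (fejer y / fejer_const) \<partial>lborel)"
    unfolding fejer_law_def by (subst emeasure_density) auto
  also have "\<dots> = ennreal (LINT y|lborel. fejer y / fejer_const)"
    using fejer_integrable fejer_const_pos by (intro nn_integral_eq_integral) auto
  also have "\<dots> = 1" using fejer_integral fejer_const_pos by simp
  finally have "prob_space fejer_law" by (intro prob_spaceI) (simp add: fejer_law_def)
  then show ?thesis by (simp add: real_distribution_def real_distribution_axioms_def fejer_law_def)
qed

lemma char_fejer: "char fejer_law t = of_real (tri t)"
proof -
  have i: "integrable lborel (\<lambda>y. of_real (fejer y) * iexp (t * y))"
    by (rule Bochner_Integration.integrable_bound[OF fejer_integrable]) (auto simp: norm_mult)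
  have re: "Re (of_real (fejer y) * iexp (t * y)) = fejer y * cos (t * y)" and im: "Im (of_real (fejer y) * iexp (t * y)) = fejer y * sin (t * y)" for y
    by (simp_all add: Re_exp Im_exp)
  have "(LINT y|lborel. fejer y * sin (t * y)) = (LINT y|lborel. fejer (- y) * sin (t * - y))"
    using lborel_integral_real_affine[of "- 1" "\<lambda>y. fejer y * sin (t * y)" 0] by simp
  also have "fejer (- y) = fejer y" for y
  proof -
    have "sinc (- u) = sinc u" for u :: real by simp
    from this[of "y / 2"] show ?thesis by (simp only: fejer_def minus_divide_left)
  qed
  then have "(LINT y|lborel. fejer (- y) * sin (t * - y)) = - (LINT y|lborel. fejer y * sin (t * y))" by simp
  finally have "(LINT y|lborel. fejer y * sin (t * y)) = 0" by simp
  then have "(CLINT y|lborel. of_real (fejer y) * iexp (t * y)) = of_real (fejer_const * tri t)"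
    using integral_Re[OF i] integral_Im[OF i] unfolding re im fejer_cos(2) by (simp add: complex_eq_iff)
  moreover have "char fejer_law t = (CLINT y|lborel. (fejer y / fejer_const) *\<^sub>R iexp (t * y))"
    unfolding char_def fejer_law_def by (rule integral_density) (use fejer_const_pos in auto)
  moreover have "(\<lambda>y. (fejer y / fejer_const) *\<^sub>R iexp (t * y)) = (\<lambda>y. (1 / fejer_const) *\<^sub>R (of_real (fejer y) * iexp (t * y)))"
    by (auto simp: fun_eq_iff scaleR_conv_of_real)
  ultimately show ?thesis using fejer_const_pos by (simp add: scaleR_conv_of_real)
qed

text \<open>Converse direction of \<open>char_fejer\<close>, by antiderivatives on [-1, 0] and
  [0, 1]; y = 0 is separate because they divide by y.\<close>

lemma tri_transform: "(CLINT u|lborel. of_real (tri u) * iexp (u * y)) = of_real (fejer y)"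
proof -
  have split: "(CLINT u|lborel. of_real (tri u) * iexp (u * y)) =
     (CLINT u|lborel. indicator {- 1..0} u *\<^sub>R (of_real (1 + u) * iexp (u * y))) + (CLINT u|lborel. indicator {0..1} u *\<^sub>R (of_real (1 - u) * iexp (u * y)))"
  proof -
    have i1: "integrable lborel (\<lambda>u. indicator {- 1..0} u *\<^sub>R (of_real (1 + u) * iexp (u * y)))"
      by (rule borel_integrable_compact[of "{- 1..0}" "\<lambda>u. of_real (1 + u) * iexp (u * y)", simplified set_integrable_def]) (auto intro!: continuous_intros)
    have i2: "integrable lborel (\<lambda>u. indicator {0..1} u *\<^sub>R (of_real (1 - u) * iexp (u * y)))"
      by (rule borel_integrable_compact[of "{0..1}" "\<lambda>u. of_real (1 - u) * iexp (u * y)", simplified set_integrable_def]) (auto intro!: continuous_intros)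
    have "(CLINT u|lborel. of_real (tri u) * iexp (u * y)) =
      (CLINT u|lborel. indicator {- 1..0} u *\<^sub>R (of_real (1 + u) * iexp (u * y)) + indicator {0..1} u *\<^sub>R (of_real (1 - u) * iexp (u * y)))"
    proof (rule integral_cong_AE)
      show "AE u in lborel. of_real (tri u) * iexp (u * y) = indicator {- 1..0} u *\<^sub>R (of_real (1 + u) * iexp (u * y)) + indicator {0..1} u *\<^sub>R (of_real (1 - u) * iexp (u * y))"
        using AE_lborel_singleton[of 0] by eventually_elim (auto split: split_indicator simp: tri_def)
    qed auto
    then show ?thesis using i1 i2 by simp
  qed
  show ?thesis
  proof (cases "y = 0")
    case True
    have "(CLINT u|lborel. indicator {- 1..0} u *\<^sub>R (of_real (1 + u))) = (of_real 0 + (of_real 0)\<^sup>2 / 2) - (of_real (- 1) + (of_real (- 1))\<^sup>2 / 2)"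
    proof (rule integral_FTC_atLeastAtMost)
      show "((\<lambda>u. of_real u + (of_real u)\<^sup>2 / 2) has_vector_derivative (of_real (1 + u) :: complex)) (at u within {- 1..0})" for u
        by (rule has_vector_derivative_real_field[where f = "\<lambda>c. c + c\<^sup>2 / 2"]) (auto intro!: derivative_eq_intros)
    qed (auto intro!: continuous_intros)
    also have "\<dots> = 1 / 2" by simp
    finally have h1: "(CLINT u|lborel. indicator {- 1..0} u *\<^sub>R (of_real (1 + u))) = (1 / 2 :: complex)" .
    have "(CLINT u|lborel. indicator {0..1} u *\<^sub>R (of_real (1 - u))) = (of_real 1 - (of_real 1)\<^sup>2 / 2) - (of_real 0 - (of_real 0)\<^sup>2 / 2)"
    proof (rule integral_FTC_atLeastAtMost)
      show "((\<lambda>u. of_real u - (of_real u)\<^sup>2 / 2) has_vector_derivative (of_real (1 - u) :: complex)) (at u within {0..1})" for u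
        by (rule has_vector_derivative_real_field[where f = "\<lambda>c. c - c\<^sup>2 / 2"]) (auto intro!: derivative_eq_intros)
    qed (auto intro!: continuous_intros)
    also have "\<dots> = 1 / 2" by simp
    finally have h2: "(CLINT u|lborel. indicator {0..1} u *\<^sub>R (of_real (1 - u))) = (1 / 2 :: complex)" .
    have "(CLINT u|lborel. of_real (tri u) * iexp (u * y)) = 1 / 2 + 1 / 2"
      using split h1 h2 True by (simp only: mult_zero_right of_real_0 exp_zero mult_1_right)
    then show ?thesis using True by (simp add: fejer_def)
  next
    case False
    define w where "w = \<i> * of_real y"
    have w: "w \<noteq> 0" using False by (simp add: w_def)
    have e: "iexp (u * y) = exp (of_real u * w)" for u by (simp add: w_def mult_ac)
    have q1: "(CLINT u|lborel. indicator {- 1..0} u *\<^sub>R (of_real (1 + u) * iexp (u * y))) =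
       ((1 + of_real 0) / w - 1 / w\<^sup>2) * exp (of_real 0 * w) - ((1 + of_real (- 1)) / w - 1 / w\<^sup>2) * exp (of_real (- 1) * w)"
      unfolding e
    proof (rule integral_FTC_atLeastAtMost)
      have "((\<lambda>c. ((1 + c) / w - 1 / w\<^sup>2) * exp (c * w)) has_field_derivative (of_real (1 + u) * exp (of_real u * w))) (at (of_real u))" for u
        using w by (auto intro!: derivative_eq_intros simp: field_simps power2_eq_square)
      then show "((\<lambda>u. ((1 + of_real u) / w - 1 / w\<^sup>2) * exp (of_real u * w)) has_vector_derivative (of_real (1 + u) * exp (of_real u * w))) (at u within {- 1..0})" for u
        by (rule has_vector_derivative_real_field)
    qed (auto intro!: continuous_intros)
    have q2: "(CLINT u|lborel. indicator {0..1} u *\<^sub>R (of_real (1 - u) * iexp (u * y))) =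
       ((1 - of_real 1) / w + 1 / w\<^sup>2) * exp (of_real 1 * w) - ((1 - of_real 0) / w + 1 / w\<^sup>2) * exp (of_real 0 * w)"
      unfolding e
    proof (rule integral_FTC_atLeastAtMost)
      have "((\<lambda>c. ((1 - c) / w + 1 / w\<^sup>2) * exp (c * w)) has_field_derivative (of_real (1 - u) * exp (of_real u * w))) (at (of_real u))" for u
        using w by (auto intro!: derivative_eq_intros simp: field_simps power2_eq_square)
      then show "((\<lambda>u. ((1 - of_real u) / w + 1 / w\<^sup>2) * exp (of_real u * w)) has_vector_derivative (of_real (1 - u) * exp (of_real u * w))) (at u within {0..1})" for u
        by (rule has_vector_derivative_real_field)
    qed (auto intro!: continuous_intros)
    have "(CLINT u|lborel. of_real (tri u) * iexp (u * y)) = (exp w + exp (- w) - 2) / w\<^sup>2"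
      unfolding split q1 q2 using w by (simp add: add_divide_distrib diff_divide_distrib)
    also have "exp w + exp (- w) = 2 * of_real (cos y)"
      by (simp add: complex_eq_iff w_def Re_exp Im_exp)
    also have "(2 * of_real (cos y) - 2) / w\<^sup>2 = of_real (fejer y)"
      using False by (simp add: fejer_eq w_def power_mult_distrib field_simps)
    finally show ?thesis .
  qed
qed

text \<open>Countable sum of measures. A single finite measure is wanted, rather than a series of
  integrals, so that Levy's continuity theorem can be applied.\<close>

definition mix :: "(nat \<Rightarrow> real measure) \<Rightarrow> real measure" where
  "mix \<mu> = measure_of UNIV (sets borel) (\<lambda>A. \<Sum>n. emeasure (\<mu> n) A)"

lemma sets_mix [simp, measurable_cong]: "sets (mix \<mu>) = sets borel" and space_mix [simp]: "space (mix \<mu>) = UNIV"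
proof -
  show "space (mix \<mu>) = UNIV" unfolding mix_def by (rule space_measure_of) simp
  have "sets (mix \<mu>) = sigma_sets UNIV (sets borel)" unfolding mix_def by (rule sets_measure_of) simp
  then show "sets (mix \<mu>) = sets borel" using sets.sigma_sets_eq[of "borel :: real measure"] by (simp only: space_borel)
qed

context
  fixes \<mu> :: "nat \<Rightarrow> real measure"
  assumes sets_mu [simp, measurable_cong]: "\<And>n. sets (\<mu> n) = sets borel"
begin

lemma emeasure_mix: assumes A: "A \<in> sets borel" shows "emeasure (mix \<mu>) A = (\<Sum>n. emeasure (\<mu> n) A)"
proof (rule emeasure_measure_of[OF mix_def])
  show "countably_additive (sets (mix \<mu>)) (\<lambda>A. \<Sum>n. emeasure (\<mu> n) A)"
  proof (rule countably_additiveI)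
    fix A :: "nat \<Rightarrow> real set" assume A: "range A \<subseteq> sets (mix \<mu>)" "disjoint_family A"
    have "(\<Sum>i. \<Sum>n. emeasure (\<mu> n) (A i)) = (\<integral>\<^sup>+i. (\<Sum>n. emeasure (\<mu> n) (A i)) \<partial>count_space UNIV)"
      by (simp add: nn_integral_count_space_nat)
    also have "\<dots> = (\<Sum>n. \<integral>\<^sup>+i. emeasure (\<mu> n) (A i) \<partial>count_space UNIV)" by (rule nn_integral_suminf) simp
    also have "\<dots> = (\<Sum>n. \<Sum>i. emeasure (\<mu> n) (A i))" by (simp add: nn_integral_count_space_nat)
    also have "\<dots> = (\<Sum>n. emeasure (\<mu> n) (\<Union>i. A i))" using A by (intro suminf_cong suminf_emeasure) auto
    finally show "(\<Sum>i. \<Sum>n. emeasure (\<mu> n) (A i)) = (\<Sum>n. emeasure (\<mu> n) (\<Union>i. A i))" .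
  qed
qed (use A in \<open>auto simp: positive_def\<close>)

lemma nn_integral_mix: assumes f: "f \<in> borel_measurable borel"
  shows "(\<integral>\<^sup>+y. f y \<partial>mix \<mu>) = (\<Sum>n. \<integral>\<^sup>+y. f y \<partial>\<mu> n)"
  using f
proof (induction rule: borel_measurable_induct)
  case (cong f g)
  then have "f = g" by (intro ext) simp
  with cong show ?case by simp
next
  case (set A) then show ?case by (simp add: emeasure_mix)
next
  case (mult u c)
  then show ?case by (simp add: nn_integral_cmult)
next
  case (add u v)
  then show ?case by (simp add: nn_integral_add suminf_add)
next
  case (seq U)
  have "(\<integral>\<^sup>+y. (SUP i. U i) y \<partial>mix \<mu>) = (SUP i. \<integral>\<^sup>+y. U i y \<partial>mix \<mu>)"
    unfolding SUP_apply using seq by (intro nn_integral_monotone_convergence_SUP) auto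
  also have "\<dots> = (SUP i. \<Sum>n. \<integral>\<^sup>+y. U i y \<partial>\<mu> n)" using seq by simp
  also have "\<dots> = (\<Sum>n. SUP i. \<integral>\<^sup>+y. U i y \<partial>\<mu> n)"
    using seq by (intro ennreal_suminf_SUP_eq[symmetric]) (auto simp: incseq_def le_fun_def intro!: nn_integral_mono)
  also have "\<dots> = (\<Sum>n. \<integral>\<^sup>+y. (SUP i. U i) y \<partial>\<mu> n)"
    unfolding SUP_apply using seq by (intro suminf_cong nn_integral_monotone_convergence_SUP[symmetric]) auto
  finally show ?case by (simp add: image_comp)
qed

context
  assumes fin: "\<And>n. finite_measure (\<mu> n)" and summ: "summable (\<lambda>n. measure (\<mu> n) UNIV)"
begin

lemma finite_mix: "finite_measure (mix \<mu>)"
proof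
  have "emeasure (mix \<mu>) UNIV = (\<Sum>n. ennreal (measure (\<mu> n) UNIV))"
    using fin by (simp add: emeasure_mix finite_measure.emeasure_eq_measure)
  also have "\<dots> = ennreal (\<Sum>n. measure (\<mu> n) UNIV)" by (rule suminf_ennreal2[OF _ summ]) simp
  finally show "emeasure (mix \<mu>) (space (mix \<mu>)) \<noteq> \<infinity>" by simp
qed

lemma integral_mix_nonneg:
  fixes f :: "real \<Rightarrow> real"
  assumes [measurable]: "f \<in> borel_measurable borel" and f: "\<And>y. 0 \<le> f y" "\<And>y. f y \<le> B"
  shows "(\<lambda>n. LINT y|\<mu> n. f y) sums (LINT y|mix \<mu>. f y)"
proof -
  have B: "0 \<le> B" using f[of 0] by linarith
  have i: "integrable (\<mu> n) f" for n
    by (rule finite_measure.integrable_const_bound[OF fin, where B=B]) (use f in auto)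
  have s: "summable (\<lambda>n. LINT y|\<mu> n. f y)"
  proof (rule summable_comparison_test'[where N=0])
    show "summable (\<lambda>n. B * measure (\<mu> n) UNIV)" using summ by (rule summable_mult)
    fix n
    have sp: "space (\<mu> n) = UNIV" using sets_eq_imp_space_eq[OF sets_mu, of n] by simp
    interpret finite_measure "\<mu> n" by (rule fin)
    have "(LINT y|\<mu> n. f y) \<le> (LINT y|\<mu> n. B)" using i f by (intro integral_mono) auto
    then show "norm (LINT y|\<mu> n. f y) \<le> B * measure (\<mu> n) UNIV"
      using f sp by (simp add: Bochner_Integration.integral_nonneg mult.commute)
  qed
  have "(LINT y|mix \<mu>. f y) = enn2real (\<Sum>n. \<integral>\<^sup>+y. ennreal (f y) \<partial>\<mu> n)"
    by (subst integral_eq_nn_integral) (use f in \<open>auto simp: nn_integral_mix\<close>)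
  also have "(\<Sum>n. \<integral>\<^sup>+y. ennreal (f y) \<partial>\<mu> n) = (\<Sum>n. ennreal (LINT y|\<mu> n. f y))"
    using i f by (intro suminf_cong nn_integral_eq_integral) auto
  also have "\<dots> = ennreal (\<Sum>n. LINT y|\<mu> n. f y)"
    using f s by (intro suminf_ennreal2) (auto intro: Bochner_Integration.integral_nonneg)
  finally have "(LINT y|mix \<mu>. f y) = (\<Sum>n. LINT y|\<mu> n. f y)"
    using f s by (simp add: suminf_nonneg Bochner_Integration.integral_nonneg)
  then show ?thesis using s by (simp add: sums_iff)
qed

lemma integral_mix_real:
  fixes f :: "real \<Rightarrow> real"
  assumes [measurable]: "f \<in> borel_measurable borel" and f: "\<And>y. \<bar>f y\<bar> \<le> B"
  shows "(\<lambda>n. LINT y|\<mu> n. f y) sums (LINT y|mix \<mu>. f y)"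
proof -
  have sp: "space (\<mu> n) = UNIV" for n using sets_eq_imp_space_eq[OF sets_mu, of n] by simp
  have B: "- B \<le> f y" "f y \<le> B" for y using f[of y] by auto
  have B0: "0 \<le> B" using f[of 0] by linarith
  \<comment> \<open>Adding B reduces the claim to nonnegative integrands.\<close>
  have "(\<lambda>n. LINT y|\<mu> n. f y + B) sums (LINT y|mix \<mu>. f y + B)"
  proof (rule integral_mix_nonneg[where B="2 * B"])
    show "0 \<le> f y + B" "f y + B \<le> 2 * B" for y using B[of y] by auto
  qed measurable
  moreover have "(\<lambda>n. LINT y|\<mu> n. B) sums (LINT y|mix \<mu>. B)"
    by (rule integral_mix_nonneg[where B=B]) (use B0 in auto)
  ultimately have 1: "(\<lambda>n. (LINT y|\<mu> n. f y + B) - (LINT y|\<mu> n. B)) sums ((LINT y|mix \<mu>. f y + B) - (LINT y|mix \<mu>. B))"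
    by (rule sums_diff)
  have "(LINT y|N. f y + B) - (LINT y|N. B) = (LINT y|N. f y)" if "finite_measure N" "sets N = sets borel" for N
  proof -
    have [measurable]: "f \<in> borel_measurable N" unfolding measurable_cong_sets[OF that(2) refl] by (rule assms(1))
    interpret finite_measure N by fact
    have "integrable N f" by (rule integrable_const_bound[where B=B]) (use f in auto)
    then show ?thesis by simp
  qed
  from this[OF fin sets_mu] this[OF finite_mix sets_mix] 1 show ?thesis by (simp only:)
qed

lemma integral_mix_complex:
  fixes f :: "real \<Rightarrow> complex"
  assumes [measurable]: "f \<in> borel_measurable borel" and f: "\<And>y. cmod (f y) \<le> B"
  shows "(\<lambda>n. CLINT y|\<mu> n. f y) sums (CLINT y|mix \<mu>. f y)"
proof -
  have i: "integrable N f" if "finite_measure N" "sets N = sets borel" for N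
  proof -
    have [measurable]: "f \<in> borel_measurable N" unfolding measurable_cong_sets[OF that(2) refl] by (rule assms(1))
    interpret finite_measure N by fact
    show ?thesis by (rule integrable_const_bound[where B=B]) (use f in auto)
  qed
  have i1: "integrable (\<mu> n) f" for n using i fin by simp
  have i2: "integrable (mix \<mu>) f" using i finite_mix by simp
  have "(\<lambda>n. LINT y|\<mu> n. Re (f y)) sums (LINT y|mix \<mu>. Re (f y))"
    by (rule integral_mix_real[where B=B]) (use f in \<open>auto intro: order_trans[OF abs_Re_le_cmod]\<close>)
  moreover have "(\<lambda>n. LINT y|\<mu> n. Im (f y)) sums (LINT y|mix \<mu>. Im (f y))"
    by (rule integral_mix_real[where B=B]) (use f in \<open>auto intro: order_trans[OF abs_Im_le_cmod]\<close>)
  ultimately show ?thesis using i1 i2 by (simp add: sums_complex_iff)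
qed

end

end

section \<open>Fourier inversion for damped convolution powers\<close>

context nonarithmetic_step begin

lemma cf_measurable [measurable]: "cf l \<in> borel_measurable borel"
  unfolding cf_def[abs_def] Complex_eq by measurable

lemma Lam_measurable [measurable]: "Lam \<in> borel_measurable borel"
proof (rule borel_measurable_LIMSEQ_metric)
  show "(\<lambda>n. of_real (a (real n)) * (1 - cf (1 / real n) (s / real n))) \<longlonglongrightarrow> Lam s" for s
    by (rule filterlim_compose[OF cf_limit filterlim_real_sequentially])
qed measurable

lemma cf_pw: assumes "0 \<le> l" "l \<le> \<kappa>"
  shows "integrable (pw n) (\<lambda>s. exp (of_real s * Complex (- l) t))"
    and "(CLINT s|pw n. exp (of_real s * Complex (- l) t)) = cf l t ^ n"
proof -
  have i: "integrable (pw n) (\<lambda>s. exp (of_real s * Complex (- l) t))" for n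
    by (rule Bochner_Integration.integrable_bound[OF exp_pw_integrable[OF assms]])
       (simp, simp only: norm_cf_integrand real_norm_def abs_exp_cancel order_refl eventually_True)
  then show "integrable (pw n) (\<lambda>s. exp (of_real s * Complex (- l) t))" .
  show "(CLINT s|pw n. exp (of_real s * Complex (- l) t)) = cf l t ^ n"
  proof (induction n)
    case 0
    show ?case unfolding pw.simps by (subst integral_return) auto
  next
    case (Suc n)
    have "(CLINT s|pw (Suc n). exp (of_real s * Complex (- l) t)) = (CLINT z|F. CLINT s|pw n. exp (of_real (z + s) * Complex (- l) t))"
      by (rule integral_pw_Suc(1)[OF _ i]) simp
    also have "\<dots> = (CLINT z|F. exp (of_real z * Complex (- l) t) * (CLINT s|pw n. exp (of_real s * Complex (- l) t)))"
    proof (intro Bochner_Integration.integral_cong refl)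
      fix z
      have "exp (of_real (z + s) * Complex (- l) t) = exp (of_real z * Complex (- l) t) * exp (of_real s * Complex (- l) t)" for s
        by (simp only: of_real_add distrib_right exp_add)
      then show "(CLINT s|pw n. exp (of_real (z + s) * Complex (- l) t)) = exp (of_real z * Complex (- l) t) * (CLINT s|pw n. exp (of_real s * Complex (- l) t))"
        by (simp only: integral_mult_right_zero)
    qed
    also have "\<dots> = cf l t ^ Suc n" unfolding Suc by (simp only: integral_mult_left_zero cf_def[symmetric] power_Suc)
    finally show ?case .
  qed
qed

text \<open>Write the kernel at s - x as the transform of \<open>tri\<close> and exchange the
  integrals. The extra oscillation shifts the frequency by \<xi>; through it the formula yields the
  characteristic function of the weighted measure and not only its mass.\<close>

lemma fejer_transform_pw: assumes l: "0 < l" "l \<le> r"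
  shows "(CLINT s|pw n. of_real (fejer (s - x) * exp (- (l * s))) * iexp (\<xi> * (s - x))) =
    (CLINT u|lborel. of_real (tri u) * iexp (- ((u + \<xi>) * x)) * cf l (u + \<xi>) ^ n)"
proof -
  have lk: "0 \<le> l" "l \<le> \<kappa>" using l r_le by auto
  interpret P: prob_space "pw n" by (rule prob_space_pw)
  interpret PP: pair_sigma_finite "pw n" lborel ..
  define g where "g s u = of_real (tri u) * (iexp (- ((u + \<xi>) * x)) * exp (of_real s * Complex (- l) (u + \<xi>)))" for s u
  have [measurable]: "(\<lambda>(s, u). g s u) \<in> borel_measurable (pw n \<Otimes>\<^sub>M lborel)" unfolding g_def Complex_eq by measurable
  have ng: "norm (g s u) = tri u * exp (- (l * s))" for s u
    unfolding g_def by (simp only: norm_mult norm_cf_integrand norm_exp_i_times) simp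
  have i: "integrable (pw n \<Otimes>\<^sub>M lborel) (\<lambda>(s, u). g s u)"
  proof (rule PP.Fubini_integrable)
    have "(LINT u|lborel. norm (case (s, u) of (s, u) \<Rightarrow> g s u)) = (LINT u|lborel. tri u) * exp (- (l * s))" for s
      unfolding prod.case ng by (rule integral_mult_left_zero)
    then show "integrable (pw n) (\<lambda>s. LINT u|lborel. norm (case (s, u) of (s, u) \<Rightarrow> g s u))"
      by (simp only:) (intro integrable_mult_right exp_pw_integrable lk)
    have "integrable lborel (g s)" for s
    proof (rule Bochner_Integration.integrable_bound)
      show "integrable lborel (\<lambda>u. tri u * exp (- (l * s)))" using tri_integrable by simp
      show "g s \<in> borel_measurable lborel" unfolding g_def Complex_eq by measurable
      show "AE u in lborel. norm (g s u) \<le> norm (tri u * exp (- (l * s)))" unfolding ng by simp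
    qed
    then show "AE s in pw n. integrable lborel (\<lambda>u. case (s, u) of (s, u) \<Rightarrow> g s u)" by (intro always_eventually) simp
  qed measurable
  have g2: "g s u = of_real (tri u) * iexp (u * (s - x)) * (of_real (exp (- (l * s))) * iexp (\<xi> * (s - x)))" for s u
  proof -
    have "iexp (- ((u + \<xi>) * x)) * exp (of_real s * Complex (- l) (u + \<xi>)) = exp (\<i> * of_real (- ((u + \<xi>) * x)) + of_real s * Complex (- l) (u + \<xi>))"
      by (rule exp_add[symmetric])
    also have "\<i> * of_real (- ((u + \<xi>) * x)) + of_real s * Complex (- l) (u + \<xi>) = \<i> * of_real (u * (s - x)) + (of_real (- (l * s)) + \<i> * of_real (\<xi> * (s - x)))"
      by (simp add: complex_eq_iff algebra_simps)
    also have "exp \<dots> = iexp (u * (s - x)) * (of_real (exp (- (l * s))) * iexp (\<xi> * (s - x)))"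
      by (simp only: exp_add exp_of_real)
    finally show ?thesis by (simp only: g_def mult.assoc)
  qed
  have "(CLINT s|pw n. of_real (fejer (s - x) * exp (- (l * s))) * iexp (\<xi> * (s - x))) = (CLINT s|pw n. CLINT u|lborel. g s u)"
  proof (intro Bochner_Integration.integral_cong refl)
    fix s
    show "of_real (fejer (s - x) * exp (- (l * s))) * iexp (\<xi> * (s - x)) = (CLINT u|lborel. g s u)"
      unfolding g2 integral_mult_left_zero tri_transform by (simp only: of_real_mult mult.assoc)
  qed
  also have "\<dots> = (CLINT u|lborel. CLINT s|pw n. g s u)" using PP.Fubini_integral[OF i] by simp
  also have "\<dots> = (CLINT u|lborel. of_real (tri u) * iexp (- ((u + \<xi>) * x)) * cf l (u + \<xi>) ^ n)"
    unfolding g_def by (simp only: integral_mult_right_zero cf_pw[OF lk] mult.assoc)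
  finally show ?thesis .
qed

text \<open>Damping allows summation under the integral: the terms are dominated by
  \<open>multichoose K n * psi l ^ n * tri u\<close>.\<close>

lemma fejer_transform_sums: assumes l: "0 < l" "l \<le> r"
  shows "(\<lambda>n. of_real (multichoose K n) * (CLINT s|pw n. of_real (fejer (s - x) * exp (- (l * s))) * iexp (\<xi> * (s - x)))) sums
    (CLINT u|lborel. of_real (tri u) * iexp (- ((u + \<xi>) * x)) * (1 / (1 - cf l (u + \<xi>)) ^ Suc K))"
proof -
  let ?f = "\<lambda>n u. of_real (multichoose K n) * (of_real (tri u) * iexp (- ((u + \<xi>) * x)) * cf l (u + \<xi>) ^ n)"
  have p: "psi l < 1" "0 \<le> psi l" using psi_lt_1[OF l] psi_nonneg by auto
  have c1: "cmod (cf l t) < 1" for t using norm_cf_le[of l t] p by linarith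
  have nf: "norm (?f n u) \<le> (multichoose K n * psi l ^ n) * tri u" for n u
  proof -
    have "norm (?f n u) = multichoose K n * (tri u * cmod (cf l (u + \<xi>)) ^ n)"
      by (simp only: norm_mult norm_exp_i_times norm_of_real norm_power) simp
    also have "\<dots> \<le> multichoose K n * (tri u * psi l ^ n)"
      by (intro mult_left_mono power_mono norm_cf_le) auto
    finally show ?thesis by (simp add: mult_ac)
  qed
  have i: "integrable lborel (?f n)" for n
    by (rule Bochner_Integration.integrable_bound[OF integrable_mult_right[OF tri_integrable, of "multichoose K n * psi l ^ n"]])
       (measurable, intro always_eventually allI order_trans[OF nf], simp add: p)
  have sm: "summable (\<lambda>n. multichoose K n * psi l ^ n)"
    using multichoose_sums(1)[of "psi l" K] p by (simp add: sums_iff)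
  have S: "(\<lambda>n. CLINT u|lborel. ?f n u) sums (CLINT u|lborel. (\<Sum>n. ?f n u))"
  proof (rule sums_integral)
    show "integrable lborel (?f n)" for n by (rule i)
    show "AE u in lborel. summable (\<lambda>n. norm (?f n u))"
    proof (intro always_eventually allI)
      fix u
      show "summable (\<lambda>n. norm (?f n u))"
        by (rule summable_comparison_test'[OF summable_mult2[OF sm, of "tri u"], of 0]) (use nf in simp)
    qed
    show "summable (\<lambda>n. LINT u|lborel. norm (?f n u))"
    proof (rule summable_comparison_test'[where N=0])
      show "summable (\<lambda>n. (multichoose K n * psi l ^ n) * (LINT u|lborel. tri u))" by (rule summable_mult2[OF sm])
      fix n
      have "(LINT u|lborel. norm (?f n u)) \<le> (LINT u|lborel. (multichoose K n * psi l ^ n) * tri u)"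
        by (intro Bochner_Integration.integral_mono nf integrable_norm i integrable_mult_right tri_integrable)
      then show "norm (LINT u|lborel. norm (?f n u)) \<le> (multichoose K n * psi l ^ n) * (LINT u|lborel. tri u)"
        by simp
    qed
  qed
  have "(\<Sum>n. ?f n u) = of_real (tri u) * iexp (- ((u + \<xi>) * x)) * (1 / (1 - cf l (u + \<xi>)) ^ Suc K)" for u
  proof -
    have "(\<lambda>n. (of_real (tri u) * iexp (- ((u + \<xi>) * x))) * (of_real (multichoose K n) * cf l (u + \<xi>) ^ n)) sums
       ((of_real (tri u) * iexp (- ((u + \<xi>) * x))) * (1 / (1 - cf l (u + \<xi>)) ^ Suc K))"
      by (intro sums_mult multichoose_sums(1) c1)
    then show ?thesis by (simp add: sums_iff mult_ac)
  qed
  then show ?thesis using S unfolding fejer_transform_pw[OF l] by (simp only: integral_mult_right_zero)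
qed

context
  fixes K :: nat
  assumes K: "4 \<le> real (Suc K) * \<alpha>" \<comment> \<open>makes \<open>1 / Lam ^ Suc K\<close> integrable, as \<open>Lam t\<close> grows at least like \<open>t powr (\<alpha>/2)\<close>\<close>
begin

definition T :: "real \<Rightarrow> real \<Rightarrow> complex" where
  "T x \<xi> = (CLINT t|lborel. of_real (tri (t / x - \<xi>)) * iexp (- t) * (1 / (of_real (a x) * (1 - cf (1 / x) (t / x))) ^ Suc K))"

text \<open>The limiting total mass. That it is real and nonnegative is not visible here; it follows
  in \<open>slot_limit\<close> because it is a limit of masses.\<close>

definition Dc :: complex where "Dc = (CLINT t|lborel. iexp (- t) * (1 / Lam t ^ Suc K))"

text \<open>The lower bound of \<open>cf_lower\<close> survives the limit.\<close>

lemma Lam_ne_0: "Lam s \<noteq> 0"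
proof -
  obtain c where c: "0 < c" and ev: "eventually (\<lambda>x. \<forall>s. \<bar>s\<bar> \<le> 1 * x \<longrightarrow> c * (1 + \<bar>s\<bar>) powr (\<alpha>/2) \<le> a x * cmod (1 - cf (1 / x) (s / x))) at_top"
    using cf_lower[of 1] by auto
  have "((\<lambda>x. cmod (of_real (a x) * (1 - cf (1 / x) (s / x)))) \<longlongrightarrow> cmod (Lam s)) at_top"
    by (intro tendsto_norm cf_limit)
  moreover have "eventually (\<lambda>x. c * (1 + \<bar>s\<bar>) powr (\<alpha>/2) \<le> cmod (of_real (a x) * (1 - cf (1 / x) (s / x)))) at_top"
    using ev eventually_ge_at_top[of "max \<bar>s\<bar> 1"]
  proof eventually_elim
    case (elim x)
    then have "c * (1 + \<bar>s\<bar>) powr (\<alpha>/2) \<le> a x * cmod (1 - cf (1 / x) (s / x))" by auto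
    then show ?case using a_pos[of x] elim by (simp add: norm_mult)
  qed
  ultimately have "c * (1 + \<bar>s\<bar>) powr (\<alpha>/2) \<le> cmod (Lam s)" by (rule tendsto_lowerbound) simp
  moreover have "0 < c * (1 + \<bar>s\<bar>) powr (\<alpha>/2)" using c by simp
  ultimately show ?thesis by auto
qed

text \<open>The limit splits into \<open>tri \<xi>\<close>, the characteristic function of
  \<open>fejer_law\<close>, and a constant: seen from x, the normalised measure without the kernel
  looks like a multiple of Lebesgue measure.\<close>

lemma T_limit: "((\<lambda>x. T x \<xi>) \<longlongrightarrow> of_real (tri \<xi>) * Dc) at_top"
proof -
  have pos: "0 < 1 + \<bar>\<xi>\<bar>" by simp
  obtain c where c: "0 < c" and ev: "eventually (\<lambda>x. \<forall>s. \<bar>s\<bar> \<le> (1 + \<bar>\<xi>\<bar>) * x \<longrightarrow> c * (1 + \<bar>s\<bar>) powr (\<alpha>/2) \<le> a x * cmod (1 - cf (1 / x) (s / x))) at_top"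
    using cf_lower[OF pos] by blast
  have lim: "((\<lambda>x. T x \<xi>) \<longlongrightarrow> (CLINT t|lborel. of_real (tri (0 - \<xi>)) * iexp (- t) * (1 / Lam t ^ Suc K))) at_top"
    unfolding T_def
  proof (rule integral_dominated_convergence_at_top[where w="\<lambda>t. (1 / c) ^ Suc K * inverse (1 + t\<^sup>2)"])
    show "integrable lborel (\<lambda>t. (1 / c) ^ Suc K * inverse (1 + t\<^sup>2))" by (intro integrable_mult_right inverse_square_integrable)
    show "AE t in lborel. ((\<lambda>x. of_real (tri (t / x - \<xi>)) * iexp (- t) * (1 / (of_real (a x) * (1 - cf (1 / x) (t / x))) ^ Suc K)) \<longlongrightarrow>
       of_real (tri (0 - \<xi>)) * iexp (- t) * (1 / Lam t ^ Suc K)) at_top"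
    proof (intro always_eventually allI)
      fix t
      have "((\<lambda>x. t / x - \<xi>) \<longlongrightarrow> 0 - \<xi>) at_top" by (intro tendsto_diff tendsto_const) real_asymp
      then have "((\<lambda>x. tri (t / x - \<xi>)) \<longlongrightarrow> tri (0 - \<xi>)) at_top" by (rule isCont_tendsto_compose[OF tri_continuous])
      then show "((\<lambda>x. of_real (tri (t / x - \<xi>)) * iexp (- t) * (1 / (of_real (a x) * (1 - cf (1 / x) (t / x))) ^ Suc K)) \<longlongrightarrow>
         of_real (tri (0 - \<xi>)) * iexp (- t) * (1 / Lam t ^ Suc K)) at_top"
        using Lam_ne_0[of t] by (intro tendsto_mult tendsto_of_real tendsto_const tendsto_divide tendsto_power cf_limit) auto
    qed
    show "\<forall>\<^sub>F x in at_top. AE t in lborel. norm (of_real (tri (t / x - \<xi>)) * iexp (- t) * (1 / (of_real (a x) * (1 - cf (1 / x) (t / x))) ^ Suc K)) \<le> (1 / c) ^ Suc K * inverse (1 + t\<^sup>2)"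
      using ev eventually_gt_at_top[of 0]
    proof eventually_elim
      case (elim x)
      show ?case
      proof (intro always_eventually allI)
        fix t
        have ax: "0 < a x" using elim by (intro a_pos)
        have n: "norm (of_real (tri (t / x - \<xi>)) * iexp (- t) * (1 / (of_real (a x) * (1 - cf (1 / x) (t / x))) ^ Suc K)) = tri (t / x - \<xi>) * (1 / (a x * cmod (1 - cf (1 / x) (t / x))) ^ Suc K)"
          using ax by (simp only: norm_mult norm_exp_i_times norm_of_real norm_divide norm_power norm_one) simp
        show "norm (of_real (tri (t / x - \<xi>)) * iexp (- t) * (1 / (of_real (a x) * (1 - cf (1 / x) (t / x))) ^ Suc K)) \<le> (1 / c) ^ Suc K * inverse (1 + t\<^sup>2)"
          unfolding n
        proof (cases "tri (t / x - \<xi>) = 0")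
          case False
          \<comment> \<open>The support of \<open>tri\<close> forces |t| \<le> (1 + |\<xi>|) x, the
            range on which the lower bound was taken.\<close>
          then have "\<bar>t / x - \<xi>\<bar> < 1" by (auto simp: tri_def max_def split: if_splits)
          then have "\<bar>t / x\<bar> \<le> 1 + \<bar>\<xi>\<bar>" by linarith
          then have "\<bar>t\<bar> \<le> (1 + \<bar>\<xi>\<bar>) * x" using elim by (simp add: abs_divide pos_divide_le_eq)
          then have lb: "c * (1 + \<bar>t\<bar>) powr (\<alpha>/2) \<le> a x * cmod (1 - cf (1 / x) (t / x))" using elim by blast
          have "1 + t\<^sup>2 \<le> (1 + \<bar>t\<bar>)\<^sup>2" by (simp add: power2_eq_square algebra_simps)
          also have "\<dots> = (1 + \<bar>t\<bar>) powr 2" by (simp add: powr_numeral)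
          \<comment> \<open>(K + 1) \<alpha>/2 \<ge> 2 turns the growth of the denominator into the
            integrable bound 1/(1 + t^2).\<close>
          also have "\<dots> \<le> (1 + \<bar>t\<bar>) powr (real (Suc K) * (\<alpha>/2))" using K by (intro powr_mono) auto
          also have "\<dots> = ((1 + \<bar>t\<bar>) powr (\<alpha>/2)) ^ Suc K"
          proof -
            have "(1 + \<bar>t\<bar>) powr (real (Suc K) * (\<alpha>/2)) = ((1 + \<bar>t\<bar>) powr (\<alpha>/2)) powr real (Suc K)"
              by (simp only: powr_powr mult.commute[of "real (Suc K)"])
            also have "\<dots> = ((1 + \<bar>t\<bar>) powr (\<alpha>/2)) ^ Suc K" by (rule powr_realpow) simp
            finally show ?thesis .
          qed
          finally have p: "1 + t\<^sup>2 \<le> ((1 + \<bar>t\<bar>) powr (\<alpha>/2)) ^ Suc K" .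
          have t0: "0 < 1 + t\<^sup>2" by (simp add: add_pos_nonneg)
          have "c ^ Suc K * (1 + t\<^sup>2) \<le> c ^ Suc K * ((1 + \<bar>t\<bar>) powr (\<alpha>/2)) ^ Suc K"
            using p c by (intro mult_left_mono) auto
          also have "\<dots> = (c * (1 + \<bar>t\<bar>) powr (\<alpha>/2)) ^ Suc K" by (rule power_mult_distrib[symmetric])
          also have "\<dots> \<le> (a x * cmod (1 - cf (1 / x) (t / x))) ^ Suc K" using lb c by (intro power_mono) auto
          finally have q: "c ^ Suc K * (1 + t\<^sup>2) \<le> (a x * cmod (1 - cf (1 / x) (t / x))) ^ Suc K" .
          have q0: "0 < c ^ Suc K * (1 + t\<^sup>2)" using c t0 by simp
          have "1 / (a x * cmod (1 - cf (1 / x) (t / x))) ^ Suc K \<le> 1 / (c ^ Suc K * (1 + t\<^sup>2))"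
            by (intro frac_le q q0) auto
          also have "\<dots> = (1 / c) ^ Suc K * inverse (1 + t\<^sup>2)" by (simp add: divide_inverse power_inverse)
          finally have "tri (t / x - \<xi>) * (1 / (a x * cmod (1 - cf (1 / x) (t / x))) ^ Suc K) \<le> 1 * ((1 / c) ^ Suc K * inverse (1 + t\<^sup>2))"
            using ax by (intro mult_mono tri_le_1) auto
          then show "tri (t / x - \<xi>) * (1 / (a x * cmod (1 - cf (1 / x) (t / x))) ^ Suc K) \<le> (1 / c) ^ Suc K * inverse (1 + t\<^sup>2)" by simp
        qed (use c in simp)
      qed
    qed
  qed measurable
  have "tri (0 - \<xi>) = tri \<xi>" by (simp add: tri_def)
  then have "(CLINT t|lborel. of_real (tri (0 - \<xi>)) * iexp (- t) * (1 / Lam t ^ Suc K)) = of_real (tri \<xi>) * Dc"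
    unfolding Dc_def by (simp only: mult.assoc integral_mult_right_zero)
  then show ?thesis using lim by (simp only:)
qed

text \<open>Damping l = 1/x and the substitution u = t/x - \<xi>.\<close>

lemma T_eq: assumes "0 < x" "1 / x \<le> r"
  shows "(\<lambda>n. of_real (x / a x ^ Suc K * multichoose K n) * (CLINT s|pw n. of_real (fejer (s - x) * exp (- (1 / x * s))) * iexp (\<xi> * (s - x)))) sums T x \<xi>"
proof -
  have l: "0 < 1 / x" using assms by simp
  let ?G = "\<lambda>t. 1 / (1 - cf (1 / x) t) ^ Suc K"
  let ?h = "\<lambda>t. of_real (tri (t / x - \<xi>)) * iexp (- t) * ?G (t / x)"
  have "(CLINT u|lborel. of_real (tri u) * iexp (- ((u + \<xi>) * x)) * ?G (u + \<xi>)) = \<bar>1 / x\<bar> *\<^sub>R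
    (CLINT t|lborel. of_real (tri (- \<xi> + 1 / x * t)) * iexp (- ((- \<xi> + 1 / x * t + \<xi>) * x)) * ?G (- \<xi> + 1 / x * t + \<xi>))"
    using l by (intro lborel_integral_real_affine) auto
  also have "(CLINT t|lborel. of_real (tri (- \<xi> + 1 / x * t)) * iexp (- ((- \<xi> + 1 / x * t + \<xi>) * x)) * ?G (- \<xi> + 1 / x * t + \<xi>)) = (CLINT t|lborel. ?h t)"
  proof (intro Bochner_Integration.integral_cong refl)
    fix t
    have "- \<xi> + 1 / x * t = t / x - \<xi>" "- \<xi> + 1 / x * t + \<xi> = t / x" "(- \<xi> + 1 / x * t + \<xi>) * x = t" using assms by auto
    then show "of_real (tri (- \<xi> + 1 / x * t)) * iexp (- ((- \<xi> + 1 / x * t + \<xi>) * x)) * ?G (- \<xi> + 1 / x * t + \<xi>) = ?h t"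
      by (simp only:)
  qed
  finally have E: "(CLINT u|lborel. of_real (tri u) * iexp (- ((u + \<xi>) * x)) * ?G (u + \<xi>)) = \<bar>1 / x\<bar> *\<^sub>R (CLINT t|lborel. ?h t)" .
  have "of_real (x / a x ^ Suc K) * (\<bar>1 / x\<bar> *\<^sub>R (CLINT t|lborel. ?h t)) = of_real (1 / a x ^ Suc K) * (CLINT t|lborel. ?h t)"
    using assms by (simp add: scaleR_conv_of_real)
  also have "\<dots> = (CLINT t|lborel. of_real (1 / a x ^ Suc K) * ?h t)" by (rule integral_mult_right_zero[symmetric])
  also have "\<dots> = T x \<xi>"
  proof -
    have "of_real (1 / a x ^ Suc K) * ?h t = of_real (tri (t / x - \<xi>)) * iexp (- t) * (1 / (of_real (a x) * (1 - cf (1 / x) (t / x))) ^ Suc K)" for t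
      by (simp add: power_mult_distrib)
    then show ?thesis unfolding T_def by (simp only:)
  qed
  finally have E2: "of_real (x / a x ^ Suc K) * (\<bar>1 / x\<bar> *\<^sub>R (CLINT t|lborel. ?h t)) = T x \<xi>" .
  have "(\<lambda>n. of_real (x / a x ^ Suc K) * (of_real (multichoose K n) * (CLINT s|pw n. of_real (fejer (s - x) * exp (- (1 / x * s))) * iexp (\<xi> * (s - x))))) sums
     (of_real (x / a x ^ Suc K) * (\<bar>1 / x\<bar> *\<^sub>R (CLINT t|lborel. ?h t)))"
    unfolding E[symmetric] using assms l by (intro sums_mult fejer_transform_sums)
  then show ?thesis unfolding E2 by (simp only: of_real_mult mult.assoc)
qed

text \<open>
  The sum over \<open>n\<close> of the measures \<open>tilted x n\<close> is the exponentially damped \<open>(K+1)\<close>-fold renewal measure, seen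
  from \<open>x\<close>, normalised, and multiplied by the Fejer kernel. The kernel's transform \<open>tri\<close> has compact support,
  so the characteristic function of the sum is the truncated integral \<open>T x\<close>; dividing by the kernel afterwards
  recovers the mass of intervals.
\<close>

definition weight :: "real \<Rightarrow> nat \<Rightarrow> real \<Rightarrow> real" where
  "weight x n s = x / a x ^ Suc K * multichoose K n * (fejer (s - x) * exp (- (1 / x * s)))"

definition tilted :: "real \<Rightarrow> nat \<Rightarrow> real measure" where
  "tilted x n = distr (density (pw n) (\<lambda>s. ennreal (weight x n s))) borel (\<lambda>s. s - x)"

lemma sets_tilted [simp, measurable_cong]: "sets (tilted x n) = sets borel" by (simp add: tilted_def)

context
  fixes x :: real
  assumes x: "0 < x" "1 / x \<le> r"
begin

lemma weight_nonneg: "0 \<le> weight x n s"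
  unfolding weight_def using x a_pos[OF x(1)] by (intro mult_nonneg_nonneg) auto

lemma weight_measurable [measurable]: "weight x n \<in> borel_measurable borel"
  unfolding weight_def[abs_def] by measurable

lemma weight_integrable: "integrable (pw n) (weight x n)"
  and weight_integral: "(LINT s|pw n. weight x n s) \<le> x / a x ^ Suc K * (multichoose K n * psi (1 / x) ^ n)"
proof -
  have lk: "0 \<le> 1 / x" "1 / x \<le> \<kappa>" using x r_le by auto
  let ?w = "\<lambda>s. x / a x ^ Suc K * multichoose K n * exp (- (1 / x * s))"
  have le: "weight x n s \<le> ?w s" for s
    unfolding weight_def using x a_pos[OF x(1)] fejer_le_1[of "s - x"]
    by (intro mult_left_mono) (auto intro!: mult_left_le_one_le mult_nonneg_nonneg)
  have i: "integrable (pw n) ?w" by (intro integrable_mult_right exp_pw_integrable lk)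
  show w: "integrable (pw n) (weight x n)"
  proof (rule Bochner_Integration.integrable_bound[OF i])
    have "norm (weight x n s) \<le> norm (?w s)" for s
      using weight_nonneg[of n s] le[of s] unfolding real_norm_def by linarith
    then show "AE s in pw n. norm (weight x n s) \<le> norm (?w s)" by (intro always_eventually allI)
  qed measurable
  have "(LINT s|pw n. weight x n s) \<le> (LINT s|pw n. ?w s)" by (intro Bochner_Integration.integral_mono w i le)
  also have "\<dots> = x / a x ^ Suc K * multichoose K n * psi (1 / x) ^ n" by (simp only: integral_mult_right_zero exp_pw_integral[OF lk])
  finally show "(LINT s|pw n. weight x n s) \<le> x / a x ^ Suc K * (multichoose K n * psi (1 / x) ^ n)" by (simp only: mult.assoc)
qed

lemma integral_tilted:
  fixes f :: "real \<Rightarrow> 'b::{banach,second_countable_topology}"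
  assumes [measurable]: "f \<in> borel_measurable borel"
  shows "(\<integral>y. f y \<partial>tilted x n) = (\<integral>s. weight x n s *\<^sub>R f (s - x) \<partial>pw n)"
  unfolding tilted_def using weight_nonneg
  by (subst integral_distr) (auto intro!: integral_density)

lemma finite_tilted: "finite_measure (tilted x n)"
  and measure_tilted: "measure (tilted x n) UNIV = (LINT s|pw n. weight x n s)"
proof -
  have "emeasure (tilted x n) UNIV = (\<integral>\<^sup>+s. ennreal (weight x n s) \<partial>pw n)"
    unfolding tilted_def by (subst emeasure_distr) (auto simp: emeasure_density)
  also have "\<dots> = ennreal (LINT s|pw n. weight x n s)"
    using weight_integrable weight_nonneg by (intro nn_integral_eq_integral) auto
  finally have e: "emeasure (tilted x n) UNIV = ennreal (LINT s|pw n. weight x n s)" .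
  have sp: "space (tilted x n) = UNIV" by (simp add: tilted_def)
  show "finite_measure (tilted x n)" by (rule finite_measureI) (simp add: e sp)
  show "measure (tilted x n) UNIV = (LINT s|pw n. weight x n s)"
    unfolding measure_def e using weight_nonneg by (simp add: Bochner_Integration.integral_nonneg)
qed

lemma summable_tilted: "summable (\<lambda>n. measure (tilted x n) UNIV)"
proof (rule summable_comparison_test'[where N=0])
  have p: "norm (psi (1 / x)) < 1" using psi_lt_1[of "1/x"] psi_nonneg[of "1/x"] x by simp
  show "summable (\<lambda>n. x / a x ^ Suc K * (multichoose K n * psi (1 / x) ^ n))"
    using multichoose_sums(1)[OF p, of K] by (intro summable_mult) (simp add: sums_iff)
  show "norm (measure (tilted x n) UNIV) \<le> x / a x ^ Suc K * (multichoose K n * psi (1 / x) ^ n)" for n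
    using weight_integral[of n] weight_nonneg by (simp add: measure_tilted Bochner_Integration.integral_nonneg)
qed

lemma char_mix_tilted: "(CLINT y|mix (tilted x). iexp (\<xi> * y)) = T x \<xi>"
proof -
  have "(\<lambda>n. CLINT y|tilted x n. iexp (\<xi> * y)) sums (CLINT y|mix (tilted x). iexp (\<xi> * y))"
    by (rule integral_mix_complex[where B=1]) (auto intro: finite_tilted summable_tilted)
  moreover have "(CLINT y|tilted x n. iexp (\<xi> * y)) =
     of_real (x / a x ^ Suc K * multichoose K n) * (CLINT s|pw n. of_real (fejer (s - x) * exp (- (1 / x * s))) * iexp (\<xi> * (s - x)))" for n
  proof -
    have "(CLINT y|tilted x n. iexp (\<xi> * y)) = (CLINT s|pw n. weight x n s *\<^sub>R iexp (\<xi> * (s - x)))"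
      by (rule integral_tilted) measurable
    also have "\<dots> = (CLINT s|pw n. of_real (x / a x ^ Suc K * multichoose K n) * (of_real (fejer (s - x) * exp (- (1 / x * s))) * iexp (\<xi> * (s - x))))"
      by (intro Bochner_Integration.integral_cong refl) (simp only: weight_def scaleR_conv_of_real of_real_mult mult.assoc)
    also have "\<dots> = of_real (x / a x ^ Suc K * multichoose K n) * (CLINT s|pw n. of_real (fejer (s - x) * exp (- (1 / x * s))) * iexp (\<xi> * (s - x)))"
      by (rule integral_mult_right_zero)
    finally show ?thesis .
  qed
  ultimately show ?thesis using T_eq[OF x, of \<xi>] sums_unique2 by (simp only:) blast
qed

lemma finite_mix_tilted: "finite_measure (mix (tilted x))"
  by (rule finite_mix) (auto intro: finite_tilted summable_tilted)

lemma mass_mix_tilted: "of_real (measure (mix (tilted x)) UNIV) = T x 0"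
  using char_mix_tilted[of 0] by (simp add: scaleR_conv_of_real)

end

text \<open>The test function that undoes the kernel on (0, h]. For h \<le> 1 the kernel is at least
  1/4 there, so \<open>slot\<close> is bounded by 4; its only discontinuities, 0 and h, are null for
  \<open>fejer_law\<close>.\<close>

definition slot :: "real \<Rightarrow> real \<Rightarrow> real" where
  "slot h y = indicator {0<..h} y / fejer y"

lemma slot_measurable [measurable]: "slot h \<in> borel_measurable borel"
  unfolding slot_def[abs_def] by measurable

lemma slot_bounds: assumes "h \<le> 1" shows "0 \<le> slot h y" "slot h y \<le> 4"
proof -
  show "0 \<le> slot h y" by (simp add: slot_def)
  show "slot h y \<le> 4"
  proof (cases "y \<in> {0<..h}")
    case True
    then have "1 / 4 \<le> fejer y" using assms by (intro fejer_lower) auto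
    then have "1 / fejer y \<le> 1 / (1 / 4)" by (intro divide_left_mono) auto
    then show ?thesis using True by (simp add: slot_def)
  qed (simp add: slot_def)
qed

lemma slot_continuous: assumes "h \<le> 1" "y \<noteq> 0" "y \<noteq> h" shows "isCont (slot h) y"
proof (cases "y \<in> {0<..h}")
  case True
  then have y: "y \<in> {0<..<h}" using assms by auto
  have "1 / 4 \<le> fejer y" using y assms by (intro fejer_lower) auto
  then have "isCont (\<lambda>y. 1 / fejer y) y" by (intro continuous_divide continuous_const fejer_continuous) auto
  moreover have "eventually (\<lambda>u. u \<in> {0<..<h}) (nhds y)" using y by (intro eventually_nhds_in_open) auto
  then have "eventually (\<lambda>u. slot h u = 1 / fejer u) (nhds y)" by eventually_elim (auto simp: slot_def)
  ultimately show ?thesis by (simp add: isCont_cong)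
next
  case False
  then have y: "y \<in> {..<0} \<union> {h<..}" using assms by auto
  have "eventually (\<lambda>u. u \<in> {..<0} \<union> {h<..}) (nhds y)" using y by (intro eventually_nhds_in_open) auto
  then have "eventually (\<lambda>u. slot h u = 0) (nhds y)" by eventually_elim (auto simp: slot_def)
  then show ?thesis using isCont_cong[of "slot h" "\<lambda>_. 0" y] by simp
qed

text \<open>Levy's continuity theorem for the measures scaled to mass 1, along an arbitrary
  sequence: by \<open>T_limit\<close> their characteristic functions tend to \<open>tri\<close>, so
  they converge weakly to \<open>fejer_law\<close>, and \<open>slot\<close> is a bounded, almost
  everywhere continuous test function.\<close>

lemma slot_limit: assumes h: "h \<le> 1"
  shows "((\<lambda>x. LINT y|mix (tilted x). slot h y) \<longlongrightarrow> Re Dc * (LINT y|fejer_law. slot h y)) at_top"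
proof (rule tendsto_at_topI_sequentially)
  fix X :: "nat \<Rightarrow> real" assume X: "filterlim X at_top sequentially"
  define mass where "mass n = measure (mix (tilted (X n))) UNIV" for n
  have ev: "eventually (\<lambda>x. 0 < x \<and> 1 / x \<le> r) at_top"
    using eventually_ge_at_top[of "1 / r"] eventually_gt_at_top[of 0]
    by eventually_elim (use r_pos in \<open>auto simp: field_simps\<close>)
  have evn: "eventually (\<lambda>n. 0 < X n \<and> 1 / X n \<le> r) sequentially"
    using eventually_compose_filterlim[OF ev X] .
  have "(\<lambda>n. Re (T (X n) 0)) \<longlonglongrightarrow> Re Dc"
    using tendsto_Re[OF filterlim_compose[OF T_limit[of 0] X]] by (simp add: tri_def)
  moreover have "eventually (\<lambda>n. Re (T (X n) 0) = mass n) sequentially"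
    using evn by eventually_elim (simp add: mass_mix_tilted[symmetric] mass_def)
  ultimately have mass: "mass \<longlonglongrightarrow> Re Dc" by (rule Lim_transform_eventually)
  have "(\<lambda>n. Im (T (X n) 0)) \<longlonglongrightarrow> Im Dc"
    using tendsto_Im[OF filterlim_compose[OF T_limit[of 0] X]] by (simp add: tri_def)
  moreover have "eventually (\<lambda>n. Im (T (X n) 0) = 0) sequentially"
    using evn by eventually_elim (simp add: mass_mix_tilted[symmetric])
  ultimately have "(\<lambda>n. 0) \<longlonglongrightarrow> Im Dc" by (rule Lim_transform_eventually)
  then have Im: "Im Dc = 0" by (simp add: LIMSEQ_const_iff)
  have D0: "0 \<le> Re Dc" using mass by (rule LIMSEQ_le_const) (auto simp: mass_def)
  show "(\<lambda>n. LINT y|mix (tilted (X n)). slot h y) \<longlonglongrightarrow> Re Dc * (LINT y|fejer_law. slot h y)"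
  proof (cases "Re Dc = 0")
    case True
    \<comment> \<open>Scaling to mass 1 is impossible here, but the integrals are at most 4 times a
      vanishing mass.\<close>
    have "(\<lambda>n. 4 * mass n) \<longlonglongrightarrow> 4 * Re Dc" by (intro tendsto_intros mass)
    then have "(\<lambda>n. 4 * mass n) \<longlonglongrightarrow> 0" using True by simp
    then have "(\<lambda>n. LINT y|mix (tilted (X n)). slot h y) \<longlonglongrightarrow> 0"
    proof (rule Lim_null_comparison[rotated])
      show "eventually (\<lambda>n. norm (LINT y|mix (tilted (X n)). slot h y) \<le> 4 * mass n) sequentially"
        using evn
      proof eventually_elim
        case (elim n)
        then interpret finite_measure "mix (tilted (X n))" by (intro finite_mix_tilted) auto
        have "integrable (mix (tilted (X n))) (slot h)"
          by (rule integrable_const_bound[where B=4]) (use slot_bounds[OF h] in auto)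
        then have "(LINT y|mix (tilted (X n)). slot h y) \<le> (LINT y|mix (tilted (X n)). 4)"
          using slot_bounds[OF h] by (intro Bochner_Integration.integral_mono) auto
        moreover have "0 \<le> (LINT y|mix (tilted (X n)). slot h y)" using slot_bounds[OF h] by (intro Bochner_Integration.integral_nonneg) auto
        ultimately show ?case by (simp add: mass_def mult.commute)
      qed
    qed
    then show ?thesis using True by simp
  next
    case False
    with D0 have D: "0 < Re Dc" by simp
    \<comment> \<open>The default \<open>fejer_law\<close> fills the finitely many indices at which
      the scaling makes no sense, so that every \<open>M n\<close> is a probability law.\<close>
    define M where "M n = (if 0 < X n \<and> 1 / X n \<le> r \<and> 0 < mass n then density (mix (tilted (X n))) (\<lambda>_. ennreal (1 / mass n)) else fejer_law)" for n
    have evm: "eventually (\<lambda>n. 0 < X n \<and> 1 / X n \<le> r \<and> 0 < mass n) sequentially"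
      using evn order_tendstoD(1)[OF mass D] by eventually_elim auto
    have int: "(\<integral>y. f y \<partial>M n) = (1 / mass n) *\<^sub>R (\<integral>y. f y \<partial>mix (tilted (X n)))"
      if "0 < X n \<and> 1 / X n \<le> r \<and> 0 < mass n" and [measurable]: "f \<in> borel_measurable borel" for n and f :: "real \<Rightarrow> 'b::{banach,second_countable_topology}"
    proof -
      have "(\<integral>y. f y \<partial>M n) = (\<integral>y. (1 / mass n) *\<^sub>R f y \<partial>mix (tilted (X n)))"
        unfolding M_def using that(1) by (simp add: integral_density)
      then show ?thesis by simp
    qed
    have rd: "real_distribution (M n)" for n
    proof (cases "0 < X n \<and> 1 / X n \<le> r \<and> 0 < mass n")
      case True
      interpret finite_measure "mix (tilted (X n))" using True by (intro finite_mix_tilted) auto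
      have "emeasure (density (mix (tilted (X n))) (\<lambda>_. ennreal (1 / mass n))) UNIV = ennreal (1 / mass n) * ennreal (mass n)"
        by (simp add: emeasure_density emeasure_eq_measure mass_def)
      also have "\<dots> = 1" using True by (simp add: ennreal_mult[symmetric])
      finally have "prob_space (M n)" unfolding M_def using True by (intro prob_spaceI) simp
      then show ?thesis using True by (simp add: real_distribution_def real_distribution_axioms_def M_def)
    next
      case False
      then have "M n = fejer_law" unfolding M_def by (simp only: if_False)
      then show ?thesis using real_distribution_fejer by simp
    qed
    have "weak_conv_m M fejer_law"
    proof (rule levy_continuity[OF rd real_distribution_fejer])
      fix t
      have "(\<lambda>n. T (X n) t / of_real (mass n)) \<longlonglongrightarrow> of_real (tri t) * Dc / of_real (Re Dc)"
        using D by (intro tendsto_intros filterlim_compose[OF T_limit X] mass) auto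
      moreover have "of_real (tri t) * Dc / of_real (Re Dc) = char fejer_law t"
      proof -
        have "Dc = of_real (Re Dc)" using Im by (simp add: complex_eq_iff)
        then show ?thesis using D char_fejer by (metis nonzero_mult_div_cancel_right of_real_eq_0_iff less_irrefl)
      qed
      moreover have "eventually (\<lambda>n. T (X n) t / of_real (mass n) = char (M n) t) sequentially"
        using evm
      proof eventually_elim
        case (elim n)
        have "char (M n) t = (1 / mass n) *\<^sub>R (CLINT y|mix (tilted (X n)). iexp (t * y))"
          unfolding char_def by (rule int[OF elim]) measurable
        also have "(CLINT y|mix (tilted (X n)). iexp (t * y)) = T (X n) t" using elim by (intro char_mix_tilted) auto
        finally show ?case by (simp add: scaleR_conv_of_real)
      qed
      ultimately show "(\<lambda>n. char (M n) t) \<longlonglongrightarrow> char fejer_law t" by (simp only: tendsto_cong)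
    qed
    then have "(\<lambda>n. LINT y|M n. slot h y) \<longlonglongrightarrow> (LINT y|fejer_law. slot h y)"
    proof (rule weak_conv_imp_bdd_ae_continuous_conv[OF rd real_distribution_fejer, where B=4])
      have "{y. \<not> isCont (slot h) y} \<subseteq> {0, h}" using slot_continuous[OF h] by auto
      then have fin: "finite {y. \<not> isCont (slot h) y}" by (rule finite_subset) simp
      then have "emeasure lborel {y. \<not> isCont (slot h) y} = 0" by (intro emeasure_lborel_countable countable_finite)
      moreover have "{y. \<not> isCont (slot h) y} \<in> sets borel" using fin by (intro borel_closed finite_imp_closed)
      ultimately have "{y. \<not> isCont (slot h) y} \<in> null_sets lborel" by auto
      then have "{y. \<not> isCont (slot h) y} \<in> null_sets fejer_law"
        unfolding fejer_law_def by (subst null_sets_density_iff) (auto intro: AE_I')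
      then show "emeasure fejer_law {y. \<not> isCont (slot h) y} = 0" by auto
      show "norm (slot h y) \<le> 4" for y using slot_bounds[OF h, of y] by simp
    qed measurable
    then have "(\<lambda>n. mass n * (LINT y|M n. slot h y)) \<longlonglongrightarrow> Re Dc * (LINT y|fejer_law. slot h y)"
      by (intro tendsto_mult mass)
    moreover have "eventually (\<lambda>n. mass n * (LINT y|M n. slot h y) = (LINT y|mix (tilted (X n)). slot h y)) sequentially"
      using evm
    proof eventually_elim
      case (elim n)
      have "(LINT y|M n. slot h y) = (1 / mass n) *\<^sub>R (LINT y|mix (tilted (X n)). slot h y)"
        by (rule int[OF elim]) measurable
      then show ?case using elim by simp
    qed
    ultimately show ?thesis by (rule Lim_transform_eventually)
  qed
qed

text \<open>On (x, x + h] the kernel cancels and the damping exp(-s/x) lies between exp(-(x + h)/x)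
  and exp(-1).\<close>

lemma slot_integral_bounds: assumes x: "0 < x" "1 / x \<le> r" and h: "0 \<le> h" "h \<le> 1"
  shows "exp (- (1 / x * (x + h))) * (V K h x * x / a x ^ Suc K) \<le> (LINT y|mix (tilted x). slot h y)"
    and "(LINT y|mix (tilted x). slot h y) \<le> exp (- (1 / x * x)) * (V K h x * x / a x ^ Suc K)"
proof -
  let ?A = "x / a x ^ Suc K"
  have A: "0 < ?A" using x a_pos[OF x(1)] by simp
  have S: "(\<lambda>n. LINT y|tilted x n. slot h y) sums (LINT y|mix (tilted x). slot h y)"
    by (rule integral_mix_nonneg[where B=4]) (use slot_bounds[OF h(2)] in \<open>auto intro: finite_tilted[OF x] summable_tilted[OF x]\<close>)
  have E: "(LINT y|tilted x n. slot h y) = ?A * multichoose K n * (LINT s|pw n. indicator {x<..x + h} s * exp (- (1 / x * s)))" for n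
  proof -
    have "(LINT y|tilted x n. slot h y) = (LINT s|pw n. weight x n s *\<^sub>R slot h (s - x))"
      by (rule integral_tilted[OF x]) measurable
    also have "\<dots> = (LINT s|pw n. ?A * multichoose K n * (indicator {x<..x + h} s * exp (- (1 / x * s))))"
    proof (intro Bochner_Integration.integral_cong refl)
      fix s
      have ind: "indicator {0<..h} (s - x) = (indicator {x<..x + h} s :: real)" by (auto split: split_indicator)
      show "weight x n s *\<^sub>R slot h (s - x) = ?A * multichoose K n * (indicator {x<..x + h} s * exp (- (1 / x * s)))"
      proof (cases "s \<in> {x<..x + h}")
        case True
        then have "1 / 4 \<le> fejer (s - x)" using h by (intro fejer_lower) auto
        then have "fejer (s - x) \<noteq> 0" by auto
        then show ?thesis unfolding slot_def ind weight_def by simp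
      next
        case False
        then show ?thesis unfolding slot_def ind by simp
      qed
    qed
    also have "\<dots> = ?A * multichoose K n * (LINT s|pw n. indicator {x<..x + h} s * exp (- (1 / x * s)))" by (rule integral_mult_right_zero)
    finally show ?thesis .
  qed
  have i: "integrable (pw n) (\<lambda>s. indicator {x<..x + h} s * exp (- (1 / x * s)))" for n
  proof (rule finite_measure.integrable_const_bound[OF finite_measure_pw, where B=1])
    show "AE s in pw n. norm (indicator {x<..x + h} s * exp (- (1 / x * s))) \<le> 1"
      using x by (intro always_eventually) (auto split: split_indicator)
  qed measurable
  have V: "(\<lambda>n. c * (?A * (multichoose K n * ivl n h x))) sums (c * (?A * V K h x))" for c
    unfolding V_def by (intro sums_mult summable_sums V_summable)
  have lo: "exp (- (1 / x * (x + h))) * ivl n h x \<le> (LINT s|pw n. indicator {x<..x + h} s * exp (- (1 / x * s)))" for n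
  proof -
    have "exp (- (1 / x * (x + h))) * ivl n h x = (LINT s|pw n. exp (- (1 / x * (x + h))) * indicator {x<..x + h} s)" by (simp add: ivl_def)
    also have "\<dots> \<le> (LINT s|pw n. indicator {x<..x + h} s * exp (- (1 / x * s)))"
      using x by (intro Bochner_Integration.integral_mono i integrable_mult_right) (auto split: split_indicator intro!: divide_right_mono)
    finally show ?thesis .
  qed
  have hi: "(LINT s|pw n. indicator {x<..x + h} s * exp (- (1 / x * s))) \<le> exp (- (1 / x * x)) * ivl n h x" for n
  proof -
    have "(LINT s|pw n. indicator {x<..x + h} s * exp (- (1 / x * s))) \<le> (LINT s|pw n. exp (- (1 / x * x)) * indicator {x<..x + h} s)"
      using x by (intro Bochner_Integration.integral_mono i integrable_mult_right) (auto split: split_indicator simp: pos_le_divide_eq)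
    also have "\<dots> = exp (- (1 / x * x)) * ivl n h x" by (simp add: ivl_def)
    finally show ?thesis .
  qed
  have "exp (- (1 / x * (x + h))) * (?A * V K h x) \<le> (LINT y|mix (tilted x). slot h y)"
  proof (rule sums_le[OF _ V S])
    fix n
    have "?A * multichoose K n * (exp (- (1 / x * (x + h))) * ivl n h x) \<le> ?A * multichoose K n * (LINT s|pw n. indicator {x<..x + h} s * exp (- (1 / x * s)))"
      using A by (intro mult_left_mono lo mult_nonneg_nonneg) auto
    then show "exp (- (1 / x * (x + h))) * (?A * (multichoose K n * ivl n h x)) \<le> (LINT y|tilted x n. slot h y)"
      unfolding E by (simp only: mult_ac)
  qed
  then show "exp (- (1 / x * (x + h))) * (V K h x * x / a x ^ Suc K) \<le> (LINT y|mix (tilted x). slot h y)" by (simp add: mult_ac)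
  have "(LINT y|mix (tilted x). slot h y) \<le> exp (- (1 / x * x)) * (?A * V K h x)"
  proof (rule sums_le[OF _ S V])
    fix n
    have "?A * multichoose K n * (LINT s|pw n. indicator {x<..x + h} s * exp (- (1 / x * s))) \<le> ?A * multichoose K n * (exp (- (1 / x * x)) * ivl n h x)"
      using A by (intro mult_left_mono hi mult_nonneg_nonneg) auto
    then show "(LINT y|tilted x n. slot h y) \<le> exp (- (1 / x * x)) * (?A * (multichoose K n * ivl n h x))"
      unfolding E by (simp only: mult_ac)
  qed
  then show "(LINT y|mix (tilted x). slot h y) \<le> exp (- (1 / x * x)) * (V K h x * x / a x ^ Suc K)" by (simp add: mult_ac)
qed

text \<open>Removing the damping costs the factor exp(1) from below and exp(1 + h/x) from above,
  which agree in the limit.\<close>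

lemma strong_renewal_large: assumes h: "0 \<le> h" "h \<le> 1" shows "strong_renewal K h"
proof -
  let ?E = "\<lambda>x. LINT y|mix (tilted x). slot h y"
  define L where "L = Re Dc * (LINT y|fejer_law. slot h y)"
  have L: "(?E \<longlongrightarrow> L) at_top" unfolding L_def by (rule slot_limit[OF h(2)])
  have 1: "((\<lambda>x. exp 1 * ?E x) \<longlongrightarrow> exp 1 * L) at_top" by (intro tendsto_intros L)
  have "((\<lambda>x::real. exp (1 + h / x)) \<longlongrightarrow> exp 1) at_top" by real_asymp
  then have 2: "((\<lambda>x. exp (1 + h / x) * ?E x) \<longlongrightarrow> exp 1 * L) at_top" by (rule tendsto_mult[OF _ L])
  have ev: "eventually (\<lambda>x. 0 < x \<and> 1 / x \<le> r) at_top"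
    using eventually_ge_at_top[of "1 / r"] eventually_gt_at_top[of 0]
    by eventually_elim (use r_pos in \<open>auto simp: field_simps\<close>)
  have "((\<lambda>x. V K h x * x / a x ^ Suc K) \<longlongrightarrow> exp 1 * L) at_top"
  proof (rule tendsto_sandwich[OF _ _ 1 2])
    show "eventually (\<lambda>x. exp 1 * ?E x \<le> V K h x * x / a x ^ Suc K) at_top" using ev
    proof eventually_elim
      case (elim x)
      have "exp 1 * ?E x \<le> exp 1 * (exp (- (1 / x * x)) * (V K h x * x / a x ^ Suc K))"
        using elim h by (intro mult_left_mono slot_integral_bounds) auto
      also have "exp 1 * (exp (- (1 / x * x)) * (V K h x * x / a x ^ Suc K)) = V K h x * x / a x ^ Suc K"
        using elim by (simp add: mult.assoc[symmetric] exp_minus)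
      finally show ?case .
    qed
    show "eventually (\<lambda>x. V K h x * x / a x ^ Suc K \<le> exp (1 + h / x) * ?E x) at_top" using ev
    proof eventually_elim
      case (elim x)
      have "exp (1 + h / x) * exp (- (1 / x * (x + h))) = exp ((1 + h / x) + - (1 / x * (x + h)))" by (rule exp_add[symmetric])
      also have "(1 + h / x) + - (1 / x * (x + h)) = 0" using elim by (simp add: field_simps)
      finally have e: "exp (1 + h / x) * exp (- (1 / x * (x + h))) = 1" by simp
      have "exp (1 + h / x) * (exp (- (1 / x * (x + h))) * (V K h x * x / a x ^ Suc K)) \<le> exp (1 + h / x) * ?E x"
        using elim h by (intro mult_left_mono slot_integral_bounds) auto
      then show ?case by (simp only: mult.assoc[symmetric] e mult_1_left)
    qed
  qed
  then show ?thesis unfolding strong_renewal_def by blast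
qed

end

theorem strong_renewal_0: assumes h: "0 \<le> h" "h \<le> 1" shows "strong_renewal 0 h"
proof -
  obtain K :: nat where "4 / \<alpha> \<le> real K" using real_arch_simple by blast
  then have "4 \<le> real K * \<alpha>" using alpha by (simp add: pos_divide_le_eq)
  also have "\<dots> \<le> real (Suc K) * \<alpha>" using alpha by (intro mult_right_mono) auto
  finally show ?thesis using strong_renewal_downward[OF h(1) strong_renewal_large[OF _ h]] by blast
qed

end

section \<open>The strong renewal theorem\<close>

lemma Gamma_lborel: assumes "0 < (s::real)"
  shows "integrable lborel (\<lambda>t. indicator {0..} t * t powr (s - 1) / exp t)"
    and "(LINT t|lborel. indicator {0..} t * t powr (s - 1) / exp t) = Gamma s"
proof -
  have e: "(\<integral>\<^sup>+t. ennreal (indicator {0..} t * t powr (s - 1) / exp t) \<partial>lborel) = ennreal (Gamma s)"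
    using Gamma_conv_nn_integral_real[OF assms] by simp
  show "integrable lborel (\<lambda>t. indicator {0..} t * t powr (s - 1) / exp t)"
    by (rule integrableI_nonneg) (auto simp: e)
  show "(LINT t|lborel. indicator {0..} t * t powr (s - 1) / exp t) = Gamma s"
    using assms by (subst integral_eq_nn_integral) (auto simp: e Gamma_real_nonneg)
qed

context nonarithmetic_step begin

lemma psi_limit: "((\<lambda>x. a x * (1 - psi (1 / x))) \<longlongrightarrow> Gamma (2 - \<alpha>)) at_top"
proof -
  have "cf l 0 = of_real (psi l)" for l
  proof -
    have "exp (of_real z * Complex (- l) 0) = of_real (exp (- (l * z)))" for z
    proof -
      have "of_real z * Complex (- l) 0 = of_real (- (l * z))" by (simp add: complex_eq_iff)
      then show ?thesis by (simp only: exp_of_real)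
    qed
    then show ?thesis unfolding cf_def psi_def by (simp only: integral_complex_of_real)
  qed
  then show ?thesis using tendsto_Re[OF cf_limit[of 0]] by (simp add: Lam_0)
qed

text \<open>For fixed s the points y with s in (y, y + h] fill [s - h, s), over which exp(-l y)
  integrates to (exp(l h) - 1)/l times exp(-l s).\<close>

lemma ivl_laplace: assumes l: "0 < l" "l \<le> r" and h: "0 \<le> h"
  shows "(\<integral>\<^sup>+y. ennreal (exp (- (l * y)) * ivl n h y) \<partial>lborel) = ennreal ((exp (l * h) - 1) / l * psi l ^ n)"
proof -
  have lk: "0 \<le> l" "l \<le> \<kappa>" using l r_le by auto
  interpret P: prob_space "pw n" by (rule prob_space_pw)
  interpret PP: pair_sigma_finite "pw n" lborel ..
  let ?g = "\<lambda>s y. ennreal (exp (- (l * y))) * indicator {p. snd p < fst p \<and> fst p \<le> snd p + h} (s, y)"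
  have inner: "(\<integral>\<^sup>+y. ?g s y \<partial>lborel) = ennreal ((exp (l * h) - 1) / l) * ennreal (exp (- (l * s)))" for s
  proof -
    have "(\<integral>\<^sup>+y. ?g s y \<partial>lborel) = (\<integral>\<^sup>+y. ennreal (exp (- (l * y))) * indicator {s - h..s} y \<partial>lborel)"
      by (intro nn_integral_cong_AE) (use AE_lborel_singleton[of s] in \<open>eventually_elim, auto split: split_indicator\<close>)
    also have "\<dots> = ennreal (- exp (- (l * s)) / l - (- exp (- (l * (s - h))) / l))"
      by (rule nn_integral_FTC_Icc) (use h l in \<open>auto intro!: derivative_eq_intros\<close>)
    also have "- exp (- (l * s)) / l - (- exp (- (l * (s - h))) / l) = (exp (l * h) - 1) / l * exp (- (l * s))"
      using l by (simp add: field_simps exp_add exp_minus exp_diff)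
    also have "ennreal ((exp (l * h) - 1) / l * exp (- (l * s))) = ennreal ((exp (l * h) - 1) / l) * ennreal (exp (- (l * s)))"
      using l h by (intro ennreal_mult) auto
    finally show ?thesis .
  qed
  have "(\<integral>\<^sup>+y. ennreal (exp (- (l * y)) * ivl n h y) \<partial>lborel) = (\<integral>\<^sup>+y. (\<integral>\<^sup>+s. ?g s y \<partial>pw n) \<partial>lborel)"
  proof (intro nn_integral_cong)
    fix y
    have "(\<integral>\<^sup>+s. ?g s y \<partial>pw n) = (\<integral>\<^sup>+s. ennreal (exp (- (l * y))) * indicator {y<..y + h} s \<partial>pw n)"
      by (intro nn_integral_cong) (auto split: split_indicator)
    also have "\<dots> = ennreal (exp (- (l * y))) * ennreal (ivl n h y)"
      by (simp add: nn_integral_cmult P.emeasure_eq_measure ivl_def)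
    finally show "ennreal (exp (- (l * y)) * ivl n h y) = (\<integral>\<^sup>+s. ?g s y \<partial>pw n)" by (simp add: ennreal_mult)
  qed
  also have "\<dots> = (\<integral>\<^sup>+s. (\<integral>\<^sup>+y. ?g s y \<partial>lborel) \<partial>pw n)" by (rule PP.Fubini') measurable
  also have "\<dots> = ennreal ((exp (l * h) - 1) / l) * ennreal (psi l ^ n)"
    unfolding inner by (simp add: nn_integral_cmult nn_exp_pw[OF lk])
  also have "\<dots> = ennreal ((exp (l * h) - 1) / l * psi l ^ n)"
    using l h psi_nonneg by (intro ennreal_mult[symmetric]) auto
  finally show ?thesis .
qed

lemma V_laplace: assumes l: "0 < l" "l \<le> r" and h: "0 \<le> h"
  shows "integrable lborel (\<lambda>y. exp (- (l * y)) * V 0 h y)"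
    and "(LINT y|lborel. exp (- (l * y)) * V 0 h y) = (exp (l * h) - 1) / l / (1 - psi l)"
proof -
  have p: "norm (psi l) < 1" using psi_lt_1[OF l] psi_nonneg[of l] by simp
  have [measurable]: "ivl n h \<in> borel_measurable borel" for n by (rule ivl_measurable[OF h])
  have [measurable]: "V 0 h \<in> borel_measurable borel" by (rule V_measurable[OF h])
  have eq: "ennreal (exp (- (l * y)) * V 0 h y) = (\<Sum>n. ennreal (exp (- (l * y)) * ivl n h y))" for y
  proof -
    have s: "summable (\<lambda>n. ivl n h y)" using V_summable[of 0 h y] by simp
    have V: "V 0 h y = (\<Sum>n. ivl n h y)" by (simp add: V_def)
    have "exp (- (l * y)) * V 0 h y = (\<Sum>n. exp (- (l * y)) * ivl n h y)"
      unfolding V by (rule suminf_mult[OF s, symmetric])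
    moreover have "(\<Sum>n. ennreal (exp (- (l * y)) * ivl n h y)) = ennreal (\<Sum>n. exp (- (l * y)) * ivl n h y)"
      by (rule suminf_ennreal2[OF _ summable_mult[OF s]]) simp
    ultimately show ?thesis by (simp only:)
  qed
  have "(\<integral>\<^sup>+y. ennreal (exp (- (l * y)) * V 0 h y) \<partial>lborel) = (\<Sum>n. \<integral>\<^sup>+y. ennreal (exp (- (l * y)) * ivl n h y) \<partial>lborel)"
    unfolding eq by (rule nn_integral_suminf) measurable
  also have "\<dots> = (\<Sum>n. ennreal ((exp (l * h) - 1) / l * psi l ^ n))" unfolding ivl_laplace[OF l h] ..
  also have "\<dots> = ennreal (\<Sum>n. (exp (l * h) - 1) / l * psi l ^ n)"
    using l h psi_nonneg p by (intro suminf_ennreal2 summable_mult summable_geometric) auto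
  also have "(\<Sum>n. (exp (l * h) - 1) / l * psi l ^ n) = (exp (l * h) - 1) / l / (1 - psi l)"
    by (simp only: suminf_mult[OF summable_geometric[OF p]] suminf_geometric[OF p] times_divide_eq_right mult_1_right)
  finally have e: "(\<integral>\<^sup>+y. ennreal (exp (- (l * y)) * V 0 h y) \<partial>lborel) = ennreal ((exp (l * h) - 1) / l / (1 - psi l))" .
  show "integrable lborel (\<lambda>y. exp (- (l * y)) * V 0 h y)"
    by (rule integrableI_nonneg) (auto simp: e V_nonneg)
  show "(LINT y|lborel. exp (- (l * y)) * V 0 h y) = (exp (l * h) - 1) / l / (1 - psi l)"
    using l h psi_lt_1[OF l] by (subst integral_eq_nn_integral) (auto simp: e V_nonneg)
qed

context
  fixes h :: real
  assumes h: "0 < h" "h \<le> 1"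
begin

lemma V0_measurable [measurable]: "V 0 h \<in> borel_measurable borel"
  using h by (intro V_measurable) auto

text \<open>From the existing limit for large y and from the exponential bound elsewhere, with one
  common constant.\<close>

lemma V_m_bound: obtains B where "0 \<le> B" "\<And>y. 1 \<le> y \<Longrightarrow> V 0 h y * m y \<le> B" "\<And>y. V 0 h y \<le> B" "\<And>y. V 0 h y \<le> B * exp (r * y)"
proof -
  obtain c where c: "((\<lambda>x. V 0 h x * x / a x ^ Suc 0) \<longlongrightarrow> c) at_top" using strong_renewal_0[of h] h by (auto simp: strong_renewal_def)
  have "eventually (\<lambda>x. V 0 h x * x / a x ^ Suc 0 < c + 1) at_top" by (rule order_tendstoD(2)[OF c]) simp
  then obtain Y where Y: "\<And>y. Y \<le> y \<Longrightarrow> V 0 h y * y / a y ^ Suc 0 < c + 1" by (auto simp: eventually_at_top_linorder)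
  define D where "D = exp (r * h) / (1 - psi r) ^ Suc 0"
  have D: "V 0 h y \<le> D * exp (r * y)" for y
    using V_bound[of r 0 h y] r_pos by (simp add: D_def distrib_left exp_add mult.commute)
  have D0: "0 \<le> D" using psi_r by (simp add: D_def)
  define Z where "Z = max Y 1"
  define B1 where "B1 = max (c + 1) (D * exp (r * Z) * m Z)"
  have Z: "1 \<le> Z" by (simp add: Z_def)
  have B1: "V 0 h y * m y \<le> B1" if "1 \<le> y" for y
  proof (cases "Y \<le> y")
    case True
    have "V 0 h y * m y = V 0 h y * y / a y ^ Suc 0" using that m_pos[of y] by (simp add: a_def)
    then show ?thesis using Y[OF True] by (simp add: B1_def)
  next
    case False
    then have y: "y \<le> Z" by (simp add: Z_def)
    have "V 0 h y * m y \<le> (D * exp (r * Z)) * m Z"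
    proof (intro mult_mono m_mono y)
      have "D * exp (r * y) \<le> D * exp (r * Z)" using y r_pos D0 by (intro mult_left_mono) auto
      then show "V 0 h y \<le> D * exp (r * Z)" using D[of y] by linarith
    qed (use D0 m_nonneg in auto)
    then show ?thesis by (simp add: B1_def)
  qed
  have B10: "0 \<le> B1" using B1[of 1] V_nonneg[of 0 h 1] m_nonneg[of 1] by (meson mult_nonneg_nonneg order_refl order_trans)
  define B where "B = B1 + B1 / m 1 + D + D * exp r"
  have m1: "0 < m 1" by (rule m_pos) simp
  show thesis
  proof (rule that[of B])
    have e1: "0 \<le> B1 / m 1" and e2: "0 \<le> D * exp r" using B10 m1 D0 by auto
    then have "B1 \<le> B" using D0 unfolding B_def by linarith
    then show "0 \<le> B" and "\<And>y. 1 \<le> y \<Longrightarrow> V 0 h y * m y \<le> B" using B1 B10 by (auto intro: order_trans)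
    show "V 0 h y \<le> B" for y
    proof (cases "1 \<le> y")
      case True
      have "V 0 h y * m 1 \<le> V 0 h y * m y" using True by (intro mult_left_mono m_mono V_nonneg)
      also have "\<dots> \<le> B1" by (rule B1[OF True])
      finally have "V 0 h y \<le> B1 / m 1" using m1 by (simp add: pos_le_divide_eq)
      then show ?thesis using B10 D0 e2 unfolding B_def by linarith
    next
      case False
      have "V 0 h y \<le> D * exp (r * y)" by (rule D)
      also have "\<dots> \<le> D * exp r" using False r_pos D0 by (intro mult_left_mono) auto
      finally show ?thesis using B10 D0 e1 unfolding B_def by linarith
    qed
    show "V 0 h y \<le> B * exp (r * y)" for y
    proof -
      have "D \<le> B" using B10 e1 e2 unfolding B_def by linarith
      then have "D * exp (r * y) \<le> B * exp (r * y)" by (intro mult_right_mono) auto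
      then show ?thesis using D[of y] by linarith
    qed
  qed
qed

text \<open>On y < 1 the growth exp(r y) of the bound on V outweighs the damping by at least the
  rate r/2 as soon as x \<ge> 2/r, so the integral stays bounded while a(x) diverges.\<close>

lemma laplace_low_part: "((\<lambda>x. (LINT y|lborel. indicator {..<1} y * (exp (- (1 / x * y)) * V 0 h y)) / a x) \<longlongrightarrow> 0) at_top"
proof -
  obtain B where B: "0 \<le> B" "\<And>y. V 0 h y \<le> B * exp (r * y)" using V_m_bound by metis
  define f where "f y = indicator {..<1} y * exp (r / 2 * y)" for y
  have [measurable]: "f \<in> borel_measurable borel" unfolding f_def[abs_def] by measurable
  have fi: "integrable lborel f"
  proof (rule integrableI_nonneg)
    have "(\<integral>\<^sup>+y. ennreal (f y) \<partial>lborel) = (\<integral>\<^sup>+y. ennreal (f (0 + (- 1) * y)) \<partial>lborel)"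
      using nn_integral_real_affine[of "\<lambda>y. ennreal (f y)" "- 1" 0] by (simp add: f_def)
    also have "\<dots> \<le> (\<integral>\<^sup>+y. ennreal (exp (- (r / 2 * y))) * indicator {- 1..} y \<partial>lborel)"
      by (intro nn_integral_mono) (auto simp: f_def split: split_indicator)
    also have "\<dots> = ennreal (0 - (- exp (- (r / 2 * - 1)) / (r / 2)))"
    proof (rule nn_integral_FTC_atLeast)
      show "((\<lambda>y. - exp (- (r / 2 * y)) / (r / 2)) \<longlongrightarrow> 0) at_top" using r_pos by real_asymp
    qed (use r_pos in \<open>auto intro!: derivative_eq_intros simp: field_simps\<close>)
    also have "\<dots> < \<infinity>" by simp
    finally show "(\<integral>\<^sup>+y. ennreal (f y) \<partial>lborel) < \<infinity>" .
  qed (auto simp: f_def)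
  have "((\<lambda>x. B * (LINT y|lborel. exp (r / 2) * f y) * inverse (a x)) \<longlongrightarrow> B * (LINT y|lborel. exp (r / 2) * f y) * 0) at_top"
    by (intro tendsto_intros tendsto_inverse_0_at_top a_at_top)
  then show ?thesis unfolding mult_zero_right
  proof (rule Lim_null_comparison[rotated])
    show "eventually (\<lambda>x. norm ((LINT y|lborel. indicator {..<1} y * (exp (- (1 / x * y)) * V 0 h y)) / a x) \<le> B * (LINT y|lborel. exp (r / 2) * f y) * inverse (a x)) at_top"
      using eventually_ge_at_top[of "2 / r"] eventually_gt_at_top[of 0]
    proof eventually_elim
      case (elim x)
      have lx: "0 < 1 / x" "1 / x \<le> r / 2" using elim r_pos by (auto simp: field_simps)
      have ax: "0 < a x" using elim by (intro a_pos)
      have b: "\<bar>indicator {..<1} y * (exp (- (1 / x * y)) * V 0 h y)\<bar> \<le> B * (exp (r / 2) * f y)" for y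
      proof (cases "y < 1")
        case True
        have e: "- (1 / x * y) + r * y \<le> r / 2 + r / 2 * y"
        proof (cases "0 \<le> y")
          case t: True
          have "0 \<le> 1 / x * y" using t lx by simp
          moreover have "r / 2 * y \<le> r / 2 * 1" using True r_pos by (intro mult_left_mono) auto
          ultimately show ?thesis by (simp add: algebra_simps)
        next
          case f: False
          have "r / 2 * y \<le> 1 / x * y" using f lx by (intro mult_right_mono_neg) auto
          moreover have "r * y = r / 2 * y + r / 2 * y" by simp
          ultimately show ?thesis using r_pos by linarith
        qed
        have "exp (- (1 / x * y)) * V 0 h y \<le> exp (- (1 / x * y)) * (B * exp (r * y))" by (intro mult_left_mono B) simp
        also have "\<dots> = B * exp (- (1 / x * y) + r * y)" by (simp only: exp_add mult_ac)
        also have "\<dots> \<le> B * exp (r / 2 + r / 2 * y)" using e B by (intro mult_left_mono) auto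
        also have "\<dots> = B * (exp (r / 2) * f y)" using True by (simp add: f_def exp_add)
        finally show ?thesis using True V_nonneg[of 0 h y] by simp
      qed (simp add: f_def)
      have "\<bar>LINT y|lborel. indicator {..<1} y * (exp (- (1 / x * y)) * V 0 h y)\<bar> \<le> (LINT y|lborel. B * (exp (r / 2) * f y))"
      proof (rule order_trans[OF integral_abs_bound], rule Bochner_Integration.integral_mono)
        show "integrable lborel (\<lambda>y. B * (exp (r / 2) * f y))" by (intro integrable_mult_right fi)
        then show "integrable lborel (\<lambda>y. \<bar>indicator {..<1} y * (exp (- (1 / x * y)) * V 0 h y)\<bar>)"
          by (rule Bochner_Integration.integrable_bound)
             (measurable, intro always_eventually allI, simp only: real_norm_def abs_abs order_trans[OF b abs_ge_self])
      qed (rule b)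
      also have "\<dots> = B * (LINT y|lborel. exp (r / 2) * f y)" by (rule integral_mult_right_zero)
      finally show ?case using ax by (simp only: norm_divide real_norm_def divide_inverse abs_mult abs_of_pos[OF ax] abs_inverse mult_right_mono) (simp add: mult_right_mono)
    qed
  qed
qed

text \<open>The Abelian half. After y = x v the integrand is exp(-v) V(x v) m(x), which tends to c
  v^(\<alpha>-1) exp(-v).\<close>

lemma laplace_high_part: assumes c: "((\<lambda>x. V 0 h x * m x) \<longlongrightarrow> c) at_top"
  shows "((\<lambda>x. (LINT y|lborel. indicator {1..} y * (exp (- (1 / x * y)) * V 0 h y)) / a x) \<longlongrightarrow> c * Gamma \<alpha>) at_top"
proof -
  obtain B where B: "0 \<le> B" "\<And>y. 1 \<le> y \<Longrightarrow> V 0 h y * m y \<le> B" using V_m_bound by metis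
  obtain C where C: "1 \<le> C" "\<And>x y. 1 \<le> y \<Longrightarrow> y \<le> x \<Longrightarrow> a y \<le> C * (y / x) powr (\<alpha>/2) * a x" using a_potter by blast
  let ?g = "\<lambda>x v. indicator {1..} (x * v) * (exp (- v) * (V 0 h (x * v) * m x))"
  let ?G = "\<lambda>s v. indicator {0..} v * v powr (s - 1) / exp v"
  have a2: "0 < \<alpha> / 2" using alpha by simp
  \<comment> \<open>The dominating profile: for v \<ge> 1 from monotonicity of \<open>m\<close>, for
    v < 1 from Potter, whose exponent keeps v^(\<alpha>/2-1) integrable at 0.\<close>
  have mb: "m x / m (x * v) \<le> C * (1 + v powr (\<alpha>/2 - 1))" if "1 \<le> x * v" "0 < x" "0 < v" for x v
  proof (cases "1 \<le> v")
    case True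
    then have "x * 1 \<le> x * v" using that by (intro mult_left_mono) auto
    then have "m x \<le> m (x * v)" by (intro m_mono) simp
    then have "m x / m (x * v) \<le> 1" using m_pos[of "x * v"] that by simp
    also have "1 \<le> C * (1 + v powr (\<alpha>/2 - 1))" using C mult_mono[of 1 C 1 "1 + v powr (\<alpha>/2 - 1)"] by simp
    finally show ?thesis .
  next
    case False
    then have "x * v \<le> x * 1" using that by (intro mult_left_mono) auto
    then have "a (x * v) \<le> C * ((x * v) / x) powr (\<alpha>/2) * a x" using that by (intro C) auto
    then have 1: "a (x * v) \<le> C * v powr (\<alpha>/2) * a x" using that by simp
    have mp: "0 < m x" "0 < m (x * v)" using that by (auto intro!: m_pos)
    have "m x / m (x * v) = a (x * v) / (v * a x)" using that mp by (simp add: a_def)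
    also have "\<dots> \<le> (C * v powr (\<alpha>/2) * a x) / (v * a x)" using 1 that a_pos[of x] by (intro divide_right_mono) auto
    also have "\<dots> = C * v powr (\<alpha>/2 - 1)" using that a_pos[of x] by (simp add: powr_diff)
    also have "\<dots> \<le> C * (1 + v powr (\<alpha>/2 - 1))" using C by (intro mult_left_mono) auto
    finally show ?thesis .
  qed
  have lim: "((\<lambda>x. LINT v|lborel. ?g x v) \<longlongrightarrow> (LINT v|lborel. c * ?G \<alpha> v)) at_top"
  proof (rule integral_dominated_convergence_at_top[where w="\<lambda>v. B * C * (?G 1 v + ?G (\<alpha>/2) v)"])
    show "integrable lborel (\<lambda>v. B * C * (?G 1 v + ?G (\<alpha>/2) v))"
      using Gamma_lborel(1)[of 1] Gamma_lborel(1)[OF a2] by (intro integrable_mult_right Bochner_Integration.integrable_add) auto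
    show "AE v in lborel. ((\<lambda>x. ?g x v) \<longlongrightarrow> c * ?G \<alpha> v) at_top"
      using AE_lborel_singleton[of 0]
    proof eventually_elim
      case (elim v)
      show ?case
      proof (cases "0 < v")
        case True
        have f: "filterlim (\<lambda>x. x * v) at_top at_top"
          using True by (intro filterlim_at_top_mult_tendsto_pos[OF tendsto_const] filterlim_ident)
        have "((\<lambda>x. m (x * v) / m x) \<longlongrightarrow> v powr (1 - \<alpha>)) at_top" using m_rv[OF True] by (simp add: mult.commute)
        then have A: "((\<lambda>x. exp (- v) * (V 0 h (x * v) * m (x * v) / (m (x * v) / m x))) \<longlongrightarrow> exp (- v) * (c / v powr (1 - \<alpha>))) at_top"
          using True by (intro tendsto_intros filterlim_compose[OF c f]) auto
        have A': "exp (- v) * (c / v powr (1 - \<alpha>)) = c * ?G \<alpha> v"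
          using True by (simp add: exp_minus divide_inverse powr_minus[symmetric])
        have "eventually (\<lambda>x. exp (- v) * (V 0 h (x * v) * m (x * v) / (m (x * v) / m x)) = ?g x v) at_top"
          using eventually_ge_at_top[of "1 / v"] eventually_gt_at_top[of 0]
        proof eventually_elim
          case (elim x)
          then have "1 \<le> x * v" using True by (simp add: pos_divide_le_eq)
          moreover have "0 < m (x * v)" using elim True by (intro m_pos) simp
          ultimately show ?case by simp
        qed
        from Lim_transform_eventually[OF A this] show ?thesis unfolding A' .
      next
        case False
        then have v: "v < 0" using elim by simp
        have "eventually (\<lambda>x. ?g x v = 0) at_top"
          using eventually_gt_at_top[of 0]
        proof eventually_elim
          case (elim x)
          then have "x * v < 0" using v by (simp add: mult_pos_neg)
          then show ?case by simp
        qed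
        then show ?thesis using v by (simp add: tendsto_eventually)
      qed
    qed
    show "\<forall>\<^sub>F x in at_top. AE v in lborel. norm (?g x v) \<le> B * C * (?G 1 v + ?G (\<alpha>/2) v)"
      using eventually_gt_at_top[of 0]
    proof eventually_elim
      case (elim x)
      show ?case
      proof (intro always_eventually allI)
        fix v
        show "norm (?g x v) \<le> B * C * (?G 1 v + ?G (\<alpha>/2) v)"
        proof (cases "1 \<le> x * v")
          case True
          then have "0 < x * v" by simp
          then have v: "0 < v" using elim by (simp add: zero_less_mult_iff)
          have "V 0 h (x * v) * m x = (V 0 h (x * v) * m (x * v)) * (m x / m (x * v))"
            using m_pos[OF \<open>0 < x * v\<close>] by simp
          also have "\<dots> \<le> B * (C * (1 + v powr (\<alpha>/2 - 1)))"
            using B True elim v m_nonneg by (intro mult_mono mb) (auto intro!: divide_nonneg_nonneg)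
          finally have "exp (- v) * (V 0 h (x * v) * m x) \<le> exp (- v) * (B * (C * (1 + v powr (\<alpha>/2 - 1))))" by (intro mult_left_mono) auto
          also have "\<dots> = B * C * (?G 1 v + ?G (\<alpha>/2) v)" using v by (simp add: exp_minus field_simps)
          finally show ?thesis using True V_nonneg m_nonneg by (simp add: abs_mult)
        next
          case False
          have "0 \<le> B * C * (?G 1 v + ?G (\<alpha>/2) v)" using B C by (intro mult_nonneg_nonneg add_nonneg_nonneg) auto
          then show ?thesis using False by simp
        qed
      qed
    qed
  qed measurable
  have "(LINT v|lborel. c * ?G \<alpha> v) = c * Gamma \<alpha>"
    using Gamma_lborel(2)[OF alpha(1)] by (simp only: integral_mult_right_zero)
  then have "((\<lambda>x. LINT v|lborel. ?g x v) \<longlongrightarrow> c * Gamma \<alpha>) at_top" using lim by (simp only:)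
  moreover have "eventually (\<lambda>x. (LINT v|lborel. ?g x v) = (LINT y|lborel. indicator {1..} y * (exp (- (1 / x * y)) * V 0 h y)) / a x) at_top"
    using eventually_gt_at_top[of 0]
  proof eventually_elim
    case (elim x)
    have mx: "0 < m x" using elim by (rule m_pos)
    have "(LINT y|lborel. indicator {1..} y * (exp (- (1 / x * y)) * V 0 h y)) = \<bar>x\<bar> *\<^sub>R (LINT v|lborel. indicator {1..} (0 + x * v) * (exp (- (1 / x * (0 + x * v))) * V 0 h (0 + x * v)))"
      using elim by (intro lborel_integral_real_affine) auto
    also have "(LINT v|lborel. indicator {1..} (0 + x * v) * (exp (- (1 / x * (0 + x * v))) * V 0 h (0 + x * v))) = (LINT v|lborel. ?g x v * inverse (m x))"
      using elim mx by (intro Bochner_Integration.integral_cong) auto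
    also have "\<dots> = (LINT v|lborel. ?g x v) * inverse (m x)" by (rule integral_mult_left_zero)
    finally have E: "(LINT y|lborel. indicator {1..} y * (exp (- (1 / x * y)) * V 0 h y)) = \<bar>x\<bar> *\<^sub>R ((LINT v|lborel. ?g x v) * inverse (m x))" .
    have "\<bar>x\<bar> *\<^sub>R (I * inverse (m x)) / a x = I" for I using elim mx by (simp add: a_def)
    then show ?case unfolding E by simp
  qed
  ultimately show ?thesis by (rule Lim_transform_eventually)
qed

text \<open>A limit c exists already. It is found by evaluating the Laplace transform at 1/x in two
  ways: exactly, as x (exp(h/x) - 1)/(1 - psi(1/x)), and asymptotically, as c \<Gamma>(\<alpha>)
  a(x).\<close>

theorem strong_renewal_theorem: "((\<lambda>x. m x * V 0 h x) \<longlongrightarrow> h * C_const \<alpha>) at_top"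
proof -
  obtain c where c0: "((\<lambda>x. V 0 h x * x / a x ^ Suc 0) \<longlongrightarrow> c) at_top" using strong_renewal_0[of h] h by (auto simp: strong_renewal_def)
  have c: "((\<lambda>x. V 0 h x * m x) \<longlongrightarrow> c) at_top"
    by (rule Lim_transform_eventually[OF c0]) (use eventually_gt_at_top[of 0] in eventually_elim, use m_pos in \<open>force simp: a_def\<close>)
  let ?I = "\<lambda>x. LINT y|lborel. exp (- (1 / x * y)) * V 0 h y"
  have 1: "((\<lambda>x. (LINT y|lborel. indicator {..<1} y * (exp (- (1 / x * y)) * V 0 h y)) / a x + (LINT y|lborel. indicator {1..} y * (exp (- (1 / x * y)) * V 0 h y)) / a x) \<longlongrightarrow> 0 + c * Gamma \<alpha>) at_top"
    by (intro tendsto_add laplace_low_part laplace_high_part c)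
  have "((\<lambda>x. x * (exp (h / x) - 1)) \<longlongrightarrow> h) at_top" by real_asymp
  then have 2: "((\<lambda>x. x * (exp (h / x) - 1) / (a x * (1 - psi (1 / x)))) \<longlongrightarrow> h / Gamma (2 - \<alpha>)) at_top"
    using alpha by (intro tendsto_divide psi_limit) (auto simp: Gamma_eq_zero_iff)
  have "eventually (\<lambda>x. x * (exp (h / x) - 1) / (a x * (1 - psi (1 / x))) = (LINT y|lborel. indicator {..<1} y * (exp (- (1 / x * y)) * V 0 h y)) / a x + (LINT y|lborel. indicator {1..} y * (exp (- (1 / x * y)) * V 0 h y)) / a x) at_top"
    using eventually_ge_at_top[of "1 / r"] eventually_gt_at_top[of 0]
  proof eventually_elim
    case (elim x)
    have l: "0 < 1 / x" "1 / x \<le> r" using elim r_pos by (auto simp: field_simps)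
    have hn: "0 \<le> h" using h by simp
    note i = V_laplace(1)[OF l hn]
    have "?I x = (LINT y|lborel. indicator {..<1} y * (exp (- (1 / x * y)) * V 0 h y) + indicator {1..} y * (exp (- (1 / x * y)) * V 0 h y))"
      by (intro Bochner_Integration.integral_cong) (auto split: split_indicator)
    also have "\<dots> = (LINT y|lborel. indicator {..<1} y * (exp (- (1 / x * y)) * V 0 h y)) + (LINT y|lborel. indicator {1..} y * (exp (- (1 / x * y)) * V 0 h y))"
      using integrable_mult_indicator[OF _ i, of "{..<1}"] integrable_mult_indicator[OF _ i, of "{1..}"] by (intro Bochner_Integration.integral_add) auto
    finally have "(LINT y|lborel. indicator {..<1} y * (exp (- (1 / x * y)) * V 0 h y)) / a x + (LINT y|lborel. indicator {1..} y * (exp (- (1 / x * y)) * V 0 h y)) / a x = ?I x / a x"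
      by (simp only: add_divide_distrib)
    also have "?I x / a x = x * (exp (h / x) - 1) / (a x * (1 - psi (1 / x)))"
      unfolding V_laplace(2)[OF l hn] by (simp add: mult.commute)
    finally show ?case by simp
  qed
  from Lim_transform_eventually[OF 2 this] 1 have "h / Gamma (2 - \<alpha>) = 0 + c * Gamma \<alpha>"
    using tendsto_unique[OF trivial_limit_at_top_linorder] by blast
  moreover have "0 < Gamma \<alpha>" "0 < Gamma (2 - \<alpha>)" using alpha by (auto intro!: Gamma_real_pos)
  ultimately have "c = h * C_const \<alpha>" by (simp add: C_const_def field_simps)
  then show ?thesis using c by (simp add: mult.commute)
qed

end

end

section \<open>The key renewal theorem\<close>

lemma exp_abs_integrable: assumes l: "0 < (l::real)"
  shows "integrable lborel (\<lambda>w. (1 + \<bar>w\<bar>) * exp (- (l * \<bar>w\<bar>)))"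
proof -
  let ?f = "\<lambda>w. indicator {0..} w * ((1 + w) * exp (- (l * w)))"
  have "integrable lborel (\<lambda>w. indicator {0..} w * exp (- (l * w)))"
  proof (rule integrableI_nonneg)
    have "(\<integral>\<^sup>+w. ennreal (exp (- (l * w))) * indicator {0..} w \<partial>lborel) = ennreal (0 - (- exp (- (l * 0)) / l))"
    proof (rule nn_integral_FTC_atLeast)
      show "((\<lambda>w. - exp (- (l * w)) / l) \<longlongrightarrow> 0) at_top" using l by real_asymp
    qed (use l in \<open>auto intro!: derivative_eq_intros\<close>)
    also have "(\<integral>\<^sup>+w. ennreal (exp (- (l * w))) * indicator {0..} w \<partial>lborel) = (\<integral>\<^sup>+w. ennreal (indicator {0..} w * exp (- (l * w))) \<partial>lborel)"
      by (intro nn_integral_cong) (auto split: split_indicator)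
    finally show "(\<integral>\<^sup>+w. ennreal (indicator {0..} w * exp (- (l * w))) \<partial>lborel) < \<infinity>" by simp
  qed auto
  from Bochner_Integration.integrable_add[OF this u_exp_integrable[OF l]]
  have f: "integrable lborel ?f" by (simp add: algebra_simps)
  have f': "integrable lborel (\<lambda>w. ?f (0 + (- 1) * w))" by (rule lborel_integrable_real_affine[OF f]) simp
  show ?thesis
    by (rule Bochner_Integration.integrable_bound[OF Bochner_Integration.integrable_add[OF f f']])
       (auto intro!: always_eventually split: split_indicator)
qed

context nonarithmetic_step begin

text \<open>A bounded shift is a scaling by a factor tending to 1; the minimum and maximum cover
  both signs of w.\<close>

lemma m_shift: "((\<lambda>y. m y / m (y - w)) \<longlongrightarrow> 1) at_top"
proof (rule tendsto_sandwich)
  show "((\<lambda>y. min 1 (y / (y - w))) \<longlongrightarrow> 1) at_top"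
  proof -
    have "((\<lambda>y. y / (y - w)) \<longlongrightarrow> 1) at_top" by real_asymp
    from tendsto_min[OF tendsto_const[of 1] this] show ?thesis by simp
  qed
  show "((\<lambda>y. max 1 (y / (y - w))) \<longlongrightarrow> 1) at_top"
  proof -
    have "((\<lambda>y. y / (y - w)) \<longlongrightarrow> 1) at_top" by real_asymp
    from tendsto_max[OF tendsto_const[of 1] this] show ?thesis by simp
  qed
  have "eventually (\<lambda>y. min 1 (y / (y - w)) \<le> m y / m (y - w) \<and> m y / m (y - w) \<le> max 1 (y / (y - w))) at_top"
    using eventually_gt_at_top[of "max 0 w"]
  proof eventually_elim
    case (elim y)
    then have y: "0 < y" "0 < y - w" by auto
    note mp = m_pos[OF y(1)] m_pos[OF y(2)]
    show ?case
    proof (cases "0 \<le> w")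
      case True
      have "m (y - w) \<le> m y" using True by (intro m_mono) auto
      then have 1: "1 \<le> m y / m (y - w)" using mp by simp
      have "m ((y / (y - w)) * (y - w)) \<le> (y / (y - w)) * m (y - w)" using y True by (intro m_scale) auto
      then have "m y \<le> (y / (y - w)) * m (y - w)" using y by simp
      then have "m y / m (y - w) \<le> y / (y - w)" using mp by (simp only: pos_divide_le_eq)
      then show ?thesis using 1 by (auto simp: min_le_iff_disj le_max_iff_disj)
    next
      case False
      have "m y \<le> m (y - w)" using False by (intro m_mono) auto
      then have 1: "m y / m (y - w) \<le> 1" using mp by simp
      have "m (((y - w) / y) * y) \<le> ((y - w) / y) * m y" using y False by (intro m_scale) auto
      then have 2: "m (y - w) \<le> ((y - w) / y) * m y" using y by simp
      have "y / (y - w) * m (y - w) \<le> y / (y - w) * (((y - w) / y) * m y)" using y 2 by (intro mult_left_mono) auto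
      then have "y / (y - w) * m (y - w) \<le> m y" using y by simp
      then have "y / (y - w) \<le> m y / m (y - w)" using mp by (simp only: pos_le_divide_eq)
      then show ?thesis using 1 by (auto simp: min_le_iff_disj le_max_iff_disj)
    qed
  qed
  then show "eventually (\<lambda>y. min 1 (y / (y - w)) \<le> m y / m (y - w)) at_top"
    and "eventually (\<lambda>y. m y / m (y - w) \<le> max 1 (y / (y - w))) at_top" by (auto elim: eventually_mono)
qed

context
  fixes h :: real
  assumes h: "0 < h" "h \<le> 1"
begin

text \<open>Domination uniform in the shift. If w \<le> y/2, then m(y) \<le> 2 m(y - w) and the
  boundedness of V m applies; if w > y/2, the crude m(y) \<le> y m(1) \<le> 2 |w| m(1) suffices.
  This is the source of the first absolute moment asked of H.\<close>

lemma renewal_bound: "\<exists>C\<ge>0. \<forall>y\<ge>2. \<forall>w. m y * V 0 h (y - w) \<le> C * (1 + \<bar>w\<bar>)"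
proof -
  obtain B where B: "0 \<le> B" "\<And>y. 1 \<le> y \<Longrightarrow> V 0 h y * m y \<le> B" "\<And>y. V 0 h y \<le> B" using V_m_bound[OF h] by metis
  define C where "C = 2 * B + 2 * m 1 * B"
  have C: "0 \<le> C" using B m_nonneg by (simp add: C_def)
  have "m y * V 0 h (y - w) \<le> C * (1 + \<bar>w\<bar>)" if y: "2 \<le> y" for y w
  proof (cases "w \<le> y / 2")
    case True
    then have yw: "1 \<le> y - w" "y \<le> 2 * (y - w)" using y by auto
    have "m y \<le> m (2 * (y - w))" by (rule m_mono) (use yw in auto)
    also have "\<dots> \<le> 2 * m (y - w)" using yw by (intro m_scale) auto
    finally have "m y * V 0 h (y - w) \<le> 2 * m (y - w) * V 0 h (y - w)" by (intro mult_right_mono V_nonneg)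
    also have "\<dots> = 2 * (V 0 h (y - w) * m (y - w))" by simp
    also have "\<dots> \<le> 2 * B" using B yw by simp
    also have "\<dots> \<le> C * 1" using B m_nonneg[of 1] by (simp add: C_def)
    also have "\<dots> \<le> C * (1 + \<bar>w\<bar>)" using C by (intro mult_left_mono) auto
    finally show ?thesis .
  next
    case False
    have "m (y * 1) \<le> y * m 1" using y by (intro m_scale) auto
    moreover have "y * m 1 \<le> (2 * \<bar>w\<bar>) * m 1" using False y m_nonneg[of 1] by (intro mult_right_mono) auto
    ultimately have "m y \<le> (2 * \<bar>w\<bar>) * m 1" by simp
    then have "m y * V 0 h (y - w) \<le> ((2 * \<bar>w\<bar>) * m 1) * B" using B V_nonneg m_nonneg by (intro mult_mono) auto
    also have "\<dots> = (2 * m 1 * B) * \<bar>w\<bar>" by simp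
    also have "\<dots> \<le> C * (1 + \<bar>w\<bar>)" using B C m_nonneg[of 1] by (intro mult_mono) (auto simp: C_def)
    finally show ?thesis .
  qed
  then show ?thesis using C by blast
qed

lemma V_shift_limit: "((\<lambda>y. m y * V 0 h (y - w)) \<longlongrightarrow> h * C_const \<alpha>) at_top"
proof -
  have f: "filterlim (\<lambda>y. y - w) at_top at_top" by real_asymp
  have "((\<lambda>y. m y / m (y - w) * (m (y - w) * V 0 h (y - w))) \<longlongrightarrow> 1 * (h * C_const \<alpha>)) at_top"
    by (intro tendsto_mult m_shift filterlim_compose[OF strong_renewal_theorem[OF h] f])
  moreover have "eventually (\<lambda>y. m y / m (y - w) * (m (y - w) * V 0 h (y - w)) = m y * V 0 h (y - w)) at_top"
    using eventually_gt_at_top[of w]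
  proof eventually_elim
    case (elim y)
    then have "0 < m (y - w)" by (intro m_pos) auto
    then show ?case by simp
  qed
  ultimately show ?thesis using Lim_transform_eventually by fastforce
qed

lemma smoothed_limit:
  assumes [measurable]: "H \<in> borel_measurable borel" and H: "\<And>w. 0 \<le> H w" and i: "integrable lborel (\<lambda>w. H w * (1 + \<bar>w\<bar>))"
  shows "((\<lambda>y. m y * (LINT w|lborel. H w * V 0 h (y - w))) \<longlongrightarrow> h * C_const \<alpha> * (LINT w|lborel. H w)) at_top"
    and "integrable lborel (\<lambda>w. H w * V 0 h (y - w))"
proof -
  have [measurable]: "V 0 h \<in> borel_measurable borel" by (rule V0_measurable[OF h])
  obtain C where C: "0 \<le> C" "\<And>y w. 2 \<le> y \<Longrightarrow> m y * V 0 h (y - w) \<le> C * (1 + \<bar>w\<bar>)" using renewal_bound by blast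
  obtain B where B: "0 \<le> B" "\<And>y. V 0 h y \<le> B" using V_m_bound[OF h] by metis
  show "integrable lborel (\<lambda>w. H w * V 0 h (y - w))"
  proof (rule Bochner_Integration.integrable_bound[OF integrable_mult_right[OF i, of B]])
    have "norm (H w * V 0 h (y - w)) \<le> norm (B * (H w * (1 + \<bar>w\<bar>)))" for w
    proof -
      have "H w * V 0 h (y - w) \<le> H w * B" using H B by (intro mult_left_mono) auto
      also have "\<dots> \<le> H w * (B * (1 + \<bar>w\<bar>))" using H B by (intro mult_left_mono) (auto simp: algebra_simps)
      finally show ?thesis using H V_nonneg B by (simp add: abs_mult mult_ac)
    qed
    then show "AE w in lborel. norm (H w * V 0 h (y - w)) \<le> norm (B * (H w * (1 + \<bar>w\<bar>)))" by (intro always_eventually allI)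
  qed measurable
  have "((\<lambda>y. LINT w|lborel. H w * (m y * V 0 h (y - w))) \<longlongrightarrow> (LINT w|lborel. H w * (h * C_const \<alpha>))) at_top"
  proof (rule integral_dominated_convergence_at_top[where w="\<lambda>w. C * (H w * (1 + \<bar>w\<bar>))"])
    show "integrable lborel (\<lambda>w. C * (H w * (1 + \<bar>w\<bar>)))" by (intro integrable_mult_right i)
    show "AE w in lborel. ((\<lambda>y. H w * (m y * V 0 h (y - w))) \<longlongrightarrow> H w * (h * C_const \<alpha>)) at_top"
      by (intro always_eventually allI tendsto_mult_left V_shift_limit)
    show "\<forall>\<^sub>F y in at_top. AE w in lborel. norm (H w * (m y * V 0 h (y - w))) \<le> C * (H w * (1 + \<bar>w\<bar>))"
      using eventually_ge_at_top[of 2]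
    proof eventually_elim
      case (elim y)
      have "norm (H w * (m y * V 0 h (y - w))) \<le> C * (H w * (1 + \<bar>w\<bar>))" for w
      proof -
        have "H w * (m y * V 0 h (y - w)) \<le> H w * (C * (1 + \<bar>w\<bar>))" using H C elim by (intro mult_left_mono) auto
        then show ?thesis using H V_nonneg m_nonneg by (simp add: abs_mult mult_ac)
      qed
      then show ?case by (intro always_eventually allI)
    qed
  qed measurable
  moreover have "(LINT w|lborel. H w * (m y * V 0 h (y - w))) = m y * (LINT w|lborel. H w * V 0 h (y - w))" for y
    by (simp only: mult.left_commute[of "H _"] integral_mult_right_zero)
  ultimately show "((\<lambda>y. m y * (LINT w|lborel. H w * V 0 h (y - w))) \<longlongrightarrow> h * C_const \<alpha> * (LINT w|lborel. H w)) at_top"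
    by (simp add: mult.commute)
qed

text \<open>Averaging the solution over (y, y + h] turns its convolution form into an integral of H
  against the masses of (y - w, y - w + h] under the renewal measure, for which the strong renewal
  theorem is available. This takes the place of direct Riemann integrability of H.\<close>

lemma smoothed_eq:
  assumes [measurable]: "H \<in> borel_measurable borel" and H: "\<And>w. 0 \<le> H w" and i: "integrable lborel (\<lambda>w. H w * (1 + \<bar>w\<bar>))"
    and G: "\<And>y. ennreal (G y) = (\<Sum>n. \<integral>\<^sup>+s. ennreal (H (y - s)) \<partial>pw n)"
  shows "(\<integral>\<^sup>+u. ennreal (G (y + u)) * indicator {0<..h} u \<partial>lborel) = ennreal (LINT w|lborel. H w * V 0 h (y - w))"
proof -
  have [measurable]: "ivl n h \<in> borel_measurable borel" for n using h by (intro ivl_measurable) simp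
  have each: "(\<integral>\<^sup>+u. (\<integral>\<^sup>+s. ennreal (H (y + u - s)) \<partial>pw n) * indicator {0<..h} u \<partial>lborel) = (\<integral>\<^sup>+w. ennreal (H w * ivl n h (y - w)) \<partial>lborel)" for n
  proof -
    interpret P: prob_space "pw n" by (rule prob_space_pw)
    interpret PP: pair_sigma_finite "pw n" lborel ..
    have "(\<integral>\<^sup>+u. (\<integral>\<^sup>+s. ennreal (H (y + u - s)) \<partial>pw n) * indicator {0<..h} u \<partial>lborel) = (\<integral>\<^sup>+u. (\<integral>\<^sup>+s. ennreal (H (y + u - s)) * indicator {0<..h} u \<partial>pw n) \<partial>lborel)"
      by (intro nn_integral_cong) (simp add: nn_integral_multc)
    also have "\<dots> = (\<integral>\<^sup>+s. (\<integral>\<^sup>+u. ennreal (H (y + u - s)) * indicator {0<..h} u \<partial>lborel) \<partial>pw n)"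
      by (rule PP.Fubini') measurable
    also have "\<dots> = (\<integral>\<^sup>+s. (\<integral>\<^sup>+w. ennreal (H w) * indicator {p. fst p - y + snd p \<in> {0<..h}} (w, s) \<partial>lborel) \<partial>pw n)"
    proof (rule nn_integral_cong)
      fix s
      have "(\<integral>\<^sup>+u. ennreal (H (y + u - s)) * indicator {0<..h} u \<partial>lborel) = ennreal \<bar>1\<bar> * (\<integral>\<^sup>+w. ennreal (H (y + ((s - y) + 1 * w) - s)) * indicator {0<..h} ((s - y) + 1 * w) \<partial>lborel)"
        by (rule nn_integral_real_affine) auto
      also have "\<dots> = (\<integral>\<^sup>+w. ennreal (H w) * indicator {p. fst p - y + snd p \<in> {0<..h}} (w, s) \<partial>lborel)"
        by (simp add: indicator_def algebra_simps)
      finally show "(\<integral>\<^sup>+u. ennreal (H (y + u - s)) * indicator {0<..h} u \<partial>lborel) = (\<integral>\<^sup>+w. ennreal (H w) * indicator {p. fst p - y + snd p \<in> {0<..h}} (w, s) \<partial>lborel)" .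
    qed
    also have "\<dots> = (\<integral>\<^sup>+w. (\<integral>\<^sup>+s. ennreal (H w) * indicator {p. fst p - y + snd p \<in> {0<..h}} (w, s) \<partial>pw n) \<partial>lborel)"
      by (rule PP.Fubini'[symmetric]) measurable
    also have "\<dots> = (\<integral>\<^sup>+w. ennreal (H w * ivl n h (y - w)) \<partial>lborel)"
    proof (intro nn_integral_cong)
      fix w
      have "(\<integral>\<^sup>+s. ennreal (H w) * indicator {p. fst p - y + snd p \<in> {0<..h}} (w, s) \<partial>pw n) = (\<integral>\<^sup>+s. ennreal (H w) * indicator {y - w<..y - w + h} s \<partial>pw n)"
        by (intro nn_integral_cong) (auto split: split_indicator)
      also have "\<dots> = ennreal (H w) * ennreal (ivl n h (y - w))"
        by (simp add: nn_integral_cmult P.emeasure_eq_measure ivl_def)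
      finally show "(\<integral>\<^sup>+s. ennreal (H w) * indicator {p. fst p - y + snd p \<in> {0<..h}} (w, s) \<partial>pw n) = ennreal (H w * ivl n h (y - w))"
        using H by (simp add: ennreal_mult)
    qed
    finally show ?thesis .
  qed
  have pm: "(\<lambda>x. \<integral>\<^sup>+s. ennreal (H (x - s)) \<partial>pw n) \<in> borel_measurable borel" for n
  proof -
    interpret P: prob_space "pw n" by (rule prob_space_pw)
    show ?thesis by (rule P.borel_measurable_nn_integral) measurable
  qed
  have "(\<integral>\<^sup>+u. ennreal (G (y + u)) * indicator {0<..h} u \<partial>lborel) = (\<integral>\<^sup>+u. (\<Sum>n. (\<integral>\<^sup>+s. ennreal (H (y + u - s)) \<partial>pw n) * indicator {0<..h} u) \<partial>lborel)"
    unfolding G by (simp add: ennreal_suminf_multc)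
  also have "\<dots> = (\<Sum>n. \<integral>\<^sup>+u. (\<integral>\<^sup>+s. ennreal (H (y + u - s)) \<partial>pw n) * indicator {0<..h} u \<partial>lborel)"
  proof (rule nn_integral_suminf)
    fix n
    have [measurable]: "(\<lambda>x. \<integral>\<^sup>+s. ennreal (H (x - s)) \<partial>pw n) \<in> borel_measurable borel" by (rule pm)
    have "(\<lambda>u. \<integral>\<^sup>+s. ennreal (H (y + u - s)) \<partial>pw n) \<in> borel_measurable borel"
      by (rule measurable_compose[OF _ pm, of "\<lambda>u. y + u" borel]) measurable
    then show "(\<lambda>u. (\<integral>\<^sup>+s. ennreal (H (y + u - s)) \<partial>pw n) * indicator {0<..h} u) \<in> borel_measurable lborel" by simp
  qed
  also have "\<dots> = (\<Sum>n. \<integral>\<^sup>+w. ennreal (H w * ivl n h (y - w)) \<partial>lborel)" unfolding each ..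
  also have "\<dots> = (\<integral>\<^sup>+w. (\<Sum>n. ennreal (H w * ivl n h (y - w))) \<partial>lborel)" by (rule nn_integral_suminf[symmetric]) measurable
  also have "\<dots> = (\<integral>\<^sup>+w. ennreal (H w * V 0 h (y - w)) \<partial>lborel)"
  proof (intro nn_integral_cong)
    fix w
    have s: "summable (\<lambda>n. ivl n h (y - w))" using V_summable[of 0 h "y - w"] by simp
    have V: "V 0 h (y - w) = (\<Sum>n. ivl n h (y - w))" by (simp add: V_def)
    have "(\<Sum>n. ennreal (H w * ivl n h (y - w))) = ennreal (\<Sum>n. H w * ivl n h (y - w))"
      using H by (intro suminf_ennreal2 summable_mult s) auto
    also have "(\<Sum>n. H w * ivl n h (y - w)) = H w * V 0 h (y - w)" unfolding V by (rule suminf_mult[OF s])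
    finally show "(\<Sum>n. ennreal (H w * ivl n h (y - w))) = ennreal (H w * V 0 h (y - w))" .
  qed
  also have "\<dots> = ennreal (LINT w|lborel. H w * V 0 h (y - w))"
    using H V_nonneg by (intro nn_integral_eq_integral smoothed_limit(2) i) (auto intro!: always_eventually)
  finally show ?thesis .
qed

end

text \<open>As Q is monotone, exp(\<kappa> y) Q(y) grows by at most the factor exp(\<kappa> h) over
  a length h. Its averages over (y, y + h], known from \<open>smoothed_limit\<close>, therefore
  bracket it, and h tends to 0 at the end.\<close>

theorem key_renewal:
  assumes [measurable]: "H \<in> borel_measurable borel" and H: "\<And>w. 0 \<le> H w" and i: "integrable lborel (\<lambda>w. H w * (1 + \<bar>w\<bar>))"
    and Q: "\<And>y. 0 \<le> Q y" "\<And>x y. x \<le> y \<Longrightarrow> Q y \<le> Q x"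
    and G: "\<And>y. ennreal (exp (\<kappa> * y) * Q y) = (\<Sum>n. \<integral>\<^sup>+s. ennreal (H (y - s)) \<partial>pw n)"
  shows "((\<lambda>y. m y * (exp (\<kappa> * y) * Q y)) \<longlongrightarrow> C_const \<alpha> * (LINT w|lborel. H w)) at_top"
proof -
  define L where "L = C_const \<alpha> * (LINT w|lborel. H w)"
  define g where "g y = exp (\<kappa> * y) * Q y" for y
  define S where "S h y = (LINT w|lborel. H w * V 0 h (y - w))" for h y
  have g0: "0 \<le> g y" for y using Q by (simp add: g_def)
  have S0: "0 \<le> S h y" for h y unfolding S_def using H V_nonneg by (intro Bochner_Integration.integral_nonneg) auto
  have L0: "0 \<le> L" unfolding L_def using H alpha
    by (auto intro!: mult_nonneg_nonneg Bochner_Integration.integral_nonneg simp: C_const_def Gamma_real_nonneg)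
  have up: "S h y \<le> h * (exp (\<kappa> * h) * g y)" and lo: "h * (exp (- (\<kappa> * h)) * g (y + h)) \<le> S h y" if h: "0 < h" "h \<le> 1" for h y
  proof -
    have const: "(\<integral>\<^sup>+u. ennreal c * indicator {0<..h} u \<partial>lborel) = ennreal (h * c)" if "0 \<le> c" for c
    proof -
      have "(\<integral>\<^sup>+u. ennreal c * indicator {0<..h} u \<partial>lborel) = ennreal c * emeasure lborel {0<..h}"
        by (rule nn_integral_cmult_indicator) simp
      then show ?thesis using h that by (simp add: ennreal_mult mult.commute)
    qed
    have E: "(\<integral>\<^sup>+u. ennreal (g (y + u)) * indicator {0<..h} u \<partial>lborel) = ennreal (S h y)"
      unfolding g_def S_def by (rule smoothed_eq[OF h _ H i G]) measurable
    have "ennreal (S h y) \<le> (\<integral>\<^sup>+u. ennreal (exp (\<kappa> * h) * g y) * indicator {0<..h} u \<partial>lborel)"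
      unfolding E[symmetric]
    proof (intro nn_integral_mono)
      fix u
      have "g (y + u) \<le> exp (\<kappa> * h) * g y" if "0 < u" "u \<le> h"
      proof -
        have "exp (\<kappa> * (y + u)) * Q (y + u) \<le> exp (\<kappa> * h + \<kappa> * y) * Q y"
          using that Q kappa by (intro mult_mono) (auto simp: distrib_left)
        then show ?thesis by (simp add: g_def exp_add mult.assoc)
      qed
      then show "ennreal (g (y + u)) * indicator {0<..h} u \<le> ennreal (exp (\<kappa> * h) * g y) * indicator {0<..h} u"
        by (auto split: split_indicator intro!: ennreal_leI)
    qed
    also have "\<dots> = ennreal (h * (exp (\<kappa> * h) * g y))"
      using g0 by (simp add: const)
    finally show "S h y \<le> h * (exp (\<kappa> * h) * g y)" using h g0 by (simp add: ennreal_le_iff)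
    have "ennreal (h * (exp (- (\<kappa> * h)) * g (y + h))) = (\<integral>\<^sup>+u. ennreal (exp (- (\<kappa> * h)) * g (y + h)) * indicator {0<..h} u \<partial>lborel)"
      using g0 by (simp add: const)
    also have "\<dots> \<le> ennreal (S h y)"
      unfolding E[symmetric]
    proof (intro nn_integral_mono)
      fix u
      have "exp (- (\<kappa> * h)) * g (y + h) \<le> g (y + u)" if "0 < u" "u \<le> h"
      proof -
        have "exp (- (\<kappa> * h)) * g (y + h) = exp (\<kappa> * y) * Q (y + h)"
          by (simp add: g_def distrib_left exp_add exp_minus)
        also have "\<dots> \<le> exp (\<kappa> * (y + u)) * Q (y + u)"
          using that Q kappa by (intro mult_mono) auto
        finally show ?thesis by (simp add: g_def)
      qed
      then show "ennreal (exp (- (\<kappa> * h)) * g (y + h)) * indicator {0<..h} u \<le> ennreal (g (y + u)) * indicator {0<..h} u"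
        by (auto split: split_indicator intro!: ennreal_leI)
    qed
    finally show "h * (exp (- (\<kappa> * h)) * g (y + h)) \<le> S h y" using S0 by (simp add: ennreal_le_iff)
  qed
  have Slim: "((\<lambda>y. m y * S h y / h) \<longlongrightarrow> L) at_top" if h: "0 < h" "h \<le> 1" for h
  proof -
    have "((\<lambda>y. m y * S h y / h) \<longlongrightarrow> h * C_const \<alpha> * (LINT w|lborel. H w) / h) at_top"
      unfolding S_def using h by (intro tendsto_divide tendsto_const smoothed_limit(1) H i) auto
    then show ?thesis using h by (simp add: L_def)
  qed
  have near: "((\<lambda>h. exp (- (\<kappa> * h)) * L) \<longlongrightarrow> L) (at_right 0)" "((\<lambda>h. exp (\<kappa> * h) * L) \<longlongrightarrow> L) (at_right 0)"
    by (auto intro!: tendsto_eq_intros)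
  have hs: "eventually (\<lambda>h::real. 0 < h \<and> h \<le> 1) (at_right 0)"
    by (rule eventually_mono[OF eventually_at_right_real[of 0 1]]) auto
  have "((\<lambda>y. m y * g y) \<longlongrightarrow> L) at_top"
  proof (rule order_tendstoI)
    fix u assume u: "u < L"
    have "eventually (\<lambda>h. u < exp (- (\<kappa> * h)) * L \<and> 0 < h \<and> h \<le> 1) (at_right 0)"
      using order_tendstoD(1)[OF near(1) u] hs by eventually_elim auto
    then obtain h where h: "u < exp (- (\<kappa> * h)) * L" "0 < h" "h \<le> 1"
      using eventually_happens'[OF trivial_limit_at_right_real] by blast
    have "((\<lambda>y. exp (- (\<kappa> * h)) * (m y * S h y / h)) \<longlongrightarrow> exp (- (\<kappa> * h)) * L) at_top" by (intro tendsto_mult_left Slim h)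
    then have "eventually (\<lambda>y. u < exp (- (\<kappa> * h)) * (m y * S h y / h)) at_top" using h(1) by (rule order_tendstoD(1))
    then show "eventually (\<lambda>y. u < m y * g y) at_top"
    proof eventually_elim
      case (elim y)
      have "exp (- (\<kappa> * h)) * (m y * S h y / h) \<le> exp (- (\<kappa> * h)) * (m y * (h * (exp (\<kappa> * h) * g y)) / h)"
        using h up[of h y] m_nonneg[of y] by (intro mult_left_mono divide_right_mono) auto
      also have "\<dots> = m y * g y" using h by (simp add: exp_minus)
      finally show ?case using elim by simp
    qed
  next
    fix u assume u: "L < u"
    have "eventually (\<lambda>h. exp (\<kappa> * h) * L < u \<and> 0 < h \<and> h \<le> 1) (at_right 0)"
      using order_tendstoD(2)[OF near(2) u] hs by eventually_elim auto
    then obtain h where h: "exp (\<kappa> * h) * L < u" "0 < h" "h \<le> 1"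
      using eventually_happens'[OF trivial_limit_at_right_real] by blast
    \<comment> \<open>The upper bound uses the average to the left of y, hence the shift by h and
      \<open>m_shift\<close>.\<close>
    have f: "filterlim (\<lambda>y. y - h) at_top at_top" by real_asymp
    have "((\<lambda>y. m y / m (y - h) * (exp (\<kappa> * h) * (m (y - h) * S h (y - h) / h))) \<longlongrightarrow> 1 * (exp (\<kappa> * h) * L)) at_top"
      by (intro tendsto_mult m_shift tendsto_const filterlim_compose[OF Slim f] h)
    then have "eventually (\<lambda>y. m y / m (y - h) * (exp (\<kappa> * h) * (m (y - h) * S h (y - h) / h)) < u) at_top"
      using h(1) by (intro order_tendstoD(2)) auto
    then show "eventually (\<lambda>y. m y * g y < u) at_top"
      using eventually_gt_at_top[of h]
    proof eventually_elim
      case (elim y)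
      have mp: "0 < m (y - h)" using elim by (intro m_pos) simp
      have "m y * g y = exp (\<kappa> * h) * (m y * (h * (exp (- (\<kappa> * h)) * g (y - h + h))) / h)" using h by (simp add: exp_minus)
      also have "\<dots> \<le> exp (\<kappa> * h) * (m y * S h (y - h) / h)"
        using h lo[of h "y - h"] m_nonneg[of y] by (intro mult_left_mono divide_right_mono) auto
      also have "\<dots> = m y / m (y - h) * (exp (\<kappa> * h) * (m (y - h) * S h (y - h) / h))" using mp by simp
      finally show ?case using elim by linarith
    qed
  qed
  then show ?thesis by (simp add: g_def L_def)
qed

end

section \<open>Solving the renewal equation by its series\<close>

context heavy_step begin

text \<open>Iterating the equation N times leaves as remainder g convolved with \<open>pw N\<close>.
  To the right of some K, g is at most \<delta> times exp(\<kappa> w), and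
  \<open>psi \<kappa>\<close> \<le> 1 keeps this small for all N; to the left, \<kappa> = 2 r lets
  one factor exp(r w) be bounded by exp(r K), and \<open>psi r ^ N\<close> tends to 0.\<close>

lemma renewal_series:
  assumes [measurable]: "H \<in> borel_measurable borel" "g \<in> borel_measurable borel"
    and g: "\<And>y. 0 \<le> g y" "\<And>y. g y \<le> exp (\<kappa> * y)" "((\<lambda>y. exp (- (\<kappa> * y)) * g y) \<longlongrightarrow> 0) at_top"
    and eq: "\<And>y. ennreal (g y) = ennreal (H y) + (\<integral>\<^sup>+z. ennreal (g (y - z)) \<partial>F)"
  shows "ennreal (g y) = (\<Sum>n. \<integral>\<^sup>+s. ennreal (H (y - s)) \<partial>pw n)"
proof -
  define T where "T n = (\<integral>\<^sup>+s. ennreal (g (y - s)) \<partial>pw n)" for n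
  define c where "c n = (\<integral>\<^sup>+s. ennreal (H (y - s)) \<partial>pw n)" for n
  have T_Suc: "T n = c n + T (Suc n)" for n
  proof -
    interpret P: prob_space "pw n" by (rule prob_space_pw)
    interpret PP: pair_sigma_finite "pw n" F ..
    have [measurable]: "(\<lambda>s. \<integral>\<^sup>+z. ennreal (g (y - s - z)) \<partial>F) \<in> borel_measurable borel"
      by (rule borel_measurable_nn_integral) measurable
    have "T n = (\<integral>\<^sup>+s. ennreal (H (y - s)) + (\<integral>\<^sup>+z. ennreal (g (y - s - z)) \<partial>F) \<partial>pw n)"
      unfolding T_def by (intro nn_integral_cong eq)
    also have "\<dots> = c n + (\<integral>\<^sup>+s. (\<integral>\<^sup>+z. ennreal (g (y - s - z)) \<partial>F) \<partial>pw n)"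
      unfolding c_def by (rule nn_integral_add) measurable
    also have "(\<integral>\<^sup>+s. (\<integral>\<^sup>+z. ennreal (g (y - s - z)) \<partial>F) \<partial>pw n) = (\<integral>\<^sup>+z. (\<integral>\<^sup>+s. ennreal (g (y - s - z)) \<partial>pw n) \<partial>F)"
      by (rule PP.Fubini'[symmetric]) measurable
    also have "\<dots> = T (Suc n)"
      unfolding T_def by (subst nn_integral_pw_Suc) (auto simp: algebra_simps)
    finally show ?thesis .
  qed
  have sum: "ennreal (g y) = (\<Sum>n<N. c n) + T N" for N
  proof (induction N)
    case 0
    show ?case by (simp add: T_def nn_integral_return)
  next
    case (Suc N)
    then show ?case using T_Suc[of N] by (simp add: add.assoc)
  qed
  have T_le: "T N \<le> ennreal (\<delta> * exp (\<kappa> * y) + exp (r * K) * exp (r * y) * psi r ^ N)"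
    if \<delta>: "0 < \<delta>" and K: "\<And>w. K \<le> w \<Longrightarrow> exp (- (\<kappa> * w)) * g w < \<delta>" for \<delta> K N
  proof -
    have split: "g w \<le> \<delta> * exp (\<kappa> * w) + exp (r * K) * exp (r * w)" for w
    proof (cases "K \<le> w")
      case True
      have "g w = exp (\<kappa> * w) * (exp (- (\<kappa> * w)) * g w)" by (simp add: exp_minus)
      also have "\<dots> \<le> exp (\<kappa> * w) * \<delta>" using K[OF True] by (intro mult_left_mono) auto
      finally have "g w \<le> \<delta> * exp (\<kappa> * w)" by (simp add: mult.commute)
      then show ?thesis by (simp add: add_increasing2)
    next
      case False
      have "g w \<le> exp (r * w) * exp (r * w)" using g(2)[of w] by (simp add: r_def mult_exp_exp)
      also have "\<dots> \<le> exp (r * K) * exp (r * w)" using False r_pos by (intro mult_right_mono) auto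
      finally show ?thesis using \<delta> by (simp add: add_increasing)
    qed
    have "T N \<le> (\<integral>\<^sup>+s. ennreal (\<delta> * exp (\<kappa> * y)) * ennreal (exp (- (\<kappa> * s))) + ennreal (exp (r * K) * exp (r * y)) * ennreal (exp (- (r * s))) \<partial>pw N)"
      unfolding T_def
    proof (intro nn_integral_mono)
      fix s
      have "g (y - s) \<le> \<delta> * exp (\<kappa> * y) * exp (- (\<kappa> * s)) + exp (r * K) * exp (r * y) * exp (- (r * s))"
        using split[of "y - s"] by (simp add: right_diff_distrib exp_diff exp_minus divide_inverse mult.assoc)
      then show "ennreal (g (y - s)) \<le> ennreal (\<delta> * exp (\<kappa> * y)) * ennreal (exp (- (\<kappa> * s))) + ennreal (exp (r * K) * exp (r * y)) * ennreal (exp (- (r * s)))"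
        using \<delta> by (simp add: ennreal_mult[symmetric] ennreal_plus[symmetric] ennreal_leI del: ennreal_plus)
    qed
    also have "\<dots> = ennreal (\<delta> * exp (\<kappa> * y)) * ennreal (psi \<kappa> ^ N) + ennreal (exp (r * K) * exp (r * y)) * ennreal (psi r ^ N)"
      using kappa r_pos r_le by (simp add: nn_integral_add nn_integral_cmult nn_exp_pw)
    also have "\<dots> \<le> ennreal (\<delta> * exp (\<kappa> * y)) * ennreal 1 + ennreal (exp (r * K) * exp (r * y)) * ennreal (psi r ^ N)"
    proof (intro add_mono mult_left_mono ennreal_leI)
      show "psi \<kappa> ^ N \<le> 1" using exp_kappa_integral psi_nonneg by (intro power_le_one) (auto simp: psi_def)
    qed auto
    also have "\<dots> = ennreal (\<delta> * exp (\<kappa> * y) + exp (r * K) * exp (r * y) * psi r ^ N)"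
      using \<delta> psi_nonneg by (simp add: ennreal_mult[symmetric] ennreal_plus[symmetric] del: ennreal_plus)
    finally show ?thesis .
  qed
  have "T \<longlonglongrightarrow> 0"
  proof (rule order_tendstoI)
    fix e :: ennreal assume "0 < e"
    then obtain d where "0 < d" "d < e" using dense by blast
    then obtain e' where e': "0 < e'" "ennreal e' < e" by (cases d) auto
    define \<delta> where "\<delta> = e' / 2 / exp (\<kappa> * y)"
    have \<delta>: "0 < \<delta>" "\<delta> * exp (\<kappa> * y) = e' / 2" using e' by (auto simp: \<delta>_def)
    have "eventually (\<lambda>w. exp (- (\<kappa> * w)) * g w < \<delta>) at_top" using g(3) \<delta>(1) by (rule order_tendstoD)
    then obtain K where K: "\<And>w. K \<le> w \<Longrightarrow> exp (- (\<kappa> * w)) * g w < \<delta>"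
      by (auto simp: eventually_at_top_linorder)
    have "(\<lambda>N. exp (r * K) * exp (r * y) * psi r ^ N) \<longlonglongrightarrow> exp (r * K) * exp (r * y) * 0"
      using psi_r psi_nonneg by (intro tendsto_mult_left LIMSEQ_power_zero) auto
    then have "eventually (\<lambda>N. exp (r * K) * exp (r * y) * psi r ^ N < e' / 2) sequentially"
      by (rule order_tendstoD(2)) (use e' in simp)
    then show "eventually (\<lambda>N. T N < e) sequentially"
    proof eventually_elim
      case (elim N)
      have "T N \<le> ennreal (\<delta> * exp (\<kappa> * y) + exp (r * K) * exp (r * y) * psi r ^ N)" by (rule T_le[OF \<delta>(1) K])
      also have "\<dots> \<le> ennreal e'" using elim \<delta> by (intro ennreal_leI) auto
      finally show ?case using e' by simp
    qed
  qed auto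
  then have "(\<lambda>N. (\<Sum>n<N. c n) + T N) \<longlonglongrightarrow> (\<Sum>n. c n) + 0"
    by (intro tendsto_add summable_LIMSEQ) auto
  then have "(\<lambda>N. ennreal (g y)) \<longlonglongrightarrow> (\<Sum>n. c n)" unfolding sum[symmetric] by simp
  then show ?thesis unfolding c_def by (rule LIMSEQ_unique[OF tendsto_const])
qed

end

section \<open>The tilted law\<close>

locale tilting = prob_space M for M :: "'w measure" +
  fixes A :: "'w \<Rightarrow> real" and \<kappa> :: real
  assumes A [measurable]: "A \<in> borel_measurable M"
    and kappa: "0 < \<kappa>"
    and moment: "(\<integral>\<^sup>+\<omega>. ennreal (A \<omega> powr \<kappa>) \<partial>M) = 1"
begin

abbreviation F where "F \<equiv> tilted_log_law M A \<kappa>"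

lemma nn_integral_F:
  assumes [measurable]: "f \<in> borel_measurable borel"
  shows "(\<integral>\<^sup>+z. f z \<partial>F) = (\<integral>\<^sup>+\<omega>. ennreal (A \<omega> powr \<kappa>) * f (ln (A \<omega>)) \<partial>M)"
  unfolding tilted_log_law_def by (subst nn_integral_distr) (auto simp: nn_integral_density)

lemma real_distribution_F: "real_distribution F"
proof -
  have "prob_space (density M (\<lambda>\<omega>. ennreal (A \<omega> powr \<kappa>)))"
    by (rule prob_spaceI) (simp add: emeasure_density moment)
  then have "prob_space F" unfolding tilted_log_law_def by (rule prob_space.prob_space_distr) measurable
  then show ?thesis by (simp add: real_distribution_def real_distribution_axioms_def tilted_log_law_def)
qed

lemma tail_F: "measure F {x<..} = Fbar_tilt M A \<kappa> x"
proof -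
  interpret F: real_distribution F by (rule real_distribution_F)
  have "measure F {x<..} = 1 - measure F {..x}"
    using F.prob_compl[of "{..x}"] by (simp add: Compl_eq_Diff_UNIV[symmetric])
  then show ?thesis using cdf_tilted_log_law[OF A, of \<kappa> x] by (simp add: Fbar_tilt_def cdf_def)
qed

text \<open>The tilt cancels: the integrand is 1 where A > 0, and 0 where A = 0 because of the
  weight.\<close>

lemma left_tail_F: "(\<integral>\<^sup>+z. ennreal (exp (- \<kappa> * z)) \<partial>F) \<le> 1"
proof -
  have "(\<integral>\<^sup>+z. ennreal (exp (- \<kappa> * z)) \<partial>F) = (\<integral>\<^sup>+\<omega>. ennreal (A \<omega> powr \<kappa> * exp (- \<kappa> * ln (A \<omega>))) \<partial>M)"
    by (subst nn_integral_F) (auto simp: ennreal_mult)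
  also have "\<dots> \<le> (\<integral>\<^sup>+\<omega>. 1 \<partial>M)"
  proof (rule nn_integral_mono)
    fix \<omega>
    have "A \<omega> powr \<kappa> * exp (- \<kappa> * ln (A \<omega>)) \<le> 1" by (simp add: powr_def mult_exp_exp)
    then show "ennreal (A \<omega> powr \<kappa> * exp (- \<kappa> * ln (A \<omega>))) \<le> 1" by simp
  qed
  finally show ?thesis by (simp add: emeasure_space_1)
qed

text \<open>Markov's inequality with the exponential moment of \<open>left_tail_F\<close>.\<close>

lemma F_tilt_left: "F_tilt M A \<kappa> (- u) \<le> exp (- (\<kappa> * u))" and F_tilt_nonneg: "0 \<le> F_tilt M A \<kappa> u"
  and F_tilt_measurable [measurable]: "F_tilt M A \<kappa> \<in> borel_measurable borel"
proof -
  interpret F: real_distribution F by (rule real_distribution_F)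
  have c: "F_tilt M A \<kappa> x = measure F {..x}" for x using cdf_tilted_log_law[OF A, of \<kappa> x] by (simp add: cdf_def)
  show "0 \<le> F_tilt M A \<kappa> u" by (simp add: c)
  have "F_tilt M A \<kappa> = cdf F" using cdf_tilted_log_law[OF A, of \<kappa>] by auto
  then show "F_tilt M A \<kappa> \<in> borel_measurable borel" using F.cdf_nondecreasing by (auto intro!: borel_measurable_mono monoI)
  have "ennreal (measure F {..-u}) = (\<integral>\<^sup>+z. indicator {..-u} z \<partial>F)" by (simp add: F.emeasure_eq_measure)
  also have "\<dots> \<le> (\<integral>\<^sup>+z. ennreal (exp (- (\<kappa> * u))) * ennreal (exp (- \<kappa> * z)) \<partial>F)"
  proof (intro nn_integral_mono)
    fix z
    have "1 \<le> exp (- (\<kappa> * u)) * exp (- \<kappa> * z)" if "z \<le> - u"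
    proof -
      have "\<kappa> * z \<le> \<kappa> * - u" using that kappa by (intro mult_left_mono) auto
      then show ?thesis by (simp add: mult_exp_exp)
    qed
    then show "indicator {..-u} z \<le> ennreal (exp (- (\<kappa> * u))) * ennreal (exp (- \<kappa> * z))"
      by (auto simp: ennreal_mult[symmetric] split: split_indicator)
  qed
  also have "\<dots> = ennreal (exp (- (\<kappa> * u))) * (\<integral>\<^sup>+z. ennreal (exp (- \<kappa> * z)) \<partial>F)"
    by (rule nn_integral_cmult) simp
  also have "\<dots> \<le> ennreal (exp (- (\<kappa> * u))) * 1" by (intro mult_left_mono left_tail_F) simp
  finally show "F_tilt M A \<kappa> (- u) \<le> exp (- (\<kappa> * u))" by (simp add: c)
qed

text \<open>The density A^\<kappa> vanishes exactly where A = 0, so F and the law of ln A given A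
  \<noteq> 0 have the same null sets.\<close>

lemma not_arithmetic_F: assumes "\<not> arithmetic_law (cond_log_law M A)" shows "\<not> arithmetic_law F"
proof
  assume "arithmetic_law F"
  then obtain h where h: "0 < h" "AE z in F. \<exists>k::int. z = h * of_int k" by (auto simp: arithmetic_law_def)
  have "AE \<omega> in density M (\<lambda>\<omega>. ennreal (A \<omega> powr \<kappa>)). \<exists>k::int. ln (A \<omega>) = h * of_int k"
    by (rule AE_distrD[OF _ h(2)[unfolded tilted_log_law_def]]) measurable
  then have "AE \<omega> in M. A \<omega> \<noteq> 0 \<longrightarrow> (\<exists>k::int. ln (A \<omega>) = h * of_int k)"
    by (subst (asm) AE_density) auto
  then have "AE \<omega> in uniform_measure M {\<omega> \<in> space M. A \<omega> \<noteq> 0}. \<exists>k::int. ln (A \<omega>) = h * of_int k"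
    by (intro AE_uniform_measureI) (auto elim: eventually_mono)
  moreover have "{x. \<exists>k::int. x = h * of_int k} \<in> sets borel"
  proof -
    have "{x. \<exists>k::int. x = h * of_int k} = range (\<lambda>k::int. h * of_int k)" by auto
    then have "countable {x. \<exists>k::int. x = h * of_int k}" by simp
    then show ?thesis by (rule sets.countable[rotated]) auto
  qed
  ultimately have "AE z in cond_log_law M A. \<exists>k::int. z = h * of_int k"
    unfolding cond_log_law_def by (subst AE_distr_iff) auto
  then show False using assms h(1) by (auto simp: arithmetic_law_def)
qed

lemma nonarithmetic_step_F:
  assumes alpha: "0 < \<alpha>" "\<alpha> \<le> 1"
    and inf: "(\<integral>\<^sup>+\<omega>. ennreal (A \<omega> powr \<kappa> * max (ln (A \<omega>)) 0) \<partial>M) = \<infinity>"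
    and L: "slowly_varying L" "\<forall>x>0. Fbar_tilt M A \<kappa> x = L x * x powr (- \<alpha>)"
    and small: "((\<lambda>\<delta>. Limsup at_top (\<lambda>x. ennreal (x * Fbar_tilt M A \<kappa> x) *
            conv_integral (\<lambda>y. 1 / (y * (Fbar_tilt M A \<kappa> y)\<^sup>2)) F x 1 (\<delta> * x))) \<longlongrightarrow> 0) (at_right 0)"
    and na: "\<not> arithmetic_law (cond_log_law M A)"
  shows "nonarithmetic_step F \<kappa> \<alpha>"
proof -
  interpret F: real_distribution F by (rule real_distribution_F)
  have sF: "sets F = sets borel" by simp
  obtain x0 where x0: "0 < x0" "\<And>x. x0 \<le> x \<Longrightarrow> 0 < L x" using L(1) by (auto simp: slowly_varying_def)
  have tail_pos: "0 < measure F {x<..}" for x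
  proof -
    \<comment> \<open>Positivity of \<open>L\<close> is known from \<open>x0\<close> on;
      monotonicity of the tail carries it to every x.\<close>
    let ?y = "max x x0"
    have "0 < Fbar_tilt M A \<kappa> ?y" using L(2) x0 by auto
    also have "\<dots> \<le> measure F {x<..}" unfolding tail_F[symmetric] by (intro F.finite_measure_mono) auto
    finally show ?thesis .
  qed
  have rv: "((\<lambda>x. measure F {c * x<..} / measure F {x<..}) \<longlongrightarrow> c powr (-\<alpha>)) at_top" if c: "0 < c" for c
  proof -
    have "((\<lambda>x. L (c * x) / L x * c powr (- \<alpha>)) \<longlongrightarrow> 1 * c powr (- \<alpha>)) at_top"
      using L(1) c by (intro tendsto_mult tendsto_const) (auto simp: slowly_varying_def)
    moreover have "eventually (\<lambda>x. L (c * x) / L x * c powr (- \<alpha>) = measure F {c * x<..} / measure F {x<..}) at_top"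
      using eventually_gt_at_top[of 0]
    proof eventually_elim
      case (elim x)
      then show ?case using c L(2) by (simp add: tail_F powr_mult)
    qed
    ultimately show ?thesis using tendsto_cong by fastforce
  qed
  have inf': "(\<integral>\<^sup>+z. ennreal (max z 0) \<partial>F) = \<infinity>"
    unfolding inf[symmetric] by (subst nn_integral_F) (auto intro!: nn_integral_cong simp del: ennreal_max_0' simp: ennreal_mult)
  have small': "\<exists>d>0. d < 1/2 \<and> eventually (\<lambda>x. ennreal (x * measure F {x<..}) *
        (\<integral>\<^sup>+z. ennreal (1 / ((x - z) * (measure F {x - z<..})\<^sup>2)) * indicator {1..d * x} (x - z) \<partial>F) \<le> ennreal e) at_top"
    if e: "0 < e" for e :: real
  proof -
    let ?S = "\<lambda>\<delta> x. ennreal (x * Fbar_tilt M A \<kappa> x) *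
            conv_integral (\<lambda>y. 1 / (y * (Fbar_tilt M A \<kappa> y)\<^sup>2)) F x 1 (\<delta> * x)"
    have "eventually (\<lambda>\<delta>. Limsup at_top (?S \<delta>) < ennreal e) (at_right 0)"
      using e by (intro order_tendstoD(2)[OF small]) auto
    moreover have "eventually (\<lambda>\<delta>::real. 0 < \<delta> \<and> \<delta> < 1/2) (at_right 0)"
      by (rule eventually_mono[OF eventually_at_right_real[of 0 "1/2"]]) auto
    ultimately have "eventually (\<lambda>\<delta>. Limsup at_top (?S \<delta>) < ennreal e \<and> 0 < \<delta> \<and> \<delta> < 1/2) (at_right 0)"
      by eventually_elim auto
    then obtain \<delta> where \<delta>: "Limsup at_top (?S \<delta>) < ennreal e" "0 < \<delta>" "\<delta> < 1/2"
      using eventually_happens'[OF trivial_limit_at_right_real] by blast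
    have "eventually (\<lambda>x. ?S \<delta> x < ennreal e) at_top" by (rule Limsup_lessD[OF \<delta>(1)])
    then have "eventually (\<lambda>x. ?S \<delta> x \<le> ennreal e) at_top" by eventually_elim simp
    then show ?thesis using \<delta> by (intro exI[of _ \<delta>]) (simp add: conv_integral_def tail_F)
  qed
  show ?thesis
    by unfold_locales (fact kappa alpha left_tail_F tail_pos rv inf' small' not_arithmetic_F[OF na])+
qed

end

section \<open>The tail of the fixed point\<close>

text \<open>The reflection v = ln p - y leads to a half-line on which the antiderivative vanishes at
  infinity.\<close>

lemma nn_integral_exp_below:
  assumes k: "0 < (k::real)" and p: "0 \<le> p"
  shows "(\<integral>\<^sup>+y. ennreal (exp (k * y)) * indicator {y. exp y < p} y \<partial>lborel) = ennreal (p powr k / k)"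
proof (cases "p = 0")
  case True
  have "{y::real. exp y < p} = {}" using True by (auto simp: not_less)
  then show ?thesis using True by simp
next
  case False
  then have p: "0 < p" using p by simp
  have "(\<integral>\<^sup>+y. ennreal (exp (k * y)) * indicator {y. exp y < p} y \<partial>lborel)
      = ennreal \<bar>-1\<bar> * (\<integral>\<^sup>+v. ennreal (exp (k * (ln p + (-1) * v))) * indicator {y. exp y < p} (ln p + (-1) * v) \<partial>lborel)"
    by (rule nn_integral_real_affine) auto
  also have "\<dots> = (\<integral>\<^sup>+v. ennreal (p powr k) * (ennreal (exp (- (k * v))) * indicator {0..} v) \<partial>lborel)"
  proof -
    have "AE v in lborel. v \<noteq> (0::real)" by (rule AE_lborel_singleton)
    then have "AE v in lborel. ennreal (exp (k * (ln p + (-1) * v))) * indicator {y. exp y < p} (ln p + (-1) * v)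
        = ennreal (p powr k) * (ennreal (exp (- (k * v))) * indicator {0..} v)"
    proof eventually_elim
      case (elim v)
      have 1: "exp (k * (ln p + (-1) * v)) = p powr k * exp (- (k * v))"
        using p by (simp add: powr_def right_diff_distrib exp_diff exp_minus divide_inverse)
      have "exp (ln p - v) < p \<longleftrightarrow> 0 < v"
        using p by (metis diff_less_eq exp_less_cancel_iff exp_ln less_add_same_cancel1)
      then have "indicator {y. exp y < p} (ln p + (-1) * v) = (indicator {0..} v :: ennreal)"
        using elim by (auto split: split_indicator)
      then show ?case unfolding 1 by (simp add: ennreal_mult mult.assoc)
    qed
    then show ?thesis by (simp add: nn_integral_cong_AE)
  qed
  also have "\<dots> = ennreal (p powr k) * ennreal (0 - (- exp (- (k * 0)) / k))"
  proof (subst nn_integral_cmult)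
    have "(\<integral>\<^sup>+v. ennreal (exp (- (k * v))) * indicator {0..} v \<partial>lborel) = ennreal (0 - (- exp (- (k * 0)) / k))"
    proof (rule nn_integral_FTC_atLeast)
      show "((\<lambda>w. - exp (- (k * w)) / k) \<longlongrightarrow> 0) at_top" using k by real_asymp
    qed (use k in \<open>auto intro!: derivative_eq_intros\<close>)
    then show "ennreal (p powr k) * (\<integral>\<^sup>+v. ennreal (exp (- (k * v))) * indicator {0..} v \<partial>lborel) = ennreal (p powr k) * ennreal (0 - (- exp (- (k * 0)) / k))"
      by simp
  qed auto
  also have "\<dots> = ennreal (p powr k / k)" using k by (simp add: ennreal_mult[symmetric])
  finally show ?thesis .
qed

lemma nn_integral_exp_between:
  assumes k: "0 < (k::real)" and p: "0 \<le> p" "0 \<le> q"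
  shows "(\<integral>\<^sup>+y. ennreal (exp (k * y)) * indicator {y. p \<le> exp y \<and> exp y < q} y \<partial>lborel) = ennreal ((max p q powr k - p powr k) / k)"
proof (cases "p < q")
  case True
  let ?I = "\<integral>\<^sup>+y. ennreal (exp (k * y)) * indicator {y. p \<le> exp y \<and> exp y < q} y \<partial>lborel"
  have "ennreal (q powr k / k) = (\<integral>\<^sup>+y. ennreal (exp (k * y)) * indicator {y. exp y < q} y \<partial>lborel)"
    by (rule nn_integral_exp_below[OF k p(2), symmetric])
  also have "\<dots> = (\<integral>\<^sup>+y. ennreal (exp (k * y)) * indicator {y. exp y < p} y + ennreal (exp (k * y)) * indicator {y. p \<le> exp y \<and> exp y < q} y \<partial>lborel)"
    using True by (intro nn_integral_cong) (auto split: split_indicator)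
  also have "\<dots> = (\<integral>\<^sup>+y. ennreal (exp (k * y)) * indicator {y. exp y < p} y \<partial>lborel) + ?I"
    by (rule nn_integral_add) measurable
  also have "\<dots> = ennreal (p powr k / k) + ?I" using nn_integral_exp_below[OF k p(1)] by simp
  finally have "?I = ennreal (q powr k / k) - ennreal (p powr k / k)" by simp
  then show ?thesis using True k by (simp add: ennreal_minus diff_divide_distrib)
next
  case False
  then have "{y::real. p \<le> exp y \<and> exp y < q} = {}" by auto
  then show ?thesis using False by (simp add: max_def)
qed

context tilting begin

text \<open>By F(-u) \<le> exp(-\<kappa> u) the left-tail part of the truncated mean stays below the
  constant \<open>K\<close>, while \<open>m\<close> diverges.\<close>

lemma m_trunc_asymptotic:
  assumes "heavy_step F \<kappa> \<alpha>"
  shows "((\<lambda>x. m_trunc M A \<kappa> x / heavy_step.m F x) \<longlongrightarrow> 1) at_top"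
proof -
  interpret S: heavy_step F \<kappa> \<alpha> by fact
  define K where "K = (LINT u|lborel. (1 + \<bar>u\<bar>) * exp (- (\<kappa> * \<bar>u\<bar>)))"
  have bound: "\<bar>indicator {0..x} u * F_tilt M A \<kappa> (- u)\<bar> \<le> (1 + \<bar>u\<bar>) * exp (- (\<kappa> * \<bar>u\<bar>))" for x u
  proof (cases "u \<in> {0..x}")
    case True
    have "F_tilt M A \<kappa> (- u) \<le> 1 * exp (- (\<kappa> * u))" using F_tilt_left by simp
    also have "\<dots> \<le> (1 + u) * exp (- (\<kappa> * u))" using True by (intro mult_right_mono) auto
    finally show ?thesis using True F_tilt_nonneg by simp
  qed simp
  have i: "set_integrable lborel {0..x} (\<lambda>u. F_tilt M A \<kappa> (- u))" for x
    unfolding set_integrable_def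
    by (rule Bochner_Integration.integrable_bound[OF exp_abs_integrable[OF kappa]])
       (use bound in \<open>auto intro!: always_eventually\<close>)
  have eq: "m_trunc M A \<kappa> x = (LBINT u:{0..x}. F_tilt M A \<kappa> (- u)) + S.m x" if "0 \<le> x" for x
  proof -
    have "m_trunc M A \<kappa> x = (LBINT u:{0..x}. F_tilt M A \<kappa> (- u) + Fbar_tilt M A \<kappa> u)"
      unfolding m_trunc_def zero_ereal_def using that by (rule interval_integral_Icc)
    also have "\<dots> = (LBINT u:{0..x}. F_tilt M A \<kappa> (- u)) + (LBINT u:{0..x}. S.Fb u)"
      unfolding tail_F[symmetric] S.Fb_def[symmetric] using S.Fb_set_integrable[of x 1]
      by (intro set_integral_add i) simp
    finally show ?thesis using that by (simp add: S.m_eq)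
  qed
  have I: "0 \<le> (LBINT u:{0..x}. F_tilt M A \<kappa> (- u))" "(LBINT u:{0..x}. F_tilt M A \<kappa> (- u)) \<le> K" for x
  proof -
    show "0 \<le> (LBINT u:{0..x}. F_tilt M A \<kappa> (- u))"
      unfolding set_lebesgue_integral_def using F_tilt_nonneg by (intro Bochner_Integration.integral_nonneg) auto
    show "(LBINT u:{0..x}. F_tilt M A \<kappa> (- u)) \<le> K"
      unfolding set_lebesgue_integral_def K_def
    proof (rule Bochner_Integration.integral_mono[OF _ exp_abs_integrable[OF kappa]])
      show "integrable lborel (\<lambda>u. indicator {0..x} u *\<^sub>R F_tilt M A \<kappa> (- u))" using i by (simp add: set_integrable_def)
      show "indicator {0..x} u *\<^sub>R F_tilt M A \<kappa> (- u) \<le> (1 + \<bar>u\<bar>) * exp (- (\<kappa> * \<bar>u\<bar>))" for u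
        using bound[of x u] by simp
    qed
  qed
  have "((\<lambda>x. 1 + K * inverse (S.m x)) \<longlongrightarrow> 1 + K * 0) at_top"
    by (intro tendsto_add tendsto_mult tendsto_const filterlim_compose[OF tendsto_inverse_0_at_top S.m_at_top] tendsto_inverse_0_at_top S.m_at_top)
  then have lim: "((\<lambda>x. 1 + K * inverse (S.m x)) \<longlongrightarrow> 1) at_top" by simp
  have ev: "eventually (\<lambda>x. 1 \<le> m_trunc M A \<kappa> x / S.m x \<and> m_trunc M A \<kappa> x / S.m x \<le> 1 + K * inverse (S.m x)) at_top"
    using eventually_gt_at_top[of 0]
  proof eventually_elim
    case (elim x)
    have mp: "0 < S.m x" using elim by (rule S.m_pos)
    then have "m_trunc M A \<kappa> x / S.m x = 1 + (LBINT u:{0..x}. F_tilt M A \<kappa> (- u)) * inverse (S.m x)"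
      using elim by (simp add: eq add_divide_distrib divide_inverse distrib_right)
    then show ?case using I[of x] mp by (auto intro!: mult_right_mono)
  qed
  show ?thesis
    by (rule tendsto_sandwich[OF _ _ tendsto_const lim]) (use ev in \<open>auto elim: eventually_mono\<close>)
qed

end

section \<open>The fixed-point equation as a renewal equation\<close>

locale max_recursion = tilting M A \<kappa> for M :: "'w measure" and A \<kappa> +
  fixes B X :: "'w \<Rightarrow> real"
  assumes B [measurable]: "B \<in> borel_measurable M"
    and A_nonneg: "AE \<omega> in M. 0 \<le> A \<omega>"
    and B_moment: "\<exists>\<nu>>\<kappa>. integrable M (\<lambda>\<omega>. \<bar>B \<omega>\<bar> powr \<nu>)"
    and indep: "indep_rv M (borel \<Otimes>\<^sub>M borel) (\<lambda>\<omega>. (A \<omega>, B \<omega>)) borel X"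
    and fixed_point: "distr M borel X = distr M borel (\<lambda>\<omega>. max (A \<omega> * X \<omega>) (B \<omega>))"
begin

lemma X [measurable]: "X \<in> borel_measurable M"
  using indep by (simp add: indep_rv_def)

definition Q :: "real \<Rightarrow> real" where "Q y = measure M {\<omega> \<in> space M. exp y < X \<omega>}"

text \<open>The forcing term of the renewal equation. It is written as the integral of an indicator
  of the pair (A X, B) so that measurability in y is automatic; \<open>H_eq\<close> is the working
  form.\<close>

definition H :: "real \<Rightarrow> real" where
  "H y = (LINT \<omega>|M. exp (\<kappa> * y) * indicator {p. fst p \<le> exp y \<and> exp y < snd p} (A \<omega> * X \<omega>, B \<omega>))"

lemma H_measurable [measurable]: "H \<in> borel_measurable borel"
  unfolding H_def by measurable

text \<open>Independence of (A, B) from X restricts to A, because A-events are (A, B)-events over C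
  \<times> UNIV. The families of preimages are intersection-stable, as the passage to generated
  \<sigma>-algebras requires.\<close>

lemma joint_law: "distr M (borel \<Otimes>\<^sub>M borel) (\<lambda>\<omega>. (A \<omega>, X \<omega>)) = distr M borel A \<Otimes>\<^sub>M distr M borel X"
proof -
  have stable: "Int_stable {Y -` C \<inter> space M | C. C \<in> sets N}" for Y :: "'w \<Rightarrow> 'b" and N
    unfolding Int_stable_def
  proof safe
    fix C D assume "C \<in> sets N" "D \<in> sets N"
    then show "\<exists>E. Y -` C \<inter> space M \<inter> (Y -` D \<inter> space M) = Y -` E \<inter> space M \<and> E \<in> sets N"
      by (intro exI[of _ "C \<inter> D"]) auto
  qed
  have ind: "indep_set {(\<lambda>\<omega>. (A \<omega>, B \<omega>)) -` C \<inter> space M | C. C \<in> sets (borel \<Otimes>\<^sub>M borel)} {X -` D \<inter> space M | D. D \<in> sets borel}"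
    using indep by (simp add: indep_rv_def)
  have "indep_set {A -` C \<inter> space M | C. C \<in> sets borel} {X -` D \<inter> space M | D. D \<in> sets borel}"
    unfolding indep_set_def
  proof (rule indep_sets_mono_sets[OF ind[unfolded indep_set_def]])
    have "A -` C \<inter> space M \<in> {(\<lambda>\<omega>. (A \<omega>, B \<omega>)) -` C \<inter> space M | C. C \<in> sets (borel \<Otimes>\<^sub>M borel)}" if "C \<in> sets borel" for C
    proof -
      have "A -` C \<inter> space M = (\<lambda>\<omega>. (A \<omega>, B \<omega>)) -` (C \<times> UNIV) \<inter> space M" by auto
      moreover have "C \<times> UNIV \<in> sets (borel \<Otimes>\<^sub>M (borel :: real measure))" using that by auto
      ultimately show ?thesis by blast
    qed
    then show "case_bool {A -` C \<inter> space M | C. C \<in> sets borel} {X -` D \<inter> space M | D. D \<in> sets borel} i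
      \<subseteq> case_bool {(\<lambda>\<omega>. (A \<omega>, B \<omega>)) -` C \<inter> space M | C. C \<in> sets (borel \<Otimes>\<^sub>M borel)} {X -` D \<inter> space M | D. D \<in> sets borel} i" for i
      by (auto split: bool.split)
  qed
  then have "indep_var borel A borel X"
    unfolding indep_var_eq by (auto intro!: indep_set_sigma_sets stable)
  then show ?thesis unfolding indep_var_distribution_eq by simp
qed

lemma Q_nonneg: "0 \<le> Q y" and Q_le_1: "Q y \<le> 1" and Q_antimono: "x \<le> y \<Longrightarrow> Q y \<le> Q x"
proof -
  assume "x \<le> y"
  then have "exp x \<le> exp y" by simp
  then show "Q y \<le> Q x" unfolding Q_def by (intro finite_measure_mono) (auto intro: le_less_trans simp del: exp_le_cancel_iff)
qed (auto simp: Q_def)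

lemma Q_measurable [measurable]: "Q \<in> borel_measurable borel"
proof -
  have "mono (\<lambda>x. - Q x)" by (auto simp: mono_def Q_antimono)
  then have "(\<lambda>x. - Q x) \<in> borel_measurable borel" by (rule borel_measurable_mono)
  then have "(\<lambda>x. - (- Q x)) \<in> borel_measurable borel" by measurable
  then show ?thesis by simp
qed

lemma Q_tendsto_0: "(Q \<longlongrightarrow> 0) at_top"
proof -
  interpret D: real_distribution "distr M borel X" by (intro real_distribution_distr) measurable
  have Q: "Q = (\<lambda>y. 1 - cdf (distr M borel X) (exp y))"
  proof
    fix y
    have "{\<omega> \<in> space M. exp y < X \<omega>} = space M - {\<omega> \<in> space M. X \<omega> \<le> exp y}" by auto
    then have "Q y = 1 - measure M {\<omega> \<in> space M. X \<omega> \<le> exp y}" unfolding Q_def by (simp add: prob_compl)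
    also have "{\<omega> \<in> space M. X \<omega> \<le> exp y} = X -` {..exp y} \<inter> space M" by auto
    finally show "Q y = 1 - cdf (distr M borel X) (exp y)" by (simp add: cdf_def measure_distr)
  qed
  have "((\<lambda>y. 1 - cdf (distr M borel X) (exp y)) \<longlongrightarrow> 1 - 1) at_top"
    by (intro tendsto_diff tendsto_const filterlim_compose[OF D.cdf_lim_at_top_prob exp_at_top])
  then show ?thesis unfolding Q by simp
qed

text \<open>Condition on A. For A > 0 the event is X > exp(y - ln A), and splitting exp(\<kappa> y)
  as A^\<kappa> exp(\<kappa> (y - ln A)) hands the weight A^\<kappa> to the tilted law; A = 0
  contributes nothing on either side.\<close>

lemma product_tail:
  "ennreal (exp (\<kappa> * y) * measure M {\<omega> \<in> space M. exp y < A \<omega> * X \<omega>}) = (\<integral>\<^sup>+z. ennreal (exp (\<kappa> * (y - z)) * Q (y - z)) \<partial>F)"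
proof -
  interpret DX: prob_space "distr M borel X" by (rule prob_space_distr) measurable
  have "{p \<in> space (borel \<Otimes>\<^sub>M (borel :: real measure)). exp y < fst p * snd p} \<in> sets (borel \<Otimes>\<^sub>M (borel :: real measure))"
    by measurable
  then have [measurable]: "{p. exp y < fst p * snd p} \<in> sets (borel \<Otimes>\<^sub>M (borel :: real measure))"
    by (simp add: space_pair_measure)
  have "emeasure M {\<omega> \<in> space M. exp y < A \<omega> * X \<omega>} = (\<integral>\<^sup>+\<omega>. indicator {\<omega> \<in> space M. exp y < A \<omega> * X \<omega>} \<omega> \<partial>M)"
    by (rule nn_integral_indicator[symmetric]) measurable
  also have "\<dots> = (\<integral>\<^sup>+\<omega>. indicator {p. exp y < fst p * snd p} (A \<omega>, X \<omega>) \<partial>M)"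
    by (intro nn_integral_cong) (auto split: split_indicator)
  also have "\<dots> = (\<integral>\<^sup>+p. indicator {p. exp y < fst p * snd p} p \<partial>distr M (borel \<Otimes>\<^sub>M borel) (\<lambda>\<omega>. (A \<omega>, X \<omega>)))"
    by (rule nn_integral_distr[symmetric]) measurable
  also have "\<dots> = (\<integral>\<^sup>+a. (\<integral>\<^sup>+x. indicator {p. exp y < fst p * snd p} (a, x) \<partial>distr M borel X) \<partial>distr M borel A)"
    unfolding joint_law by (rule DX.nn_integral_fst[symmetric]) measurable
  also have "\<dots> = (\<integral>\<^sup>+\<omega>. (\<integral>\<^sup>+x. indicator {p. exp y < fst p * snd p} (A \<omega>, x) \<partial>distr M borel X) \<partial>M)"
  proof (rule nn_integral_distr)
    have "(\<lambda>a. \<integral>\<^sup>+x. indicator {p. exp y < fst p * snd p} (a, x) \<partial>distr M borel X) \<in> borel_measurable borel"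
      by (rule DX.borel_measurable_nn_integral) measurable
    then show "(\<lambda>a. \<integral>\<^sup>+x. indicator {p. exp y < fst p * snd p} (a, x) \<partial>distr M borel X) \<in> borel_measurable (distr M borel A)"
      by simp
  qed measurable
  also have "\<dots> = (\<integral>\<^sup>+\<omega>. ennreal (if A \<omega> = 0 then 0 else Q (y - ln (A \<omega>))) \<partial>M)"
  proof (rule nn_integral_cong_AE)
    show "AE \<omega> in M. (\<integral>\<^sup>+x. indicator {p. exp y < fst p * snd p} (A \<omega>, x) \<partial>distr M borel X) = ennreal (if A \<omega> = 0 then 0 else Q (y - ln (A \<omega>)))"
      using A_nonneg
    proof eventually_elim
      case (elim \<omega>)
      have "(\<integral>\<^sup>+x. indicator {p. exp y < fst p * snd p} (A \<omega>, x) \<partial>distr M borel X) = (\<integral>\<^sup>+x. indicator {x. exp y < A \<omega> * x} x \<partial>distr M borel X)"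
        by (intro nn_integral_cong) (auto split: split_indicator)
      also have "\<dots> = emeasure (distr M borel X) {x. exp y < A \<omega> * x}" by (rule nn_integral_indicator) simp
      also have "\<dots> = emeasure M (X -` {x. exp y < A \<omega> * x} \<inter> space M)" by (rule emeasure_distr) simp_all
      also have "\<dots> = ennreal (if A \<omega> = 0 then 0 else Q (y - ln (A \<omega>)))"
      proof (cases "A \<omega> = 0")
        case True
        then have "X -` {x. exp y < A \<omega> * x} \<inter> space M = {}" by (auto simp: not_less)
        then show ?thesis using True by simp
      next
        case False
        then have a: "0 < A \<omega>" using elim by simp
        then have "X -` {x. exp y < A \<omega> * x} \<inter> space M = {\<omega>' \<in> space M. exp (y - ln (A \<omega>)) < X \<omega>'}"
          by (auto simp: exp_diff pos_divide_less_eq mult.commute)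
        then show ?thesis using False by (simp add: Q_def emeasure_eq_measure)
      qed
      finally show ?case .
    qed
  qed
  finally have P: "ennreal (measure M {\<omega> \<in> space M. exp y < A \<omega> * X \<omega>}) = (\<integral>\<^sup>+\<omega>. ennreal (if A \<omega> = 0 then 0 else Q (y - ln (A \<omega>))) \<partial>M)"
    by (simp add: emeasure_eq_measure)
  have "ennreal (exp (\<kappa> * y) * measure M {\<omega> \<in> space M. exp y < A \<omega> * X \<omega>}) = ennreal (exp (\<kappa> * y)) * (\<integral>\<^sup>+\<omega>. ennreal (if A \<omega> = 0 then 0 else Q (y - ln (A \<omega>))) \<partial>M)"
    unfolding P[symmetric] by (simp add: ennreal_mult)
  also have "\<dots> = (\<integral>\<^sup>+\<omega>. ennreal (exp (\<kappa> * y)) * ennreal (if A \<omega> = 0 then 0 else Q (y - ln (A \<omega>))) \<partial>M)"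
    by (rule nn_integral_cmult[symmetric]) measurable
  also have "\<dots> = (\<integral>\<^sup>+\<omega>. ennreal (A \<omega> powr \<kappa>) * ennreal (exp (\<kappa> * (y - ln (A \<omega>))) * Q (y - ln (A \<omega>))) \<partial>M)"
  proof (rule nn_integral_cong)
    fix \<omega>
    have "exp (\<kappa> * y) * (if A \<omega> = 0 then 0 else Q (y - ln (A \<omega>))) = A \<omega> powr \<kappa> * (exp (\<kappa> * (y - ln (A \<omega>))) * Q (y - ln (A \<omega>)))"
      by (simp add: powr_def right_diff_distrib exp_diff)
    then show "ennreal (exp (\<kappa> * y)) * ennreal (if A \<omega> = 0 then 0 else Q (y - ln (A \<omega>))) = ennreal (A \<omega> powr \<kappa>) * ennreal (exp (\<kappa> * (y - ln (A \<omega>))) * Q (y - ln (A \<omega>)))"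
      using Q_nonneg by (simp only: ennreal_mult'[symmetric] exp_ge_zero powr_ge_zero)
  qed
  also have "\<dots> = (\<integral>\<^sup>+z. ennreal (exp (\<kappa> * (y - z)) * Q (y - z)) \<partial>F)"
    by (rule nn_integral_F[symmetric]) measurable
  finally show ?thesis .
qed

lemma H_eq: "H y = exp (\<kappa> * y) * measure M {\<omega> \<in> space M. A \<omega> * X \<omega> \<le> exp y \<and> exp y < B \<omega>}"
proof -
  have "(LINT \<omega>|M. indicator {p. fst p \<le> exp y \<and> exp y < snd p} (A \<omega> * X \<omega>, B \<omega>) :: real) = (LINT \<omega>|M. indicator {\<omega> \<in> space M. A \<omega> * X \<omega> \<le> exp y \<and> exp y < B \<omega>} \<omega>)"
    by (intro Bochner_Integration.integral_cong) (auto split: split_indicator)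
  then show ?thesis by (simp add: H_def)
qed

lemma H_nonneg: "0 \<le> H y" by (simp add: H_eq)

text \<open>The maximum exceeds exp y either through A X, which gives the convolution, or through B
  alone, which gives \<open>H\<close>.\<close>

lemma renewal_equation:
  "ennreal (exp (\<kappa> * y) * Q y) = ennreal (H y) + (\<integral>\<^sup>+z. ennreal (exp (\<kappa> * (y - z)) * Q (y - z)) \<partial>F)"
proof -
  have "Q y = measure (distr M borel X) {exp y<..}" unfolding Q_def by (subst measure_distr) (auto intro!: arg_cong2[where f=measure])
  also have "\<dots> = measure M {\<omega> \<in> space M. exp y < max (A \<omega> * X \<omega>) (B \<omega>)}"
    unfolding fixed_point by (subst measure_distr) (auto intro!: arg_cong2[where f=measure])
  also have "{\<omega> \<in> space M. exp y < max (A \<omega> * X \<omega>) (B \<omega>)} = {\<omega> \<in> space M. A \<omega> * X \<omega> \<le> exp y \<and> exp y < B \<omega>} \<union> {\<omega> \<in> space M. exp y < A \<omega> * X \<omega>}"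
    by auto
  also have "measure M \<dots> = measure M {\<omega> \<in> space M. A \<omega> * X \<omega> \<le> exp y \<and> exp y < B \<omega>} + measure M {\<omega> \<in> space M. exp y < A \<omega> * X \<omega>}"
    by (rule finite_measure_Union) auto
  finally show ?thesis
    unfolding product_tail[symmetric] H_eq by (simp add: distrib_left)
qed

text \<open>\<open>H\<close> decays exponentially on both sides: to the left through its factor
  exp(\<kappa> w), to the right by Markov's inequality with the moment of order \<nu> > \<kappa>,
  which leaves exp(-(\<nu> - \<kappa>) w).\<close>

lemma H_integrable: "integrable lborel (\<lambda>w. H w * (1 + \<bar>w\<bar>))"
proof -
  obtain \<nu> where \<nu>: "\<kappa> < \<nu>" "integrable M (\<lambda>\<omega>. \<bar>B \<omega>\<bar> powr \<nu>)" using B_moment by blast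
  define b where "b = (LINT \<omega>|M. \<bar>B \<omega>\<bar> powr \<nu>)"
  define C where "C = max 1 b"
  \<comment> \<open>The slower of the two decay rates.\<close>
  define l where "l = min \<kappa> (\<nu> - \<kappa>)"
  have l: "0 < l" "l \<le> \<kappa>" "l \<le> \<nu> - \<kappa>" using kappa \<nu> by (auto simp: l_def)
  have H_le: "H w \<le> C * exp (- (l * \<bar>w\<bar>))" for w
  proof (cases "0 \<le> w")
    case True
    let ?S = "{\<omega> \<in> space M. A \<omega> * X \<omega> \<le> exp w \<and> exp w < B \<omega>}"
    have "exp (\<nu> * w) * measure M ?S = (LINT \<omega>|M. exp (\<nu> * w) * indicator ?S \<omega>)" by simp
    also have "\<dots> \<le> b" unfolding b_def
    proof (rule integral_mono[OF _ \<nu>(2)])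
      fix \<omega>
      have "exp (\<nu> * w) \<le> \<bar>B \<omega>\<bar> powr \<nu>" if "exp w < B \<omega>"
      proof -
        have "exp w powr \<nu> \<le> \<bar>B \<omega>\<bar> powr \<nu>" using that kappa \<nu> by (intro powr_mono2) auto
        then show ?thesis by (simp add: powr_def)
      qed
      then show "exp (\<nu> * w) * indicator ?S \<omega> \<le> \<bar>B \<omega>\<bar> powr \<nu>" by (auto split: split_indicator)
    qed (auto simp: less_top[symmetric])
    finally have "exp (- ((\<nu> - \<kappa>) * w)) * (exp (\<nu> * w) * measure M ?S) \<le> exp (- ((\<nu> - \<kappa>) * w)) * b" by (intro mult_left_mono) auto
    moreover have "exp (- ((\<nu> - \<kappa>) * w)) * (exp (\<nu> * w) * measure M ?S) = H w"
      by (simp add: H_eq mult.assoc[symmetric] mult_exp_exp algebra_simps)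
    moreover have "exp (- ((\<nu> - \<kappa>) * w)) * b \<le> exp (- (l * w)) * C"
      using True l by (intro mult_mono) (auto simp: C_def b_def intro!: mult_right_mono)
    ultimately have "H w \<le> exp (- (l * w)) * C" by linarith
    then show ?thesis using True by (simp add: mult.commute[of C])
  next
    case False
    have "H w \<le> exp (\<kappa> * w) * 1" unfolding H_eq by (intro mult_left_mono) auto
    also have "\<dots> \<le> exp (- (l * \<bar>w\<bar>)) * C" using False l
      by (intro mult_mono) (auto simp: C_def intro!: mult_right_mono_neg)
    finally show ?thesis by (simp add: mult.commute)
  qed
  show ?thesis
  proof (rule Bochner_Integration.integrable_bound[OF integrable_mult_right[OF exp_abs_integrable[OF l(1)], of C]])
    have "norm (H w * (1 + \<bar>w\<bar>)) \<le> norm (C * ((1 + \<bar>w\<bar>) * exp (- (l * \<bar>w\<bar>))))" for w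
    proof -
      have "H w * (1 + \<bar>w\<bar>) \<le> (C * exp (- (l * \<bar>w\<bar>))) * (1 + \<bar>w\<bar>)" using H_le by (intro mult_right_mono) auto
      moreover have "0 \<le> C" by (simp add: C_def)
      ultimately show ?thesis using H_nonneg by (simp add: abs_mult mult_ac)
    qed
    then show "AE w in lborel. norm (H w * (1 + \<bar>w\<bar>)) \<le> norm (C * ((1 + \<bar>w\<bar>) * exp (- (l * \<bar>w\<bar>))))" by (intro always_eventually allI)
  qed measurable
qed

text \<open>Tonelli: for a fixed outcome the w with A X \<le> exp w < B contribute (max(p,
  q)^\<kappa> - p^\<kappa>)/\<kappa>, where p = A X_+ and q = B_+. Positive parts may be taken
  because exp w is positive.\<close>

lemma integral_H:
  "(LINT w|lborel. H w) = (1 / \<kappa>) * (LINT \<omega>|M. (max (A \<omega> * max (X \<omega>) 0) (max (B \<omega>) 0)) powr \<kappa> - (A \<omega> * max (X \<omega>) 0) powr \<kappa>)"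
proof -
  let ?c = "\<lambda>\<omega>. ((max (A \<omega> * max (X \<omega>) 0) (max (B \<omega>) 0)) powr \<kappa> - (A \<omega> * max (X \<omega>) 0) powr \<kappa>) / \<kappa>"
  let ?h = "\<lambda>w \<omega>. ennreal (exp (\<kappa> * w)) * indicator {p. fst p \<le> exp w \<and> exp w < snd p} (A \<omega> * X \<omega>, B \<omega>)"
  interpret P: pair_sigma_finite lborel M ..
  have nnH: "ennreal (H w) = (\<integral>\<^sup>+\<omega>. ?h w \<omega> \<partial>M)" for w
  proof -
    have "(\<integral>\<^sup>+\<omega>. ?h w \<omega> \<partial>M) = (\<integral>\<^sup>+\<omega>. ennreal (exp (\<kappa> * w)) * indicator {\<omega> \<in> space M. A \<omega> * X \<omega> \<le> exp w \<and> exp w < B \<omega>} \<omega> \<partial>M)"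
      by (intro nn_integral_cong) (auto split: split_indicator)
    also have "\<dots> = ennreal (H w)" by (simp add: nn_integral_cmult H_eq emeasure_eq_measure ennreal_mult)
    finally show ?thesis by simp
  qed
  have c0: "AE \<omega> in M. 0 \<le> ?c \<omega>"
    using A_nonneg by eventually_elim (use kappa in \<open>auto intro!: divide_nonneg_pos powr_mono2\<close>)
  have "(\<integral>\<^sup>+w. ennreal (H w) \<partial>lborel) = (\<integral>\<^sup>+w. (\<integral>\<^sup>+\<omega>. ?h w \<omega> \<partial>M) \<partial>lborel)" by (simp add: nnH)
  also have "\<dots> = (\<integral>\<^sup>+\<omega>. (\<integral>\<^sup>+w. ?h w \<omega> \<partial>lborel) \<partial>M)" by (rule P.Fubini'[symmetric]) measurable
  also have "\<dots> = (\<integral>\<^sup>+\<omega>. ennreal (?c \<omega>) \<partial>M)"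
  proof (rule nn_integral_cong_AE)
    show "AE \<omega> in M. (\<integral>\<^sup>+w. ?h w \<omega> \<partial>lborel) = ennreal (?c \<omega>)"
      using A_nonneg
    proof eventually_elim
      case (elim \<omega>)
      let ?p = "A \<omega> * max (X \<omega>) 0" and ?q = "max (B \<omega>) 0"
      have "A \<omega> * X \<omega> \<le> exp w \<longleftrightarrow> ?p \<le> exp w" for w
      proof (cases "0 \<le> X \<omega>")
        case False
        then have "A \<omega> * X \<omega> \<le> 0" using elim by (auto simp: mult_le_0_iff)
        then have "A \<omega> * X \<omega> \<le> exp w" by (rule order_trans) simp
        then show ?thesis using False by (simp add: max_def)
      qed (simp add: max_def)
      moreover have "exp w < B \<omega> \<longleftrightarrow> exp w < ?q" for w by (auto simp: less_max_iff_disj not_less)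
      ultimately have "(\<integral>\<^sup>+w. ?h w \<omega> \<partial>lborel) = (\<integral>\<^sup>+w. ennreal (exp (\<kappa> * w)) * indicator {w. ?p \<le> exp w \<and> exp w < ?q} w \<partial>lborel)"
        by (intro nn_integral_cong) (auto split: split_indicator)
      also have "\<dots> = ennreal (?c \<omega>)" using elim by (intro nn_integral_exp_between kappa) auto
      finally show ?case .
    qed
  qed
  finally have E: "(\<integral>\<^sup>+w. ennreal (H w) \<partial>lborel) = (\<integral>\<^sup>+\<omega>. ennreal (?c \<omega>) \<partial>M)" .
  have "(LINT w|lborel. H w) = enn2real (\<integral>\<^sup>+w. ennreal (H w) \<partial>lborel)"
    by (rule integral_eq_nn_integral) (auto simp: H_nonneg)
  also have "\<dots> = (LINT \<omega>|M. ?c \<omega>)"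
    unfolding E by (rule integral_eq_nn_integral[symmetric]) (use c0 in auto)
  finally show ?thesis by simp
qed

text \<open>\<open>Q_tendsto_0\<close> supplies the growth condition of
  \<open>renewal_series\<close>; in the limit of \<open>key_renewal\<close>, \<open>S.m\<close> is
  exchanged for \<open>m_trunc\<close>, and y = ln x turns exp(\<kappa> y) into x^\<kappa>.\<close>

lemma tail_asymptotic:
  assumes "nonarithmetic_step F \<kappa> \<alpha>"
  shows "((\<lambda>x. m_trunc M A \<kappa> (ln x) * x powr \<kappa> * measure M {\<omega> \<in> space M. x < X \<omega>})
           \<longlongrightarrow> C_const \<alpha> / \<kappa> *
               (LINT \<omega>|M. (max (A \<omega> * max (X \<omega>) 0) (max (B \<omega>) 0)) powr \<kappa>
                         - (A \<omega> * max (X \<omega>) 0) powr \<kappa>)) at_top"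
    (is "(_ \<longlongrightarrow> C_const \<alpha> / \<kappa> * ?E) _")
proof -
  interpret S: nonarithmetic_step F \<kappa> \<alpha> by fact
  define g where "g y = exp (\<kappa> * y) * Q y" for y
  have "ennreal (g y) = (\<Sum>n. \<integral>\<^sup>+s. ennreal (H (y - s)) \<partial>S.pw n)" for y
  proof (rule S.renewal_series)
    show "g \<in> borel_measurable borel" unfolding g_def by measurable
    show "0 \<le> g y" "g y \<le> exp (\<kappa> * y)" for y using Q_nonneg[of y] Q_le_1[of y] by (auto simp: g_def)
    have "exp (- (\<kappa> * y)) * g y = Q y" for y by (simp add: g_def exp_minus)
    then show "((\<lambda>y. exp (- (\<kappa> * y)) * g y) \<longlongrightarrow> 0) at_top" using Q_tendsto_0 by simp
    show "ennreal (g y) = ennreal (H y) + (\<integral>\<^sup>+z. ennreal (g (y - z)) \<partial>F)" for y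
      unfolding g_def by (rule renewal_equation)
  qed measurable
  then have "((\<lambda>y. S.m y * (exp (\<kappa> * y) * Q y)) \<longlongrightarrow> C_const \<alpha> * (LINT w|lborel. H w)) at_top"
    unfolding g_def by (intro S.key_renewal H_measurable H_nonneg H_integrable Q_nonneg Q_antimono)
  from tendsto_mult[OF m_trunc_asymptotic[OF S.heavy_step_axioms] this]
  have "((\<lambda>y. m_trunc M A \<kappa> y / S.m y * (S.m y * (exp (\<kappa> * y) * Q y))) \<longlongrightarrow> C_const \<alpha> / \<kappa> * ?E) at_top"
    by (simp add: integral_H)
  moreover have "eventually (\<lambda>y. m_trunc M A \<kappa> y / S.m y * (S.m y * (exp (\<kappa> * y) * Q y)) = m_trunc M A \<kappa> y * (exp (\<kappa> * y) * Q y)) at_top"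
    using eventually_gt_at_top[of 0]
  proof eventually_elim
    case (elim y)
    then have "0 < S.m y" by (rule S.m_pos)
    then show ?case by simp
  qed
  ultimately have "((\<lambda>y. m_trunc M A \<kappa> y * (exp (\<kappa> * y) * Q y)) \<longlongrightarrow> C_const \<alpha> / \<kappa> * ?E) at_top"
    by (rule Lim_transform_eventually)
  from filterlim_compose[OF this ln_at_top]
  have "((\<lambda>x. m_trunc M A \<kappa> (ln x) * (exp (\<kappa> * ln x) * Q (ln x))) \<longlongrightarrow> C_const \<alpha> / \<kappa> * ?E) at_top" .
  moreover have "eventually (\<lambda>x. m_trunc M A \<kappa> (ln x) * (exp (\<kappa> * ln x) * Q (ln x)) = m_trunc M A \<kappa> (ln x) * x powr \<kappa> * measure M {\<omega> \<in> space M. x < X \<omega>}) at_top"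
    using eventually_gt_at_top[of 0] by eventually_elim (simp add: Q_def powr_def)
  ultimately show ?thesis by (rule Lim_transform_eventually)
qed

end

theorem theorem2:
  fixes M :: "'w measure"
    and A B X :: "'w \<Rightarrow> real"
    and \<kappa> \<alpha> :: real
    and L :: "real \<Rightarrow> real"
  assumes "prob_space M"
    and "A \<in> borel_measurable M" "B \<in> borel_measurable M" "X \<in> borel_measurable M"
    and "AE \<omega> in M. 0 \<le> A \<omega>"
    and "\<not> (AE \<omega> in M. A \<omega> = 1)"
    and "0 < \<kappa>"
    and "0 < \<alpha>" "\<alpha> \<le> 1"
    and "(\<integral>\<^sup>+\<omega>. ennreal (A \<omega> powr \<kappa>) \<partial>M) = 1"
    and "(\<integral>\<^sup>+\<omega>. ennreal (A \<omega> powr \<kappa> * max (ln (A \<omega>)) 0) \<partial>M) = \<infinity>"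
    and "slowly_varying L"
    and "\<forall>x>0. Fbar_tilt M A \<kappa> x = L x * x powr (- \<alpha>)"
    and "((\<lambda>\<delta>. Limsup at_top (\<lambda>x. ennreal (x * Fbar_tilt M A \<kappa> x) *
            conv_integral (\<lambda>y. 1 / (y * (Fbar_tilt M A \<kappa> y)\<^sup>2)) (tilted_log_law M A \<kappa>) x 1 (\<delta> * x)))
          \<longlongrightarrow> 0) (at_right 0)"
    and "\<not> arithmetic_law (cond_log_law M A)"
    and "\<exists>\<nu>>\<kappa>. integrable M (\<lambda>\<omega>. \<bar>B \<omega>\<bar> powr \<nu>)"
    and "indep_rv M (borel \<Otimes>\<^sub>M borel) (\<lambda>\<omega>. (A \<omega>, B \<omega>)) borel X"
    and "distr M borel X = distr M borel (\<lambda>\<omega>. max (A \<omega> * X \<omega>) (B \<omega>))"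
  shows "((\<lambda>x. m_trunc M A \<kappa> (ln x) * x powr \<kappa> * measure M {\<omega> \<in> space M. x < X \<omega>})
           \<longlongrightarrow> C_const \<alpha> / \<kappa> *
               (LINT \<omega>|M. (max (A \<omega> * max (X \<omega>) 0) (max (B \<omega>) 0)) powr \<kappa>
                         - (A \<omega> * max (X \<omega>) 0) powr \<kappa>)) at_top"
proof -
  interpret max_recursion M A \<kappa> B X
    by (intro max_recursion.intro max_recursion_axioms.intro tilting.intro tilting_axioms.intro) fact+
  show ?thesis
    by (intro tail_asymptotic nonarithmetic_step_F) fact+
qed

end
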